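(* For every $\lambda\in\overline{\mathbb{C}}\setminus[-1/2,1/2]$, the Riemann–Hilbert problem for $\Gamma(z;\lambda)$ stated in the context has a unique solution, and it is given by $$\Gamma(z;\lambda)=\sigma_2Q^{-1}(\lambda)\hat{\Gamma}^{-1}\left(M_1(\infty)\right)\begin{bmatrix} 1 & \frac{b_Lb_R}{z(b_R-b_L)(a+1)} \\ 0 & 1 \end{bmatrix}\hat{\Gamma}\left(M_1(z)\right)Q(\lambda)\sigma_2,$$ where $a=a(\lambda)$, $M_1(z)=\frac{b_R(z-b_L)}{z(b_R-b_L)}$ and $$Q(\lambda)=\begin{bmatrix} -\tan(a\pi) & 0 \\ 0 & 4^{2a+1}e^{a\pi i}\frac{\Gamma(a+3/2)\Gamma(a+1/2)}{\Gamma(a)\Gamma(a+2)} \end{bmatrix}\begin{bmatrix} 1 & e^{a\pi i} \\ -e^{a\pi i} & 1 \end{bmatrix},\qquad \hat{\Gamma}(\eta)=\begin{bmatrix} h_\infty(\eta) & s_\infty(\eta) \\ h_\infty'(\eta) & s_\infty'(\eta) \end{bmatrix}.$$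
   Context: Fix real numbers $b_L<0<b_R$. $\overline{\mathbb C}=\mathbb C\cup\{\infty\}$, $\mathbf 1$ is the $2\times2$ identity matrix, $\sigma_2=\begin{bmatrix}0&-i\\ i&0\end{bmatrix}$. In the entries of $Q$, $\Gamma(\cdot)$ with one argument denotes Euler's Gamma function. Riemann–Hilbert problem. Find a $2\times2$ matrix function $\Gamma(z;\lambda)$, $\lambda\in\overline{\mathbb{C}}\setminus[-1/2,1/2]$, analytic for $z\in\overline{\mathbb{C}}\setminus [b_L,b_R]$, with (i) $\Gamma(z_+;\lambda)=\Gamma(z_-;\lambda)\begin{bmatrix} 1 & -\frac{i}{\lambda} \\ 0 & 1 \end{bmatrix}$ for $z\in[b_L,0]$; (ii) $\Gamma(z_+;\lambda)=\Gamma(z_-;\lambda)\begin{bmatrix} 1 & 0 \\ \frac{i}{\lambda} & 1 \end{bmatrix}$ for $z\in[0,b_R]$; (iii) as $z\to b_L$, the first column is $O(1)$ and the second column is $O(\log(z-b_L))$; (iv) as $z\to b_R$, the first column is $O(\log(z-b_R))$ and the second column is $O(1)$; (v) $\Gamma(z;\lambda)\in L^2([b_L,b_R])$ (entries of the boundary values are square integrable); (vi) $\Gamma(z;\lambda)=\mathbf 1+O(z^{-1})$ as $z\to\infty$. The interval is oriented from left to right, so $z_+$ and $z_-$ denote boundary values from the upper and lower half-plane. Function $a$: $a(\lambda)=\frac{1}{i\pi}\ln\left(\frac{i+\sqrt{4\lambda^2-1}}{2\lambda}\right)$ with the principal logarithm and $\sqrt{4\lambda^2-1}$ analytic off $[-1/2,1/2]$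 with $\sqrt{4\lambda^2-1}=2\lambda+O(1)$ as $\lambda\to\infty$. Hypergeometric functions (${}_2F_1$ is the Gauss hypergeometric function, prime is $d/d\eta$): $h_\infty(\eta)=e^{a\pi i}\eta^{-a}{}_2F_1(a,a+1;2a+2;\frac1\eta)$, $s_\infty(\eta)=-e^{-a\pi i}\eta^{a+1}{}_2F_1(-a-1,-a;-2a;\frac1\eta)$, so $h'_\infty(\eta)=-ae^{a\pi i}\eta^{-a-1}{}_2F_1(a+1,a+1;2a+2;\frac1\eta)$ and $s_\infty'(\eta)=-(a+1)e^{-a\pi i}\eta^{a}{}_2F_1(-a,-a;-2a;\frac1\eta)$. These formulas define the functions for $\operatorname{Im}\eta>0$ with principal branches; on $\mathbb C\setminus((-\infty,0]\cup[1,\infty))$ they are extended by analytic continuation across $(0,1)$. Note $M_1$ maps $[b_L,0]$ to $[-\infty,0]$, $[0,b_R]$ to $[1,\infty]$, and $M_1(\infty)=\frac{b_R}{b_R-b_L}\in(0,1)$. At $\lambda=\infty$ (where $a=0$) the right-hand side of the formula is understood as its limit.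
   Formalization: Condition (v) is strengthened: boundary values are also attained in L² from both sides; with square integrability alone uniqueness fails, since (1+N e^{-1/z²}/z)Γ also satisfies (i)–(vi); jumps are imposed on the open intervals (b_L,0) and (0,b_R). *)

theory Defs
  imports "HOL-Complex_Analysis.Complex_Analysis" "HOL-Library.Landau_Symbols"
begin

section \<open>Preliminaries\<close>

definition mat2 :: "complex \<Rightarrow> complex \<Rightarrow> complex \<Rightarrow> complex \<Rightarrow> complex^2^2" where
  "mat2 p q r s = vector [vector [p, q], vector [r, s]]"

definition sigma2 :: "complex^2^2" where
  "sigma2 = mat2 0 (- \<i>) \<i> 0"

definition real_seg :: "real \<Rightarrow> real \<Rightarrow> complex set" where
  "real_seg x y = complex_of_real ` {x..y}"

text \<open>The Riemann sphere of the spectral parameter is the type \<^typ>\<open>complex option\<close> (as in the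
  library's Alexandroff compactification), where \<^term>\<open>None\<close> is the point at infinity.\<close>

definition lambda_domain :: "complex option set" where
  "lambda_domain = - (Some ` real_seg (-1/2) (1/2))"

definition recip :: "complex option \<Rightarrow> complex" where
  "recip l = (case l of None \<Rightarrow> 0 | Some \<mu> \<Rightarrow> 1 / \<mu>)"


section \<open>The Riemann--Hilbert problem\<close>

text \<open>
  The problem is stated for the values of the unknown at finite points off \<open>[bL, bR]\<close>; analyticity
  at infinity is expressed in the coordinate \<open>1/z\<close>.  \<open>Gp\<close> and \<open>Gm\<close> are the boundary values from the
  upper and the lower half-plane, taken at the points of \<open>(bL, 0)\<close> and \<open>(0, bR)\<close>; their values at
  the three nodes \<open>bL\<close>, \<open>0\<close>, \<open>bR\<close> are irrelevant.

  The condition that the unknown belongs to \<open>L\<^sup>2([bL, bR])\<close> is read in the usual sense of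
  \<open>L\<^sup>2\<close> Riemann--Hilbert problems: the boundary values are square integrable and they are attained
  in \<open>L\<^sup>2([bL, bR])\<close> from either side.  This is the only restriction at the node \<open>0\<close>.  Square
  integrability of the pointwise boundary values alone would not determine the solution: if \<open>G\<close> is
  a solution, then \<open>(1 + N exp (-1/z\<^sup>2) / z) G\<close>, with any constant matrix \<open>N\<close>, has the same jumps,
  the same behaviour at \<open>bL\<close>, \<open>bR\<close> and infinity, and square integrable boundary values.

  At the end points the choice of the branch of the logarithm does not affect the \<open>O\<close> bounds.
\<close>

definition analytic_off :: "real \<Rightarrow> real \<Rightarrow> (complex \<Rightarrow> complex^2^2) \<Rightarrow> bool" where
  "analytic_off bL bR G \<longleftrightarrow>
    (\<forall>i j. (\<lambda>z. G z $ i $ j) holomorphic_on (- real_seg bL bR)) \<and>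
    (\<forall>i j. \<exists>g. g analytic_on {0} \<and> (\<forall>\<^sub>F z in at_infinity. G z $ i $ j = g (1 / z)))"

definition boundary_values ::
  "real \<Rightarrow> real \<Rightarrow> (complex \<Rightarrow> complex^2^2) \<Rightarrow> (real \<Rightarrow> complex^2^2) \<Rightarrow> (real \<Rightarrow> complex^2^2) \<Rightarrow> bool" where
  "boundary_values bL bR G Gp Gm \<longleftrightarrow>
    (\<forall>x \<in> {bL<..<0} \<union> {0<..<bR}.
       (G \<longlongrightarrow> Gp x) (at (complex_of_real x) within {z. Im z > 0}) \<and>
       (G \<longlongrightarrow> Gm x) (at (complex_of_real x) within {z. Im z < 0}))"

definition jump_conditions ::
  "real \<Rightarrow> real \<Rightarrow> complex option \<Rightarrow> (real \<Rightarrow> complex^2^2) \<Rightarrow> (real \<Rightarrow> complex^2^2) \<Rightarrow> bool" where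
  "jump_conditions bL bR l Gp Gm \<longleftrightarrow>
    (\<forall>x \<in> {bL<..<0}. Gp x = Gm x ** mat2 1 (- \<i> * recip l) 0 1) \<and>
    (\<forall>x \<in> {0<..<bR}. Gp x = Gm x ** mat2 1 0 (\<i> * recip l) 1)"

definition L2_dist_sq :: "real \<Rightarrow> real \<Rightarrow> (real \<Rightarrow> complex) \<Rightarrow> (real \<Rightarrow> complex) \<Rightarrow> ennreal" where
  "L2_dist_sq bL bR f g = (\<integral>\<^sup>+ x \<in> {bL..bR}. ennreal ((cmod (f x - g x))\<^sup>2) \<partial>lborel)"

definition L2_boundary ::
  "real \<Rightarrow> real \<Rightarrow> (complex \<Rightarrow> complex^2^2) \<Rightarrow> (real \<Rightarrow> complex^2^2) \<Rightarrow> (real \<Rightarrow> complex^2^2) \<Rightarrow> bool" where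
  "L2_boundary bL bR G Gp Gm \<longleftrightarrow>
    (\<forall>i j.
       set_integrable lborel {bL..bR} (\<lambda>x. (cmod (Gp x $ i $ j))\<^sup>2) \<and>
       set_integrable lborel {bL..bR} (\<lambda>x. (cmod (Gm x $ i $ j))\<^sup>2) \<and>
       ((\<lambda>\<epsilon>. L2_dist_sq bL bR (\<lambda>x. G (Complex x \<epsilon>) $ i $ j) (\<lambda>x. Gp x $ i $ j))
          \<longlongrightarrow> 0) (at_right 0) \<and>
       ((\<lambda>\<epsilon>. L2_dist_sq bL bR (\<lambda>x. G (Complex x (- \<epsilon>)) $ i $ j) (\<lambda>x. Gm x $ i $ j))
          \<longlongrightarrow> 0) (at_right 0))"

definition endpoint_growth :: "real \<Rightarrow> real \<Rightarrow> (complex \<Rightarrow> complex^2^2) \<Rightarrow> bool" where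
  "endpoint_growth bL bR G \<longleftrightarrow>
    (let FL = at (complex_of_real bL) within - real_seg bL bR;
         FR = at (complex_of_real bR) within - real_seg bL bR
     in \<forall>i. (\<lambda>z. G z $ i $ 1) \<in> O[FL](\<lambda>_. 1) \<and>
            (\<lambda>z. G z $ i $ 2) \<in> O[FL](\<lambda>z. Ln (z - of_real bL)) \<and>
            (\<lambda>z. G z $ i $ 1) \<in> O[FR](\<lambda>z. Ln (z - of_real bR)) \<and>
            (\<lambda>z. G z $ i $ 2) \<in> O[FR](\<lambda>_. 1))"

definition normalised_at_infinity :: "(complex \<Rightarrow> complex^2^2) \<Rightarrow> bool" where
  "normalised_at_infinity G \<longleftrightarrow>
    (\<forall>i j. (\<lambda>z. (G z - mat 1) $ i $ j) \<in> O[at_infinity](\<lambda>z. 1 / z))"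

definition RHP_solution ::
  "real \<Rightarrow> real \<Rightarrow> complex option \<Rightarrow> (complex \<Rightarrow> complex^2^2) \<Rightarrow> bool" where
  "RHP_solution bL bR l G \<longleftrightarrow>
    analytic_off bL bR G \<and>
    (\<exists>Gp Gm. boundary_values bL bR G Gp Gm \<and> jump_conditions bL bR l Gp Gm \<and>
             L2_boundary bL bR G Gp Gm) \<and>
    endpoint_growth bL bR G \<and>
    normalised_at_infinity G"


section \<open>The function \<open>a\<close>\<close>

text \<open>The branch of \<open>sqrt (4 \<mu>\<^sup>2 - 1)\<close> that is analytic off \<open>[-1/2, 1/2]\<close> and behaves like
  \<open>2 \<mu> + O(1)\<close> at infinity; the three lemmas below are its defining properties.\<close>

definition sqrt_branch :: "complex \<Rightarrow> complex" where
  "sqrt_branch \<mu> = 2 * \<mu> * csqrt (1 - 1 / (4 * \<mu>\<^sup>2))"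

lemma sqrt_branch_square:
  assumes "\<mu> \<noteq> 0"
  shows "(sqrt_branch \<mu>)\<^sup>2 = 4 * \<mu>\<^sup>2 - 1"
  using assms by (simp add: sqrt_branch_def power_mult_distrib field_simps)

lemma sqrt_branch_holomorphic: "sqrt_branch holomorphic_on (- real_seg (-1/2) (1/2))"
proof -
  have nz: "\<mu> \<noteq> 0" if "\<mu> \<in> - real_seg (-1/2) (1/2)" for \<mu>
    using that by (auto simp: real_seg_def image_iff)
  have "1 - 1 / (4 * \<mu>\<^sup>2) \<notin> \<real>\<^sub>\<le>\<^sub>0" if l: "\<mu> \<in> - real_seg (-1/2) (1/2)" for \<mu>
  proof
    assume "1 - 1 / (4 * \<mu>\<^sup>2) \<in> \<real>\<^sub>\<le>\<^sub>0"
    then obtain t where t: "t \<le> 0" "1 - 1 / (4 * \<mu>\<^sup>2) = complex_of_real t"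
      by (auto elim!: nonpos_Reals_cases)
    define r where "r = 1 / (4 * (1 - t))"
    have r: "0 \<le> r" "r \<le> 1/4" using t(1) by (auto simp: r_def field_simps)
    have "1 = 4 * \<mu>\<^sup>2 * (1 - complex_of_real t)" using t(2) nz[OF l] by (simp add: field_simps)
    moreover have "1 - complex_of_real t \<noteq> 0"
    proof
      assume "1 - complex_of_real t = 0"
      hence "complex_of_real t = of_real 1" by simp
      hence "t = 1" by (simp only: of_real_eq_iff)
      thus False using t(1) by simp
    qed
    ultimately have "\<mu>\<^sup>2 = complex_of_real r" by (simp add: r_def field_simps)
    hence "\<mu>\<^sup>2 = (complex_of_real (sqrt r))\<^sup>2" using r(1) by (metis of_real_power real_sqrt_pow2)
    moreover obtain u where u: "sqrt r = u" by blast
    ultimately have "\<mu> = complex_of_real u \<or> \<mu> = complex_of_real (- u)"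
      by (simp add: power2_eq_iff)
    moreover have "0 \<le> u" using r unfolding u[symmetric] by simp
    moreover have "u \<le> 1/2"
      using r unfolding u[symmetric] by (intro real_le_lsqrt) (auto simp: power2_eq_square)
    ultimately have "\<mu> \<in> real_seg (-1/2) (1/2)" by (force simp: real_seg_def)
    thus False using l by blast
  qed
  thus ?thesis unfolding sqrt_branch_def using nz by (intro holomorphic_intros) auto
qed

lemma sqrt_branch_at_infinity: "(\<lambda>\<mu>. sqrt_branch \<mu> - 2 * \<mu>) \<in> O[at_infinity](\<lambda>_. 1)"
proof -
  have csqrt_bound: "cmod (csqrt w - 1) \<le> cmod (w - 1)" for w
  proof -
    have "1 \<le> Re (csqrt w + 1)" using csqrt_principal[of w] by auto
    hence "1 \<le> cmod (csqrt w + 1)" using complex_Re_le_cmod order.trans by blast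
    moreover have "cmod (w - 1) = cmod (csqrt w - 1) * cmod (csqrt w + 1)"
      by (simp add: norm_mult[symmetric] algebra_simps power2_eq_square[symmetric])
    ultimately show ?thesis by (simp add: mult_le_cancel_left1)
  qed
  have "cmod (sqrt_branch \<mu> - 2 * \<mu>) \<le> 1 * cmod 1" if "1 \<le> cmod \<mu>" for \<mu>
  proof -
    have nz: "\<mu> \<noteq> 0" using that by auto
    have "sqrt_branch \<mu> - 2 * \<mu> = 2 * \<mu> * (csqrt (1 - 1 / (4 * \<mu>\<^sup>2)) - 1)"
      by (simp add: sqrt_branch_def algebra_simps)
    hence "cmod (sqrt_branch \<mu> - 2 * \<mu>) = 2 * cmod \<mu> * cmod (csqrt (1 - 1 / (4 * \<mu>\<^sup>2)) - 1)"
      by (simp add: norm_mult)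
    also have "\<dots> \<le> 2 * cmod \<mu> * cmod (1 / (4 * \<mu>\<^sup>2))"
      using csqrt_bound[of "1 - 1 / (4 * \<mu>\<^sup>2)"] by (intro mult_left_mono) auto
    also have "\<dots> \<le> 1"
      using that nz by (simp add: norm_divide norm_mult norm_power field_simps power2_eq_square)
    finally show ?thesis by simp
  qed
  thus ?thesis by (intro bigoI[where c = 1]) (auto simp: eventually_at_infinity)
qed

definition a_fun :: "complex \<Rightarrow> complex" where
  "a_fun \<mu> = Ln ((\<i> + sqrt_branch \<mu>) / (2 * \<mu>)) / (\<i> * of_real pi)"


section \<open>Hypergeometric functions\<close>

text \<open>The principal branch of the Gauss hypergeometric function: the analytic continuation of the
  Gauss series to the plane slit along \<open>[1, \<infinity>)\<close>.\<close>

definition hyp2F1 :: "complex \<Rightarrow> complex \<Rightarrow> complex \<Rightarrow> complex \<Rightarrow> complex" where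
  "hyp2F1 p q r = (SOME f. f holomorphic_on (- complex_of_real ` {1..}) \<and>
     (\<forall>z \<in> ball 0 1. f z = eval_fps (fps_hypergeo [p, q] [r] 1) z))"

definition eta_domain :: "complex set" where
  "eta_domain = - complex_of_real ` ({..0} \<union> {1..})"

text \<open>Analytic continuation, across \<open>(0, 1)\<close>, of a function given on the upper half-plane.  In the
  lower half-plane it differs from the given formula with principal branches, since
  \<open>1/\<eta>\<close> crosses the cut of the hypergeometric function.\<close>

definition continue_from_upper :: "(complex \<Rightarrow> complex) \<Rightarrow> complex \<Rightarrow> complex" where
  "continue_from_upper f =
     (SOME g. g holomorphic_on eta_domain \<and> (\<forall>\<eta>. Im \<eta> > 0 \<longrightarrow> g \<eta> = f \<eta>))"

definition h_inf :: "complex \<Rightarrow> complex \<Rightarrow> complex" where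
  "h_inf a = continue_from_upper
     (\<lambda>\<eta>. exp (a * of_real pi * \<i>) * \<eta> powr (- a) * hyp2F1 a (a + 1) (2 * a + 2) (1 / \<eta>))"

definition s_inf :: "complex \<Rightarrow> complex \<Rightarrow> complex" where
  "s_inf a = continue_from_upper
     (\<lambda>\<eta>. - exp (- a * of_real pi * \<i>) * \<eta> powr (a + 1) * hyp2F1 (- a - 1) (- a) (- 2 * a) (1 / \<eta>))"

definition Gamma_hat :: "complex \<Rightarrow> complex \<Rightarrow> complex^2^2" where
  "Gamma_hat a \<eta> = mat2 (h_inf a \<eta>) (s_inf a \<eta>) (deriv (h_inf a) \<eta>) (deriv (s_inf a) \<eta>)"


section \<open>The explicit formula\<close>

definition Q_mat :: "complex \<Rightarrow> complex^2^2" where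
  "Q_mat a =
     mat2 (- tan (a * of_real pi)) 0
          0 (4 powr (2 * a + 1) * exp (a * of_real pi * \<i>) *
             (Gamma (a + 3/2) * Gamma (a + 1/2) / (Gamma a * Gamma (a + 2)))) **
     mat2 1 (exp (a * of_real pi * \<i>)) (- exp (a * of_real pi * \<i>)) 1"

definition M1 :: "real \<Rightarrow> real \<Rightarrow> complex \<Rightarrow> complex" where
  "M1 bL bR z = of_real bR * (z - of_real bL) / (z * of_real (bR - bL))"

definition M1_infinity :: "real \<Rightarrow> real \<Rightarrow> complex" where
  "M1_infinity bL bR = of_real (bR / (bR - bL))"

definition Gamma_formula :: "real \<Rightarrow> real \<Rightarrow> complex \<Rightarrow> complex \<Rightarrow> complex^2^2" where
  "Gamma_formula bL bR \<mu> z = (let a = a_fun \<mu> in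
     sigma2 ** matrix_inv (Q_mat a) ** matrix_inv (Gamma_hat a (M1_infinity bL bR)) **
     mat2 1 (of_real (bL * bR) / (z * of_real (bR - bL) * (a + 1))) 0 1 **
     Gamma_hat a (M1 bL bR z) ** Q_mat a ** sigma2)"

end

theory Submission
  imports Defs "HOL-Real_Asymp.Real_Asymp"
begin

text \<open>
  With \<open>\<kappa> = a (a + 1)\<close> both columns of \<open>\<Gamma>^(\<eta>)\<close> come from the equation \<open>\<eta> (1 - \<eta>) f'' + \<kappa> f = 0\<close>.
  Let \<open>\<phi>\<close> be its solution with \<open>\<phi>(0) = 0\<close>, \<open>\<phi>'(0) = 1\<close>, obtained by Picard iteration on the plane slit along
  \<open>[1, \<infinity>)\<close>.  Up to one scalar, \<open>\<Gamma>^ Q \<sigma>\<^sub>2\<close> is the matrix \<open>\<Phi>\<close> with columns \<open>(\<phi>(\<eta>), \<phi>'(\<eta>))\<close> and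
  \<open>(- \<phi>(1 - \<eta>), \<phi>'(1 - \<eta>))\<close>, so the formula reads \<open>\<Phi>(m)\<^sup>-\<^sup>1 T \<Phi>(\<eta>)\<close> with \<open>m = M1(\<infinity>)\<close>, and
  \<open>det \<Phi> = sin (\<pi> a) / (\<pi> \<kappa>)\<close> is a nonzero constant.  Across its cut, \<open>\<phi>(1 - \<eta>)\<close> changes by
  \<open>2 i sin (\<pi> a) \<phi>(\<eta>)\<close> up to sign, and \<open>2 sin (\<pi> a) = 1 / \<lambda>\<close> gives the jumps.  As \<open>\<eta> \<rightarrow> \<infinity>\<close> the
  solutions behave like \<open>\<eta>\<close> to the powers \<open>a + 1\<close> and \<open>- a\<close>; the factor \<open>T\<close> cancels the leading term of the former, so that
  at \<open>z = 0\<close> the entries grow at most like \<open>|z|\<close> to the power \<open>- |Re a| > - 1/2\<close>, which is the \<open>L\<^sup>2\<close> condition.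

  For uniqueness, let \<open>u\<close> and \<open>v\<close> be rows of two solutions.  Their determinant \<open>u\<^sub>1 v\<^sub>2 - u\<^sub>2 v\<^sub>1\<close> has no jump
  and at most logarithmic singularities at \<open>bL\<close> and \<open>bR\<close>, and its boundary values are attained in \<open>L\<^sup>1\<close>.  Hence its
  primitives stay bounded near \<open>0\<close>, all three singularities are removable, and Liouville's theorem makes it constant.
  At \<open>\<lambda> = \<infinity>\<close> the solution is the identity matrix, and \<open>\<phi>(\<eta>) \<rightarrow> \<eta>\<close> as \<open>\<kappa> \<rightarrow> 0\<close>.
\<close>

section \<open>Picard iteration at a regular singular point\<close>

text \<open>\<open>hyp2F1\<close> and \<open>continue_from_upper\<close> are chosen continuations,
  so their values are unknown until some continuation is exhibited. It is not built from integral
  representations: near infinity the Gauss series is identified with a combination of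
  \<open>hg_phi\<close> and \<open>hg_cut\<close>, which live on whole slit planes. The ratio of the
  two coefficients is forced by the monodromy at infinity, the remaining scalar by comparing
  logarithmic growth as \<eta> tends to 1, where only the limit of n times the n-th coefficient
  matters. The exponents are 0 and 1 both at \<eta> = 0 and at \<eta> = 1. They differ by an
  integer, so the second solution carries a logarithm, whose coefficient produces the jumps.
  Invariance under \<eta> \<mapsto> 1 - \<eta> is the reason why one function \<phi> suffices. The
  exponents at infinity are a and - a - 1; the strip |Re a| < 1/2 without 0 keeps 2 a off the
  integers, so no logarithm occurs there and neither sin (\<pi> a) nor cos (\<pi> a)
  vanishes.\<close>

definition picard_op :: "(complex \<Rightarrow> complex) \<Rightarrow> complex \<Rightarrow> complex" where
  "picard_op f z = z * integral {0..1} (\<lambda>t::real. of_real (1 - t) * f (of_real t * z))"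

text \<open>By Cauchy's formula for repeated integration, \<open>z * picard_op f z\<close> is the
  second primitive of f that vanishes to second order at 0. With r = z v the equation z r'' = P r +
  z g becomes (z v)'' = P v + g, and these are the terms of the Neumann series for v.\<close>

fun picard_seq :: "(complex \<Rightarrow> complex) \<Rightarrow> (complex \<Rightarrow> complex) \<Rightarrow> nat \<Rightarrow> complex \<Rightarrow> complex" where
  "picard_seq P g 0 = picard_op g"
| "picard_seq P g (Suc n) = picard_op (\<lambda>z. P z * picard_seq P g n z)"

text \<open>Phrased by scaling, because \<open>picard_op\<close> evaluates its argument at the
  points t z.\<close>

definition starlike0 :: "complex set \<Rightarrow> bool" where
  "starlike0 S \<longleftrightarrow> open S \<and> 0 \<in> S \<and> (\<forall>z\<in>S. \<forall>t\<in>{0..1}. of_real t * z \<in> S)"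

lemma starlike0_starlike: "starlike0 S \<Longrightarrow> starlike S"
  unfolding starlike0_def starlike_def
  by (auto intro!: bexI[of _ 0] simp: closed_segment_def scaleR_conv_of_real)

lemma starlike0_primitive:
  assumes S: "starlike0 S" and f: "f holomorphic_on S"
  obtains F where "\<And>z. z \<in> S \<Longrightarrow> (F has_field_derivative f z) (at z)" "F 0 = 0" "F holomorphic_on S"
proof -
  have "\<exists>F. \<forall>x\<in>S. (F has_field_derivative f x) (at x)"
    by (rule holomorphic_starlike_primitive[where k = "{}"])
       (use S holomorphic_on_imp_differentiable_at[OF f] in
        \<open>auto intro: starlike0_starlike holomorphic_on_imp_continuous_on[OF f] simp: starlike0_def\<close>)
  then obtain F where F: "\<And>x. x \<in> S \<Longrightarrow> (F has_field_derivative f x) (at x)" by blast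
  have *: "((\<lambda>z. F z - F 0) has_field_derivative f z) (at z)" if "z \<in> S" for z
    using F[OF that] by (auto intro!: derivative_eq_intros)
  have "(\<lambda>z. F z - F 0) holomorphic_on S"
    using * S unfolding starlike0_def by (subst holomorphic_on_open) auto
  with * show thesis by (intro that[of "\<lambda>z. F z - F 0"]) auto
qed

lemma picard_op:
  assumes S: "starlike0 S" and f: "f holomorphic_on S"
  shows picard_op_holomorphic: "picard_op f holomorphic_on S"
    and picard_op_deriv2: "\<And>z. z \<in> S \<Longrightarrow> (deriv ^^ 2) (\<lambda>z. z * picard_op f z) z = f z"
proof -
  have op: "open S" using S by (simp add: starlike0_def)
  obtain F1 where F1: "\<And>z. z \<in> S \<Longrightarrow> (F1 has_field_derivative f z) (at z)" "F1 0 = 0" "F1 holomorphic_on S"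
    using starlike0_primitive[OF S f] by blast
  obtain F2 where F2: "\<And>z. z \<in> S \<Longrightarrow> (F2 has_field_derivative F1 z) (at z)" "F2 0 = 0" "F2 holomorphic_on S"
    using starlike0_primitive[OF S F1(3)] by blast
  have eq: "z * picard_op f z = F2 z" if z: "z \<in> S" for z
  proof -
    have tz: "of_real t * z \<in> S" if "t \<in> {0..1}" for t
      using S z that by (auto simp: starlike0_def)
    \<comment> \<open>Taylor's formula with integral remainder on the segment from 0 to z: (1 - t) z
      F1 (t z) + F2 (t z) is a primitive of the integrand in t, and it vanishes at t = 0.\<close>
    have "((\<lambda>t::real. z\<^sup>2 * (of_real (1 - t) * f (of_real t * z))) has_integral
            (of_real (1 - 1) * z * F1 (of_real 1 * z) + F2 (of_real 1 * z)) -
            (of_real (1 - 0) * z * F1 (of_real 0 * z) + F2 (of_real 0 * z))) {0..1}"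
    proof (rule fundamental_theorem_of_calculus, simp)
      fix t :: real assume t: "t \<in> {0..1}"
      note [derivative_intros] = has_vector_derivative_real_field
      let ?G = "\<lambda>w. (1 - w) * z * F1 (w * z) + F2 (w * z)"
      have "(?G has_field_derivative z\<^sup>2 * (of_real (1 - t) * f (of_real t * z))) (at (of_real t))"
        by (rule derivative_eq_intros DERIV_chain2[OF F1(1)] DERIV_chain2[OF F2(1)] tz[OF t] refl)+
           (simp add: algebra_simps power2_eq_square)
      from has_vector_derivative_real_field[OF this]
      show "((\<lambda>a. of_real (1 - a) * z * F1 (of_real a * z) + F2 (of_real a * z)) has_vector_derivative
         z\<^sup>2 * (of_real (1 - t) * f (of_real t * z))) (at t within {0..1})"
        by simp
    qed
    from integral_unique[OF this]
    have "integral {0..1} (\<lambda>t::real. z\<^sup>2 * (of_real (1 - t) * f (of_real t * z))) = F2 z"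
      using F1(2) F2(2) by simp
    thus ?thesis by (simp add: picard_op_def power2_eq_square mult.assoc)
  qed
  \<comment> \<open>\<open>picard_op f\<close> is the difference quotient of \<open>F2\<close> at 0,
    so the singularity there is removable. The value filled in is \<open>F1 0 = 0\<close>, in
    agreement with the factor z of \<open>picard_op\<close>.\<close>
  have "(\<lambda>z. if z = 0 then deriv F2 0 else (F2 z - F2 0) / (z - 0)) holomorphic_on S"
    by (rule pole_lemma_open) (use F2 op in auto)
  moreover have "deriv F2 0 = 0"
    using F2(1)[of 0] F1(2) S by (auto simp: starlike0_def DERIV_imp_deriv)
  ultimately show "picard_op f holomorphic_on S"
    by (rule_tac holomorphic_transform)
       (use eq F2(2) in \<open>force simp: picard_op_def[of f 0] field_simps\<close>)+
  fix z assume z: "z \<in> S"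
  have ev: "eventually (\<lambda>w. w \<in> S) (nhds z)" using op z by (rule eventually_nhds_in_open)
  have "eventually (\<lambda>w. deriv (\<lambda>z. z * picard_op f z) w = F1 w) (nhds z)"
  proof -
    have "deriv (\<lambda>z. z * picard_op f z) w = F1 w" if "w \<in> S" for w
    proof -
      have "deriv (\<lambda>z. z * picard_op f z) w = deriv F2 w"
        using op that eq by (intro deriv_cong_ev eventually_mono[OF eventually_nhds_in_open[of S w]]) auto
      thus ?thesis using F2(1)[OF that] by (simp add: DERIV_imp_deriv)
    qed
    thus ?thesis using ev by (rule eventually_mono[rotated])
  qed
  hence "deriv (deriv (\<lambda>z. z * picard_op f z)) z = deriv F1 z"
    by (intro deriv_cong_ev) auto
  thus "(deriv ^^ 2) (\<lambda>z. z * picard_op f z) z = f z"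
    using F1(1)[OF z] by (simp add: DERIV_imp_deriv numeral_2_eq_2)
qed

text \<open>The factor 1 - t is estimated by 1; integrating t ^ n already gives 1 / (n + 1), which
  is what builds up the factorial in \<open>picard_seq_bound\<close>.\<close>

lemma picard_op_bound:
  assumes S: "starlike0 S" and f: "f holomorphic_on S" and z: "z \<in> S"
    and b: "\<And>t. t \<in> {0..1} \<Longrightarrow> cmod (f (of_real t * z)) \<le> c * t ^ n"
  shows "cmod (picard_op f z) \<le> cmod z * (c / (n + 1))"
proof -
  have int: "((\<lambda>t::real. c * t ^ n) has_integral c * (1 ^ Suc n / Suc n) - c * (0 ^ Suc n / Suc n)) {0..1}"
    by (rule fundamental_theorem_of_calculus)
       (auto intro!: derivative_eq_intros simp flip: has_real_derivative_iff_has_vector_derivative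
             simp del: power_Suc)
  have "continuous_on {0..1} (\<lambda>t::real. of_real (1 - t) * f (of_real t * z))"
    using S z by (intro continuous_intros continuous_on_compose2[OF holomorphic_on_imp_continuous_on[OF f]])
                 (auto simp: starlike0_def)
  hence "(\<lambda>t::real. of_real (1 - t) * f (of_real t * z)) integrable_on {0..1}"
    by (rule integrable_continuous_real)
  moreover have "norm (of_real (1 - t) * f (of_real t * z)) \<le> c * t ^ n" if "t \<in> {0..1}" for t
  proof -
    have "norm (of_real (1 - t) * f (of_real t * z)) = (1 - t) * cmod (f (of_real t * z))"
      using that by (simp only: norm_mult norm_of_real) auto
    also have "\<dots> \<le> 1 * cmod (f (of_real t * z))"
      using that by (intro mult_right_mono) auto
    finally show ?thesis using b[OF that] by simp
  qed
  ultimately have "norm (integral {0..1} (\<lambda>t::real. of_real (1 - t) * f (of_real t * z))) \<le>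
      integral {0..1} (\<lambda>t::real. c * t ^ n)"
    using int by (intro integral_norm_bound_integral) (auto simp: has_integral_integrable)
  also have "\<dots> = c / (n + 1)" using integral_unique[OF int] by simp
  finally show ?thesis unfolding picard_op_def norm_mult by (rule mult_left_mono) simp
qed

lemma picard_seq_holomorphic:
  assumes "starlike0 S" "P holomorphic_on S" "g holomorphic_on S"
  shows "picard_seq P g n holomorphic_on S"
  by (induction n) (auto intro!: picard_op_holomorphic[OF assms(1)] holomorphic_intros assms)

text \<open>The bounds on P and g are imposed on the whole segment from 0 to z, so that the
  induction hypothesis applies at t z. There the power of |t z| supplies the power of t that
  \<open>picard_op_bound\<close> asks for.\<close>

lemma picard_seq_bound:
  assumes S: "starlike0 S" and P: "P holomorphic_on S" and g: "g holomorphic_on S" and z: "z \<in> S"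
    and m: "\<And>t. t \<in> {0..1} \<Longrightarrow> cmod (P (of_real t * z)) \<le> m"
    and m': "\<And>t. t \<in> {0..1} \<Longrightarrow> cmod (g (of_real t * z)) \<le> m'"
  shows "cmod (picard_seq P g n z) \<le> m' * m ^ n * cmod z ^ Suc n / fact (Suc n)"
  using z m m'
proof (induction n arbitrary: z)
  case 0
  have "cmod (picard_op g z) \<le> cmod z * (m' / (0 + 1))"
    using picard_op_bound[OF S g, of z m' 0] 0 by simp
  thus ?case by (simp add: mult_ac)
next
  case (Suc n)
  have m0: "0 \<le> m" using order_trans[OF norm_ge_zero Suc.prems(2)[of 0]] by simp
  have tz: "of_real t * z \<in> S" if "t \<in> {0..1}" for t
    using S Suc.prems(1) that by (auto simp: starlike0_def)
  have IH: "cmod (picard_seq P g n (of_real t * z)) \<le> m' * m ^ n * cmod (of_real t * z) ^ Suc n / fact (Suc n)"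
    if t: "t \<in> {0..1}" for t
  proof (rule Suc.IH[OF tz[OF t]])
    fix s :: real assume s: "s \<in> {0..1}"
    have st: "s * t \<in> {0..1}" using s t by (auto intro: mult_le_one)
    show "cmod (P (of_real s * (of_real t * z))) \<le> m" "cmod (g (of_real s * (of_real t * z))) \<le> m'"
      using Suc.prems(2,3)[OF st] by (simp_all add: mult_ac)
  qed
  let ?c = "m * (m' * m ^ n * cmod z ^ Suc n / fact (Suc n))"
  have "cmod (picard_op (\<lambda>z. P z * picard_seq P g n z) z) \<le> cmod z * (?c / real (Suc n + 1))"
  proof (rule picard_op_bound[OF S _ Suc.prems(1)])
    show "(\<lambda>z. P z * picard_seq P g n z) holomorphic_on S"
      by (intro holomorphic_intros P picard_seq_holomorphic S g)
    fix t :: real assume t: "t \<in> {0..1}"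
    have "cmod (P (of_real t * z) * picard_seq P g n (of_real t * z)) \<le>
          m * (m' * m ^ n * cmod (of_real t * z) ^ Suc n / fact (Suc n))"
      unfolding norm_mult[of "P _"] by (intro mult_mono Suc.prems(2) IH t m0) auto
    also have "\<dots> = ?c * t ^ Suc n"
      using t by (simp add: norm_mult power_mult_distrib)
    finally show "cmod (P (of_real t * z) * picard_seq P g n (of_real t * z)) \<le> ?c * t ^ Suc n" .
  qed
  also have "\<dots> = m' * m ^ Suc n * cmod z ^ Suc (Suc n) / fact (Suc (Suc n))"
    by (simp add: divide_simps) (simp add: algebra_simps)?
  finally show ?case by simp
qed

lemma summable_picard: "summable (\<lambda>n. m' * m ^ n * R ^ Suc n / fact (Suc n) :: real)"
proof (rule summable_comparison_test'[of "\<lambda>n. \<bar>m'\<bar> * \<bar>R\<bar> * ((\<bar>m\<bar> * \<bar>R\<bar>) ^ n /\<^sub>R fact n)" 0])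
  show "summable (\<lambda>n. \<bar>m'\<bar> * \<bar>R\<bar> * ((\<bar>m\<bar> * \<bar>R\<bar>) ^ n /\<^sub>R fact n))"
    by (intro summable_mult summable_exp_generic)
  fix n :: nat
  have "norm (m' * m ^ n * R ^ Suc n / fact (Suc n)) =
      \<bar>m'\<bar> * \<bar>R\<bar> * (\<bar>m\<bar> * \<bar>R\<bar>) ^ n / fact (Suc n)"
    by (simp add: abs_mult power_abs power_mult_distrib)
  also have "\<dots> \<le> \<bar>m'\<bar> * \<bar>R\<bar> * (\<bar>m\<bar> * \<bar>R\<bar>) ^ n / fact n"
    by (intro divide_left_mono fact_mono) auto
  finally show "norm (m' * m ^ n * R ^ Suc n / fact (Suc n)) \<le> \<bar>m'\<bar> * \<bar>R\<bar> * ((\<bar>m\<bar> * \<bar>R\<bar>) ^ n /\<^sub>R fact n)"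
    by (simp add: divide_inverse mult_ac)
qed

lemma suminf_picard_le:
  assumes "0 \<le> m'" "0 \<le> m" "0 \<le> R"
  shows "(\<Sum>n. m' * m ^ n * R ^ Suc n / fact (Suc n)) \<le> m' * R * exp (m * R :: real)"
proof -
  have "(\<Sum>n. m' * m ^ n * R ^ Suc n / fact (Suc n)) \<le> (\<Sum>n. m' * R * ((m * R) ^ n /\<^sub>R fact n))"
  proof (intro suminf_le summable_picard summable_mult summable_exp_generic)
    fix n
    have "m' * m ^ n * R ^ Suc n / fact (Suc n) \<le> m' * m ^ n * R ^ Suc n / fact n"
      using assms by (intro divide_left_mono fact_mono) auto
    thus "m' * m ^ n * R ^ Suc n / fact (Suc n) \<le> m' * R * ((m * R) ^ n /\<^sub>R fact n)"
      by (simp add: power_mult_distrib divide_inverse mult_ac)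
  qed
  also have "\<dots> = m' * R * exp (m * R)"
    by (subst suminf_mult[OF summable_exp_generic]) (simp add: exp_def)
  finally show ?thesis .
qed

text \<open>The segments from 0 to the points of K sweep out a compact subset of S, on which f is
  bounded.\<close>

lemma starlike0_compact_bound:
  assumes S: "starlike0 S" and f: "f holomorphic_on S" and K: "compact K" "K \<subseteq> S"
  obtains m where "0 \<le> m" "\<And>z t. z \<in> K \<Longrightarrow> t \<in> {0..1} \<Longrightarrow> cmod (f (of_real t * z)) \<le> m"
proof -
  have "compact ((\<lambda>(t, z). of_real t * z) ` ({0..1::real} \<times> K))"
    by (intro compact_continuous_image compact_Times K) (auto intro!: continuous_intros simp: case_prod_beta)
  moreover have "(\<lambda>(t, z). of_real t * z) ` ({0..1::real} \<times> K) \<subseteq> S"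
    using S K by (auto simp: starlike0_def)
  ultimately have "bounded (f ` ((\<lambda>(t, z). of_real t * z) ` ({0..1::real} \<times> K)))"
    using compact_imp_bounded compact_continuous_image
      continuous_on_subset[OF holomorphic_on_imp_continuous_on[OF f]] by metis
  then obtain m where m: "\<And>x. x \<in> f ` ((\<lambda>(t, z). of_real t * z) ` ({0..1::real} \<times> K)) \<Longrightarrow> norm x \<le> m"
    unfolding bounded_iff by blast
  have "cmod (f (of_real t * z)) \<le> max 0 m" if "z \<in> K" "t \<in> {0..1}" for z t
  proof -
    have "f (of_real t * z) \<in> f ` ((\<lambda>(t, z). of_real t * z) ` ({0..1::real} \<times> K))"
      using that by (intro imageI rev_image_eqI[of "(t, z)"]) auto
    from m[OF this] show ?thesis by simp
  qed
  thus thesis by (intro that[of "max 0 m"]) auto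
qed

text \<open>r is z times the sum v of the Neumann series, which converges locally uniformly thanks
  to the factorial in \<open>picard_seq_bound\<close>. The last conclusion is kept explicit in the
  sizes of P and g on the segment from 0 to z: with P and g proportional to \<kappa> it yields the
  limit \<kappa> \<rightarrow> 0.\<close>

lemma picard_solution:
  assumes S: "starlike0 S" and P: "P holomorphic_on S" and g: "g holomorphic_on S"
  obtains r where "r holomorphic_on S" "r 0 = 0" "deriv r 0 = 0"
    "\<And>z. z \<in> S \<Longrightarrow> z * (deriv ^^ 2) r z = P z * r z + z * g z"
    "\<And>z m m'. z \<in> S \<Longrightarrow> (\<And>t. t \<in> {0..1} \<Longrightarrow> cmod (P (of_real t * z)) \<le> m) \<Longrightarrow>
       (\<And>t. t \<in> {0..1} \<Longrightarrow> cmod (g (of_real t * z)) \<le> m') \<Longrightarrow>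
       cmod (r z) \<le> m' * cmod z ^ 2 * exp (m * cmod z)"
proof -
  let ?v = "picard_seq P g"
  define v where "v z = (\<Sum>n. ?v n z)" for z
  have op: "open S" and zS: "0 \<in> S" using S by (auto simp: starlike0_def)
  have hol: "?v n holomorphic_on S" for n by (rule picard_seq_holomorphic[OF S P g])
  have summ: "summable (\<lambda>n. ?v n z)" if z: "z \<in> S" for z
  proof -
    obtain m where m: "0 \<le> m" "\<And>w t. w \<in> {z} \<Longrightarrow> t \<in> {0..1} \<Longrightarrow> cmod (P (of_real t * w)) \<le> m"
      using starlike0_compact_bound[OF S P, of "{z}"] z by auto
    obtain m' where m': "0 \<le> m'" "\<And>w t. w \<in> {z} \<Longrightarrow> t \<in> {0..1} \<Longrightarrow> cmod (g (of_real t * w)) \<le> m'"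
      using starlike0_compact_bound[OF S g, of "{z}"] z by auto
    show ?thesis
      by (rule summable_comparison_test'[OF summable_picard[of m' m "cmod z"], of 0])
         (use picard_seq_bound[OF S P g z, of m m'] m m' in auto)
  qed
  have unif: "\<exists>d>0. cball x d \<subseteq> S \<and> uniform_limit (cball x d) (\<lambda>N z. \<Sum>n<N. ?v n z) v sequentially \<and>
                uniform_limit (cball x d) (\<lambda>N z. \<Sum>n<N. z * ?v n z) (\<lambda>z. z * v z) sequentially"
    if x: "x \<in> S" for x
  proof -
    obtain d where d: "d > 0" "cball x d \<subseteq> S" using op x open_contains_cball by blast
    obtain m where m: "0 \<le> m" "\<And>w t. w \<in> cball x d \<Longrightarrow> t \<in> {0..1} \<Longrightarrow> cmod (P (of_real t * w)) \<le> m"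
      using starlike0_compact_bound[OF S P compact_cball d(2)] by auto
    obtain m' where m': "0 \<le> m'" "\<And>w t. w \<in> cball x d \<Longrightarrow> t \<in> {0..1} \<Longrightarrow> cmod (g (of_real t * w)) \<le> m'"
      using starlike0_compact_bound[OF S g compact_cball d(2)] by auto
    define R where "R = cmod x + d"
    have R: "cmod w \<le> R" if "w \<in> cball x d" for w
      using that norm_triangle_sub[of w x] by (auto simp: R_def dist_norm norm_minus_commute)
    have R0: "0 \<le> R" using d by (simp add: R_def)
    have b: "cmod (?v n w) \<le> m' * m ^ n * R ^ Suc n / fact (Suc n)" if w: "w \<in> cball x d" for n w
    proof -
      have "cmod (?v n w) \<le> m' * m ^ n * cmod w ^ Suc n / fact (Suc n)"
        by (rule picard_seq_bound[OF S P g]) (use m m' w d in auto)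
      also have "\<dots> \<le> m' * m ^ n * R ^ Suc n / fact (Suc n)"
        using R[OF w] m m' by (intro divide_right_mono mult_left_mono power_mono) auto
      finally show ?thesis .
    qed
    have "uniform_limit (cball x d) (\<lambda>N z. \<Sum>n<N. ?v n z) (\<lambda>z. \<Sum>n. ?v n z) sequentially"
      by (rule Weierstrass_m_test[OF b summable_picard])
    moreover have u: "uniform_limit (cball x d) (\<lambda>N z. \<Sum>n<N. z * ?v n z) (\<lambda>z. \<Sum>n. z * ?v n z) sequentially"
    proof (rule Weierstrass_m_test[OF _ summable_mult[OF summable_picard[of m' m R], of R]])
      fix n w assume w: "w \<in> cball x d"
      show "norm (w * ?v n w) \<le> R * (m' * m ^ n * R ^ Suc n / fact (Suc n))"
        unfolding norm_mult[of w] by (intro mult_mono R b w R0) auto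
    qed
    moreover have eq: "(\<Sum>n. z * ?v n z) = z * v z" if "z \<in> cball x d" for z
      using that summ[of z] d by (auto simp: v_def suminf_mult)
    have "uniform_limit (cball x d) (\<lambda>N z. \<Sum>n<N. z * ?v n z) (\<lambda>z. z * v z) sequentially"
      by (rule uniform_limit_cong'[THEN iffD1, OF _ _ u]) (use eq in auto)
    ultimately show ?thesis using d unfolding v_def by (intro exI[of _ d] conjI)
  qed
  have v: "v holomorphic_on S"
    by (rule holomorphic_uniform_sequence[OF op, of "\<lambda>N z. \<Sum>n<N. ?v n z"])
       (use unif in \<open>auto intro!: holomorphic_intros hol\<close>)
  have v0: "v 0 = 0"
  proof -
    have "?v n 0 = 0" for n by (cases n) (auto simp: picard_op_def)
    thus ?thesis by (simp add: v_def)
  qed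
  have ode: "(deriv ^^ 2) (\<lambda>z. z * v z) z = P z * v z + g z" if z: "z \<in> S" for z
  proof -
    obtain d where d: "d > 0" "cball z d \<subseteq> S"
      "uniform_limit (cball z d) (\<lambda>N z. \<Sum>n<N. z * ?v n z) (\<lambda>z. z * v z) sequentially"
      using unif[OF z] by blast
    have zd: "z \<in> ball z d" using d by simp
    have hn: "(\<lambda>z. z * ?v n z) holomorphic_on ball z d" for n
      using d by (auto intro!: holomorphic_intros holomorphic_on_subset[OF hol[of n]])
    have "(\<lambda>N. (deriv ^^ 2) (\<lambda>z. \<Sum>n<N. z * ?v n z) z) \<longlonglongrightarrow> (deriv ^^ 2) (\<lambda>z. z * v z) z"
    proof (rule higher_deriv_complex_uniform_limit[where A = "ball z d"])
      show "uniform_limit (ball z d) (\<lambda>N z. \<Sum>n<N. z * ?v n z) (\<lambda>z. z * v z) sequentially"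
        by (rule uniform_limit_on_subset[OF d(3)]) auto
      show "\<forall>\<^sub>F N in sequentially. (\<lambda>z. \<Sum>n<N. z * ?v n z) holomorphic_on ball z d"
        by (intro always_eventually allI holomorphic_on_sum hn)
    qed (use zd in auto)
    moreover have *: "(deriv ^^ 2) (\<lambda>z. \<Sum>n<N. z * ?v n z) z = (\<Sum>n<N. (deriv ^^ 2) (\<lambda>z. z * ?v n z) z)" for N
    proof (induction N)
      case (Suc N)
      have "(\<lambda>z. \<Sum>n<N. z * ?v n z) holomorphic_on ball z d" by (intro holomorphic_on_sum hn)
      from higher_deriv_add[OF this hn[of N] open_ball zd, of 2] Suc show ?case by simp
    qed simp
    moreover have "(deriv ^^ 2) (\<lambda>z. z * ?v 0 z) z = g z"
      "(deriv ^^ 2) (\<lambda>z. z * ?v (Suc n) z) z = P z * ?v n z" for n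
      using picard_op_deriv2[OF S g z] picard_op_deriv2[OF S _ z, of "\<lambda>z. P z * ?v n z"]
      by (auto intro!: holomorphic_intros P hol)
    \<comment> \<open>A partial sum of z v differentiated twice is g plus P times the preceding
      partial sum of v. This shift of the index becomes the equation in the limit.\<close>
    hence "(\<Sum>n<Suc N. (deriv ^^ 2) (\<lambda>z. z * ?v n z) z) = g z + P z * (\<Sum>n<N. ?v n z)" for N
      by (simp only: sum.lessThan_Suc_shift sum_distrib_left)
    ultimately have "(\<lambda>N. g z + P z * (\<Sum>n<N. ?v n z)) \<longlonglongrightarrow> (deriv ^^ 2) (\<lambda>z. z * v z) z"
      by (subst (asm) filterlim_sequentially_Suc[symmetric]) (simp only: *)
    moreover have "(\<lambda>N. g z + P z * (\<Sum>n<N. ?v n z)) \<longlonglongrightarrow> g z + P z * v z"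
      unfolding v_def by (intro tendsto_intros summable_LIMSEQ summ z)
    ultimately show ?thesis using LIMSEQ_unique by fastforce
  qed
  show thesis
  proof (rule that[of "\<lambda>z. z * v z"])
    show "(\<lambda>z. z * v z) holomorphic_on S" by (intro holomorphic_intros v)
    have "(v has_field_derivative deriv v 0) (at 0)" using v op zS by (rule holomorphic_derivI)
    hence "((\<lambda>z. z * v z) has_field_derivative 0) (at 0)"
      by (auto intro!: derivative_eq_intros simp: v0)
    thus "deriv (\<lambda>z. z * v z) 0 = 0" by (rule DERIV_imp_deriv)
    show "z * (deriv ^^ 2) (\<lambda>z. z * v z) z = P z * (z * v z) + z * g z" if "z \<in> S" for z
      using ode[OF that] by (simp add: algebra_simps)
    fix z m m' assume z: "z \<in> S" and m: "\<And>t. t \<in> {0..1} \<Longrightarrow> cmod (P (of_real t * z)) \<le> m"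
       and m': "\<And>t. t \<in> {0..1} \<Longrightarrow> cmod (g (of_real t * z)) \<le> m'"
    have m0: "0 \<le> m" "0 \<le> m'"
      using order_trans[OF norm_ge_zero m[of 0]] order_trans[OF norm_ge_zero m'[of 0]] by auto
    have b: "cmod (?v n z) \<le> m' * m ^ n * cmod z ^ Suc n / fact (Suc n)" for n
      by (rule picard_seq_bound[OF S P g z m m'])
    have "cmod (v z) \<le> (\<Sum>n. m' * m ^ n * cmod z ^ Suc n / fact (Suc n))"
      unfolding v_def by (rule norm_suminf_le[OF b summable_picard])
    also have "\<dots> \<le> m' * cmod z * exp (m * cmod z)" by (rule suminf_picard_le) (use m0 in auto)
    finally have "cmod z * cmod (v z) \<le> cmod z * (m' * cmod z * exp (m * cmod z))"
      by (intro mult_left_mono) auto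
    thus "cmod (z * v z) \<le> m' * cmod z ^ 2 * exp (m * cmod z)"
      by (simp add: norm_mult power2_eq_square mult_ac)
  qed auto
qed

section \<open>The hypergeometric equation\<close>

definition plane0 :: "complex set" where "plane0 = - complex_of_real ` {0..}"

definition plane1 :: "complex set" where "plane1 = - complex_of_real ` {1..}"

lemma plane0_iff: "z \<in> plane0 \<longleftrightarrow> Im z \<noteq> 0 \<or> Re z < 0"
  by (auto simp: plane0_def image_iff complex_eq_iff)

lemma plane1_iff: "z \<in> plane1 \<longleftrightarrow> Im z \<noteq> 0 \<or> Re z < 1"
  by (auto simp: plane1_def image_iff complex_eq_iff)

lemma eta_domain_iff: "z \<in> eta_domain \<longleftrightarrow> Im z \<noteq> 0 \<or> 0 < Re z \<and> Re z < 1"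
  by (auto simp: eta_domain_def image_iff complex_eq_iff)

lemma closed_of_real_image: "closed S \<Longrightarrow> closed (complex_of_real ` S)"
  by (rule closed_injective_linear_image) (auto simp: linear_iff scaleR_conv_of_real inj_def)

lemma open_plane0: "open plane0" and open_plane1: "open plane1" and open_eta_domain: "open eta_domain"
  unfolding plane0_def plane1_def eta_domain_def
  by (intro open_Compl closed_of_real_image closed_Un closed_atLeast closed_atMost)+

lemma starlike0_plane1: "starlike0 plane1"
  unfolding starlike0_def using open_plane1
  by (auto simp: plane1_iff) (metis mult.commute mult_le_one mult_left_le less_eq_real_def linorder_not_le mult_less_cancel_right2 mult_nonneg_nonpos not_less zero_less_one less_le_trans order_refl le_less_trans)

lemma starlike_eta_domain: "starlike eta_domain"
  unfolding starlike_def
proof (intro bexI[of _ "1/2"] ballI subsetI)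
  fix x z assume x: "x \<in> eta_domain" and "z \<in> closed_segment (1/2) x"
  then obtain u where u: "0 \<le> u" "u \<le> 1" "z = (1 - u) *\<^sub>R (1/2) + u *\<^sub>R x"
    by (auto simp: closed_segment_def)
  have *: "Re z = u * Re x + (1 - u) / 2" "Im z = u * Im x" using u(3) by auto
  show "z \<in> eta_domain"
  proof (cases "u = 0")
    case False
    have "0 < Re z \<and> Re z < 1" if "0 < Re x" "Re x < 1"
    proof -
      define y where "y = u * Re x"
      have "0 < y" "y < u" using that u(1) False by (simp_all add: y_def)
      thus ?thesis unfolding *(1) y_def[symmetric] using u(1,2) by (simp add: field_simps)
    qed
    thus ?thesis using x *(2) False by (auto simp: eta_domain_iff)
  qed (use * in \<open>auto simp: eta_domain_iff\<close>)
qed (auto simp: eta_domain_iff)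

lemma connected_eta_domain: "connected eta_domain"
  by (rule starlike_imp_connected[OF starlike_eta_domain])

text \<open>Gauss's equation with upper parameters a, - a - 1 and lower parameter 0, where \<kappa>
  = a (a + 1). It has no first order term, and it is invariant under \<eta> \<mapsto> 1 -
  \<eta>.\<close>

definition hg_ode :: "complex \<Rightarrow> (complex \<Rightarrow> complex) \<Rightarrow> complex set \<Rightarrow> bool" where
  "hg_ode \<kappa> f S \<longleftrightarrow> f holomorphic_on S \<and> (\<forall>z\<in>S. z * (1 - z) * deriv (deriv f) z + \<kappa> * f z = 0)"

lemma hg_ode_holomorphic: "hg_ode \<kappa> f S \<Longrightarrow> f holomorphic_on S"
  by (simp add: hg_ode_def)

lemma hg_ode_subset: "hg_ode \<kappa> f S \<Longrightarrow> T \<subseteq> S \<Longrightarrow> hg_ode \<kappa> f T"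
  by (auto simp: hg_ode_def intro: holomorphic_on_subset)

lemma deriv2I:
  assumes "open S" "z \<in> S" "\<And>w. w \<in> S \<Longrightarrow> (f has_field_derivative f' w) (at w)"
    "(f' has_field_derivative d) (at z)"
  shows "deriv (deriv f) z = d"
proof -
  have "eventually (\<lambda>w. deriv f w = f' w) (nhds z)"
    by (rule eventually_mono[OF eventually_nhds_in_open[OF assms(1,2)]]) (auto intro: DERIV_imp_deriv assms(3))
  hence "deriv (deriv f) z = deriv f' z" by (intro deriv_cong_ev) auto
  thus ?thesis using assms(4) by (simp add: DERIV_imp_deriv)
qed

lemma hg_odeI:
  assumes "open S" "\<And>z. z \<in> S \<Longrightarrow> (f has_field_derivative f1 z) (at z)"
    "\<And>z. z \<in> S \<Longrightarrow> (f1 has_field_derivative f2 z) (at z)"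
    "\<And>z. z \<in> S \<Longrightarrow> z * (1 - z) * f2 z + \<kappa> * f z = 0"
  shows "hg_ode \<kappa> f S"
  unfolding hg_ode_def
proof (intro conjI ballI)
  show "f holomorphic_on S" using assms(1,2) by (auto simp: holomorphic_on_open)
  fix z assume z: "z \<in> S"
  have "deriv (deriv f) z = f2 z" by (rule deriv2I[OF assms(1) z assms(2,3)]) (use z in auto)
  thus "z * (1 - z) * deriv (deriv f) z + \<kappa> * f z = 0" using assms(4)[OF z] by simp
qed

lemma hg_odeD:
  assumes "hg_ode \<kappa> f S" "open S" "z \<in> S"
  shows "(f has_field_derivative deriv f z) (at z)"
    and "(deriv f has_field_derivative deriv (deriv f) z) (at z)"
    and "z * (1 - z) * deriv (deriv f) z + \<kappa> * f z = 0"
    and "z \<noteq> 0 \<Longrightarrow> z \<noteq> 1 \<Longrightarrow> deriv (deriv f) z = - \<kappa> * f z / (z * (1 - z))"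
proof -
  have h: "f holomorphic_on S" using assms(1) by (simp add: hg_ode_def)
  show "(f has_field_derivative deriv f z) (at z)"
    using h assms(2,3) by (rule holomorphic_derivI)
  show "(deriv f has_field_derivative deriv (deriv f) z) (at z)"
    using holomorphic_deriv[OF h assms(2)] assms(2,3) by (rule holomorphic_derivI)
  show *: "z * (1 - z) * deriv (deriv f) z + \<kappa> * f z = 0" using assms by (simp add: hg_ode_def)
  assume "z \<noteq> 0" "z \<noteq> 1"
  thus "deriv (deriv f) z = - \<kappa> * f z / (z * (1 - z))" using * by (simp add: field_simps add_eq_0_iff)
qed

lemma hg_ode_lincomb:
  assumes "hg_ode \<kappa> f S" "hg_ode \<kappa> g S" "open S"
  shows "hg_ode \<kappa> (\<lambda>z. c * f z + d * g z) S"
proof (rule hg_odeI[OF assms(3)])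
  fix z assume z: "z \<in> S"
  note f = hg_odeD[OF assms(1,3) z] and g = hg_odeD[OF assms(2,3) z]
  show "((\<lambda>z. c * f z + d * g z) has_field_derivative c * deriv f z + d * deriv g z) (at z)"
    "((\<lambda>z. c * deriv f z + d * deriv g z) has_field_derivative c * deriv (deriv f) z + d * deriv (deriv g) z) (at z)"
    using f(1,2) g(1,2) by (auto intro!: derivative_eq_intros)
  have "z * (1 - z) * (c * deriv (deriv f) z + d * deriv (deriv g) z) + \<kappa> * (c * f z + d * g z) =
     c * (z * (1 - z) * deriv (deriv f) z + \<kappa> * f z) + d * (z * (1 - z) * deriv (deriv g) z + \<kappa> * g z)"
    by (simp add: algebra_simps)
  thus "z * (1 - z) * (c * deriv (deriv f) z + d * deriv (deriv g) z) + \<kappa> * (c * f z + d * g z) = 0"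
    using f(3) g(3) by simp
qed

lemma hg_ode_reflect:
  assumes "hg_ode \<kappa> f S" "open S" "open T" "\<And>z. z \<in> T \<Longrightarrow> 1 - z \<in> S"
  shows "hg_ode \<kappa> (\<lambda>z. f (1 - z)) T"
    and "z \<in> T \<Longrightarrow> deriv (\<lambda>z. f (1 - z)) z = - deriv f (1 - z)"
proof -
  have *: "((\<lambda>z. f (1 - z)) has_field_derivative - deriv f (1 - z)) (at z)"
    "((\<lambda>z. - deriv f (1 - z)) has_field_derivative deriv (deriv f) (1 - z)) (at z)" if z: "z \<in> T" for z
  proof -
    have m: "((\<lambda>z. 1 - z) has_field_derivative -1) (at z)" by (auto intro!: derivative_eq_intros)
    have d: "(f has_field_derivative deriv f (1 - z)) (at (1 - z))"
      "(deriv f has_field_derivative deriv (deriv f) (1 - z)) (at (1 - z))"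
      using hg_odeD(1,2)[OF assms(1,2) assms(4)[OF z]] .
    show "((\<lambda>z. f (1 - z)) has_field_derivative - deriv f (1 - z)) (at z)"
      using DERIV_chain2[of f _ "\<lambda>z. 1 - z", OF d(1) m] by simp
    show "((\<lambda>z. - deriv f (1 - z)) has_field_derivative deriv (deriv f) (1 - z)) (at z)"
      using DERIV_minus[OF DERIV_chain2[of "deriv f" _ "\<lambda>z. 1 - z", OF d(2) m]] by simp
  qed
  show "hg_ode \<kappa> (\<lambda>z. f (1 - z)) T"
    by (rule hg_odeI[OF assms(3) *]) (use hg_odeD(3)[OF assms(1,2) assms(4)] in \<open>auto simp: algebra_simps\<close>)
  show "z \<in> T \<Longrightarrow> deriv (\<lambda>z. f (1 - z)) z = - deriv f (1 - z)"
    using *(1) by (rule DERIV_imp_deriv)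
qed

definition wronskian :: "(complex \<Rightarrow> complex) \<Rightarrow> (complex \<Rightarrow> complex) \<Rightarrow> complex \<Rightarrow> complex" where
  "wronskian f g z = f z * deriv g z - deriv f z * g z"

text \<open>Abel's identity: since the equation has no first order term, the Wronskian has
  derivative 0. The points 0 and 1 are excluded because the equation is solved for the second
  derivative.\<close>

lemma wronskian_constant:
  assumes f: "hg_ode \<kappa> f S" and g: "hg_ode \<kappa> g S" and S: "open S" "connected S" "0 \<notin> S" "1 \<notin> S"
  obtains c where "\<And>z. z \<in> S \<Longrightarrow> wronskian f g z = c"
proof -
  have *: "(wronskian f g has_field_derivative 0) (at z)" if z: "z \<in> S" for z
  proof -
    have nz: "z \<noteq> 0" "z \<noteq> 1" using z S by auto
    note F = hg_odeD[OF f S(1) z] and G = hg_odeD[OF g S(1) z]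
    show ?thesis unfolding wronskian_def
      using F(1,2) G(1,2) by (auto intro!: derivative_eq_intros simp: F(4)[OF nz] G(4)[OF nz])
  qed
  hence "continuous_on S (wronskian f g)"
    by (intro continuous_at_imp_continuous_on ballI) (metis DERIV_isCont)
  thus thesis using DERIV_zero_connected_constant[OF S(2,1), of "{}" "wronskian f g"] * that by auto
qed

text \<open>Cramer's rule. The coefficients are quotients of Wronskians, hence constants.\<close>

lemma hg_ode_span:
  assumes f: "hg_ode \<kappa> f S" and g: "hg_ode \<kappa> g S" and y: "hg_ode \<kappa> y S"
    and S: "open S" "connected S" "0 \<notin> S" "1 \<notin> S"
    and w: "\<exists>z\<in>S. wronskian f g z \<noteq> 0"
  obtains c d where "\<And>z. z \<in> S \<Longrightarrow> y z = c * f z + d * g z"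
proof -
  obtain w0 where w0: "\<And>z. z \<in> S \<Longrightarrow> wronskian f g z = w0" using wronskian_constant[OF f g S] by blast
  obtain w1 where w1: "\<And>z. z \<in> S \<Longrightarrow> wronskian y g z = w1" using wronskian_constant[OF y g S] by blast
  obtain w2 where w2: "\<And>z. z \<in> S \<Longrightarrow> wronskian f y z = w2" using wronskian_constant[OF f y S] by blast
  have nz: "w0 \<noteq> 0" using w w0 by auto
  have "y z = w1 / w0 * f z + w2 / w0 * g z" if z: "z \<in> S" for z
  proof -
    have "y z * wronskian f g z = wronskian y g z * f z + wronskian f y z * g z"
      by (simp add: wronskian_def algebra_simps)
    hence "y z * w0 = w1 * f z + w2 * g z" using w0 w1 w2 z by simp
    thus ?thesis using nz by (simp add: field_simps)
  qed
  thus thesis by (rule that)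
qed

text \<open>The solution is sought as z + r. With P = - \<kappa> / (1 - z) the correction satisfies
  z r'' = P r + z P, which is the equation of \<open>picard_solution\<close> with g = P. The
  estimate carries a factor |\<kappa>| and so shows that the solution tends to z as \<kappa>
  \<rightarrow> 0.\<close>

lemma hg_phi_exists:
  "\<exists>f. hg_ode \<kappa> f plane1 \<and> f 0 = 0 \<and> deriv f 0 = 1 \<and>
     (\<forall>z C. z \<in> plane1 \<longrightarrow> (\<forall>t\<in>{0..1}. 1 / cmod (1 - of_real t * z) \<le> C) \<longrightarrow>
         cmod (f z - z) \<le> cmod \<kappa> * C * (cmod z)\<^sup>2 * exp (cmod \<kappa> * C * cmod z))"
proof -
  define P where "P z = - \<kappa> / (1 - z)" for z :: complex
  have P: "P holomorphic_on plane1"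
    unfolding P_def by (intro holomorphic_intros) (auto simp: plane1_iff)
  obtain r where r: "r holomorphic_on plane1" "r 0 = 0" "deriv r 0 = 0"
    "\<And>z. z \<in> plane1 \<Longrightarrow> z * (deriv ^^ 2) r z = P z * r z + z * P z"
    "\<And>z m m'. z \<in> plane1 \<Longrightarrow> (\<And>t. t \<in> {0..1} \<Longrightarrow> cmod (P (of_real t * z)) \<le> m) \<Longrightarrow>
       (\<And>t. t \<in> {0..1} \<Longrightarrow> cmod (P (of_real t * z)) \<le> m') \<Longrightarrow>
       cmod (r z) \<le> m' * cmod z ^ 2 * exp (m * cmod z)"
    using picard_solution[OF starlike0_plane1 P P] by blast
  note d1 = holomorphic_derivI[OF r(1) open_plane1]
  note d2 = holomorphic_derivI[OF holomorphic_deriv[OF r(1) open_plane1] open_plane1]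
  have "hg_ode \<kappa> (\<lambda>z. z + r z) plane1"
  proof (rule hg_odeI[OF open_plane1])
    fix z assume z: "z \<in> plane1"
    show "((\<lambda>z. z + r z) has_field_derivative 1 + deriv r z) (at z)"
      "((\<lambda>z. 1 + deriv r z) has_field_derivative deriv (deriv r) z) (at z)"
      using d1[OF z] d2[OF z] by (auto intro!: derivative_eq_intros)
    have z1: "1 - z \<noteq> 0" using z by (auto simp: plane1_iff)
    have "z * (1 - z) * deriv (deriv r) z = (1 - z) * (P z * r z + z * P z)"
      using r(4)[OF z] by (simp add: numeral_2_eq_2 algebra_simps)
    also have "\<dots> = ((1 - z) * P z) * (z + r z)" by (simp add: algebra_simps)
    also have "(1 - z) * P z = - \<kappa>" using z1 by (simp add: P_def)
    finally show "z * (1 - z) * deriv (deriv r) z + \<kappa> * (z + r z) = 0" by (simp add: algebra_simps)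
  qed
  moreover have "deriv (\<lambda>z. z + r z) 0 = 1"
    using d1[of 0] r(3) by (intro DERIV_imp_deriv) (auto intro!: derivative_eq_intros simp: plane1_iff)
  moreover have "cmod (z + r z - z) \<le> cmod \<kappa> * C * (cmod z)\<^sup>2 * exp (cmod \<kappa> * C * cmod z)"
    if z: "z \<in> plane1" and C: "\<forall>t\<in>{0..1}. 1 / cmod (1 - of_real t * z) \<le> C" for z C
  proof -
    have "cmod (P (of_real t * z)) \<le> cmod \<kappa> * C" if "t \<in> {0..1}" for t
      using mult_left_mono[OF C[rule_format, OF that], of "cmod \<kappa>"] by (simp add: P_def norm_divide)
    from r(5)[OF z this this] show ?thesis by simp
  qed
  ultimately show ?thesis using r(2) by (intro exI[of _ "\<lambda>z. z + r z"]) auto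
qed

text \<open>The estimate is part of the choice, so that it is available for the chosen function
  itself.\<close>

definition hg_phi :: "complex \<Rightarrow> complex \<Rightarrow> complex" where
  "hg_phi \<kappa> = (SOME f. hg_ode \<kappa> f plane1 \<and> f 0 = 0 \<and> deriv f 0 = 1 \<and>
     (\<forall>z C. z \<in> plane1 \<longrightarrow> (\<forall>t\<in>{0..1}. 1 / cmod (1 - of_real t * z) \<le> C) \<longrightarrow>
         cmod (f z - z) \<le> cmod \<kappa> * C * (cmod z)\<^sup>2 * exp (cmod \<kappa> * C * cmod z)))"

lemma hg_phi:
  shows hg_phi_ode: "hg_ode \<kappa> (hg_phi \<kappa>) plane1"
    and hg_phi_0: "hg_phi \<kappa> 0 = 0" and deriv_hg_phi_0: "deriv (hg_phi \<kappa>) 0 = 1"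
    and hg_phi_bound: "z \<in> plane1 \<Longrightarrow> (\<And>t. t \<in> {0..1} \<Longrightarrow> 1 / cmod (1 - of_real t * z) \<le> C) \<Longrightarrow>
         cmod (hg_phi \<kappa> z - z) \<le> cmod \<kappa> * C * (cmod z)\<^sup>2 * exp (cmod \<kappa> * C * cmod z)"
  using someI_ex[OF hg_phi_exists[of \<kappa>], folded hg_phi_def] by blast+

text \<open>The regular part \<open>p\<close> of the second Frobenius solution \<open>p - \<kappa> \<phi> log\<close> at \<open>0\<close>.\<close>

lemma hg_reg_exists:
  "\<exists>p. p holomorphic_on plane1 \<and> p 0 = 1 \<and>
     (\<forall>z\<in>plane1 - {0}. deriv (deriv p) z =
        - \<kappa> * p z / (z * (1 - z)) + \<kappa> * (2 * deriv (hg_phi \<kappa>) z / z - hg_phi \<kappa> z / z\<^sup>2))"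
proof -
  define P where "P z = - \<kappa> / (1 - z)" for z :: complex
  have P: "P holomorphic_on plane1"
    unfolding P_def by (intro holomorphic_intros) (auto simp: plane1_iff)
  have phi: "hg_phi \<kappa> holomorphic_on plane1" using hg_phi_ode by (rule hg_ode_holomorphic)
  define q1 where "q1 z = (if z = 0 then deriv (hg_phi \<kappa>) 0 else (hg_phi \<kappa> z - hg_phi \<kappa> 0) / (z - 0))" for z
  have q1: "q1 holomorphic_on plane1"
    using pole_lemma_open[OF phi open_plane1, of 0] unfolding q1_def .
  define q2 where "q2 z = 2 * deriv (hg_phi \<kappa>) z - q1 z" for z
  have q2: "q2 holomorphic_on plane1"
    unfolding q2_def by (intro holomorphic_intros q1 phi open_plane1)
  have q20: "q2 0 = 1" by (simp add: q2_def q1_def deriv_hg_phi_0)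
  define q3 where "q3 z = (if z = 0 then deriv q2 0 else (q2 z - q2 0) / (z - 0))" for z
  have q3: "q3 holomorphic_on plane1"
    using pole_lemma_open[OF q2 open_plane1, of 0] unfolding q3_def .
  \<comment> \<open>The forcing term is \<kappa> q2 / z, with residue \<kappa> at 0 because q2 = 1
    there. For p = 1 + r the constant 1 contributes P / z = P - \<kappa> / z, whose pole cancels it;
    this is why p is normalised by p (0) = 1. What is left, P + \<kappa> (q2 - 1) / z, is
    holomorphic.\<close>
  define g where "g z = P z + \<kappa> * q3 z" for z
  have g: "g holomorphic_on plane1" unfolding g_def by (intro holomorphic_intros P q3)
  obtain r where r: "r holomorphic_on plane1" "r 0 = 0"
    "\<And>z. z \<in> plane1 \<Longrightarrow> z * (deriv ^^ 2) r z = P z * r z + z * g z"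
    using picard_solution[OF starlike0_plane1 P g] by metis
  note d1 = holomorphic_derivI[OF r(1) open_plane1]
  note d2 = holomorphic_derivI[OF holomorphic_deriv[OF r(1) open_plane1] open_plane1]
  have "deriv (deriv (\<lambda>z. 1 + r z)) z = - \<kappa> * (1 + r z) / (z * (1 - z)) +
          \<kappa> * (2 * deriv (hg_phi \<kappa>) z / z - hg_phi \<kappa> z / z\<^sup>2)" if z: "z \<in> plane1 - {0}" for z
  proof -
    have z1: "1 - z \<noteq> 0" "z \<noteq> 0" using z by (auto simp: plane1_iff)
    have "deriv (deriv (\<lambda>z. 1 + r z)) z = deriv (deriv r) z"
      by (rule deriv2I[OF open_plane1, of _ _ "deriv r"])
         (use z d1 d2 in \<open>auto intro!: derivative_eq_intros\<close>)
    also have "\<dots> = (P z * r z + z * g z) / z" using r(3)[of z] z z1 by (auto simp: numeral_2_eq_2 field_simps)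
    also have "\<dots> = P z * r z / z + g z" using z1 by (simp add: add_divide_distrib)
    also have "P z * r z / z = - \<kappa> * r z / (z * (1 - z))" by (simp add: P_def)
    also have "g z = P z + \<kappa> * ((2 * deriv (hg_phi \<kappa>) z - hg_phi \<kappa> z / z - 1) / z)"
      using z1 by (simp add: g_def q3_def q2_def q1_def hg_phi_0 deriv_hg_phi_0)
    also have "- \<kappa> * r z / (z * (1 - z)) + (P z + \<kappa> * ((2 * deriv (hg_phi \<kappa>) z - hg_phi \<kappa> z / z - 1) / z)) =
        - \<kappa> * r z / (z * (1 - z)) + (P z - \<kappa> / z) + \<kappa> * (2 * deriv (hg_phi \<kappa>) z / z - hg_phi \<kappa> z / z\<^sup>2)"
      by (simp add: diff_divide_distrib right_diff_distrib power2_eq_square)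
    also have "P z - \<kappa> / z = - \<kappa> / (z * (1 - z))"
      using z1 unfolding P_def by (simp add: divide_simps) (simp add: algebra_simps)
    also have "- \<kappa> * r z / (z * (1 - z)) + - \<kappa> / (z * (1 - z)) = - \<kappa> * (1 + r z) / (z * (1 - z))"
      by (simp add: ring_distribs add_divide_distrib diff_divide_distrib)
    finally show ?thesis .
  qed
  moreover have "(\<lambda>z. 1 + r z) holomorphic_on plane1" by (intro holomorphic_intros r)
  ultimately show ?thesis using r(2) by (intro exI[of _ "\<lambda>z. 1 + r z"]) auto
qed

definition hg_reg :: "complex \<Rightarrow> complex \<Rightarrow> complex" where
  "hg_reg \<kappa> = (SOME p. p holomorphic_on plane1 \<and> p 0 = 1 \<and>
     (\<forall>z\<in>plane1 - {0}. deriv (deriv p) z =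
        - \<kappa> * p z / (z * (1 - z)) + \<kappa> * (2 * deriv (hg_phi \<kappa>) z / z - hg_phi \<kappa> z / z\<^sup>2)))"

lemma hg_reg:
  shows hg_reg_holomorphic: "hg_reg \<kappa> holomorphic_on plane1"
    and hg_reg_0: "hg_reg \<kappa> 0 = 1"
    and hg_reg_deriv2: "z \<in> plane1 - {0} \<Longrightarrow> deriv (deriv (hg_reg \<kappa>)) z =
        - \<kappa> * hg_reg \<kappa> z / (z * (1 - z)) + \<kappa> * (2 * deriv (hg_phi \<kappa>) z / z - hg_phi \<kappa> z / z\<^sup>2)"
  using someI_ex[OF hg_reg_exists[of \<kappa>], folded hg_reg_def] by blast+

text \<open>The branch of the logarithm is a parameter: \<open>Ln\<close> serves on
  \<open>eta_domain\<close>, and \<open>Ln (- z)\<close> on \<open>plane0\<close>.\<close>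

definition hg_log :: "complex \<Rightarrow> (complex \<Rightarrow> complex) \<Rightarrow> complex \<Rightarrow> complex" where
  "hg_log \<kappa> L z = hg_reg \<kappa> z - \<kappa> * hg_phi \<kappa> z * L z"

text \<open>The only property of L that enters is L' = 1 / z. The terms that still contain L cancel
  by the equation of \<phi>, and the equation imposed on \<open>hg_reg\<close> is exactly what makes
  the rest vanish.\<close>

lemma hg_log:
  assumes S: "open S" "S \<subseteq> plane1 - {0}" and L: "\<And>z. z \<in> S \<Longrightarrow> (L has_field_derivative 1 / z) (at z)"
  shows hg_log_ode: "hg_ode \<kappa> (hg_log \<kappa> L) S"
    and hg_log_deriv: "z \<in> S \<Longrightarrow> deriv (hg_log \<kappa> L) z =
      deriv (hg_reg \<kappa>) z - \<kappa> * (deriv (hg_phi \<kappa>) z * L z) - \<kappa> * (hg_phi \<kappa> z / z)"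
proof -
  let ?\<phi> = "hg_phi \<kappa>" and ?p = "hg_reg \<kappa>"
  let ?f1 = "\<lambda>z. deriv ?p z - \<kappa> * (deriv ?\<phi> z * L z) - \<kappa> * (?\<phi> z / z)"
  let ?f2 = "\<lambda>z. deriv (deriv ?p) z - \<kappa> * deriv (deriv ?\<phi>) z * L z - 2 * \<kappa> * deriv ?\<phi> z / z + \<kappa> * ?\<phi> z / z\<^sup>2"
  have d: "(hg_log \<kappa> L has_field_derivative ?f1 z) (at z)" "(?f1 has_field_derivative ?f2 z) (at z)"
    "z * (1 - z) * ?f2 z + \<kappa> * hg_log \<kappa> L z = 0" if z: "z \<in> S" for z
  proof -
    have zp: "z \<in> plane1" "z \<noteq> 0" "1 - z \<noteq> 0" "z \<noteq> 1" using z S by (auto simp: plane1_iff)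
    note ders = hg_odeD(1,2)[OF hg_phi_ode[of \<kappa>] open_plane1 zp(1)] L[OF z]
      holomorphic_derivI[OF hg_reg_holomorphic[of \<kappa>] open_plane1 zp(1)]
      holomorphic_derivI[OF holomorphic_deriv[OF hg_reg_holomorphic[of \<kappa>] open_plane1] open_plane1 zp(1)]
    have "((\<lambda>z. ?p z - \<kappa> * (?\<phi> z * L z)) has_field_derivative
        deriv ?p z - \<kappa> * (deriv ?\<phi> z * L z + 1 / z * ?\<phi> z)) (at z)"
      by (intro DERIV_diff DERIV_cmult DERIV_mult ders)
    moreover have "hg_log \<kappa> L = (\<lambda>z. ?p z - \<kappa> * (?\<phi> z * L z))"
      by (auto simp: hg_log_def)
    ultimately show "(hg_log \<kappa> L has_field_derivative ?f1 z) (at z)"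
      by (simp add: algebra_simps)
    have "(?f1 has_field_derivative deriv (deriv ?p) z - \<kappa> * (deriv (deriv ?\<phi>) z * L z + 1 / z * deriv ?\<phi> z)
            - \<kappa> * ((deriv ?\<phi> z * z - ?\<phi> z * 1) / (z * z))) (at z)"
      by (intro DERIV_diff DERIV_cmult DERIV_mult DERIV_divide DERIV_ident ders zp)
    moreover have "deriv (deriv ?p) z - \<kappa> * (deriv (deriv ?\<phi>) z * L z + 1 / z * deriv ?\<phi> z)
            - \<kappa> * ((deriv ?\<phi> z * z - ?\<phi> z * 1) / (z * z)) = ?f2 z"
      using zp by (simp add: diff_divide_distrib power2_eq_square algebra_simps)
    ultimately show "(?f1 has_field_derivative ?f2 z) (at z)" by (simp only:)
    have "deriv (deriv ?p) z = - \<kappa> * ?p z / (z * (1 - z)) + \<kappa> * (2 * deriv ?\<phi> z / z - ?\<phi> z / z\<^sup>2)"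
      by (rule hg_reg_deriv2) (use zp in auto)
    hence "?f2 z = - \<kappa> * ?p z / (z * (1 - z)) - \<kappa> * (- \<kappa> * ?\<phi> z / (z * (1 - z))) * L z"
      using hg_odeD(4)[OF hg_phi_ode open_plane1 zp(1,2,4)] by (simp add: algebra_simps)
    also have "\<dots> = - \<kappa> * hg_log \<kappa> L z / (z * (1 - z))"
      unfolding hg_log_def by (simp add: divide_inverse algebra_simps)
    finally show "z * (1 - z) * ?f2 z + \<kappa> * hg_log \<kappa> L z = 0"
      using zp by simp
  qed
  show "hg_ode \<kappa> (hg_log \<kappa> L) S" by (rule hg_odeI[OF S(1) d])
  show "z \<in> S \<Longrightarrow> deriv (hg_log \<kappa> L) z = ?f1 z" using d(1) by (rule DERIV_imp_deriv)
qed


lemma tendsto_of_real_within: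
  assumes "continuous_on S f" "open S" "of_real c \<in> S"
  shows "((\<lambda>x::real. f (complex_of_real x)) \<longlongrightarrow> f (of_real c)) (at c within T)"
proof -
  have "isCont f (of_real c)" using assms by (simp add: continuous_on_eq_continuous_at)
  moreover have "isCont complex_of_real c" by simp
  ultimately have "isCont (\<lambda>x. f (of_real x)) c" by (rule isCont_o2[rotated])
  thus ?thesis unfolding isCont_def by (rule tendsto_within_subset) auto
qed

lemma eta_domain_subset: "eta_domain \<subseteq> plane1 - {0}" "0 \<notin> eta_domain" "1 \<notin> eta_domain"
  by (auto simp: eta_domain_iff plane1_iff)

lemma Ln_deriv_eta_domain: "z \<in> eta_domain \<Longrightarrow> (Ln has_field_derivative 1 / z) (at z)"
  using has_field_derivative_Ln[of z] by (auto simp: eta_domain_iff complex_nonpos_Reals_iff inverse_eq_divide)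

text \<open>The terms with L cancel. The right-hand side therefore has a limit at 0, although the
  derivative of \<open>hg_log\<close> contains the logarithm; \<open>wronskian_hg_log_Ln\<close>
  reads the constant off from this limit.\<close>

lemma wronskian_hg_log:
  assumes "open S" "S \<subseteq> plane1 - {0}" "\<And>z. z \<in> S \<Longrightarrow> (L has_field_derivative 1 / z) (at z)" "z \<in> S"
  shows "wronskian (hg_log \<kappa> L) (hg_phi \<kappa>) z =
    hg_reg \<kappa> z * deriv (hg_phi \<kappa>) z - deriv (hg_reg \<kappa>) z * hg_phi \<kappa> z + \<kappa> * (hg_phi \<kappa> z * (hg_phi \<kappa> z / z))"
proof -
  have eq: "deriv (hg_log \<kappa> L) z =
      deriv (hg_reg \<kappa>) z - \<kappa> * (deriv (hg_phi \<kappa>) z * L z) - \<kappa> * (hg_phi \<kappa> z / z)"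
    using assms by (rule hg_log_deriv)
  show ?thesis unfolding wronskian_def eq by (simp add: hg_log_def algebra_simps)
qed

lemma wronskian_hg_log_Ln:
  assumes z: "z \<in> eta_domain"
  shows "wronskian (hg_log \<kappa> Ln) (hg_phi \<kappa>) z = 1"
proof -
  let ?\<phi> = "hg_phi \<kappa>" and ?p = "hg_reg \<kappa>"
  let ?w = "wronskian (hg_log \<kappa> Ln) ?\<phi>"
  obtain c where c: "\<And>z. z \<in> eta_domain \<Longrightarrow> ?w z = c"
    using wronskian_constant[OF hg_log_ode[OF open_eta_domain eta_domain_subset(1) Ln_deriv_eta_domain]
       hg_ode_subset[OF hg_phi_ode] open_eta_domain connected_eta_domain eta_domain_subset(2,3)]
      eta_domain_subset(1) by blast
  have [simp]: "0 \<in> plane1" by (auto simp: plane1_iff)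
  have h: "?\<phi> holomorphic_on plane1" "?p holomorphic_on plane1"
    using hg_phi_ode hg_reg_holomorphic by (auto simp: hg_ode_def)
  note lim = tendsto_of_real_within[OF holomorphic_on_imp_continuous_on open_plane1, of _ 0 "{0<..}", simplified]
  have "((\<lambda>z. ?\<phi> z / z) \<longlongrightarrow> 1) (at 0)"
    using hg_odeD(1)[OF hg_phi_ode open_plane1, of 0] by (simp add: hg_phi_0 deriv_hg_phi_0 has_field_derivative_iff)
  moreover have "filterlim complex_of_real (at 0) (at_right 0)"
    by (auto simp: filterlim_at eventually_at_filter intro!: tendsto_eq_intros)
  ultimately have q: "((\<lambda>x. ?\<phi> (of_real x) / of_real x) \<longlongrightarrow> 1) (at_right 0)"
    by (rule filterlim_compose)
  have "((\<lambda>x. ?p (of_real x) * deriv ?\<phi> (of_real x) - deriv ?p (of_real x) * ?\<phi> (of_real x) +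
       \<kappa> * (?\<phi> (of_real x) * (?\<phi> (of_real x) / of_real x))) \<longlongrightarrow>
       1 * 1 - deriv ?p 0 * 0 + \<kappa> * (0 * 1)) (at_right 0)"
    using lim[of ?p] lim[of "deriv ?\<phi>"] lim[of "deriv ?p"] lim[of ?\<phi>] h
    by (intro tendsto_intros q) (auto simp: hg_reg_0 deriv_hg_phi_0 hg_phi_0 intro: holomorphic_deriv open_plane1)
  moreover have "eventually (\<lambda>x. ?p (of_real x) * deriv ?\<phi> (of_real x) - deriv ?p (of_real x) * ?\<phi> (of_real x) +
       \<kappa> * (?\<phi> (of_real x) * (?\<phi> (of_real x) / of_real x)) = c) (at_right 0)"
  proof (rule eventually_mono[OF eventually_at_right_real[of 0 1]])
    fix x :: real assume "x \<in> {0<..<1}"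
    hence "of_real x \<in> eta_domain" by (auto simp: eta_domain_iff)
    from c[OF this] wronskian_hg_log[OF open_eta_domain eta_domain_subset(1) Ln_deriv_eta_domain this]
    show "?p (of_real x) * deriv ?\<phi> (of_real x) - deriv ?p (of_real x) * ?\<phi> (of_real x) +
       \<kappa> * (?\<phi> (of_real x) * (?\<phi> (of_real x) / of_real x)) = c" by simp
  qed auto
  ultimately have "((\<lambda>x::real. c) \<longlongrightarrow> 1) (at_right 0)"
    by (simp add: tendsto_cong)
  hence "c = 1" by (simp add: tendsto_const_iff)
  with c[OF z] show ?thesis by simp
qed

section \<open>Connection between the singular points 0 and 1\<close>

lemma hg_connection_exists:
  "\<exists>c d. \<forall>z\<in>eta_domain. hg_phi \<kappa> (1 - z) = c * hg_log \<kappa> Ln z + d * hg_phi \<kappa> z"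
proof -
  have "hg_ode \<kappa> (\<lambda>z. hg_phi \<kappa> (1 - z)) eta_domain"
    by (rule hg_ode_reflect[OF hg_phi_ode open_plane1 open_eta_domain]) (auto simp: plane1_iff eta_domain_iff)
  moreover have "1/2 \<in> eta_domain" by (auto simp: eta_domain_iff)
  hence "\<exists>z\<in>eta_domain. wronskian (hg_log \<kappa> Ln) (hg_phi \<kappa>) z \<noteq> 0"
    using wronskian_hg_log_Ln[of "1/2" \<kappa>] by force
  ultimately show ?thesis
    using hg_ode_span[OF hg_log_ode[OF open_eta_domain eta_domain_subset(1) Ln_deriv_eta_domain]
       hg_ode_subset[OF hg_phi_ode] _ open_eta_domain connected_eta_domain eta_domain_subset(2,3)]
      eta_domain_subset(1) by (metis Diff_subset subset_trans)
qed

definition hg_coef :: "complex \<Rightarrow> complex \<times> complex" where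
  "hg_coef \<kappa> = (SOME (c, d). \<forall>z\<in>eta_domain. hg_phi \<kappa> (1 - z) = c * hg_log \<kappa> Ln z + d * hg_phi \<kappa> z)"

text \<open>This coefficient of the logarithmic solution is also the determinant of
  \<open>hg_mat\<close>; multiplied by \<kappa> it equals sin (\<pi> a) / \<pi>.\<close>

definition hg_alpha :: "complex \<Rightarrow> complex" where "hg_alpha \<kappa> = fst (hg_coef \<kappa>)"

definition hg_beta :: "complex \<Rightarrow> complex" where "hg_beta \<kappa> = snd (hg_coef \<kappa>)"

lemma hg_connection:
  assumes "z \<in> eta_domain"
  shows "hg_phi \<kappa> (1 - z) = hg_alpha \<kappa> * hg_log \<kappa> Ln z + hg_beta \<kappa> * hg_phi \<kappa> z"
proof -
  have "\<exists>p. case p of (c, d) \<Rightarrow> \<forall>z\<in>eta_domain. hg_phi \<kappa> (1 - z) = c * hg_log \<kappa> Ln z + d * hg_phi \<kappa> z"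
    using hg_connection_exists[of \<kappa>] by auto
  from someI_ex[OF this] show ?thesis
    using assms unfolding hg_coef_def[symmetric] hg_alpha_def hg_beta_def by (auto simp: case_prod_beta)
qed

text \<open>The branch \<open>Ln (- z)\<close> is the average of the two continuations of \<open>Ln\<close> across the negative axis.\<close>

definition hg_cut :: "complex \<Rightarrow> complex \<Rightarrow> complex" where
  "hg_cut \<kappa> z = hg_alpha \<kappa> * hg_log \<kappa> (\<lambda>z. Ln (- z)) z + hg_beta \<kappa> * hg_phi \<kappa> z"

lemma plane0_subset: "plane0 \<subseteq> plane1 - {0}" "0 \<notin> plane0" "1 \<notin> plane0"
  by (auto simp: plane0_iff plane1_iff)

lemma Ln_minus_deriv: "z \<in> plane0 \<Longrightarrow> ((\<lambda>z. Ln (- z)) has_field_derivative 1 / z) (at z)"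
  by (auto intro!: derivative_eq_intros simp: plane0_iff complex_nonpos_Reals_iff inverse_eq_divide)

lemma hg_cut_ode: "hg_ode \<kappa> (hg_cut \<kappa>) plane0"
  unfolding hg_cut_def
  using hg_log_ode[OF open_plane0 plane0_subset(1) Ln_minus_deriv] hg_ode_subset[OF hg_phi_ode] plane0_subset(1)
  by (intro hg_ode_lincomb open_plane0) auto

text \<open>Off the real axis \<phi> (1 - z) is expressed through \<open>Ln z\<close> and
  \<open>hg_cut\<close> through \<open>Ln (- z)\<close>. The two logarithms differ by - i \<pi>
  above and by + i \<pi> below the axis, and the logarithm is multiplied by - \<kappa>
  \<phi>.\<close>

lemma hg_cut_jump:
  shows "0 < Im z \<Longrightarrow> hg_phi \<kappa> (1 - z) = hg_cut \<kappa> z - \<i> * of_real pi * hg_alpha \<kappa> * \<kappa> * hg_phi \<kappa> z"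
    and "Im z < 0 \<Longrightarrow> hg_phi \<kappa> (1 - z) = hg_cut \<kappa> z + \<i> * of_real pi * hg_alpha \<kappa> * \<kappa> * hg_phi \<kappa> z"
proof -
  have *: "hg_phi \<kappa> (1 - z) = hg_cut \<kappa> z + hg_alpha \<kappa> * \<kappa> * hg_phi \<kappa> z * (Ln (- z) - Ln z)"
    if "Im z \<noteq> 0" for z
    using hg_connection[of z \<kappa>] that by (simp add: hg_cut_def hg_log_def eta_domain_iff algebra_simps)
  show "hg_phi \<kappa> (1 - z) = hg_cut \<kappa> z - \<i> * of_real pi * hg_alpha \<kappa> * \<kappa> * hg_phi \<kappa> z" if z: "0 < Im z"
  proof -
    have "Ln (- z) - Ln z = - \<i> * of_real pi" using z by (subst Ln_minus) auto
    thus ?thesis using *[of z] z by simp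
  qed
  show "hg_phi \<kappa> (1 - z) = hg_cut \<kappa> z + \<i> * of_real pi * hg_alpha \<kappa> * \<kappa> * hg_phi \<kappa> z" if z: "Im z < 0"
  proof -
    have "Ln (- z) - Ln z = \<i> * of_real pi" using z by (subst Ln_minus) auto
    thus ?thesis using *[of z] z by simp
  qed
qed

section \<open>Logarithmic singularities of power series\<close>

lemma tendsto_ln_at_left_1: "filterlim (\<lambda>x::real. ln (1 / (1 - x))) at_top (at_left 1)"
  by real_asymp

text \<open>An Abelian comparison with the series of x ^ n / n for log (1 / (1 - x)): from some
  index on each coefficient is at most s / n, and the finitely many others contribute a bounded
  amount, which is negligible against the logarithm.\<close>

lemma log_series_small:
  fixes e :: "nat \<Rightarrow> complex"
  assumes e: "(\<lambda>n. of_nat n * e n) \<longlonglongrightarrow> 0"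
  shows "((\<lambda>x. (\<Sum>n. e n * of_real x ^ n) / of_real (ln (1 / (1 - x)))) \<longlongrightarrow> 0) (at_left 1)"
proof (rule tendstoI)
  fix r :: real assume r: "r > 0"
  define s where "s = r / 2"
  have s: "s > 0" using r by (simp add: s_def)
  have "eventually (\<lambda>n. dist (of_nat n * e n) 0 < s) sequentially" using e s by (rule tendstoD)
  then obtain N where N: "\<And>n. n \<ge> N \<Longrightarrow> cmod (of_nat n * e n) < s"
    by (auto simp: eventually_sequentially)
  define C where "C = (\<Sum>n<Suc N. cmod (e n))"
  have C0: "C \<ge> 0" unfolding C_def by (intro sum_nonneg) auto
  have bound: "cmod (\<Sum>n. e n * of_real x ^ n) \<le> C + s * ln (1 / (1 - x))" if x: "0 < x" "x < 1" for x
  proof -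
    have "(\<lambda>n. - ((-(- x)) ^ n) / of_nat n) sums ln (1 + - x)"
      using x by (intro ln_series') auto
    hence ls: "(\<lambda>n. x ^ n / of_nat n) sums ln (1 / (1 - x))"
      using sums_minus x by (fastforce simp: ln_div)
    have fin: "(\<lambda>n. if n \<in> {..<Suc N} then cmod (e n) else 0) sums C"
      unfolding C_def by (rule sums_If_finite_set) auto
    have S: "(\<lambda>n. (if n \<in> {..<Suc N} then cmod (e n) else 0) + s * (x ^ n / of_nat n)) sums (C + s * ln (1 / (1 - x)))"
      by (intro sums_add fin sums_mult ls)
    have b: "cmod (e n * of_real x ^ n) \<le> (if n \<in> {..<Suc N} then cmod (e n) else 0) + s * (x ^ n / of_nat n)" for n
    proof (cases "n < Suc N")
      case True
      have "cmod (e n * of_real x ^ n) \<le> cmod (e n) * 1"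
        unfolding norm_mult using x by (intro mult_left_mono) (auto simp: norm_power power_le_one)
      thus ?thesis using True x s by (simp add: add_increasing2)
    next
      case False
      hence n: "n > 0" "N \<le> n" by auto
      have "cmod (e n) \<le> s / n" using N[OF n(2)] n by (simp add: norm_mult field_simps)
      hence "cmod (e n) * x ^ n \<le> s / n * x ^ n" using x by (intro mult_right_mono) auto
      thus ?thesis using False x by (simp add: norm_mult norm_power)
    qed
    show ?thesis
      using norm_suminf_le[OF b sums_summable[OF S]] unfolding sums_unique[OF S, symmetric] .
  qed
  have "eventually (\<lambda>x::real. ln (1 / (1 - x)) > (C + 1) / s) (at_left 1)"
    using tendsto_ln_at_left_1 by (simp add: filterlim_at_top_dense)
  moreover have "eventually (\<lambda>x::real. x \<in> {0<..<1}) (at_left 1)"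
    by (rule eventually_at_left_real) auto
  ultimately show "eventually (\<lambda>x. dist ((\<Sum>n. e n * of_real x ^ n) / of_real (ln (1 / (1 - x)))) 0 < r) (at_left 1)"
  proof eventually_elim
    case (elim x)
    define l where "l = ln (1 / (1 - x))"
    have l: "(C + 1) / s < l" "0 < l"
      using elim(1) C0 s unfolding l_def by (auto intro: le_less_trans[rotated] simp: divide_nonneg_pos)
    have "C < s * l" using l(1) s by (simp add: field_simps)
    hence "cmod (\<Sum>n. e n * of_real x ^ n) < r * l"
      using bound[of x] elim(2) unfolding l_def[symmetric] s_def by auto
    thus ?case unfolding l_def[symmetric] using l(2) by (simp add: norm_divide field_simps)
  qed
qed

lemma log_series:
  fixes d :: "nat \<Rightarrow> complex"
  assumes d: "(\<lambda>n. of_nat n * d n) \<longlonglongrightarrow> K"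
  shows "((\<lambda>x. (\<Sum>n. d n * of_real x ^ n) / of_real (ln (1 / (1 - x)))) \<longlongrightarrow> K) (at_left 1)"
proof -
  \<comment> \<open>At n = 0 the quotient K / 0 is 0, which matches the missing constant term of the
    logarithmic series.\<close>
  define e where "e n = d n - K / of_nat n" for n
  have "(\<lambda>n. of_nat n * d n - K) \<longlonglongrightarrow> K - K" by (intro tendsto_intros d)
  moreover have "eventually (\<lambda>n. of_nat n * d n - K = of_nat n * e n) sequentially"
    using eventually_gt_at_top[of 0] by eventually_elim (simp add: e_def field_simps)
  ultimately have en: "(\<lambda>n. of_nat n * e n) \<longlonglongrightarrow> 0"
    by (simp add: tendsto_cong)
  have ev: "eventually (\<lambda>x::real. x \<in> {0<..<1}) (at_left 1)"
    by (rule eventually_at_left_real) auto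
  have "((\<lambda>x. (\<Sum>n. e n * of_real x ^ n) / of_real (ln (1 / (1 - x))) + K) \<longlongrightarrow> 0 + K) (at_left 1)"
    by (intro tendsto_intros log_series_small en)
  moreover have "eventually (\<lambda>x. (\<Sum>n. e n * of_real x ^ n) / of_real (ln (1 / (1 - x))) + K =
      (\<Sum>n. d n * of_real x ^ n) / of_real (ln (1 / (1 - x)))) (at_left 1)"
    using ev
  proof eventually_elim
    case (elim x)
    have x: "0 < x" "x < 1" using elim by auto
    have "(\<lambda>n. - ((-(- x)) ^ n) / of_nat n) sums ln (1 + - x)"
      using x by (intro ln_series') auto
    hence ls: "(\<lambda>n. x ^ n / of_nat n) sums ln (1 / (1 - x))"
      using sums_minus x by (fastforce simp: ln_div)
    have ls': "(\<lambda>n. K * of_real (x ^ n / of_nat n)) sums (K * of_real (ln (1 / (1 - x))))"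
      by (intro sums_mult sums_of_real ls)
    have "Bseq (\<lambda>n. of_nat n * e n)" using en by (intro convergent_imp_Bseq convergentI)
    then obtain B where B: "B > 0" "\<And>n. cmod (of_nat n * e n) \<le> B" by (auto elim: BseqE)
    have "summable (\<lambda>n. e n * of_real x ^ n)"
    proof (rule summable_comparison_test'[of "\<lambda>n. B * x ^ n" 1])
      show "summable (\<lambda>n. B * x ^ n)" using x by (intro summable_mult summable_geometric) auto
      fix n :: nat assume n: "n \<ge> 1"
      have "1 * cmod (e n) \<le> of_nat n * cmod (e n)" using n by (intro mult_right_mono) auto
      hence "cmod (e n) \<le> B" using B(2)[of n] by (simp add: norm_mult)
      thus "norm (e n * of_real x ^ n) \<le> B * x ^ n"
        using x by (simp add: norm_mult norm_power mult_right_mono)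
    qed
    hence "(\<lambda>n. e n * of_real x ^ n + K * of_real (x ^ n / of_nat n)) sums
        ((\<Sum>n. e n * of_real x ^ n) + K * of_real (ln (1 / (1 - x))))"
      by (intro sums_add summable_sums ls')
    moreover have "e n * of_real x ^ n + K * of_real (x ^ n / of_nat n) = d n * of_real x ^ n" for n
      by (simp add: e_def algebra_simps)
    ultimately have "(\<Sum>n. d n * of_real x ^ n) = (\<Sum>n. e n * of_real x ^ n) + K * of_real (ln (1 / (1 - x)))"
      by (simp add: sums_iff)
    moreover have "ln (1 / (1 - x)) \<noteq> 0" using x by (simp add: ln_div)
    ultimately show ?case by (simp add: add_divide_distrib)
  qed
  ultimately show ?thesis by (simp add: tendsto_cong)
qed

section \<open>Coefficient asymptotics and the value of the connection coefficient\<close>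

lemma tendsto_const_over_nat: "(\<lambda>n. c / of_nat n :: complex) \<longlonglongrightarrow> 0"
  using tendsto_mult[OF tendsto_const[of c] lim_inverse_n] by (simp add: divide_inverse)

text \<open>p + q = r is the case with a logarithm at the point 1. The coefficient is written
  through \<open>rGamma_series\<close>: the powers of n cancel because n to the r is the product of
  n to the p and n to the q, and the last factors (p + n) (q + n) / (r + n) account for the factor
  n, up to the correction \<open>?B\<close>, which tends to 1.\<close>

lemma hypergeo_coeff_asymp:
  fixes p q r :: complex
  assumes r: "r \<notin> \<int>\<^sub>\<le>\<^sub>0" and pqr: "p + q = r"
  shows "(\<lambda>n. of_nat n * (pochhammer p n * pochhammer q n / (pochhammer r n * fact n)))
           \<longlonglongrightarrow> rGamma p * rGamma q * Gamma r"
proof -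
  let ?B = "\<lambda>n. (r / of_nat n + 1) / ((p / of_nat n + 1) * (q / of_nat n + 1))"
  have "(\<lambda>n. rGamma_series p n * rGamma_series q n / rGamma_series r n * ?B n) \<longlonglongrightarrow>
      rGamma p * rGamma q / rGamma r * ((0 + 1) / ((0 + 1) * (0 + 1)))"
    using r by (intro tendsto_intros tendsto_const_over_nat) (auto simp: rGamma_eq_zero_iff)
  also have "rGamma p * rGamma q / rGamma r * ((0 + 1) / ((0 + 1) * (0 + 1))) = rGamma p * rGamma q * Gamma r"
    by (simp add: Gamma_def divide_inverse)
  finally have lim: "(\<lambda>n. rGamma_series p n * rGamma_series q n / rGamma_series r n * ?B n)
    \<longlonglongrightarrow> rGamma p * rGamma q * Gamma r" .
  have "eventually (\<lambda>n. real n > cmod p \<and> real n > cmod q \<and> n > 0) sequentially"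
    by (intro eventually_conj eventually_gt_at_top filterlim_at_top_dense[THEN iffD1, rule_format]
          filterlim_real_sequentially)
  hence "eventually (\<lambda>n. rGamma_series p n * rGamma_series q n / rGamma_series r n * ?B n =
      of_nat n * (pochhammer p n * pochhammer q n / (pochhammer r n * fact n))) sequentially"
  proof eventually_elim
    case (elim n)
    have nz: "z + of_nat n \<noteq> 0" if "cmod z < real n" for z :: complex
    proof
      assume "z + of_nat n = 0"
      hence "z = - of_nat n" by (simp add: add_eq_0_iff2)
      thus False using that by simp
    qed
    have p: "p + of_nat n \<noteq> 0" and q: "q + of_nat n \<noteq> 0" using nz elim by auto
    have rn: "r + of_nat n \<noteq> 0" using r by (metis add_eq_0_iff2 minus_of_nat_in_nonpos_Ints)
    have pr: "pochhammer r n \<noteq> 0" using r by (auto simp: pochhammer_eq_0_iff)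
    let ?E = "\<lambda>z. exp (z * of_real (ln (of_nat n))) :: complex"
    have E: "?E r = ?E p * ?E q" by (simp add: pqr[symmetric] exp_add ring_distribs)
    have "rGamma_series p n * rGamma_series q n / rGamma_series r n =
       pochhammer p n * pochhammer q n / (pochhammer r n * fact n) *
         ((p + of_nat n) * (q + of_nat n) / (r + of_nat n))"
    proof -
      have gen: "(P * s / (f * E1)) * (Q * t / (f * E2)) / (R * u / (f * (E1 * E2))) = P * Q / (R * f) * (s * t / u)"
        if "f \<noteq> 0" "E1 \<noteq> 0" "E2 \<noteq> 0" for P Q R s t u f E1 E2 :: complex
        using that by (simp add: divide_simps)
      show ?thesis unfolding rGamma_series_def E Suc_eq_plus1[symmetric] pochhammer_Suc
        by (rule gen) auto
    qed
    moreover have "?B n = of_nat n * ((r + of_nat n) / ((p + of_nat n) * (q + of_nat n)))"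
      using elim p q by (simp add: divide_simps) (simp add: algebra_simps)?
    ultimately show ?case using p q rn by simp
  qed
  with lim show ?thesis by (simp add: tendsto_cong)
qed

lemma sums_of_has_fps_expansion:
  assumes "f has_fps_expansion F" "f holomorphic_on ball 0 r" "cmod z < r"
  shows "(\<lambda>n. fps_nth F n * z ^ n) sums f z"
  by (rule has_fps_expansion_imp_sums_complex[OF assms(1), of r]) (use assms in auto)

text \<open>Comparing coefficients in the equation gives the recursion with ratio (n (n + 1) -
  \<kappa>) / (n + 1)^2 for the coefficients of \<phi>', and the numerator factors as (a + 1 + n) (-
  a + n). The upper parameters a + 1 and - a add up to the lower parameter 1, as
  \<open>hypergeo_coeff_asymp\<close> requires.\<close>

lemma deriv_hg_phi_sums:
  assumes \<kappa>: "\<kappa> = a * (a + 1)" and z: "cmod z < 1"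
  shows "(\<lambda>n. pochhammer (a + 1) n * pochhammer (- a) n / (pochhammer 1 n * fact n) * z ^ n)
           sums deriv (hg_phi \<kappa>) z"
proof -
  let ?\<phi> = "hg_phi \<kappa>"
  define A where "A = fps_expansion ?\<phi> 0"
  have sub: "ball 0 1 \<subseteq> plane1"
  proof
    fix w :: complex assume "w \<in> ball 0 1"
    thus "w \<in> plane1" using complex_Re_le_cmod[of w] by (auto simp: plane1_iff)
  qed
  have h: "?\<phi> holomorphic_on plane1" using hg_phi_ode by (rule hg_ode_holomorphic)
  have A: "?\<phi> has_fps_expansion A" unfolding A_def
    by (rule has_fps_expansion_fps_expansion[OF open_plane1 _ h]) (auto simp: plane1_iff)
  have A1: "deriv ?\<phi> has_fps_expansion fps_deriv A" by (rule has_fps_expansion_deriv[OF A])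
  have A2: "deriv (deriv ?\<phi>) has_fps_expansion fps_deriv (fps_deriv A)" by (rule has_fps_expansion_deriv[OF A1])
  have "(\<lambda>z. z * (1 - z) * deriv (deriv ?\<phi>) z + \<kappa> * ?\<phi> z) has_fps_expansion
     fps_X * (1 - fps_X) * fps_deriv (fps_deriv A) + fps_const \<kappa> * A"
    by (intro fps_expansion_intros A A2)
  moreover have "(\<lambda>z. z * (1 - z) * deriv (deriv ?\<phi>) z + \<kappa> * ?\<phi> z) has_fps_expansion 0"
    unfolding has_fps_expansion_0_iff
    using eventually_nhds_in_open[OF open_plane1, of 0] hg_phi_ode[of \<kappa>]
    by (auto simp: hg_ode_def plane1_iff elim!: eventually_mono)
  ultimately have eq: "fps_X * (1 - fps_X) * fps_deriv (fps_deriv A) + fps_const \<kappa> * A = 0"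
    by (rule fps_expansion_unique_complex)
  let ?D = "fps_deriv A"
  have rec: "fps_nth ?D (Suc n) * of_nat (Suc n) ^ 2 = (of_nat n * of_nat (Suc n) - \<kappa>) * fps_nth ?D n" for n
  proof -
    have e2: "fps_X * (1 - fps_X) * fps_deriv ?D = fps_X * (fps_deriv ?D - fps_X * fps_deriv ?D)"
      by (simp add: algebra_simps)
    have "fps_nth (fps_X * (fps_deriv ?D - fps_X * fps_deriv ?D) + fps_const \<kappa> * A) (Suc n) = 0"
      unfolding e2[symmetric] eq by simp
    hence "of_nat (Suc n) * fps_nth ?D (Suc n) - of_nat n * fps_nth ?D n + \<kappa> * fps_nth A (Suc n) = 0"
      by (cases n) (simp_all del: fps_deriv_nth add: fps_deriv_nth[of "fps_deriv A"] algebra_simps)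
    moreover have "of_nat (Suc n) * fps_nth A (Suc n) = fps_nth ?D n" by simp
    moreover have "D1 * s ^ 2 = (m * s - \<kappa>) * D0" if "s * D1 - m * D0 + \<kappa> * A1 = 0" "s * A1 = D0"
      for s m D0 D1 A1 :: complex using that by algebra
    ultimately show ?thesis by blast
  qed
  have D: "fps_nth ?D n = pochhammer (a + 1) n * pochhammer (- a) n / (pochhammer 1 n * fact n)" for n
  proof (induction n)
    case 0
    have "fps_nth ?D 0 = deriv ?\<phi> 0" by (rule has_fps_expansion_imp_0_eq_fps_nth_0[OF A1, symmetric])
    thus ?case using deriv_hg_phi_0 by simp
  next
    case (Suc n)
    have nz: "(of_nat (Suc n) :: complex) \<noteq> 0" by (simp only: of_nat_eq_0_iff)
    have "fps_nth ?D (Suc n) = (of_nat n * of_nat (Suc n) - \<kappa>) / of_nat (Suc n) ^ 2 * fps_nth ?D n"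
      using rec[of n] nz by (simp add: field_simps del: of_nat_Suc fps_deriv_nth)
    also have "of_nat n * of_nat (Suc n) - \<kappa> = (a + 1 + of_nat n) * (- a + of_nat n)"
      by (simp add: \<kappa> algebra_simps)
    finally show ?case
      unfolding Suc.IH pochhammer_Suc[of "a + 1"] pochhammer_Suc[of "- a"] pochhammer_fact[symmetric] fact_Suc
      using nz by (simp add: power2_eq_square mult_ac del: of_nat_Suc)
  qed
  show ?thesis
    using sums_of_has_fps_expansion[OF A1 holomorphic_on_subset[OF holomorphic_deriv[OF h open_plane1] sub] z]
    unfolding D .
qed

lemma one_notin_nonpos_Ints: "(1::complex) \<notin> \<int>\<^sub>\<le>\<^sub>0"
  by (auto elim!: nonpos_Ints_cases simp: complex_eq_iff)

lemma of_real_at_left_1_eta: "eventually (\<lambda>x. of_real x \<in> eta_domain \<and> x \<in> {0<..<1}) (at_left (1::real))"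
  by (rule eventually_mono[OF eventually_at_left_real[of 0 1]]) (auto simp: eta_domain_iff)

lemma hg_phi_reflect_deriv:
  assumes z: "z \<in> eta_domain"
  shows "deriv (\<lambda>z. hg_phi \<kappa> (1 - z)) z = - deriv (hg_phi \<kappa>) (1 - z)"
    and "deriv (hg_phi \<kappa>) (1 - z) = - (hg_alpha \<kappa> * deriv (hg_log \<kappa> Ln) z + hg_beta \<kappa> * deriv (hg_phi \<kappa>) z)"
proof -
  let ?\<phi> = "hg_phi \<kappa>"
  have p1: "z \<in> plane1" using z eta_domain_subset by auto
  have "((\<lambda>z. hg_alpha \<kappa> * hg_log \<kappa> Ln z + hg_beta \<kappa> * ?\<phi> z) has_field_derivative
      hg_alpha \<kappa> * deriv (hg_log \<kappa> Ln) z + hg_beta \<kappa> * deriv ?\<phi> z) (at z)"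
    by (intro DERIV_add DERIV_cmult hg_odeD(1)[OF hg_phi_ode open_plane1 p1]
         hg_odeD(1)[OF hg_log_ode[OF open_eta_domain eta_domain_subset(1) Ln_deriv_eta_domain] open_eta_domain z])
  hence "deriv (\<lambda>z. hg_alpha \<kappa> * hg_log \<kappa> Ln z + hg_beta \<kappa> * ?\<phi> z) z =
      hg_alpha \<kappa> * deriv (hg_log \<kappa> Ln) z + hg_beta \<kappa> * deriv ?\<phi> z" by (rule DERIV_imp_deriv)
  moreover have "deriv (\<lambda>z. hg_alpha \<kappa> * hg_log \<kappa> Ln z + hg_beta \<kappa> * ?\<phi> z) z = deriv (\<lambda>z. ?\<phi> (1 - z)) z"
    by (rule deriv_cong_ev[OF eventually_mono[OF eventually_nhds_in_open[OF open_eta_domain z]]])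
       (auto simp: hg_connection)
  moreover show "deriv (\<lambda>z. ?\<phi> (1 - z)) z = - deriv ?\<phi> (1 - z)"
    by (rule hg_ode_reflect(2)[OF hg_phi_ode open_plane1 open_eta_domain _ z])
       (auto simp: eta_domain_iff plane1_iff)
  ultimately show "deriv ?\<phi> (1 - z) = - (hg_alpha \<kappa> * deriv (hg_log \<kappa> Ln) z + hg_beta \<kappa> * deriv ?\<phi> z)"
    by (metis minus_equation_iff)
qed

text \<open>The growth of \<phi>' (x) relative to log (1 / (1 - x)) as x tends to 1 from below is
  found twice. The power series gives 1 / (Gamma (a + 1) Gamma (- a)); the connection formula gives
  - \<kappa> times the coefficient, because there only the logarithm is unbounded. Euler's
  reflection formula then produces the sine.\<close>

lemma hg_alpha:
  assumes \<kappa>: "\<kappa> = a * (a + 1)"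
  shows "of_real pi * hg_alpha \<kappa> * \<kappa> = sin (of_real pi * a)"
proof -
  let ?\<phi> = "hg_phi \<kappa>" and ?p = "hg_reg \<kappa>" and ?l = "\<lambda>x::real. complex_of_real (ln (1 / (1 - x)))"
  have "((\<lambda>x. (\<Sum>n. pochhammer (a + 1) n * pochhammer (- a) n / (pochhammer 1 n * fact n) * of_real x ^ n) / ?l x)
      \<longlongrightarrow> rGamma (a + 1) * rGamma (- a) * Gamma 1) (at_left 1)"
    by (intro log_series hypergeo_coeff_asymp one_notin_nonpos_Ints) simp
  moreover have "eventually (\<lambda>x. (\<Sum>n. pochhammer (a + 1) n * pochhammer (- a) n / (pochhammer 1 n * fact n) * of_real x ^ n) / ?l x
     = deriv ?\<phi> (of_real x) / ?l x) (at_left 1)"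
    using of_real_at_left_1_eta
    by eventually_elim (use deriv_hg_phi_sums[OF \<kappa>, THEN sums_unique] in auto)
  ultimately have "((\<lambda>x. deriv ?\<phi> (of_real x) / ?l x) \<longlongrightarrow> rGamma (a + 1) * rGamma (- a) * Gamma 1) (at_left 1)"
    by (rule Lim_transform_eventually)
  hence 1: "((\<lambda>x. deriv ?\<phi> (of_real x) / ?l x) \<longlongrightarrow> rGamma (a + 1) * rGamma (- a)) (at_left 1)"
    by simp
  have [simp]: "0 \<in> plane1" by (auto simp: plane1_iff)
  have h: "?\<phi> holomorphic_on plane1" "?p holomorphic_on plane1"
    using hg_phi_ode hg_reg_holomorphic by (auto simp: hg_ode_def)
  have flt: "filterlim (\<lambda>x. complex_of_real (1 - x)) (at 0) (at_left 1)"
    by (auto simp: filterlim_at eventually_at_filter intro!: tendsto_eq_intros)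
  have lim: "((\<lambda>x. f (complex_of_real (1 - x))) \<longlongrightarrow> f 0) (at_left 1)" if "f holomorphic_on plane1" for f
  proof (rule filterlim_compose[OF _ flt])
    have "isCont f 0" using holomorphic_on_imp_continuous_on[OF that] open_plane1
      by (simp add: continuous_on_eq_continuous_at)
    thus "f \<midarrow>0\<rightarrow> f 0" by (simp add: isCont_def)
  qed
  have q: "((\<lambda>x. ?\<phi> (complex_of_real (1 - x)) / complex_of_real (1 - x)) \<longlongrightarrow> 1) (at_left 1)"
  proof (rule filterlim_compose[OF _ flt])
    show "((\<lambda>z. ?\<phi> z / z) \<longlongrightarrow> 1) (at 0)"
      using hg_odeD(1)[OF hg_phi_ode[of \<kappa>] open_plane1, of 0] by (simp add: hg_phi_0 deriv_hg_phi_0 has_field_derivative_iff)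
  qed
  have "((\<lambda>x::real. 1 / ln (1 / (1 - x))) \<longlongrightarrow> 0) (at_left 1)" by real_asymp
  hence "((\<lambda>x::real. complex_of_real (1 / ln (1 / (1 - x)))) \<longlongrightarrow> of_real 0) (at_left 1)"
    by (rule tendsto_of_real)
  hence l0: "((\<lambda>x. 1 / ?l x) \<longlongrightarrow> of_real 0) (at_left 1)" by simp
  have ev: "eventually (\<lambda>x. deriv ?\<phi> (of_real x) / ?l x =
      - (hg_alpha \<kappa> * (deriv ?p (of_real (1 - x)) * (1 / ?l x) + \<kappa> * deriv ?\<phi> (of_real (1 - x))
          - \<kappa> * (?\<phi> (of_real (1 - x)) / of_real (1 - x)) * (1 / ?l x)))
      - hg_beta \<kappa> * deriv ?\<phi> (of_real (1 - x)) * (1 / ?l x)) (at_left 1)"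
    using of_real_at_left_1_eta
  proof eventually_elim
    case (elim x)
    define z where "z = complex_of_real (1 - x)"
    have z: "z \<in> eta_domain" "1 - z = of_real x" using elim by (auto simp: z_def eta_domain_iff)
    have "deriv ?\<phi> (of_real x) = - (hg_alpha \<kappa> * deriv (hg_log \<kappa> Ln) z + hg_beta \<kappa> * deriv ?\<phi> z)"
      using hg_phi_reflect_deriv[OF z(1), of \<kappa>] z(2) by simp
    also have "deriv (hg_log \<kappa> Ln) z = deriv ?p z - \<kappa> * (deriv ?\<phi> z * Ln z) - \<kappa> * (?\<phi> z / z)"
      by (rule hg_log_deriv[OF open_eta_domain eta_domain_subset(1) Ln_deriv_eta_domain z(1)])
    also have "Ln z = - ?l x" using elim unfolding z_def by (subst Ln_of_real) (auto simp: ln_div)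
    finally have e: "deriv ?\<phi> (of_real x) = - (hg_alpha \<kappa> * (deriv ?p z - \<kappa> * (deriv ?\<phi> z * (- ?l x)) - \<kappa> * (?\<phi> z / z)) +
        hg_beta \<kappa> * deriv ?\<phi> z)" .
    have l: "?l x \<noteq> 0" using elim by (simp add: ln_div)
    show ?case unfolding z_def[symmetric] e
      using l by (simp add: field_simps)
  qed
  have "((\<lambda>x. - (hg_alpha \<kappa> * (deriv ?p (of_real (1 - x)) * (1 / ?l x) + \<kappa> * deriv ?\<phi> (of_real (1 - x))
          - \<kappa> * (?\<phi> (of_real (1 - x)) / of_real (1 - x)) * (1 / ?l x)))
      - hg_beta \<kappa> * deriv ?\<phi> (of_real (1 - x)) * (1 / ?l x)) \<longlongrightarrow>
      - (hg_alpha \<kappa> * (deriv ?p 0 * of_real 0 + \<kappa> * deriv ?\<phi> 0 - \<kappa> * 1 * of_real 0))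
      - hg_beta \<kappa> * deriv ?\<phi> 0 * of_real 0) (at_left 1)"
    by (intro tendsto_intros lim q l0 holomorphic_deriv h open_plane1)
  hence "((\<lambda>x. deriv ?\<phi> (of_real x) / ?l x) \<longlongrightarrow> - (hg_alpha \<kappa> * \<kappa>)) (at_left 1)"
    using ev by (simp add: tendsto_cong deriv_hg_phi_0)
  from tendsto_unique[OF _ 1 this] have "hg_alpha \<kappa> * \<kappa> = - (rGamma (- a) * rGamma (1 - (- a)))"
    by (simp add: add.commute mult.commute)
  also have "\<dots> = sin (of_real pi * a) / of_real pi"
    unfolding rGamma_reflection_complex by simp
  finally show ?thesis by (simp add: field_simps)
qed

text \<open>The circuit relations: crossing the cut of one fundamental solution adds a multiple of the other.\<close>

lemma hg_circuit:
  assumes \<kappa>: "\<kappa> = a * (a + 1)"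
  shows "0 < Im z \<Longrightarrow> hg_phi \<kappa> (1 - z) = hg_cut \<kappa> z - \<i> * sin (of_real pi * a) * hg_phi \<kappa> z"
    and "Im z < 0 \<Longrightarrow> hg_phi \<kappa> (1 - z) = hg_cut \<kappa> z + \<i> * sin (of_real pi * a) * hg_phi \<kappa> z"
    and "0 < Im z \<Longrightarrow> hg_phi \<kappa> z = hg_cut \<kappa> (1 - z) + \<i> * sin (of_real pi * a) * hg_phi \<kappa> (1 - z)"
    and "Im z < 0 \<Longrightarrow> hg_phi \<kappa> z = hg_cut \<kappa> (1 - z) - \<i> * sin (of_real pi * a) * hg_phi \<kappa> (1 - z)"
  using hg_cut_jump[of z \<kappa>] hg_cut_jump[of "1 - z" \<kappa>] unfolding hg_alpha[OF \<kappa>, symmetric]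
  by (simp_all add: mult.assoc)

lemma wronskian_hg_phi:
  assumes z: "z \<in> eta_domain"
  shows "wronskian (hg_phi \<kappa>) (\<lambda>z. hg_phi \<kappa> (1 - z)) z = - hg_alpha \<kappa>"
proof -
  have d: "deriv (\<lambda>z. hg_phi \<kappa> (1 - z)) z =
      hg_alpha \<kappa> * deriv (hg_log \<kappa> Ln) z + hg_beta \<kappa> * deriv (hg_phi \<kappa>) z"
    using hg_phi_reflect_deriv[OF z, of \<kappa>] by simp
  have "wronskian (hg_phi \<kappa>) (\<lambda>z. hg_phi \<kappa> (1 - z)) z = - hg_alpha \<kappa> * wronskian (hg_log \<kappa> Ln) (hg_phi \<kappa>) z"
    unfolding wronskian_def d hg_connection[OF z] by (simp add: algebra_simps)
  thus ?thesis using wronskian_hg_log_Ln[OF z] by simp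
qed

section \<open>Solutions at infinity\<close>

lemma conv_radius_ge_1:
  fixes d :: "nat \<Rightarrow> complex"
  assumes d: "(\<lambda>n. of_nat n * d n) \<longlonglongrightarrow> K"
  shows "conv_radius d \<ge> 1"
proof (rule conv_radius_geI_ex')
  fix r :: real assume r: "0 < r" "ereal r < 1"
  hence r1: "r < 1" by simp
  have "Bseq (\<lambda>n. of_nat n * d n)" using d by (intro convergent_imp_Bseq convergentI)
  then obtain B where B: "B > 0" "\<And>n. cmod (of_nat n * d n) \<le> B" by (auto elim: BseqE)
  show "summable (\<lambda>n. d n * of_real r ^ n)"
  proof (rule summable_comparison_test'[of "\<lambda>n. B * r ^ n" 1])
    show "summable (\<lambda>n. B * r ^ n)" using r r1 by (intro summable_mult summable_geometric) auto
    fix n :: nat assume n: "n \<ge> 1"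
    have "1 * cmod (d n) \<le> of_nat n * cmod (d n)" using n by (intro mult_right_mono) auto
    hence "cmod (d n) \<le> B" using B(2)[of n] by (simp add: norm_mult)
    thus "norm (d n * of_real r ^ n) \<le> B * r ^ n"
      using r by (simp add: norm_mult norm_power mult_right_mono)
  qed
qed

text \<open>One series for both columns: \<rho> = a belongs to \<open>h_inf\<close> and \<rho> = - a
  - 1 to \<open>s_inf\<close>.\<close>

definition hg_F :: "complex \<Rightarrow> complex \<Rightarrow> complex" where
  "hg_F \<rho> = eval_fps (fps_hypergeo [\<rho>, \<rho> + 1] [2 * \<rho> + 2] 1)"

text \<open>The coefficient of log (1 / (1 - x)) in the derivative of \<open>hg_F \<rho>\<close> as
  x tends to 1.\<close>

definition hg_K :: "complex \<Rightarrow> complex" where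
  "hg_K \<rho> = rGamma \<rho> * rGamma (\<rho> + 1) * Gamma (2 * \<rho> + 2)"

lemma not_nonpos_Ints_if_not_half_int:
  fixes \<rho> :: complex
  assumes "2 * \<rho> \<notin> \<int>"
  shows "2 * \<rho> + 2 \<notin> \<int>\<^sub>\<le>\<^sub>0" "2 * \<rho> + 1 \<notin> \<int>\<^sub>\<le>\<^sub>0"
proof -
  have "2 * \<rho> + of_int n \<notin> \<int>\<^sub>\<le>\<^sub>0" for n
    using assms by (metis Ints_diff Ints_of_int add_diff_cancel_right' nonpos_Ints_subset_Ints subsetD)
  from this[of 2] this[of 1] show "2 * \<rho> + 2 \<notin> \<int>\<^sub>\<le>\<^sub>0" "2 * \<rho> + 1 \<notin> \<int>\<^sub>\<le>\<^sub>0" by simp_all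
qed

lemma sin_pi_not_half_int:
  fixes \<rho> :: complex
  assumes "2 * \<rho> \<notin> \<int>"
  shows "sin (of_real pi * \<rho>) \<noteq> 0"
proof
  assume "sin (of_real pi * \<rho>) = 0"
  then obtain n :: int where "of_real pi * \<rho> = of_real (of_int n * pi)" by (auto simp: sin_eq_0)
  hence "\<rho> = of_int n" by simp
  thus False using assms by (metis Ints_mult Ints_numeral Ints_of_int)
qed

lemma hg_F_coeff:
  "fps_nth (fps_hypergeo [\<rho>, \<rho> + 1] [2 * \<rho> + 2] 1) n =
    pochhammer \<rho> n * pochhammer (\<rho> + 1) n / (pochhammer (2 * \<rho> + 2) n * fact n)"
  by simp

text \<open>The lower parameter 2 \<rho> + 2 exceeds the sum of the upper ones by 1, so
  \<open>hypergeo_coeff_asymp\<close> does not apply directly. Compared with the lower parameter q =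
  2 \<rho> + 1 the coefficients carry a factor q / (q + n), which tends to 0. Differentiation raises
  all three parameters by 1 and so leads back to the balanced case.\<close>

lemma hg_F_coeff_tendsto:
  assumes \<rho>: "2 * \<rho> \<notin> \<int>"
  shows "(\<lambda>n. of_nat n * fps_nth (fps_hypergeo [\<rho>, \<rho> + 1] [2 * \<rho> + 2] 1) n) \<longlonglongrightarrow> 0"
    and "(\<lambda>n. of_nat n * fps_nth (fps_deriv (fps_hypergeo [\<rho>, \<rho> + 1] [2 * \<rho> + 2] 1)) n) \<longlonglongrightarrow> hg_K \<rho>"
proof -
  note r = not_nonpos_Ints_if_not_half_int[OF \<rho>]
  let ?q = "2 * \<rho> + 1"
  have q0: "?q \<noteq> 0" using r(2) by (metis zero_in_nonpos_Ints)
  have "(\<lambda>n. of_nat n * (pochhammer \<rho> n * pochhammer (\<rho> + 1) n / (pochhammer ?q n * fact n)) * (?q / of_nat n / (?q / of_nat n + 1)))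
      \<longlonglongrightarrow> rGamma \<rho> * rGamma (\<rho> + 1) * Gamma ?q * (0 / (0 + 1))"
    by (intro tendsto_intros tendsto_const_over_nat hypergeo_coeff_asymp r) auto
  moreover have "eventually (\<lambda>n. of_nat n * (pochhammer \<rho> n * pochhammer (\<rho> + 1) n / (pochhammer ?q n * fact n)) * (?q / of_nat n / (?q / of_nat n + 1)) =
     of_nat n * fps_nth (fps_hypergeo [\<rho>, \<rho> + 1] [2 * \<rho> + 2] 1) n) sequentially"
    using eventually_gt_at_top[of 0]
  proof eventually_elim
    case (elim n)
    have qn: "?q + of_nat n \<noteq> 0" using r(2) by (metis add_eq_0_iff2 minus_of_nat_in_nonpos_Ints)
    have nz: "pochhammer ?q n \<noteq> 0" "pochhammer (2 * \<rho> + 2) n \<noteq> 0" using r by (auto simp: pochhammer_eq_0_iff)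
    have "?q * pochhammer (?q + 1) n = pochhammer ?q n * (?q + of_nat n)"
      by (simp only: pochhammer_rec[symmetric] pochhammer_Suc)
    hence "pochhammer (2 * \<rho> + 2) n = pochhammer ?q n * ((?q + of_nat n) / ?q)"
      using q0 by (simp add: field_simps)
    moreover have "q / of_nat n / (q / of_nat n + 1) = q / (q + of_nat n)" for q :: complex
      using elim by (simp add: divide_simps add.commute)
    hence "?q / of_nat n / (?q / of_nat n + 1) = ?q / (?q + of_nat n)" .
    ultimately show ?case unfolding hg_F_coeff using q0 qn nz by (simp add: mult_ac)
  qed
  ultimately show "(\<lambda>n. of_nat n * fps_nth (fps_hypergeo [\<rho>, \<rho> + 1] [2 * \<rho> + 2] 1) n) \<longlonglongrightarrow> 0"
    by (simp add: tendsto_cong del: fps_hypergeo_nth)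
  let ?r = "2 * \<rho> + 2" and ?p = "\<rho> + 1"
  have r1: "?r + 1 \<notin> \<int>\<^sub>\<le>\<^sub>0" "?r \<noteq> 0" using r(1)
    by (metis plus_one_in_nonpos_Ints_imp, metis zero_in_nonpos_Ints)
  have "(\<lambda>n. (\<rho> * ?p / ?r) * (of_nat n * (pochhammer (\<rho> + 1) n * pochhammer (?p + 1) n / (pochhammer (?r + 1) n * fact n))))
      \<longlonglongrightarrow> (\<rho> * ?p / ?r) * (rGamma (\<rho> + 1) * rGamma (?p + 1) * Gamma (?r + 1))"
    by (intro tendsto_intros hypergeo_coeff_asymp r1) auto
  moreover have "(\<rho> * ?p / ?r) * (rGamma (\<rho> + 1) * rGamma (?p + 1) * Gamma (?r + 1)) =
     (\<rho> * rGamma (\<rho> + 1)) * (?p * rGamma (?p + 1)) * (Gamma (?r + 1) / ?r)"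
    by simp
  also have "\<dots> = hg_K \<rho>"
    unfolding rGamma_plus1 Gamma_plus1[OF r(1)] hg_K_def using r1(2) by simp
  finally have lim: "(\<lambda>n. (\<rho> * ?p / ?r) * (of_nat n * (pochhammer (\<rho> + 1) n * pochhammer (?p + 1) n / (pochhammer (?r + 1) n * fact n))))
      \<longlonglongrightarrow> hg_K \<rho>" .
  have e: "(\<rho> * ?p / ?r) * (of_nat n * (pochhammer (\<rho> + 1) n * pochhammer (?p + 1) n / (pochhammer (?r + 1) n * fact n))) =
       of_nat n * fps_nth (fps_deriv (fps_hypergeo [\<rho>, \<rho> + 1] [2 * \<rho> + 2] 1)) n" for n
  proof -
    have "(of_nat (Suc n) :: complex) \<noteq> 0" by (simp only: of_nat_eq_0_iff)
    thus ?thesis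
      unfolding fps_deriv_nth Suc_eq_plus1[symmetric] hg_F_coeff pochhammer_rec fact_Suc by simp
  qed
  show "(\<lambda>n. of_nat n * fps_nth (fps_deriv (fps_hypergeo [\<rho>, \<rho> + 1] [2 * \<rho> + 2] 1)) n) \<longlonglongrightarrow> hg_K \<rho>"
    using lim by (simp only: e)
qed

lemma hg_F_radius: "2 * \<rho> \<notin> (\<int> :: complex set) \<Longrightarrow> fps_conv_radius (fps_hypergeo [\<rho>, \<rho> + 1] [2 * \<rho> + 2] 1) \<ge> 1"
  unfolding fps_conv_radius_def by (rule conv_radius_ge_1[OF hg_F_coeff_tendsto(1)])

lemma hg_F_radius': "2 * \<rho> \<notin> (\<int> :: complex set) \<Longrightarrow> cmod z < 1 \<Longrightarrow>
    ereal (cmod z) < fps_conv_radius (fps_hypergeo [\<rho>, \<rho> + 1] [2 * \<rho> + 2] 1)"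
  using hg_F_radius[of \<rho>] by (rule less_le_trans[rotated]) auto

lemma hg_F_holomorphic: "2 * \<rho> \<notin> \<int> \<Longrightarrow> hg_F \<rho> holomorphic_on ball 0 1"
  unfolding hg_F_def by (rule holomorphic_on_eval_fps) (use hg_F_radius'[of \<rho>] in force)

lemma deriv_hg_F:
  assumes "2 * \<rho> \<notin> \<int>" "cmod z < 1"
  shows "deriv (hg_F \<rho>) z = eval_fps (fps_deriv (fps_hypergeo [\<rho>, \<rho> + 1] [2 * \<rho> + 2] 1)) z"
  unfolding hg_F_def by (intro DERIV_imp_deriv has_field_derivative_eval_fps hg_F_radius' assms)

lemma hg_F_log:
  assumes "2 * \<rho> \<notin> \<int>"
  shows "((\<lambda>x. hg_F \<rho> (of_real x) / of_real (ln (1 / (1 - x)))) \<longlongrightarrow> 0) (at_left 1)"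
    and "((\<lambda>x. deriv (hg_F \<rho>) (of_real x) / of_real (ln (1 / (1 - x)))) \<longlongrightarrow> hg_K \<rho>) (at_left 1)"
proof -
  show "((\<lambda>x. hg_F \<rho> (of_real x) / of_real (ln (1 / (1 - x)))) \<longlongrightarrow> 0) (at_left 1)"
    using log_series[OF hg_F_coeff_tendsto(1)[OF assms]] unfolding hg_F_def eval_fps_def .
  have "eventually (\<lambda>x. eval_fps (fps_deriv (fps_hypergeo [\<rho>, \<rho> + 1] [2 * \<rho> + 2] 1)) (of_real x) / of_real (ln (1 / (1 - x)))
     = deriv (hg_F \<rho>) (of_real x) / of_real (ln (1 / (1 - x)))) (at_left 1)"
    using of_real_at_left_1_eta by eventually_elim (subst deriv_hg_F[OF assms], auto)
  with log_series[OF hg_F_coeff_tendsto(2)[OF assms], folded eval_fps_def]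
  show "((\<lambda>x. deriv (hg_F \<rho>) (of_real x) / of_real (ln (1 / (1 - x)))) \<longlongrightarrow> hg_K \<rho>) (at_left 1)"
    by (rule Lim_transform_eventually)
qed

lemma hg_F_ode:
  assumes \<rho>: "2 * \<rho> \<notin> \<int>" and w: "cmod w < 1"
  shows "w * (1 - w) * deriv (deriv (hg_F \<rho>)) w + (2 * \<rho> + 2) * (1 - w) * deriv (hg_F \<rho>) w
           - \<rho> * (\<rho> + 1) * hg_F \<rho> w = 0"
proof -
  define A where "A = fps_hypergeo [\<rho>, \<rho> + 1] [2 * \<rho> + 2] 1"
  have h: "hg_F \<rho> holomorphic_on ball 0 1" by (rule hg_F_holomorphic[OF \<rho>])
  have "fps_conv_radius A > 0" using hg_F_radius[OF \<rho>] unfolding A_def by (rule less_le_trans[rotated]) simp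
  hence A: "hg_F \<rho> has_fps_expansion A" unfolding hg_F_def A_def by (rule eval_fps_has_fps_expansion)
  note A1 = has_fps_expansion_deriv[OF A] and A2 = has_fps_expansion_deriv[OF has_fps_expansion_deriv[OF A]]
  have "(\<lambda>w. w * (1 - w) * deriv (deriv (hg_F \<rho>)) w + (2 * \<rho> + 2) * (1 - w) * deriv (hg_F \<rho>) w
           - \<rho> * (\<rho> + 1) * hg_F \<rho> w) has_fps_expansion
     fps_X * (1 - fps_X) * fps_deriv (fps_deriv A) + fps_const (2 * \<rho> + 2) * (1 - fps_X) * fps_deriv A
        - fps_const (\<rho> * (\<rho> + 1)) * A" (is "?g has_fps_expansion ?G")
    by (intro fps_expansion_intros A A1 A2)
  moreover have "?G = 0"
  proof (rule fps_ext)
    fix n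
    have rec: "of_nat (Suc n) * (of_nat n + (2 * \<rho> + 2)) * fps_nth A (Suc n) = (of_nat n + \<rho>) * (of_nat n + (\<rho> + 1)) * fps_nth A n"
    proof -
      have nz: "pochhammer (2 * \<rho> + 2) (Suc n) \<noteq> 0" "(of_nat (Suc n) :: complex) \<noteq> 0"
        using not_nonpos_Ints_if_not_half_int[OF \<rho>] by (auto simp: pochhammer_eq_0_iff simp del: of_nat_Suc)
      thus ?thesis unfolding A_def hg_F_coeff
        by (simp add: pochhammer_Suc[of \<rho>] pochhammer_Suc[of "\<rho> + 1"] pochhammer_Suc[of "2 * \<rho> + 2"] divide_simps del: of_nat_Suc)
           (simp add: algebra_simps)?
    qed
    have e: "?G = fps_X * fps_deriv (fps_deriv A) - fps_X * (fps_X * fps_deriv (fps_deriv A))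
        + fps_const (2 * \<rho> + 2) * fps_deriv A - fps_const (2 * \<rho> + 2) * (fps_X * fps_deriv A)
        - fps_const (\<rho> * (\<rho> + 1)) * A"
      by (simp add: algebra_simps)
    have "fps_nth ?G n = of_nat (Suc n) * (of_nat n + (2 * \<rho> + 2)) * fps_nth A (Suc n) - (of_nat n + \<rho>) * (of_nat n + (\<rho> + 1)) * fps_nth A n"
      unfolding e
    proof (cases n)
      case (Suc m)
      thus "fps_nth (fps_X * fps_deriv (fps_deriv A) - fps_X * (fps_X * fps_deriv (fps_deriv A))
        + fps_const (2 * \<rho> + 2) * fps_deriv A - fps_const (2 * \<rho> + 2) * (fps_X * fps_deriv A)
        - fps_const (\<rho> * (\<rho> + 1)) * A) n = of_nat (Suc n) * (of_nat n + (2 * \<rho> + 2)) * fps_nth A (Suc n) - (of_nat n + \<rho>) * (of_nat n + (\<rho> + 1)) * fps_nth A n"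
        by (cases m) (simp_all add: algebra_simps)
    qed (simp add: algebra_simps)
    thus "fps_nth ?G n = fps_nth 0 n" using rec by simp
  qed
  ultimately have "?g has_fps_expansion 0" by simp
  moreover have "?g holomorphic_on ball 0 1" by (intro holomorphic_intros h open_ball)
  ultimately have "eval_fps 0 w = ?g w"
    using w by (intro has_fps_expansion_imp_eval_fps_eq[of ?g 0 w 1]) auto
  thus ?thesis by simp
qed

text \<open>The solution with exponent \<rho> at infinity, \<eta> to the power - \<rho> times the
  series in 1 / \<eta>; the branch L of the logarithm selects the branch of the power.\<close>

definition hg_inf :: "complex \<Rightarrow> (complex \<Rightarrow> complex) \<Rightarrow> complex \<Rightarrow> complex" where
  "hg_inf \<rho> L z = exp (- \<rho> * L z) * hg_F \<rho> (1 / z)"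

lemma hg_inf:
  assumes \<rho>: "2 * \<rho> \<notin> \<int>" and S: "open S" "\<And>z. z \<in> S \<Longrightarrow> 1 < cmod z"
    and L: "\<And>z. z \<in> S \<Longrightarrow> (L has_field_derivative 1 / z) (at z)"
  shows hg_inf_ode: "hg_ode (\<rho> * (\<rho> + 1)) (hg_inf \<rho> L) S"
    and hg_inf_deriv: "z \<in> S \<Longrightarrow> deriv (hg_inf \<rho> L) z =
      exp (- \<rho> * L z) * (- \<rho> / z * hg_F \<rho> (1 / z) - deriv (hg_F \<rho>) (1 / z) / z\<^sup>2)"
proof -
  let ?F = "hg_F \<rho>" and ?E = "\<lambda>z. exp (- \<rho> * L z)"
  let ?f1 = "\<lambda>z. ?E z * (- \<rho> / z * ?F (1 / z) - deriv ?F (1 / z) / z\<^sup>2)"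
  let ?f2 = "\<lambda>z. ?E z * (\<rho> * (\<rho> + 1) / z\<^sup>2 * ?F (1 / z) + (2 * \<rho> + 2) * deriv ?F (1 / z) / z ^ 3 + deriv (deriv ?F) (1 / z) / z ^ 4)"
  have h: "?F holomorphic_on ball 0 1" by (rule hg_F_holomorphic[OF \<rho>])
  have d: "(hg_inf \<rho> L has_field_derivative ?f1 z) (at z)" "(?f1 has_field_derivative ?f2 z) (at z)"
    "z * (1 - z) * ?f2 z + \<rho> * (\<rho> + 1) * hg_inf \<rho> L z = 0" if z: "z \<in> S" for z
  proof -
    have z1: "1 < cmod z" "z \<noteq> 0" "z \<noteq> 1" using S(2)[OF z] by auto
    have w: "1 / z \<in> ball 0 1" using z1 by (simp add: norm_divide)
    have i: "((\<lambda>z. 1 / z) has_field_derivative - (1 / z\<^sup>2)) (at z)"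
      using z1 by (auto intro!: derivative_eq_intros simp: power2_eq_square)
    have F0: "((\<lambda>z. ?F (1 / z)) has_field_derivative deriv ?F (1 / z) * - (1 / z\<^sup>2)) (at z)"
      using DERIV_chain2[of ?F _ "\<lambda>z. 1 / z", OF holomorphic_derivI[OF h open_ball w] i] .
    have F1: "((\<lambda>z. deriv ?F (1 / z)) has_field_derivative deriv (deriv ?F) (1 / z) * - (1 / z\<^sup>2)) (at z)"
      using DERIV_chain2[of "deriv ?F" _ "\<lambda>z. 1 / z", OF holomorphic_derivI[OF holomorphic_deriv[OF h open_ball] open_ball w] i] .
    have E: "(?E has_field_derivative ?E z * (- \<rho> * (1 / z))) (at z)"
      using L[OF z] by (auto intro!: derivative_eq_intros)
    have "(hg_inf \<rho> L has_field_derivative ?E z * (- \<rho> * (1 / z)) * ?F (1 / z) + deriv ?F (1 / z) * - (1 / z\<^sup>2) * ?E z) (at z)"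
      unfolding hg_inf_def[abs_def] by (rule DERIV_mult[OF E F0])
    thus "(hg_inf \<rho> L has_field_derivative ?f1 z) (at z)"
      by (simp add: algebra_simps)
    have r: "((\<lambda>z. - \<rho> / z) has_field_derivative \<rho> / z\<^sup>2) (at z)"
      using z1 by (auto intro!: derivative_eq_intros simp: power2_eq_square)
    have sq: "((\<lambda>z. z\<^sup>2) has_field_derivative 2 * z) (at z)" by (auto intro!: derivative_eq_intros)
    have "(?f1 has_field_derivative ?E z * (- \<rho> * (1 / z)) * (- \<rho> / z * ?F (1 / z) - deriv ?F (1 / z) / z\<^sup>2) +
       (\<rho> / z\<^sup>2 * ?F (1 / z) + deriv ?F (1 / z) * - (1 / z\<^sup>2) * (- \<rho> / z) -
         (deriv (deriv ?F) (1 / z) * - (1 / z\<^sup>2) * z\<^sup>2 - deriv ?F (1 / z) * (2 * z)) / (z\<^sup>2 * z\<^sup>2)) * ?E z) (at z)"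
      by (intro DERIV_mult[OF E] DERIV_diff DERIV_mult[OF r F0] DERIV_divide F1 sq) (use z1 in auto)
    moreover have "E0 * (- \<rho> * (1 / z)) * (- \<rho> / z * f0 - fd / z\<^sup>2) +
       (\<rho> / z\<^sup>2 * f0 + fd * - (1 / z\<^sup>2) * (- \<rho> / z) -
         (fdd * - (1 / z\<^sup>2) * z\<^sup>2 - fd * (2 * z)) / (z\<^sup>2 * z\<^sup>2)) * E0 =
       E0 * (\<rho> * (\<rho> + 1) / z\<^sup>2 * f0 + (2 * \<rho> + 2) * fd / z ^ 3 + fdd / z ^ 4)" for E0 f0 fd fdd
      using z1(2) by (simp add: field_simps power2_eq_square power3_eq_cube power4_eq_xxxx)
    ultimately show "(?f1 has_field_derivative ?f2 z) (at z)" by (simp only:)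
    have ode: "1 / z * (1 - 1 / z) * deriv (deriv ?F) (1 / z) + (2 * \<rho> + 2) * (1 - 1 / z) * deriv ?F (1 / z)
           - \<rho> * (\<rho> + 1) * ?F (1 / z) = 0"
      using w by (intro hg_F_ode \<rho>) auto
    have "z * (1 - z) * (E0 * (k / z\<^sup>2 * f0 + r * fd / z ^ 3 + fdd / z ^ 4)) + k * (E0 * f0) =
        - E0 / z * (1 / z * (1 - 1 / z) * fdd + r * (1 - 1 / z) * fd - k * f0)" for E0 f0 fd fdd k r
      using z1(2) by (simp add: field_simps power2_eq_square power3_eq_cube power4_eq_xxxx)
    thus "z * (1 - z) * ?f2 z + \<rho> * (\<rho> + 1) * hg_inf \<rho> L z = 0"
      unfolding hg_inf_def using ode by simp
  qed
  show "hg_ode (\<rho> * (\<rho> + 1)) (hg_inf \<rho> L) S" by (rule hg_odeI[OF S(1) d])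
  show "z \<in> S \<Longrightarrow> deriv (hg_inf \<rho> L) z = ?f1 z" using d(1) by (rule DERIV_imp_deriv)
qed


section \<open>Domains outside the unit disc\<close>

lemma connected_exp_strip: "connected (exp ` {w. 0 < Re w \<and> s < Im w \<and> Im w < t})"
proof (rule connected_continuous_image)
  have "convex ({w. 0 < Re w} \<inter> ({w. s < Im w} \<inter> {w. Im w < t}))"
    by (intro convex_Int convex_halfspace_Re_gt convex_halfspace_Im_gt convex_halfspace_Im_lt)
  thus "connected {w. 0 < Re w \<and> s < Im w \<and> Im w < t}"
    by (intro convex_connected) (simp add: Collect_conj_eq)
qed (intro continuous_intros)

definition outer_upper :: "complex set" where "outer_upper = {z. 0 < Im z \<and> 1 < cmod z}"

definition outer_lower :: "complex set" where "outer_lower = {z. Im z < 0 \<and> 1 < cmod z}"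

text \<open>Here \<open>Ln (- z)\<close> is holomorphic; \<open>outer_slit1\<close> is the
  corresponding domain for \<open>Ln\<close>. Both contain the two outer half-planes and differ in
  the half-axis along which these are joined.\<close>

definition outer_slit0 :: "complex set" where "outer_slit0 = plane0 \<inter> {z. 1 < cmod z}"

definition outer_slit1 :: "complex set" where "outer_slit1 = - \<real>\<^sub>\<le>\<^sub>0 \<inter> {z. 1 < cmod z}"

lemma open_outer: "open outer_upper" "open outer_lower" "open outer_slit0" "open outer_slit1"
proof -
  have *: "open {z::complex. 1 < cmod z}" by (intro open_Collect_less continuous_intros)
  show "open outer_upper" "open outer_lower"
    unfolding outer_upper_def outer_lower_def Collect_conj_eq
    by (intro open_Int * open_halfspace_Im_gt open_halfspace_Im_lt)+
  show "open outer_slit0" "open outer_slit1" unfolding outer_slit0_def outer_slit1_def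
    by (intro open_Int * open_plane0 open_Compl closed_nonpos_Reals_complex)+
qed

text \<open>In the logarithmic coordinate the domain is a half-strip; this is where its
  connectedness comes from.\<close>

lemma outer_slit1_eq: "outer_slit1 = exp ` {w. 0 < Re w \<and> - pi < Im w \<and> Im w < pi}"
proof (intro equalityI subsetI)
  fix z assume z: "z \<in> outer_slit1"
  hence "z \<noteq> 0" by (auto simp: outer_slit1_def)
  moreover have "Im (Ln z) \<noteq> pi"
    using z Im_Ln_eq_pi[OF \<open>z \<noteq> 0\<close>] by (auto simp: outer_slit1_def complex_nonpos_Reals_iff)
  ultimately show "z \<in> exp ` {w. 0 < Re w \<and> - pi < Im w \<and> Im w < pi}"
    using z mpi_less_Im_Ln[of z] Im_Ln_le_pi[of z] by (intro image_eqI[of _ _ "Ln z"]) (auto simp: outer_slit1_def)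
next
  fix z assume "z \<in> exp ` {w. 0 < Re w \<and> - pi < Im w \<and> Im w < pi}"
  then obtain w where w: "z = exp w" "0 < Re w" "- pi < Im w" "Im w < pi" by auto
  have "Ln z = w" unfolding w(1) by (rule Ln_exp) (use w in auto)
  have z0: "z \<noteq> 0" using w(1) by simp
  have "z \<notin> \<real>\<^sub>\<le>\<^sub>0"
  proof
    assume "z \<in> \<real>\<^sub>\<le>\<^sub>0"
    hence "Re z < 0 \<and> Im z = 0" using z0 by (auto simp: complex_nonpos_Reals_iff complex_eq_iff)
    hence "Im (Ln z) = pi" using Im_Ln_eq_pi[OF z0] by blast
    thus False using \<open>Ln z = w\<close> w(4) by simp
  qed
  thus "z \<in> outer_slit1" using w by (auto simp: outer_slit1_def)
qed

lemma outer_upper_eq: "outer_upper = exp ` {w. 0 < Re w \<and> 0 < Im w \<and> Im w < pi}"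
proof (intro equalityI subsetI)
  fix z assume z: "z \<in> outer_upper"
  hence "z \<noteq> 0" by (auto simp: outer_upper_def)
  thus "z \<in> exp ` {w. 0 < Re w \<and> 0 < Im w \<and> Im w < pi}"
    using z Im_Ln_pos_lt_imp[of z] Im_Ln_pos_lt[of z] by (intro image_eqI[of _ _ "Ln z"]) (auto simp: outer_upper_def)
next
  fix z assume "z \<in> exp ` {w. 0 < Re w \<and> 0 < Im w \<and> Im w < pi}"
  then obtain w where w: "z = exp w" "0 < Re w" "0 < Im w" "Im w < pi" by auto
  thus "z \<in> outer_upper" by (auto simp: outer_upper_def Im_exp sin_gt_zero)
qed

lemma outer_slit0_eq: "outer_slit0 = uminus ` outer_slit1"
proof -
  have *: "z \<in> outer_slit0 \<longleftrightarrow> - z \<in> outer_slit1" for z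
    by (auto simp: outer_slit0_def outer_slit1_def plane0_iff complex_nonpos_Reals_iff)
  show ?thesis
  proof (intro equalityI subsetI)
    fix z assume "z \<in> outer_slit0"
    thus "z \<in> uminus ` outer_slit1" using *[of z] by (intro image_eqI[of _ _ "- z"]) simp_all
  next
    fix z assume "z \<in> uminus ` outer_slit1"
    then obtain y where "z = - y" "y \<in> outer_slit1" by blast
    thus "z \<in> outer_slit0" using *[of z] by simp
  qed
qed

lemma connected_outer: "connected outer_upper" "connected outer_slit1" "connected outer_slit0"
  unfolding outer_slit0_eq unfolding outer_slit1_eq outer_upper_eq
  by (intro connected_exp_strip connected_continuous_image continuous_intros)+

lemma outer_subset:
  "outer_upper \<subseteq> outer_slit0" "outer_upper \<subseteq> outer_slit1" "outer_lower \<subseteq> outer_slit0" "outer_lower \<subseteq> outer_slit1"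
  "outer_upper \<subseteq> eta_domain" "outer_lower \<subseteq> eta_domain" "outer_slit0 \<subseteq> plane0"
  "outer_upper \<noteq> {}" "outer_lower \<noteq> {}"
proof -
  have "2 * \<i> \<in> outer_upper" "- 2 * \<i> \<in> outer_lower" by (auto simp: outer_upper_def outer_lower_def norm_mult)
  thus "outer_upper \<noteq> {}" "outer_lower \<noteq> {}" by auto
qed (auto simp: outer_upper_def outer_lower_def outer_slit0_def outer_slit1_def plane0_iff complex_nonpos_Reals_iff eta_domain_iff)

section \<open>Connection with the solutions at infinity\<close>

lemma hg_independent:
  assumes "hg_alpha \<kappa> \<noteq> 0" "open S" "S \<subseteq> eta_domain" "z \<in> S"
    and eq: "\<And>z. z \<in> S \<Longrightarrow> c * hg_phi \<kappa> z + d * hg_phi \<kappa> (1 - z) = 0"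
  shows "c = 0 \<and> d = 0"
proof -
  let ?\<phi> = "hg_phi \<kappa>" and ?\<psi> = "\<lambda>z. hg_phi \<kappa> (1 - z)"
  have z: "z \<in> eta_domain" using assms by auto
  have ode: "hg_ode \<kappa> ?\<psi> eta_domain" "hg_ode \<kappa> ?\<phi> eta_domain"
    using hg_ode_reflect(1)[OF hg_phi_ode open_plane1 open_eta_domain, of \<kappa>] eta_domain_subset(1)
      hg_ode_subset[OF hg_phi_ode] by (auto simp: eta_domain_iff plane1_iff)
  have "((\<lambda>z. c * ?\<phi> z + d * ?\<psi> z) has_field_derivative c * deriv ?\<phi> z + d * deriv ?\<psi> z) (at z)"
    by (intro DERIV_add DERIV_cmult hg_odeD(1)[OF ode(1) open_eta_domain z] hg_odeD(1)[OF ode(2) open_eta_domain z])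
  moreover have "((\<lambda>z. 0) has_field_derivative c * deriv ?\<phi> z + d * deriv ?\<psi> z) (at z)"
    using calculation
    by (rule has_field_derivative_transform_within_open[OF _ assms(2,4)]) (use eq in auto)
  hence 1: "c * deriv ?\<phi> z + d * deriv ?\<psi> z = 0" by (metis DERIV_const DERIV_unique)
  have 0: "c * ?\<phi> z + d * ?\<psi> z = 0" using eq assms by auto
  let ?w = "wronskian ?\<phi> ?\<psi> z"
  have w: "?w \<noteq> 0" using wronskian_hg_phi[OF z] assms(1) by simp
  have cd: "c * ?w = (c * ?\<phi> z + d * ?\<psi> z) * deriv ?\<psi> z - ?\<psi> z * (c * deriv ?\<phi> z + d * deriv ?\<psi> z)"
    "d * ?w = (c * deriv ?\<phi> z + d * deriv ?\<psi> z) * ?\<phi> z - deriv ?\<phi> z * (c * ?\<phi> z + d * ?\<psi> z)"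
    by (simp_all add: wronskian_def algebra_simps)
  have "c * ?w = 0" "d * ?w = 0" unfolding cd 0 1 by simp_all
  thus ?thesis using w by simp
qed

lemma Ln_minus_upper: "0 < Im z \<Longrightarrow> Ln (- z) = Ln z - \<i> * of_real pi"
  and Ln_minus_lower: "Im z < 0 \<Longrightarrow> Ln (- z) = Ln z + \<i> * of_real pi"
  using Ln_minus[of z] by (cases "z = 0"; simp)+

lemma exp_pi_sin:
  "\<epsilon> = exp (\<i> * of_real pi * \<rho>) \<Longrightarrow> 2 * \<i> * sin (of_real pi * \<rho>) = \<epsilon> - 1 / \<epsilon>"
  by (simp add: sin_exp_eq exp_minus inverse_eq_divide mult_ac)

text \<open>Going once around infinity multiplies \<open>hg_inf \<rho>\<close> by a scalar; comparing this with the circuit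
  relations determines the solution up to a factor.\<close>

lemma hg_inf_connection_exists:
  assumes \<rho>: "2 * \<rho> \<notin> \<int>" and \<epsilon>: "\<epsilon> = exp (\<i> * of_real pi * \<rho>)" and \<kappa>: "\<kappa> = \<rho> * (\<rho> + 1)"
  obtains c where
    "\<And>z. z \<in> outer_slit0 \<Longrightarrow>
       hg_inf \<rho> (\<lambda>z. Ln (- z)) z = c * (\<epsilon> * hg_phi \<kappa> z + (hg_cut \<kappa> z - \<i> * sin (of_real pi * \<rho>) * hg_phi \<kappa> z))"
    "\<And>z. z \<in> outer_slit1 \<Longrightarrow>
       \<epsilon> * hg_inf \<rho> Ln z = c * (\<epsilon> * hg_cut \<kappa> (1 - z) + (1 + \<epsilon> * \<i> * sin (of_real pi * \<rho>)) * hg_phi \<kappa> (1 - z))"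
proof -
  let ?\<phi> = "hg_phi \<kappa>" and ?\<psi> = "\<lambda>z. hg_phi \<kappa> (1 - z)"
  let ?H = "hg_inf \<rho> (\<lambda>z. Ln (- z))" and ?R = "hg_inf \<rho> Ln"
  define \<sigma> where "\<sigma> = \<i> * sin (of_real pi * \<rho>)"
  have s0: "sin (of_real pi * \<rho>) \<noteq> 0" by (rule sin_pi_not_half_int[OF \<rho>])
  have al: "hg_alpha \<kappa> \<noteq> 0" using hg_alpha[OF \<kappa>] s0 by auto
  have e0: "\<epsilon> \<noteq> 0" by (simp add: \<epsilon>)
  have se: "2 * \<sigma> = \<epsilon> - 1 / \<epsilon>" unfolding \<sigma>_def mult.assoc[symmetric] by (rule exp_pi_sin[OF \<epsilon>])
  note circ = hg_circuit[OF \<kappa>, folded \<sigma>_def]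
  have ode: "hg_ode \<kappa> ?\<psi> eta_domain" "hg_ode \<kappa> ?\<phi> eta_domain"
    using hg_ode_reflect(1)[OF hg_phi_ode open_plane1 open_eta_domain, of \<kappa>] eta_domain_subset(1)
      hg_ode_subset[OF hg_phi_ode] by (auto simp: eta_domain_iff plane1_iff)
  have L0: "((\<lambda>z. Ln (- z)) has_field_derivative 1 / z) (at z)" if "z \<in> outer_slit0" for z
    using that outer_subset(7) by (intro Ln_minus_deriv) auto
  have L1: "(Ln has_field_derivative 1 / z) (at z)" if "z \<in> outer_slit1" for z
    using that has_field_derivative_Ln[of z] by (auto simp: outer_slit1_def inverse_eq_divide)
  have H: "hg_ode \<kappa> ?H outer_slit0" unfolding \<kappa>
    by (rule hg_inf_ode[OF \<rho> open_outer(3) _ L0]) (auto simp: outer_slit0_def)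
  have R: "hg_ode \<kappa> ?R outer_slit1" unfolding \<kappa>
    by (rule hg_inf_ode[OF \<rho> open_outer(4) _ L1]) (auto simp: outer_slit1_def)
  have "\<exists>z\<in>outer_upper. wronskian ?\<phi> ?\<psi> z \<noteq> 0"
    using outer_subset(5,8) wronskian_hg_phi al by fastforce
  then obtain x y where xy: "\<And>z. z \<in> outer_upper \<Longrightarrow> ?H z = x * ?\<phi> z + y * ?\<psi> z"
    using hg_ode_span[OF hg_ode_subset[OF ode(2) outer_subset(5)] hg_ode_subset[OF ode(1) outer_subset(5)]
      hg_ode_subset[OF H outer_subset(1)] open_outer(1) connected_outer(1)] by (auto simp: outer_upper_def)
  have hol: "?\<phi> holomorphic_on plane1" "hg_cut \<kappa> holomorphic_on plane0"
    using hg_phi_ode hg_cut_ode by (auto intro: hg_ode_holomorphic)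
  \<comment> \<open>Across the negative axis \<phi> is holomorphic and \<phi> (1 - z) is continued
    by means of \<open>hg_cut\<close>. In \<open>B\<close> the positive axis is crossed instead, and
    the two functions exchange their roles.\<close>
  have A: "?H z = x * ?\<phi> z + y * (hg_cut \<kappa> z - \<sigma> * ?\<phi> z)" if "z \<in> outer_slit0" for z
  proof (rule analytic_continuation_open[OF open_outer(1,3) outer_subset(8) connected_outer(3) outer_subset(1) _ _ _ that])
    show "?H holomorphic_on outer_slit0" using H by (rule hg_ode_holomorphic)
    show "(\<lambda>z. x * ?\<phi> z + y * (hg_cut \<kappa> z - \<sigma> * ?\<phi> z)) holomorphic_on outer_slit0"
      by (intro holomorphic_intros hol[THEN holomorphic_on_subset])
         (auto simp: outer_slit0_def plane0_iff plane1_iff)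
    show "?H z = x * ?\<phi> z + y * (hg_cut \<kappa> z - \<sigma> * ?\<phi> z)" if "z \<in> outer_upper" for z
      using xy[OF that] circ(1)[of z] that by (simp add: outer_upper_def)
  qed
  have HR: "?H z = \<epsilon> * ?R z" if "z \<in> outer_upper" for z
    using that unfolding hg_inf_def \<epsilon>
    by (subst Ln_minus_upper) (auto simp: outer_upper_def algebra_simps exp_add[symmetric])
  have HR': "\<epsilon> * ?H z = ?R z" if "z \<in> outer_lower" for z
    using that unfolding hg_inf_def \<epsilon>
    by (subst Ln_minus_lower) (auto simp: outer_lower_def algebra_simps exp_add[symmetric])
  have B: "\<epsilon> * ?R z = x * (hg_cut \<kappa> (1 - z) + \<sigma> * ?\<psi> z) + y * ?\<psi> z" if "z \<in> outer_slit1" for z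
  proof (rule analytic_continuation_open[OF open_outer(1,4) outer_subset(8) connected_outer(2) outer_subset(2) _ _ _ that])
    show "(\<lambda>z. \<epsilon> * ?R z) holomorphic_on outer_slit1" using R by (intro holomorphic_intros hg_ode_holomorphic)
    have im: "(\<lambda>z. 1 - z) ` outer_slit1 \<subseteq> plane0" "(\<lambda>z. 1 - z) ` outer_slit1 \<subseteq> plane1"
    proof -
      have "1 - z \<in> plane0 \<and> 1 - z \<in> plane1" if z: "z \<in> outer_slit1" for z
      proof (cases "Im z = 0")
        case True
        hence "cmod z = \<bar>Re z\<bar>" by (simp add: cmod_def)
        thus ?thesis using z True by (auto simp: outer_slit1_def plane0_iff plane1_iff complex_nonpos_Reals_iff)
      qed (auto simp: plane0_iff plane1_iff)
      thus "(\<lambda>z. 1 - z) ` outer_slit1 \<subseteq> plane0" "(\<lambda>z. 1 - z) ` outer_slit1 \<subseteq> plane1" by auto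
    qed
    have "(hg_cut \<kappa> \<circ> (\<lambda>z. 1 - z)) holomorphic_on outer_slit1" "(?\<phi> \<circ> (\<lambda>z. 1 - z)) holomorphic_on outer_slit1"
      by (intro holomorphic_on_compose_gen[OF _ hol(2) im(1)] holomorphic_on_compose_gen[OF _ hol(1) im(2)] holomorphic_intros)+
    thus "(\<lambda>z. x * (hg_cut \<kappa> (1 - z) + \<sigma> * ?\<psi> z) + y * ?\<psi> z) holomorphic_on outer_slit1"
      unfolding o_def by (intro holomorphic_intros)
    show "\<epsilon> * ?R z = x * (hg_cut \<kappa> (1 - z) + \<sigma> * ?\<psi> z) + y * ?\<psi> z" if "z \<in> outer_upper" for z
      using xy[OF that] HR[OF that] circ(3)[of z] that by (simp add: outer_upper_def)
  qed
  \<comment> \<open>In the lower half-plane both continuations are available. They represent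
    different branches of the same power, related by
    \<open>\<epsilon>\<^sup>2 * ?H z = \<epsilon> * ?R z\<close>, which gives a linear relation
    between \<phi> and \<phi> (1 - z). The vanishing of the coefficient of \<phi> already forces x =
    \<epsilon> y.\<close>
  have "(\<epsilon>\<^sup>2 * (x - 2 * \<sigma> * y) - x) * ?\<phi> z + (\<epsilon>\<^sup>2 * y - (2 * \<sigma> * x + y)) * ?\<psi> z = 0" if z: "z \<in> outer_lower" for z
  proof -
    have *: "Im z < 0" "z \<in> outer_slit0" "z \<in> outer_slit1" using z outer_subset by (auto simp: outer_lower_def)
    have c: "hg_cut \<kappa> z = ?\<psi> z - \<sigma> * ?\<phi> z" "hg_cut \<kappa> (1 - z) = ?\<phi> z + \<sigma> * ?\<psi> z"
    proof -
      have g: "x = y + t \<Longrightarrow> y = x - t" "x = y - t \<Longrightarrow> y = x + t" for x y t :: complex by auto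
      show "hg_cut \<kappa> z = ?\<psi> z - \<sigma> * ?\<phi> z" by (rule g(1)[OF circ(2)[OF *(1)]])
      show "hg_cut \<kappa> (1 - z) = ?\<phi> z + \<sigma> * ?\<psi> z" by (rule g(2)[OF circ(4)[OF *(1)]])
    qed
    have "\<epsilon>\<^sup>2 * ?H z = \<epsilon> * ?R z" using HR'[OF z] by (simp add: power2_eq_square mult.assoc)
    thus ?thesis unfolding A[OF *(2)] B[OF *(3)] c by (simp add: algebra_simps)
  qed
  hence "\<epsilon>\<^sup>2 * (x - 2 * \<sigma> * y) - x = 0"
    using hg_independent[OF al open_outer(2) outer_subset(6)] outer_subset(9) by blast
  hence "\<epsilon>\<^sup>2 * x - x = \<epsilon>\<^sup>2 * (2 * \<sigma>) * y" by (simp add: algebra_simps)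
  also have "\<epsilon>\<^sup>2 * (2 * \<sigma>) = \<epsilon> * (\<epsilon>\<^sup>2 - 1)" unfolding se using e0 by (simp add: field_simps power2_eq_square)
  finally have "(\<epsilon>\<^sup>2 - 1) * x = (\<epsilon>\<^sup>2 - 1) * (\<epsilon> * y)" by (simp add: algebra_simps)
  moreover have "\<epsilon>\<^sup>2 - 1 \<noteq> 0"
  proof
    assume "\<epsilon>\<^sup>2 - 1 = 0"
    hence "2 * \<sigma> = 0" unfolding se using e0 by (simp add: field_simps power2_eq_square)
    thus False using s0 by (simp add: \<sigma>_def)
  qed
  ultimately have x: "x = \<epsilon> * y" by simp
  show thesis
    by (rule that[of y]) (use A B in \<open>simp_all add: x \<sigma>_def algebra_simps\<close>)
qed


lemma hg_cut_deriv:
  assumes "z \<in> plane0"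
  shows "deriv (hg_cut \<kappa>) z = hg_alpha \<kappa> * (deriv (hg_reg \<kappa>) z - \<kappa> * (deriv (hg_phi \<kappa>) z * Ln (- z)) - \<kappa> * (hg_phi \<kappa> z / z))
           + hg_beta \<kappa> * deriv (hg_phi \<kappa>) z"
proof -
  have p1: "z \<in> plane1" using assms plane0_subset by auto
  have "(hg_cut \<kappa> has_field_derivative hg_alpha \<kappa> * deriv (hg_log \<kappa> (\<lambda>z. Ln (- z))) z + hg_beta \<kappa> * deriv (hg_phi \<kappa>) z) (at z)"
    unfolding hg_cut_def[abs_def]
    by (intro DERIV_add DERIV_cmult hg_odeD(1)[OF hg_phi_ode open_plane1 p1]
         hg_odeD(1)[OF hg_log_ode[OF open_plane0 plane0_subset(1) Ln_minus_deriv] open_plane0 assms])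
  hence "deriv (hg_cut \<kappa>) z = hg_alpha \<kappa> * deriv (hg_log \<kappa> (\<lambda>z. Ln (- z))) z + hg_beta \<kappa> * deriv (hg_phi \<kappa>) z"
    by (rule DERIV_imp_deriv)
  also have "deriv (hg_log \<kappa> (\<lambda>z. Ln (- z))) z =
      deriv (hg_reg \<kappa>) z - \<kappa> * (deriv (hg_phi \<kappa>) z * Ln (- z)) - \<kappa> * (hg_phi \<kappa> z / z)"
    by (rule hg_log_deriv[OF open_plane0 plane0_subset(1) Ln_minus_deriv assms])
  finally show ?thesis .
qed

text \<open>Both sides are differentiated and divided by log (1 / (1 - x)) at \<eta> = 1 / x, x
  tending to 1 from below. The series contributes \<open>hg_K\<close>, the cut solution its
  logarithmic coefficient; the term with d stays bounded and drops out, so that c alone is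
  determined.\<close>

lemma hg_inf_constant:
  assumes \<rho>: "2 * \<rho> \<notin> \<int>" and \<kappa>: "\<kappa> = \<rho> * (\<rho> + 1)" and e: "\<epsilon> \<noteq> 0"
    and eq: "\<And>z. z \<in> outer_slit1 \<Longrightarrow> \<epsilon> * hg_inf \<rho> Ln z = c * (\<epsilon> * hg_cut \<kappa> (1 - z) + d * hg_phi \<kappa> (1 - z))"
  shows "of_real pi * hg_K \<rho> = c * sin (of_real pi * \<rho>)"
proof -
  let ?\<phi> = "hg_phi \<kappa>" and ?p = "hg_reg \<kappa>" and ?l = "\<lambda>x::real. complex_of_real (ln (1 / (1 - x)))"
  let ?F = "hg_F \<rho>" and ?\<zeta> = "\<lambda>x. complex_of_real (1 - 1 / x)"
  let ?A = "\<lambda>x. \<epsilon> * (exp (\<rho> * of_real (ln x)) * (- \<rho> * of_real x * (?F (of_real x) / ?l x) - (of_real x)\<^sup>2 * (deriv ?F (of_real x) / ?l x)))"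
  let ?B = "\<lambda>x. - (c * (\<epsilon> * (hg_alpha \<kappa> * (deriv ?p (?\<zeta> x) * (1 / ?l x) - \<kappa> * (deriv ?\<phi> (?\<zeta> x) * of_real (ln ((1 - x) / x) / ln (1 / (1 - x))))
      - \<kappa> * (?\<phi> (?\<zeta> x) / ?\<zeta> x) * (1 / ?l x)) + hg_beta \<kappa> * deriv ?\<phi> (?\<zeta> x) * (1 / ?l x)) + d * deriv ?\<phi> (?\<zeta> x) * (1 / ?l x)))"
  have AB: "eventually (\<lambda>x. ?A x = ?B x) (at_left 1)"
    using of_real_at_left_1_eta
  proof eventually_elim
    case (elim x)
    hence x: "0 < x" "x < 1" by auto
    define \<eta> where "\<eta> = complex_of_real (1 / x)"
    have \<eta>: "1 < cmod \<eta>" "\<eta> \<noteq> 0" "1 / \<eta> = of_real x" "1 - \<eta> = ?\<zeta> x"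
      using x by (auto simp: \<eta>_def norm_divide)
    have os: "\<eta> \<in> outer_slit1" using x \<eta>(1) by (auto simp: outer_slit1_def \<eta>_def complex_nonpos_Reals_iff)
    have z0: "1 - \<eta> \<in> plane0" and z1: "1 - \<eta> \<in> plane1" using x by (auto simp: plane0_iff plane1_iff \<eta>_def)
    have L1: "(Ln has_field_derivative 1 / z) (at z)" if "z \<in> outer_slit1" for z
      using that has_field_derivative_Ln[of z] by (auto simp: outer_slit1_def inverse_eq_divide)
    have gt: "\<And>z. z \<in> outer_slit1 \<Longrightarrow> 1 < cmod z" by (auto simp: outer_slit1_def)
    have "((\<lambda>z. \<epsilon> * hg_inf \<rho> Ln z) has_field_derivative \<epsilon> * deriv (hg_inf \<rho> Ln) \<eta>) (at \<eta>)"
      by (intro DERIV_cmult hg_odeD(1)[OF hg_inf_ode[OF \<rho> open_outer(4) gt L1] open_outer(4) os])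
    hence 1: "((\<lambda>z. c * (\<epsilon> * hg_cut \<kappa> (1 - z) + d * ?\<phi> (1 - z))) has_field_derivative \<epsilon> * deriv (hg_inf \<rho> Ln) \<eta>) (at \<eta>)"
      by (rule has_field_derivative_transform_within_open[OF _ open_outer(4) os]) (use eq in auto)
    have m: "((\<lambda>z. 1 - z) has_field_derivative -1) (at \<eta>)" by (auto intro!: derivative_eq_intros)
    have "((\<lambda>z. c * (\<epsilon> * hg_cut \<kappa> (1 - z) + d * ?\<phi> (1 - z))) has_field_derivative
        c * (\<epsilon> * (deriv (hg_cut \<kappa>) (1 - \<eta>) * -1) + d * (deriv ?\<phi> (1 - \<eta>) * -1))) (at \<eta>)"
      by (intro DERIV_cmult DERIV_add DERIV_chain2[of "hg_cut \<kappa>", OF hg_odeD(1)[OF hg_cut_ode open_plane0 z0] m]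
           DERIV_chain2[of ?\<phi>, OF hg_odeD(1)[OF hg_phi_ode open_plane1 z1] m])
    from DERIV_unique[OF 1 this] have "\<epsilon> * deriv (hg_inf \<rho> Ln) \<eta> =
        - (c * (\<epsilon> * deriv (hg_cut \<kappa>) (1 - \<eta>) + d * deriv ?\<phi> (1 - \<eta>)))" by (simp add: algebra_simps)
    also have "deriv (hg_inf \<rho> Ln) \<eta> = exp (- \<rho> * Ln \<eta>) * (- \<rho> / \<eta> * ?F (1 / \<eta>) - deriv ?F (1 / \<eta>) / \<eta>\<^sup>2)"
      by (rule hg_inf_deriv[OF \<rho> open_outer(4) gt L1 os])
    also have "Ln \<eta> = - of_real (ln x)" using x unfolding \<eta>_def by (subst Ln_of_real) (auto simp: ln_div)
    also have "- \<rho> / \<eta> = - \<rho> * of_real x" unfolding \<eta>(3)[symmetric] by simp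
    also have "deriv ?F (1 / \<eta>) / \<eta>\<^sup>2 = (of_real x)\<^sup>2 * deriv ?F (of_real x)" unfolding \<eta>(3)[symmetric] by (simp add: power_divide)
    also have "deriv (hg_cut \<kappa>) (1 - \<eta>) = hg_alpha \<kappa> * (deriv ?p (1 - \<eta>) - \<kappa> * (deriv ?\<phi> (1 - \<eta>) * Ln (- (1 - \<eta>))) - \<kappa> * (?\<phi> (1 - \<eta>) / (1 - \<eta>)))
           + hg_beta \<kappa> * deriv ?\<phi> (1 - \<eta>)" by (rule hg_cut_deriv[OF z0])
    also have "Ln (- (1 - \<eta>)) = of_real (ln ((1 - x) / x))"
    proof -
      have "- (1 - \<eta>) = of_real ((1 - x) / x)" using x by (simp add: \<eta>_def field_simps)
      thus ?thesis using x by (simp only:) (subst Ln_of_real, auto)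
    qed
    finally have main: "\<epsilon> * (exp (- \<rho> * - of_real (ln x)) * (- \<rho> * of_real x * ?F (1 / \<eta>) - (of_real x)\<^sup>2 * deriv ?F (of_real x))) =
      - (c * (\<epsilon> * (hg_alpha \<kappa> * (deriv ?p (1 - \<eta>) - \<kappa> * (deriv ?\<phi> (1 - \<eta>) * of_real (ln ((1 - x) / x))) - \<kappa> * (?\<phi> (1 - \<eta>) / (1 - \<eta>)))
           + hg_beta \<kappa> * deriv ?\<phi> (1 - \<eta>)) + d * deriv ?\<phi> (1 - \<eta>)))" .
    have "?A x = \<epsilon> * (exp (- \<rho> * - of_real (ln x)) * (- \<rho> * of_real x * ?F (1 / \<eta>) - (of_real x)\<^sup>2 * deriv ?F (of_real x))) * (1 / ?l x)"
      unfolding \<eta>(3) by (simp add: divide_inverse algebra_simps)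
    also have "\<dots> = ?B x" unfolding main \<eta>(4) of_real_divide[of "ln _"] by (simp add: divide_inverse algebra_simps)
    finally show "?A x = ?B x" .
  qed
  have [simp]: "0 \<in> plane1" by (auto simp: plane1_iff)
  have h: "?\<phi> holomorphic_on plane1" "?p holomorphic_on plane1"
    using hg_phi_ode hg_reg_holomorphic by (auto simp: hg_ode_def)
  have flt: "filterlim ?\<zeta> (at 0) (at_left 1)"
    unfolding filterlim_at
  proof
    have "((\<lambda>x::real. 1 - 1 / x) \<longlongrightarrow> 0) (at_left 1)" by real_asymp
    hence "((\<lambda>x::real. complex_of_real (1 - 1 / x)) \<longlongrightarrow> of_real 0) (at_left 1)" by (rule tendsto_of_real)
    thus "(?\<zeta> \<longlongrightarrow> 0) (at_left 1)" by simp
    show "eventually (\<lambda>x. ?\<zeta> x \<in> UNIV \<and> ?\<zeta> x \<noteq> 0) (at_left 1)"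
      using of_real_at_left_1_eta by eventually_elim (auto simp: complex_eq_iff)
  qed
  have lim: "((\<lambda>x. f (?\<zeta> x)) \<longlongrightarrow> f 0) (at_left 1)" if "f holomorphic_on plane1" for f
  proof (rule filterlim_compose[OF _ flt])
    have "isCont f 0" using holomorphic_on_imp_continuous_on[OF that] open_plane1
      by (simp add: continuous_on_eq_continuous_at)
    thus "f \<midarrow>0\<rightarrow> f 0" by (simp add: isCont_def)
  qed
  have q: "((\<lambda>x. ?\<phi> (?\<zeta> x) / ?\<zeta> x) \<longlongrightarrow> 1) (at_left 1)"
  proof (rule filterlim_compose[OF _ flt])
    show "((\<lambda>z. ?\<phi> z / z) \<longlongrightarrow> 1) (at 0)"
      using hg_odeD(1)[OF hg_phi_ode[of \<kappa>] open_plane1, of 0] by (simp add: hg_phi_0 deriv_hg_phi_0 has_field_derivative_iff)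
  qed
  have "((\<lambda>x::real. 1 / ln (1 / (1 - x))) \<longlongrightarrow> 0) (at_left 1)" by real_asymp
  hence "((\<lambda>x::real. complex_of_real (1 / ln (1 / (1 - x)))) \<longlongrightarrow> of_real 0) (at_left 1)"
    by (rule tendsto_of_real)
  hence l0: "((\<lambda>x. 1 / ?l x) \<longlongrightarrow> of_real 0) (at_left 1)" by simp
  have "((\<lambda>x::real. ln ((1 - x) / x) / ln (1 / (1 - x))) \<longlongrightarrow> -1) (at_left 1)" by real_asymp
  hence l1: "((\<lambda>x::real. complex_of_real (ln ((1 - x) / x) / ln (1 / (1 - x)))) \<longlongrightarrow> of_real (-1)) (at_left 1)"
    by (rule tendsto_of_real)
  have "((\<lambda>x::real. ln x) \<longlongrightarrow> 0) (at_left 1)" by real_asymp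
  hence l2: "((\<lambda>x::real. complex_of_real (ln x)) \<longlongrightarrow> of_real 0) (at_left 1)" by (rule tendsto_of_real)
  have l3: "((\<lambda>x::real. complex_of_real x) \<longlongrightarrow> of_real 1) (at_left 1)" by (intro tendsto_of_real tendsto_ident_at)
  have "(?A \<longlongrightarrow> \<epsilon> * (exp (\<rho> * of_real 0) * (- \<rho> * of_real 1 * 0 - (of_real 1)\<^sup>2 * hg_K \<rho>))) (at_left 1)"
    by (intro tendsto_intros l2 l3 hg_F_log \<rho>)
  moreover have "(?B \<longlongrightarrow> - (c * (\<epsilon> * (hg_alpha \<kappa> * (deriv ?p 0 * of_real 0 - \<kappa> * (deriv ?\<phi> 0 * of_real (-1))
      - \<kappa> * 1 * of_real 0) + hg_beta \<kappa> * deriv ?\<phi> 0 * of_real 0) + d * deriv ?\<phi> 0 * of_real 0))) (at_left 1)"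
    by (intro tendsto_intros l0 l1 q lim holomorphic_deriv h open_plane1)
  ultimately have "\<epsilon> * (exp (\<rho> * of_real 0) * (- \<rho> * of_real 1 * 0 - (of_real 1)\<^sup>2 * hg_K \<rho>)) =
    - (c * (\<epsilon> * (hg_alpha \<kappa> * (deriv ?p 0 * of_real 0 - \<kappa> * (deriv ?\<phi> 0 * of_real (-1))
      - \<kappa> * 1 * of_real 0) + hg_beta \<kappa> * deriv ?\<phi> 0 * of_real 0) + d * deriv ?\<phi> 0 * of_real 0))"
    using tendsto_unique[OF _ Lim_transform_eventually[OF _ AB]] by fastforce
  hence "\<epsilon> * hg_K \<rho> = \<epsilon> * (c * (hg_alpha \<kappa> * \<kappa>))" by (simp add: deriv_hg_phi_0)
  hence "hg_K \<rho> = c * (hg_alpha \<kappa> * \<kappa>)" using e by simp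
  thus ?thesis using hg_alpha[OF \<kappa>] by (simp add: mult_ac)
qed

lemma hg_K_nonzero:
  assumes "2 * \<rho> \<notin> \<int>"
  shows "hg_K \<rho> \<noteq> 0"
proof -
  have r1: "\<rho> \<notin> \<int>" using assms Ints_mult[OF Ints_numeral] by blast
  have r2: "\<rho> + 1 \<notin> \<int>" using r1 Ints_diff[of "\<rho> + 1" 1] by auto
  from r1 r2 show ?thesis using not_nonpos_Ints_if_not_half_int[OF assms] nonpos_Ints_subset_Ints
    by (auto simp: hg_K_def rGamma_eq_zero_iff Gamma_eq_zero_iff)
qed

definition hg_c :: "complex \<Rightarrow> complex" where
  "hg_c \<rho> = of_real pi * hg_K \<rho> / sin (of_real pi * \<rho>)"

lemma hg_c_nonzero: "2 * \<rho> \<notin> \<int> \<Longrightarrow> hg_c \<rho> \<noteq> 0"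
  using hg_K_nonzero[of \<rho>] sin_pi_not_half_int[of \<rho>] by (simp add: hg_c_def)

lemma hg_inf_connection:
  assumes \<rho>: "2 * \<rho> \<notin> \<int>" and \<epsilon>: "\<epsilon> = exp (\<i> * of_real pi * \<rho>)" and \<kappa>: "\<kappa> = \<rho> * (\<rho> + 1)"
  shows "z \<in> outer_slit0 \<Longrightarrow> hg_inf \<rho> (\<lambda>z. Ln (- z)) z =
      hg_c \<rho> * (\<epsilon> * hg_phi \<kappa> z + (hg_cut \<kappa> z - \<i> * sin (of_real pi * \<rho>) * hg_phi \<kappa> z))"
proof -
  obtain c where c: "\<And>z. z \<in> outer_slit0 \<Longrightarrow>
       hg_inf \<rho> (\<lambda>z. Ln (- z)) z = c * (\<epsilon> * hg_phi \<kappa> z + (hg_cut \<kappa> z - \<i> * sin (of_real pi * \<rho>) * hg_phi \<kappa> z))"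
    "\<And>z. z \<in> outer_slit1 \<Longrightarrow>
       \<epsilon> * hg_inf \<rho> Ln z = c * (\<epsilon> * hg_cut \<kappa> (1 - z) + (1 + \<epsilon> * \<i> * sin (of_real pi * \<rho>)) * hg_phi \<kappa> (1 - z))"
    using hg_inf_connection_exists[OF assms] by blast
  have "of_real pi * hg_K \<rho> = c * sin (of_real pi * \<rho>)"
    by (rule hg_inf_constant[OF \<rho> \<kappa> _ c(2)]) (simp_all add: \<epsilon>)
  hence "c = hg_c \<rho>" using sin_pi_not_half_int[OF \<rho>] by (simp add: hg_c_def field_simps)
  with c(1) show "z \<in> outer_slit0 \<Longrightarrow> ?thesis" by simp
qed

text \<open>Below the axis \<epsilon> turns into 1 / \<epsilon>: the circuit relation changes the
  coefficient of \<phi> by 2 i sin (\<pi> \<rho>) = \<epsilon> - 1 / \<epsilon>.\<close>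

lemma hg_inf_half_planes:
  assumes \<rho>: "2 * \<rho> \<notin> \<int>" and \<epsilon>: "\<epsilon> = exp (\<i> * of_real pi * \<rho>)" and \<kappa>: "\<kappa> = \<rho> * (\<rho> + 1)"
  shows "z \<in> outer_upper \<Longrightarrow> hg_inf \<rho> (\<lambda>z. Ln (- z)) z = hg_c \<rho> * (\<epsilon> * hg_phi \<kappa> z + hg_phi \<kappa> (1 - z))"
    and "z \<in> outer_lower \<Longrightarrow> hg_inf \<rho> (\<lambda>z. Ln (- z)) z = hg_c \<rho> * (hg_phi \<kappa> z / \<epsilon> + hg_phi \<kappa> (1 - z))"
proof -
  show "hg_inf \<rho> (\<lambda>z. Ln (- z)) z = hg_c \<rho> * (\<epsilon> * hg_phi \<kappa> z + hg_phi \<kappa> (1 - z))" if "z \<in> outer_upper"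
    using that hg_inf_connection[OF assms, of z] outer_subset(1) hg_circuit(1)[OF \<kappa>, of z]
    by (auto simp: outer_upper_def)
  show "hg_inf \<rho> (\<lambda>z. Ln (- z)) z = hg_c \<rho> * (hg_phi \<kappa> z / \<epsilon> + hg_phi \<kappa> (1 - z))" if z: "z \<in> outer_lower"
  proof -
    have e: "\<epsilon> - 2 * \<i> * sin (of_real pi * \<rho>) = 1 / \<epsilon>" using exp_pi_sin[OF \<epsilon>] by simp
    have "hg_inf \<rho> (\<lambda>z. Ln (- z)) z =
      hg_c \<rho> * (\<epsilon> * hg_phi \<kappa> z + (hg_cut \<kappa> z - \<i> * sin (of_real pi * \<rho>) * hg_phi \<kappa> z))"
      using z outer_subset(3) by (intro hg_inf_connection[OF assms]) auto
    also have "\<epsilon> * hg_phi \<kappa> z + (hg_cut \<kappa> z - \<i> * sin (of_real pi * \<rho>) * hg_phi \<kappa> z) =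
       (\<epsilon> - 2 * \<i> * sin (of_real pi * \<rho>)) * hg_phi \<kappa> z + hg_phi \<kappa> (1 - z)"
      using z hg_circuit(2)[OF \<kappa>, of z] by (simp add: outer_lower_def algebra_simps)
    finally show ?thesis unfolding e by simp
  qed
qed

section \<open>Identification with the continued hypergeometric functions\<close>

lemma connected_plane1: "connected plane1"
  by (rule starlike_imp_connected[OF starlike0_starlike[OF starlike0_plane1]])

text \<open>A witness for the choice in \<open>hyp2F1\<close> is pasted together from the series on
  the unit disc and, on \<open>plane0\<close>, the combination of \<phi> and \<open>hg_cut\<close>
  from \<open>hg_inf_connection\<close>, which agree on the overlap. The identity theorem on
  \<open>plane1\<close> then shows that the chosen function is this one.\<close>

lemma hyp2F1_continuation:
  assumes \<rho>: "2 * \<rho> \<notin> \<int>" and \<epsilon>: "\<epsilon> = exp (\<i> * of_real pi * \<rho>)" and \<kappa>: "\<kappa> = \<rho> * (\<rho> + 1)"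
    and z: "0 < Im z"
  shows "hyp2F1 \<rho> (\<rho> + 1) (2 * \<rho> + 2) (1 / z) =
    exp (\<rho> * Ln (- z)) * (hg_c \<rho> * (\<epsilon> * hg_phi \<kappa> z + hg_phi \<kappa> (1 - z)))"
proof -
  define E where "E z = hg_c \<rho> * (\<epsilon> * hg_phi \<kappa> z + (hg_cut \<kappa> z - \<i> * sin (of_real pi * \<rho>) * hg_phi \<kappa> z))" for z
  define G where "G w = exp (\<rho> * Ln (- (1 / w))) * E (1 / w)" for w
  define f where "f w = (if cmod w < 1 then hg_F \<rho> w else G w)" for w
  have inv: "1 / w \<in> plane0" if "w \<in> plane0" for w
    using that by (auto simp: plane0_iff Re_divide Im_divide divide_less_0_iff)
  have E: "E holomorphic_on plane0"
  proof -
    have "hg_phi \<kappa> holomorphic_on plane0" "hg_cut \<kappa> holomorphic_on plane0"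
      using hg_ode_holomorphic[OF hg_phi_ode] hg_ode_holomorphic[OF hg_cut_ode] plane0_subset(1)
      by (auto intro: holomorphic_on_subset)
    thus ?thesis unfolding E_def by (intro holomorphic_intros)
  qed
  have G: "G holomorphic_on plane0"
  proof -
    have i: "(\<lambda>w. 1 / w) holomorphic_on plane0" by (intro holomorphic_intros) (auto simp: plane0_iff)
    have "(E \<circ> (\<lambda>w. 1 / w)) holomorphic_on plane0"
      by (rule holomorphic_on_compose_gen[OF i E]) (use inv in auto)
    moreover have "(\<lambda>w. exp (\<rho> * Ln (- (1 / w)))) holomorphic_on plane0"
      using inv by (intro holomorphic_intros i) (force simp: plane0_iff complex_nonpos_Reals_iff)+
    ultimately show ?thesis unfolding G_def o_def by (rule holomorphic_on_mult[rotated])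
  qed
  have fG: "f w = G w" if w: "w \<in> plane0" for w
  proof (cases "cmod w < 1")
    case True
    have w0: "w \<noteq> 0" using w by (auto simp: plane0_iff)
    hence "1 / w \<in> outer_slit0" using inv[OF w] True by (auto simp: outer_slit0_def norm_divide)
    hence "E (1 / w) = hg_inf \<rho> (\<lambda>z. Ln (- z)) (1 / w)"
      unfolding E_def by (rule hg_inf_connection[OF \<rho> \<epsilon> \<kappa>, symmetric])
    hence "G w = hg_F \<rho> w" by (simp add: G_def hg_inf_def mult.assoc[symmetric] exp_add[symmetric])
    thus ?thesis using True by (simp add: f_def)
  qed (simp add: f_def)
  have "f holomorphic_on (ball 0 1 \<union> plane0)"
  proof (rule holomorphic_on_Un)
    show "f holomorphic_on ball 0 1"
      using hg_F_holomorphic[OF \<rho>] by (rule holomorphic_transform) (auto simp: f_def)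
    show "f holomorphic_on plane0" using G by (rule holomorphic_transform) (simp add: fG)
  qed (auto intro: open_plane0)
  moreover have sub: "plane1 \<subseteq> ball 0 1 \<union> plane0"
  proof
    fix w assume "w \<in> plane1"
    thus "w \<in> ball 0 1 \<union> plane0" by (cases "Im w = 0") (auto simp: plane1_iff plane0_iff cmod_def)
  qed
  ultimately have f: "f holomorphic_on plane1" by (rule holomorphic_on_subset)
  have "\<exists>f. f holomorphic_on (- complex_of_real ` {1..}) \<and>
     (\<forall>z \<in> ball 0 1. f z = eval_fps (fps_hypergeo [\<rho>, \<rho> + 1] [2 * \<rho> + 2] 1) z)"
    using f unfolding plane1_def hg_F_def[symmetric] by (intro exI[of _ f]) (auto simp: f_def)
  from someI_ex[OF this, folded hyp2F1_def plane1_def hg_F_def]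
  have h: "hyp2F1 \<rho> (\<rho> + 1) (2 * \<rho> + 2) holomorphic_on plane1"
    "\<And>w. w \<in> ball 0 1 \<Longrightarrow> hyp2F1 \<rho> (\<rho> + 1) (2 * \<rho> + 2) w = f w" by (auto simp: f_def)
  have z1: "1 / z \<in> plane1" "1 / z \<in> plane0" using z by (auto simp: plane1_iff plane0_iff Im_divide complex_eq_iff sum_power2_eq_zero_iff)
  have "hyp2F1 \<rho> (\<rho> + 1) (2 * \<rho> + 2) (1 / z) = f (1 / z)"
  proof (rule analytic_continuation_open[OF _ open_plane1 _ connected_plane1 _ h(1) f h(2) z1(1)])
    show "ball (0::complex) 1 \<subseteq> plane1"
    proof
      fix w :: complex assume "w \<in> ball 0 1"
      thus "w \<in> plane1" using complex_Re_le_cmod[of w] by (auto simp: plane1_iff)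
    qed
  qed auto
  also have "\<dots> = G (1 / z)" by (rule fG[OF z1(2)])
  also have "\<dots> = exp (\<rho> * Ln (- z)) * E z" by (simp add: G_def)
  also have "E z = hg_c \<rho> * (\<epsilon> * hg_phi \<kappa> z + hg_phi \<kappa> (1 - z))"
    unfolding E_def hg_circuit(1)[OF \<kappa> z] ..
  finally show ?thesis .
qed

lemma continue_from_upper_hyp2F1:
  assumes \<rho>: "2 * \<rho> \<notin> \<int>" and \<epsilon>: "\<epsilon> = exp (\<i> * of_real pi * \<rho>)" and \<kappa>: "\<kappa> = \<rho> * (\<rho> + 1)"
    and f: "\<And>\<eta>. 0 < Im \<eta> \<Longrightarrow> f \<eta> = \<epsilon> * \<eta> powr (- \<rho>) * hyp2F1 \<rho> (\<rho> + 1) (2 * \<rho> + 2) (1 / \<eta>)"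
    and z: "z \<in> eta_domain"
  shows "continue_from_upper f z = hg_c \<rho> * (\<epsilon> * hg_phi \<kappa> z + hg_phi \<kappa> (1 - z))"
proof -
  define g where "g z = hg_c \<rho> * (\<epsilon> * hg_phi \<kappa> z + hg_phi \<kappa> (1 - z))" for z
  have "hg_ode \<kappa> (\<lambda>z. hg_phi \<kappa> (1 - z)) eta_domain" "hg_ode \<kappa> (hg_phi \<kappa>) eta_domain"
    using hg_ode_reflect(1)[OF hg_phi_ode open_plane1 open_eta_domain, of \<kappa>] eta_domain_subset(1)
      hg_ode_subset[OF hg_phi_ode] by (auto simp: eta_domain_iff plane1_iff)
  hence g: "g holomorphic_on eta_domain"
    unfolding g_def by (intro holomorphic_intros hg_ode_holomorphic)
  have gf: "g \<eta> = f \<eta>" if \<eta>: "0 < Im \<eta>" for \<eta>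
  proof -
    have n0: "\<eta> \<noteq> 0" using \<eta> by auto
    \<comment> \<open>The exponential prefactors of \<open>h_inf\<close> and \<open>s_inf\<close>
      turn the principal power of \<eta> into a power of - \<eta>, and this cancels the power in
      \<open>hyp2F1_continuation\<close>. What remains is holomorphic on all of
      \<open>eta_domain\<close>.\<close>
    have "\<epsilon> * \<eta> powr (- \<rho>) = exp (- (\<rho> * Ln (- \<eta>)))"
      unfolding \<epsilon> Ln_minus_upper[OF \<eta>] using n0 by (simp add: powr_def exp_add[symmetric] algebra_simps)
    thus ?thesis unfolding f[OF \<eta>] hyp2F1_continuation[OF \<rho> \<epsilon> \<kappa> \<eta>] g_def
      by (simp add: mult.assoc[symmetric] exp_add[symmetric])
  qed
  have "\<exists>g. g holomorphic_on eta_domain \<and> (\<forall>\<eta>. Im \<eta> > 0 \<longrightarrow> g \<eta> = f \<eta>)" using g gf by blast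
  from someI_ex[OF this, folded continue_from_upper_def]
  have c: "continue_from_upper f holomorphic_on eta_domain" "\<And>\<eta>. Im \<eta> > 0 \<Longrightarrow> continue_from_upper f \<eta> = f \<eta>" by auto
  have "continue_from_upper f z = g z"
  proof (rule analytic_continuation_open[OF _ open_eta_domain _ connected_eta_domain _ c(1) g _ z])
    show "open {z. 0 < Im z}" by (rule open_halfspace_Im_gt)
    have "\<i> \<in> {z. 0 < Im z}" by simp
    thus "{z. 0 < Im z} \<noteq> {}" by blast
    show "{z. 0 < Im z} \<subseteq> eta_domain" by (auto simp: eta_domain_iff)
    show "continue_from_upper f \<eta> = g \<eta>" if "\<eta> \<in> {z. 0 < Im z}" for \<eta>
      using c(2)[of \<eta>] gf[of \<eta>] that by simp
  qed
  thus ?thesis by (simp add: g_def)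
qed

section \<open>The function \<open>a\<close>\<close>

text \<open>Keeps the argument of the square root off the cut, so that the root has strictly
  positive real part; the strict bound on Re a rests on this.\<close>

lemma one_minus_inv_square_notin_nonpos:
  assumes "\<mu> \<notin> real_seg (-1/2) (1/2)"
  shows "1 - 1 / (4 * \<mu>\<^sup>2) \<notin> \<real>\<^sub>\<le>\<^sub>0"
proof
  assume "1 - 1 / (4 * \<mu>\<^sup>2) \<in> \<real>\<^sub>\<le>\<^sub>0"
  then obtain t where t: "t \<le> 0" "1 - 1 / (4 * \<mu>\<^sup>2) = complex_of_real t"
    by (auto elim!: nonpos_Reals_cases)
  have mem: "\<mu> \<in> real_seg (-1/2) (1/2)" if "\<mu> = complex_of_real u" "\<bar>u\<bar> \<le> 1/2" for u
    unfolding real_seg_def that(1) using that(2) by (intro imageI) auto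
  have "\<mu> \<noteq> 0" using mem[of 0] assms by auto
  define u where "u = 1 / (2 * sqrt (1 - t))"
  have st: "sqrt (1 - t) \<ge> 1" using t(1) by simp
  have u: "0 \<le> u" "u \<le> 1/2" using st by (auto simp: u_def field_simps)
  have "u\<^sup>2 = 1 / (4 * (1 - t))" using t(1) by (simp add: u_def power_divide power_mult_distrib)
  hence "(complex_of_real u)\<^sup>2 = 1 / (4 * (1 - complex_of_real t))"
    by (simp flip: of_real_power)
  also have "1 - complex_of_real t = 1 / (4 * \<mu>\<^sup>2)" unfolding t(2)[symmetric] by simp
  finally have "\<mu>\<^sup>2 = (complex_of_real u)\<^sup>2" by simp
  hence "\<mu> = complex_of_real u \<or> \<mu> = complex_of_real (- u)" by (simp add: power2_eq_iff)
  thus False using mem u assms by fastforce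
qed

text \<open>With s the square root, exp (i \<pi> a) = (i + s) / (2 \<mu>) has the inverse (s - i) /
  (2 \<mu>). Half their difference over i is 1 / (2 \<mu>), half their sum is the principal root of
  1 - 1 / (4 \<mu>^2). The real part of that root is positive, so cos (\<pi> Re a) > 0, and the
  principal logarithm bounds |\<pi> Re a| by \<pi>; together these confine a to the strip.\<close>

lemma a_fun:
  assumes \<mu>: "\<mu> \<notin> real_seg (-1/2) (1/2)"
  shows a_fun_Re: "\<bar>Re (a_fun \<mu>)\<bar> < 1/2"
    and sin_a_fun: "sin (of_real pi * a_fun \<mu>) = 1 / (2 * \<mu>)"
    and a_fun_nonzero: "a_fun \<mu> \<noteq> 0"
proof -
  have "0 \<in> real_seg (-1/2) (1/2)" unfolding real_seg_def by (rule image_eqI[of _ _ 0]) auto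
  hence m0: "\<mu> \<noteq> 0" using \<mu> by auto
  define s where "s = sqrt_branch \<mu>"
  define w where "w = (\<i> + s) / (2 * \<mu>)"
  define w' where "w' = (s - \<i>) / (2 * \<mu>)"
  have s2: "s\<^sup>2 = 4 * \<mu>\<^sup>2 - 1" unfolding s_def by (rule sqrt_branch_square[OF m0])
  have "w * w' = (s\<^sup>2 + 1) / (4 * \<mu>\<^sup>2)" by (simp add: w_def w'_def power2_eq_square algebra_simps)
  also have "\<dots> = 1" unfolding s2 using m0 by simp
  finally have ww: "w * w' = 1" .
  hence w0: "w \<noteq> 0" by auto
  have L: "\<i> * (of_real pi * a_fun \<mu>) = Ln w" by (simp add: a_fun_def w_def s_def)
  have e: "exp (\<i> * (of_real pi * a_fun \<mu>)) = w" unfolding L using w0 by simp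
  have e': "exp (- (\<i> * (of_real pi * a_fun \<mu>))) = w'" unfolding exp_minus e using ww w0 by (simp add: field_simps)
  have "sin (of_real pi * a_fun \<mu>) = (w - w') / (2 * \<i>)" unfolding sin_exp_eq e e' ..
  also have "\<dots> = 1 / (2 * \<mu>)" using m0 by (simp add: w_def w'_def field_simps)
  finally show s: "sin (of_real pi * a_fun \<mu>) = 1 / (2 * \<mu>)" .
  thus "a_fun \<mu> \<noteq> 0" using m0 by auto
  have "cos (of_real pi * a_fun \<mu>) = (w + w') / 2" unfolding cos_exp_eq e e' ..
  also have "\<dots> = csqrt (1 - 1 / (4 * \<mu>\<^sup>2))"
    using m0 by (simp add: w_def w'_def s_def sqrt_branch_def field_simps)
  finally have c: "cos (of_real pi * a_fun \<mu>) = csqrt (1 - 1 / (4 * \<mu>\<^sup>2))" .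
  have "Re (csqrt (1 - 1 / (4 * \<mu>\<^sup>2))) > 0"
  proof (rule ccontr)
    let ?q = "csqrt (1 - 1 / (4 * \<mu>\<^sup>2))"
    assume "\<not> Re ?q > 0"
    hence "Re ?q = 0" using csqrt_principal[of "1 - 1 / (4 * \<mu>\<^sup>2)"] by auto
    hence "?q\<^sup>2 = of_real (- (Im ?q)\<^sup>2)" by (simp add: complex_eq_iff power2_eq_square)
    moreover have "complex_of_real (- (Im ?q)\<^sup>2) \<in> \<real>\<^sub>\<le>\<^sub>0" by (simp only: nonpos_Reals_of_real_iff) simp
    ultimately have "?q\<^sup>2 \<in> \<real>\<^sub>\<le>\<^sub>0" by (simp only:)
    thus False using one_minus_inv_square_notin_nonpos[OF \<mu>] by simp
  qed
  hence "0 < cos (Re (of_real pi * a_fun \<mu>))" unfolding c[symmetric] Re_cos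
    by (simp add: zero_less_mult_iff) (smt (verit) exp_gt_zero)
  moreover define x where "x = \<bar>pi * Re (a_fun \<mu>)\<bar>"
  ultimately have cx: "0 < cos x" by (simp add: x_def)
  have "pi * Re (a_fun \<mu>) = Im (Ln w)" unfolding L[symmetric] by simp
  hence "x \<le> pi" using mpi_less_Im_Ln[OF w0] Im_Ln_le_pi[OF w0] by (simp add: x_def)
  have "x < pi / 2"
  proof (rule ccontr)
    assume "\<not> x < pi / 2"
    hence "cos x \<le> cos (pi / 2)" using \<open>x \<le> pi\<close> by (intro cos_monotone_0_pi_le) auto
    thus False using cx by simp
  qed
  thus "\<bar>Re (a_fun \<mu>)\<bar> < 1/2" by (simp add: x_def abs_mult)
qed

lemma a_fun_tendsto: "(a_fun \<longlongrightarrow> 0) at_infinity"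
proof -
  have "((\<lambda>\<mu>. Ln (\<i> * inverse \<mu> / 2 + csqrt (1 - (inverse \<mu>)\<^sup>2 / 4)) / (\<i> * of_real pi)) \<longlongrightarrow>
      Ln (\<i> * 0 / 2 + csqrt (1 - 0\<^sup>2 / 4)) / (\<i> * of_real pi)) at_infinity"
    by (intro tendsto_intros tendsto_inverse_0 isCont_tendsto_compose[OF continuous_at_csqrt]) auto
  moreover have "eventually (\<lambda>\<mu>. Ln (\<i> * inverse \<mu> / 2 + csqrt (1 - (inverse \<mu>)\<^sup>2 / 4)) / (\<i> * of_real pi) = a_fun \<mu>) at_infinity"
    using eventually_not_equal_at_infinity[of 0]
  proof eventually_elim
    case (elim \<mu>)
    have e1: "(\<i> + 2 * \<mu> * q) / (2 * \<mu>) = \<i> * inverse \<mu> / 2 + q" for q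
      using elim by (simp add: field_simps)
    have e2: "1 / (4 * \<mu>\<^sup>2) = (inverse \<mu>)\<^sup>2 / 4" by (simp add: field_simps)
    show ?case unfolding a_fun_def sqrt_branch_def e1 e2 ..
  qed
  ultimately show ?thesis by (simp add: Lim_transform_eventually)
qed

lemma not_half_int_strip:
  assumes "\<bar>Re a\<bar> < 1/2" "a \<noteq> 0"
  shows "2 * a \<notin> \<int>" "2 * (- a - 1) \<notin> \<int>"
proof -
  show *: "2 * a \<notin> \<int>"
  proof
    assume "2 * a \<in> \<int>"
    then obtain n :: int where n: "2 * a = of_int n" by (auto elim: Ints_cases)
    hence "2 * Re a = of_int n" "2 * Im a = 0" by (simp_all add: complex_eq_iff)
    hence "\<bar>real_of_int n\<bar> < 1" using assms(1) by simp
    hence "n = 0" by linarith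
    thus False using n assms(2) by simp
  qed
  show "2 * (- a - 1) \<notin> \<int>"
  proof
    assume "2 * (- a - 1) \<in> \<int>"
    hence "- (2 * (- a - 1)) - 2 \<in> \<int>" by (intro Ints_diff Ints_minus) auto
    thus False using * by (simp add: algebra_simps)
  qed
qed

section \<open>Connection with the matrix \<open>Q\<close>\<close>

text \<open>This explains the Gamma quotient in \<open>Q_mat\<close>: up to the tangent it is the
  ratio of the connection constants of the two columns. Reflection moves the Gamma values at - a -
  1, - a and - 2 a to the right half-plane; Legendre duplication at a + 1/2 and at a + 1 then
  absorbs the power of 4.\<close>

lemma hg_K_ratio:
  assumes a: "\<bar>Re a\<bar> < 1/2" "a \<noteq> 0"
  shows "4 powr (2 * a + 1) * (Gamma (a + 3/2) * Gamma (a + 1/2) / (Gamma a * Gamma (a + 2))) * hg_K (- a - 1)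
          = tan (of_real pi * a) * hg_K a"
proof -
  define S where "S = sin (of_real pi * a)"
  define C where "C = cos (of_real pi * a)"
  have ni: "z \<notin> \<int>\<^sub>\<le>\<^sub>0" if "Re z > 0" for z :: complex
    using that by (auto elim!: nonpos_Ints_cases)
  have a2: "2 * a \<notin> \<int>" by (rule not_half_int_strip[OF a])
  hence ai: "a \<notin> \<int>" using Ints_mult[OF Ints_numeral] by blast
  have S0: "S \<noteq> 0" unfolding S_def by (rule sin_pi_not_half_int[OF a2])
  have "of_real pi * (- 2 * a) = - (2 * (of_real pi * a))" by simp
  hence sin2: "sin (of_real pi * (- 2 * a)) = - (2 * S * C)"
    by (simp only: sin_minus sin_double S_def C_def)
  have C0: "C \<noteq> 0"
  proof
    assume "C = 0"
    hence "sin (of_real pi * (2 * a)) = 0" using sin2 by (simp add: mult_ac)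
    then obtain n :: int where "of_real pi * (2 * a) = of_real (of_int n * pi)" by (auto simp: sin_eq_0)
    hence "2 * a = of_int n" by simp
    thus False using a2 by simp
  qed
  define P where "P = complex_of_real pi"
  have P0: "P \<noteq> 0" by (simp add: P_def)
  note nz = Gamma_eq_zero_iff
  have g: "Gamma (a + 1) \<noteq> 0" "Gamma (a + 2) \<noteq> 0" "Gamma (2 * a + 1) \<noteq> 0" "Gamma (2 * a + 2) \<noteq> 0" "Gamma a \<noteq> 0"
    using a ni[of "a + 1"] ni[of "a + 2"] ni[of "2 * a + 1"] ni[of "2 * a + 2"] ai nonpos_Ints_subset_Ints
    by (auto simp: nz)
  have r1: "rGamma (- a) * rGamma (a + 1) = - S / P"
    using rGamma_reflection_complex[of "- a"] by (simp add: S_def P_def add.commute)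
  have "sin (of_real pi * (- a - 1)) = S"
    by (simp add: S_def right_diff_distrib sin_diff)
  hence r2: "rGamma (- a - 1) * rGamma (a + 2) = S / P"
    using rGamma_reflection_complex[of "- a - 1"] by (simp add: P_def add.commute)
  have r3: "rGamma (- 2 * a) * rGamma (2 * a + 1) = - (2 * S * C) / P"
    using rGamma_reflection_complex[of "- 2 * a"] sin2 by (simp add: P_def add.commute)
  have K2: "hg_K (- a - 1) = (S / P * Gamma (a + 2)) * (- S / P * Gamma (a + 1)) / (- (2 * S * C) / P * Gamma (2 * a + 1))"
  proof -
    have inv: "x = t * Gamma y" if "x * rGamma y = t" "Gamma y \<noteq> 0" for x y t :: complex
      using that by (auto simp: rGamma_inverse_Gamma)
    note inv[OF r2 g(2)]
    moreover note inv[OF r1 g(1)]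
    moreover note inv[OF r3 g(3)]
    moreover have "hg_K (- a - 1) = rGamma (- a - 1) * rGamma (- a) / rGamma (- 2 * a)"
      by (simp add: hg_K_def Gamma_def divide_inverse)
    ultimately show ?thesis by simp
  qed
  have K1: "hg_K a = Gamma (2 * a + 2) / (Gamma a * Gamma (a + 1))"
    by (simp add: hg_K_def rGamma_inverse_Gamma divide_inverse)
  have d1: "Gamma (a + 1/2) * Gamma (a + 1) = exp (- 2 * a * of_real (ln 2)) * of_real (sqrt pi) * Gamma (2 * a + 1)"
    using Gamma_legendre_duplication[of "a + 1/2"] a ni[of "a + 1/2"] ni[of "a + 1"] by (simp add: algebra_simps)
  have d2: "Gamma (a + 1) * Gamma (a + 3/2) = exp ((- 1 - 2 * a) * of_real (ln 2)) * of_real (sqrt pi) * Gamma (2 * a + 2)"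
    using Gamma_legendre_duplication[of "a + 1"] a ni[of "a + 1"] ni[of "a + 3/2"] by (simp add: algebra_simps)
  have "Ln (4::complex) = of_real (ln 4)" using Ln_of_real[of 4] by simp
  also have "ln (4::real) = 2 * ln 2" using ln_mult[of 2 2] by simp
  finally have p4: "4 powr (2 * a + 1) = exp ((2 * a + 1) * (2 * of_real (ln 2)))" by (simp add: powr_def)
  have "4 powr (2 * a + 1) * (Gamma (a + 1/2) * Gamma (a + 1)) * (Gamma (a + 1) * Gamma (a + 3/2)) =
      exp ((2 * a + 1) * (2 * of_real (ln 2))) * exp (- 2 * a * of_real (ln 2)) * exp ((- 1 - 2 * a) * of_real (ln 2)) *
      (of_real (sqrt pi) * of_real (sqrt pi)) * (Gamma (2 * a + 1) * Gamma (2 * a + 2))"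
    unfolding d1 d2 p4 by (simp add: mult_ac)
  also have "exp ((2 * a + 1) * (2 * of_real (ln 2))) * exp (- 2 * a * of_real (ln 2)) * exp ((- 1 - 2 * a) * of_real (ln 2)) = exp (of_real (ln 2))"
    unfolding exp_add[symmetric] by (simp add: algebra_simps)
  also have "\<dots> = 2" by (subst exp_of_real) simp
  also have "complex_of_real (sqrt pi) * of_real (sqrt pi) = P" unfolding P_def by (simp flip: of_real_mult)
  finally have dup: "4 powr (2 * a + 1) * (Gamma (a + 1/2) * Gamma (a + 1)) * (Gamma (a + 1) * Gamma (a + 3/2)) =
     2 * P * (Gamma (2 * a + 1) * Gamma (2 * a + 2))" .
  have K2': "hg_K (- a - 1) = S / C * (Gamma (a + 1) * Gamma (a + 2) / (2 * P * Gamma (2 * a + 1)))"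
    unfolding K2 using S0 C0 P0 g by (simp add: field_simps)
  have "4 powr (2 * a + 1) * (Gamma (a + 3/2) * Gamma (a + 1/2) / (Gamma a * Gamma (a + 2))) * hg_K (- a - 1) =
     S / C * (4 powr (2 * a + 1) * (Gamma (a + 1/2) * Gamma (a + 1)) * (Gamma (a + 1) * Gamma (a + 3/2))) /
       (2 * P * Gamma (2 * a + 1) * Gamma a * Gamma (a + 1))"
    unfolding K2' using C0 P0 g by (simp add: field_simps)
  also have "\<dots> = S / C * hg_K a" unfolding dup K1 using C0 P0 g by (simp add: field_simps)
  finally show ?thesis by (simp add: tan_def S_def C_def)
qed

section \<open>Matrices and the reduction of the explicit formula\<close>

lemma mat2_nth [simp]:
  "mat2 p q r s $ 1 $ 1 = p" "mat2 p q r s $ 1 $ 2 = q" "mat2 p q r s $ 2 $ 1 = r" "mat2 p q r s $ 2 $ 2 = s"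
  by (simp_all add: mat2_def)

lemma mat2_mult: "mat2 p q r s ** mat2 p' q' r' s' =
    mat2 (p * p' + q * r') (p * q' + q * s') (r * p' + s * r') (r * q' + s * s')"
  by (simp add: vec_eq_iff forall_2 matrix_matrix_mult_def sum_2)

lemma mat2_cong: "p = p' \<Longrightarrow> q = q' \<Longrightarrow> r = r' \<Longrightarrow> s = s' \<Longrightarrow> mat2 p q r s = mat2 p' q' r' s'"
  by simp

lemma mat2_one: "mat 1 = mat2 1 0 0 1"
  by (simp add: vec_eq_iff forall_2 mat_def)

lemma mat2_eta: "A = mat2 (A $ 1 $ 1) (A $ 1 $ 2) (A $ 2 $ 1) (A $ 2 $ 2)"
  by (simp add: vec_eq_iff forall_2)

lemma matrix_inv_unique:
  fixes A B :: "'a::field^'n^'n"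
  assumes "A ** B = mat 1"
  shows "matrix_inv A = B"
proof -
  have BA: "B ** A = mat 1" using assms matrix_left_right_inverse by blast
  have "\<exists>A'. A ** A' = mat 1 \<and> A' ** A = mat 1" using assms BA by blast
  from someI_ex[OF this] have "matrix_inv A ** A = mat 1" unfolding matrix_inv_def by blast
  hence "matrix_inv A ** (A ** B) = B" by (simp add: matrix_mul_assoc)
  thus ?thesis by (simp add: assms)
qed

text \<open>Since S is its own inverse, the product in question is the inverse of N = X Q S. The
  invertibility of X and of Q is deduced from that of N, so a right inverse of N is all that has to
  be supplied.\<close>

lemma matrix_inv_product:
  fixes X Q S N N' :: "'a::field^'n^'n"
  assumes N: "X ** Q ** S = N" "N ** N' = mat 1" and S: "S ** S = mat 1"
  shows "S ** matrix_inv Q ** matrix_inv X = N'"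
proof -
  have "X ** (Q ** S ** N') = mat 1" using N by (simp add: matrix_mul_assoc)
  hence X: "matrix_inv X = Q ** S ** N'" by (rule matrix_inv_unique)
  have N'N: "N' ** N = mat 1" using N(2) matrix_left_right_inverse by blast
  hence "(N' ** X ** Q) ** S = mat 1" unfolding N(1)[symmetric] by (simp add: matrix_mul_assoc)
  hence "S ** (N' ** X ** Q) = mat 1" using matrix_left_right_inverse by blast
  hence "(S ** N' ** X) ** Q = mat 1" by (simp add: matrix_mul_assoc)
  hence Q: "matrix_inv Q = S ** N' ** X" using matrix_inv_unique matrix_left_right_inverse by blast
  have "S ** matrix_inv Q ** matrix_inv X = (S ** S) ** (N' ** (X ** Q ** S)) ** N'"
    unfolding X Q by (simp only: matrix_mul_assoc)
  thus ?thesis by (simp add: S N N'N)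
qed

definition hg_mat :: "complex \<Rightarrow> complex \<Rightarrow> complex^2^2" where
  "hg_mat \<kappa> z = mat2 (hg_phi \<kappa> z) (- hg_phi \<kappa> (1 - z)) (deriv (hg_phi \<kappa>) z) (deriv (hg_phi \<kappa>) (1 - z))"

text \<open>The adjugate divided by the determinant, which \<open>hg_mat_det\<close>
  evaluates.\<close>

definition hg_mat_inv :: "complex \<Rightarrow> complex \<Rightarrow> complex^2^2" where
  "hg_mat_inv \<kappa> z = mat2 (deriv (hg_phi \<kappa>) (1 - z) / hg_alpha \<kappa>) (hg_phi \<kappa> (1 - z) / hg_alpha \<kappa>)
     (- deriv (hg_phi \<kappa>) z / hg_alpha \<kappa>) (hg_phi \<kappa> z / hg_alpha \<kappa>)"

lemma hg_mat_det:
  assumes "z \<in> eta_domain"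
  shows "hg_phi \<kappa> z * deriv (hg_phi \<kappa>) (1 - z) + hg_phi \<kappa> (1 - z) * deriv (hg_phi \<kappa>) z = hg_alpha \<kappa>"
  using wronskian_hg_phi[OF assms, of \<kappa>]
  unfolding wronskian_def hg_phi_reflect_deriv(1)[OF assms] by (simp add: algebra_simps)

text \<open>Up to their constants the columns of \<open>Gamma_hat\<close> are e \<phi> + \<psi> and
  - \<phi> / e + \<psi>, where \<psi> (\<eta>) = \<phi> (1 - \<eta>). The diagonal factor of
  \<open>Q_mat\<close> brings the two constants into the ratio given by \<open>hg_K_ratio\<close>,
  its other factor separates \<psi> from \<phi>, and \<open>sigma2\<close> exchanges the columns and
  adjusts the signs.\<close>

lemma Gamma_hat_Q:
  assumes a: "\<bar>Re a\<bar> < 1/2" "a \<noteq> 0" and z: "z \<in> eta_domain"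
  defines "\<kappa> \<equiv> a * (a + 1)"
  defines "C \<equiv> - \<i> * tan (of_real pi * a) * hg_c a * (1 + exp (2 * \<i> * of_real pi * a))"
  shows "Gamma_hat a z ** Q_mat a ** sigma2 = mat2 C 0 0 C ** hg_mat \<kappa> z"
    and "C \<noteq> 0"
proof -
  define e where "e = exp (\<i> * of_real pi * a)"
  define e' where "e' = exp (\<i> * of_real pi * (- a - 1))"
  have e0: "e \<noteq> 0" by (simp add: e_def)
  have ee: "e' = - 1 / e"
  proof -
    have "\<i> * of_real pi * (- a - 1) = - (\<i> * of_real pi * a) + - (of_real pi * \<i>)" by (simp add: algebra_simps)
    hence "e' = exp (- (\<i> * of_real pi * a)) * exp (- (of_real pi * \<i>))"
      by (simp only: e'_def exp_add)
    also have "exp (- (of_real pi * \<i>)) = -1" unfolding exp_minus by simp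
    finally show ?thesis by (simp add: e_def exp_minus divide_inverse)
  qed
  note r = not_half_int_strip[OF a]
  have k2: "\<kappa> = (- a - 1) * ((- a - 1) + 1)" by (simp add: \<kappa>_def algebra_simps)
  let ?\<phi> = "hg_phi \<kappa>" and ?\<psi> = "\<lambda>z. hg_phi \<kappa> (1 - z)"
  let ?ca = "hg_c a" and ?cs = "hg_c (- a - 1)" and ?t = "tan (of_real pi * a)"
  have h: "h_inf a w = ?ca * (e * ?\<phi> w + ?\<psi> w)" if "w \<in> eta_domain" for w
    unfolding h_inf_def
    by (rule continue_from_upper_hyp2F1[OF r(1) e_def \<kappa>_def[THEN meta_eq_to_obj_eq] _ that])
       (simp add: e_def mult_ac)
  have s: "s_inf a w = ?cs * (e' * ?\<phi> w + ?\<psi> w)" if "w \<in> eta_domain" for w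
    unfolding s_inf_def
  proof (rule continue_from_upper_hyp2F1[OF r(2) e'_def k2 _ that])
    fix \<eta> :: complex
    have "- exp (- a * of_real pi * \<i>) = e'" unfolding ee by (simp add: e_def exp_minus inverse_eq_divide mult_ac)
    moreover have "- (- a - 1) = a + 1" "- a - 1 + 1 = - a" "2 * (- a - 1) + 2 = - 2 * a" by simp_all
    ultimately show "- exp (- a * complex_of_real pi * \<i>) * \<eta> powr (a + 1) * hyp2F1 (- a - 1) (- a) (- 2 * a) (1 / \<eta>) =
       e' * \<eta> powr (- (- a - 1)) * hyp2F1 (- a - 1) (- a - 1 + 1) (2 * (- a - 1) + 2) (1 / \<eta>)" by (simp only:)
  qed
  have z1: "z \<in> plane1" "1 - z \<in> eta_domain" using z by (auto simp: eta_domain_iff plane1_iff)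
  have dif: "deriv f z = c * (d * deriv ?\<phi> z - deriv ?\<phi> (1 - z))"
    if f: "\<And>w. w \<in> eta_domain \<Longrightarrow> f w = c * (d * ?\<phi> w + ?\<psi> w)" for f c d
  proof -
    have ode: "hg_ode \<kappa> ?\<psi> eta_domain"
      using hg_ode_reflect(1)[OF hg_phi_ode open_plane1 open_eta_domain, of \<kappa>] by (auto simp: eta_domain_iff plane1_iff)
    have "((\<lambda>w. c * (d * ?\<phi> w + ?\<psi> w)) has_field_derivative c * (d * deriv ?\<phi> z + deriv ?\<psi> z)) (at z)"
      by (intro DERIV_cmult DERIV_add hg_odeD(1)[OF hg_phi_ode open_plane1 z1(1)] hg_odeD(1)[OF ode open_eta_domain z])
    hence "(f has_field_derivative c * (d * deriv ?\<phi> z + deriv ?\<psi> z)) (at z)"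
      by (rule has_field_derivative_transform_within_open[OF _ open_eta_domain z]) (simp add: f)
    thus ?thesis unfolding hg_phi_reflect_deriv(1)[OF z] by (simp add: DERIV_imp_deriv)
  qed
  have dh: "deriv (h_inf a) z = ?ca * (e * deriv ?\<phi> z - deriv ?\<phi> (1 - z))"
    by (rule dif[of "h_inf a"], rule h)
  have ds: "deriv (s_inf a) z = ?cs * (e' * deriv ?\<phi> z - deriv ?\<phi> (1 - z))"
    by (rule dif[of "s_inf a"], rule s)
  define d where "d = 4 powr (2 * a + 1) * exp (a * of_real pi * \<i>) *
             (Gamma (a + 3/2) * Gamma (a + 1/2) / (Gamma a * Gamma (a + 2)))"
  have sn: "sin (of_real pi * (- a - 1)) = sin (of_real pi * a)"
    by (simp add: right_diff_distrib sin_diff)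
  define R where "R = 4 powr (2 * a + 1) * (Gamma (a + 3/2) * Gamma (a + 1/2) / (Gamma a * Gamma (a + 2)))"
  have R: "R * hg_K (- a - 1) = ?t * hg_K a" unfolding R_def by (rule hg_K_ratio[OF a])
  have "d = R * e" by (simp add: d_def R_def e_def mult_ac)
  hence "d * ?cs = (R * hg_K (- a - 1)) * e * of_real pi / sin (of_real pi * a)"
    unfolding hg_c_def sn by simp
  hence dcs: "d * ?cs = ?t * e * ?ca" unfolding R hg_c_def by simp
  have Q: "Q_mat a = mat2 (- ?t) (- ?t * e) (- (d * e)) d"
    unfolding Q_mat_def d_def[symmetric] mat2_mult by (simp add: e_def mult_ac)
  have C: "C = - \<i> * ?t * ?ca * (1 + e * e)"
    unfolding C_def e_def exp_add[symmetric] by (simp add: algebra_simps)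
  \<comment> \<open>Used twice each: for the values of \<phi> and \<psi>, and for their
    derivatives.\<close>
  have q1: "- ?t * (?ca * (e * x + y)) - d * e * (?cs * (e' * x + y)) = - ?t * ?ca * (1 + e * e) * y"
    and q2: "- ?t * e * (?ca * (e * x + y)) + d * (?cs * (e' * x + y)) = - ?t * ?ca * (1 + e * e) * x" for x y
  proof -
    have "- ?t * (?ca * (e * x + y)) - d * e * (?cs * (e' * x + y)) = - ?t * (?ca * (e * x + y)) - (d * ?cs) * e * (e' * x + y)"
      "- ?t * e * (?ca * (e * x + y)) + d * (?cs * (e' * x + y)) = - ?t * e * (?ca * (e * x + y)) + (d * ?cs) * (e' * x + y)"
      by (simp_all add: algebra_simps)
    thus "- ?t * (?ca * (e * x + y)) - d * e * (?cs * (e' * x + y)) = - ?t * ?ca * (1 + e * e) * y"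
      "- ?t * e * (?ca * (e * x + y)) + d * (?cs * (e' * x + y)) = - ?t * ?ca * (1 + e * e) * x"
      unfolding dcs ee using e0 by (simp_all add: field_simps)
  qed
  note q = q1[of "?\<phi> z" "?\<psi> z"] q2[of "?\<phi> z" "?\<psi> z"]
    q1[of "deriv ?\<phi> z" "- deriv ?\<phi> (1 - z)"] q2[of "deriv ?\<phi> z" "- deriv ?\<phi> (1 - z)"]
  have "Gamma_hat a z ** Q_mat a ** sigma2 = mat2
      (\<i> * (- ?t * e * (?ca * (e * ?\<phi> z + ?\<psi> z)) + d * (?cs * (e' * ?\<phi> z + ?\<psi> z))))
      (- \<i> * (- ?t * (?ca * (e * ?\<phi> z + ?\<psi> z)) - d * e * (?cs * (e' * ?\<phi> z + ?\<psi> z))))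
      (\<i> * (- ?t * e * (?ca * (e * deriv ?\<phi> z + - deriv ?\<phi> (1 - z))) + d * (?cs * (e' * deriv ?\<phi> z + - deriv ?\<phi> (1 - z)))))
      (- \<i> * (- ?t * (?ca * (e * deriv ?\<phi> z + - deriv ?\<phi> (1 - z))) - d * e * (?cs * (e' * deriv ?\<phi> z + - deriv ?\<phi> (1 - z)))))"
    unfolding Gamma_hat_def h[OF z] s[OF z] dh ds Q sigma2_def mat2_mult
    by (rule mat2_cong; simp add: algebra_simps)
  also have "\<dots> = mat2 C 0 0 C ** hg_mat \<kappa> z"
    unfolding q hg_mat_def mat2_mult C by (rule mat2_cong; simp add: algebra_simps)
  finally show "Gamma_hat a z ** Q_mat a ** sigma2 = mat2 C 0 0 C ** hg_mat \<kappa> z" .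
  have S: "sin (of_real pi * a) \<noteq> 0" by (rule sin_pi_not_half_int[OF r(1)])
  have S2: "sin (of_real pi * (2 * a)) \<noteq> 0"
  proof
    assume "sin (of_real pi * (2 * a)) = 0"
    then obtain n :: int where "of_real pi * (2 * a) = of_real (of_int n * pi)" by (auto simp: sin_eq_0)
    hence "2 * a = of_int n" by simp
    thus False using r(1) by simp
  qed
  hence C2: "cos (of_real pi * a) \<noteq> 0"
    using sin_double[of "of_real pi * a"] by (auto simp: mult_ac)
  have "1 + e * e = 2 * e * cos (of_real pi * a)"
    unfolding cos_exp_eq using e0 by (simp add: e_def exp_minus field_simps)
  thus "C \<noteq> 0" unfolding C using S C2 e0 hg_c_nonzero[OF r(1)] by (simp add: tan_def)
qed

text \<open>The scalar C enters once as a factor and once through the inverse; being central, it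
  passes the unipotent matrix and cancels.\<close>

lemma Gamma_formula_eq:
  assumes b: "bL < 0" "0 < bR" and a: "\<bar>Re (a_fun \<mu>)\<bar> < 1/2" "a_fun \<mu> \<noteq> 0" and z: "M1 bL bR z \<in> eta_domain"
  shows "Gamma_formula bL bR \<mu> z =
    hg_mat_inv (a_fun \<mu> * (a_fun \<mu> + 1)) (M1_infinity bL bR) **
    mat2 1 (of_real (bL * bR) / (z * of_real (bR - bL) * (a_fun \<mu> + 1))) 0 1 **
    hg_mat (a_fun \<mu> * (a_fun \<mu> + 1)) (M1 bL bR z)"
proof -
  define a where "a = a_fun \<mu>"
  note a' = a[folded a_def]
  define \<kappa> where "\<kappa> = a * (a + 1)"
  define m where "m = M1_infinity bL bR"
  have m: "m \<in> eta_domain" using b by (auto simp: m_def M1_infinity_def eta_domain_iff field_simps)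
  define C where "C = - \<i> * tan (of_real pi * a) * hg_c a * (1 + exp (2 * \<i> * of_real pi * a))"
  note GQ = Gamma_hat_Q[OF a', folded \<kappa>_def C_def]
  have C0: "C \<noteq> 0" by (rule GQ(2)[OF m])
  have "hg_alpha \<kappa> \<noteq> 0" using hg_alpha[OF \<kappa>_def] sin_pi_not_half_int[OF not_half_int_strip(1)[OF a']] by auto
  hence inv: "hg_mat \<kappa> m ** hg_mat_inv \<kappa> m = mat 1"
    unfolding hg_mat_def hg_mat_inv_def mat2_mult mat2_one
    using hg_mat_det[OF m, of \<kappa>] by (simp add: divide_simps) (simp add: algebra_simps)?
  have cc: "mat2 C 0 0 C ** mat2 (1/C) 0 0 (1/C) = mat 1" "mat2 (1/C) 0 0 (1/C) ** mat2 C 0 0 C = mat 1"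
    using C0 by (simp_all add: mat2_mult mat2_one)
  have comm: "mat2 c 0 0 c ** A = A ** mat2 c 0 0 c" for c A
    by (subst (1 2) mat2_eta[of A]) (simp add: mat2_mult mult_ac)
  define N' where "N' = hg_mat_inv \<kappa> m ** mat2 (1/C) 0 0 (1/C)"
  have "mat2 C 0 0 C ** hg_mat \<kappa> m ** N' = mat 1"
    unfolding N'_def by (metis cc(1) comm inv matrix_mul_assoc matrix_mul_rid)
  hence W: "sigma2 ** matrix_inv (Q_mat a) ** matrix_inv (Gamma_hat a m) = N'"
    by (intro matrix_inv_product[OF GQ(1)[OF m]]) (simp_all add: sigma2_def mat2_mult mat2_one)
  define T where "T = mat2 1 (of_real (bL * bR) / (z * of_real (bR - bL) * (a + 1))) 0 1"
  have "Gamma_formula bL bR \<mu> z = N' ** T ** (Gamma_hat a (M1 bL bR z) ** Q_mat a ** sigma2)"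
    unfolding Gamma_formula_def Let_def a_def[symmetric] m_def[symmetric] W T_def[symmetric]
    by (simp only: matrix_mul_assoc)
  also have "\<dots> = hg_mat_inv \<kappa> m ** (mat2 (1/C) 0 0 (1/C) ** T) ** mat2 C 0 0 C ** hg_mat \<kappa> (M1 bL bR z)"
    unfolding GQ(1)[OF z] N'_def by (simp only: matrix_mul_assoc)
  also have "mat2 (1/C) 0 0 (1/C) ** T = T ** mat2 (1/C) 0 0 (1/C)" by (rule comm)
  also have "hg_mat_inv \<kappa> m ** (T ** mat2 (1/C) 0 0 (1/C)) ** mat2 C 0 0 C ** hg_mat \<kappa> (M1 bL bR z) =
     hg_mat_inv \<kappa> m ** T ** (mat2 (1/C) 0 0 (1/C) ** mat2 C 0 0 C) ** hg_mat \<kappa> (M1 bL bR z)"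
    by (simp only: matrix_mul_assoc)
  finally show ?thesis unfolding cc(2) \<kappa>_def a_def m_def T_def by simp
qed

section \<open>The limit \<open>\<lambda> \<rightarrow> \<infinity>\<close>\<close>

text \<open>The estimate of \<open>hg_phi_bound\<close> is uniform on a disc around z, so the
  derivatives converge as well. The filter \<open>nhds 0\<close> admits \<kappa> = 0, so that the
  limits can be composed with any a tending to 0.\<close>

lemma hg_phi_tendsto:
  assumes z: "z \<in> plane1"
  shows "((\<lambda>\<kappa>. hg_phi \<kappa> z) \<longlongrightarrow> z) (nhds 0)"
    and "((\<lambda>\<kappa>. deriv (hg_phi \<kappa>) z) \<longlongrightarrow> 1) (nhds 0)"
proof -
  obtain d where d: "d > 0" "cball z d \<subseteq> plane1" using open_plane1 z open_contains_cball by blast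
  have "(\<lambda>z. 1 / (1 - z)) holomorphic_on plane1"
    by (intro holomorphic_intros) (auto simp: plane1_iff)
  then obtain C where C: "0 \<le> C" "\<And>w t. w \<in> cball z d \<Longrightarrow> t \<in> {0..1} \<Longrightarrow> cmod (1 / (1 - of_real t * w)) \<le> C"
    using starlike0_compact_bound[OF starlike0_plane1 _ compact_cball d(2)] by auto
  define R where "R = cmod z + d"
  have R: "cmod w \<le> R" if "w \<in> cball z d" for w
    using that norm_triangle_sub[of w z] by (auto simp: R_def dist_norm norm_minus_commute)
  have R0: "0 \<le> R" using d by (simp add: R_def)
  let ?b = "\<lambda>\<kappa>. cmod \<kappa> * C * R\<^sup>2 * exp (cmod \<kappa> * C * R)"
  have b: "cmod (hg_phi \<kappa> w - w) \<le> ?b \<kappa>" if w: "w \<in> cball z d" for w \<kappa>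
  proof -
    have "cmod (hg_phi \<kappa> w - w) \<le> cmod \<kappa> * C * (cmod w)\<^sup>2 * exp (cmod \<kappa> * C * cmod w)"
      by (rule hg_phi_bound) (use w d C(2)[OF w] in \<open>auto simp: norm_divide\<close>)
    also have "\<dots> \<le> ?b \<kappa>" using R[OF w] C(1) R0
      by (intro mult_mono power_mono exp_le_cancel_iff[THEN iffD2]) auto
    finally show ?thesis .
  qed
  have "isCont ?b 0" by (intro continuous_intros)
  from isCont_tendsto_compose[OF this filterlim_ident] have b0: "(?b \<longlongrightarrow> 0) (nhds 0)" by simp
  have u: "uniform_limit (ball z d) hg_phi (\<lambda>w. w) (nhds 0)"
  proof (rule uniform_limitI)
    fix e :: real assume e: "e > 0"
    have "eventually (\<lambda>\<kappa>. ?b \<kappa> < e) (nhds 0)" using b0 e by (rule order_tendstoD(2))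
    thus "\<forall>\<^sub>F \<kappa> in nhds 0. \<forall>w\<in>ball z d. dist (hg_phi \<kappa> w) w < e"
    proof (rule eventually_mono, intro ballI)
      fix \<kappa> w assume "?b \<kappa> < e" "w \<in> ball z d"
      thus "dist (hg_phi \<kappa> w) w < e" using b[of w \<kappa>] by (simp add: dist_norm)
    qed
  qed
  show "((\<lambda>\<kappa>. hg_phi \<kappa> z) \<longlongrightarrow> z) (nhds 0)"
    using tendsto_uniform_limitI[OF u, of z] d by simp
  have "((\<lambda>\<kappa>. deriv (hg_phi \<kappa>) z) \<longlongrightarrow> deriv (\<lambda>w. w) z) (nhds 0)"
    using d by (intro deriv_complex_uniform_limit[OF u] always_eventually)
               (auto intro!: holomorphic_on_subset[OF hg_ode_holomorphic[OF hg_phi_ode]])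
  thus "((\<lambda>\<kappa>. deriv (hg_phi \<kappa>) z) \<longlongrightarrow> 1) (nhds 0)" by simp
qed


section \<open>Rows of the solution\<close>

text \<open>The first entry of \<open>(k1, k2) T \<Phi>(\<eta>)\<close>, where \<open>\<Phi>\<close> is \<^const>\<open>hg_mat\<close> and \<open>T\<close> is the unipotent matrix
  with upper right entry \<open>(m - \<eta>) c\<close>.  The symmetry \<open>\<eta> \<mapsto> 1 - \<eta>\<close> reduces the second entry to the first.\<close>

definition hg_row :: "complex \<Rightarrow> complex \<Rightarrow> complex \<Rightarrow> complex \<Rightarrow> complex \<Rightarrow> complex \<Rightarrow> complex" where
  "hg_row \<kappa> c k1 k2 m \<eta> = k1 * hg_phi \<kappa> \<eta> + (k1 * (m - \<eta>) * c + k2) * deriv (hg_phi \<kappa>) \<eta>"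

text \<open>The row with \<phi> replaced by \<open>hg_cut \<kappa> (1 - \<eta>)\<close>; the inner
  derivative gives the minus sign. It is holomorphic across (1, \<infinity>) and is the average of
  the two continuations of \<open>hg_row\<close> to that cut.\<close>

definition hg_row_cut :: "complex \<Rightarrow> complex \<Rightarrow> complex \<Rightarrow> complex \<Rightarrow> complex \<Rightarrow> complex \<Rightarrow> complex" where
  "hg_row_cut \<kappa> c k1 k2 m \<eta> = k1 * hg_cut \<kappa> (1 - \<eta>) - (k1 * (m - \<eta>) * c + k2) * deriv (hg_cut \<kappa>) (1 - \<eta>)"

lemma hg_row_holomorphic: "hg_row \<kappa> c k1 k2 m holomorphic_on plane1"
proof -
  have h: "hg_phi \<kappa> holomorphic_on plane1" using hg_phi_ode by (rule hg_ode_holomorphic)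
  show ?thesis unfolding hg_row_def[abs_def] by (intro holomorphic_intros h open_plane1)
qed

lemma hg_row_isCont: "\<eta> \<in> plane1 \<Longrightarrow> isCont (hg_row \<kappa> c k1 k2 m) \<eta>"
  using holomorphic_on_imp_continuous_on[OF hg_row_holomorphic] open_plane1
  by (simp add: continuous_on_eq_continuous_at)

lemma hg_row_cut_isCont:
  assumes "1 - \<eta> \<in> plane0"
  shows "isCont (hg_row_cut \<kappa> c k1 k2 m) \<eta>"
proof -
  have h: "hg_cut \<kappa> holomorphic_on plane0" using hg_cut_ode by (rule hg_ode_holomorphic)
  have "isCont (hg_cut \<kappa>) (1 - \<eta>)" "isCont (deriv (hg_cut \<kappa>)) (1 - \<eta>)"
    using assms holomorphic_on_imp_continuous_on[OF h] holomorphic_on_imp_continuous_on[OF holomorphic_deriv[OF h open_plane0]]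
      open_plane0 by (simp_all add: continuous_on_eq_continuous_at)
  moreover have m: "isCont (\<lambda>\<eta>. 1 - \<eta>) \<eta>" by (intro continuous_intros)
  ultimately have "isCont (\<lambda>\<eta>. hg_cut \<kappa> (1 - \<eta>)) \<eta>" "isCont (\<lambda>\<eta>. deriv (hg_cut \<kappa>) (1 - \<eta>)) \<eta>"
    using isCont_o2[OF m, of "hg_cut \<kappa>"] isCont_o2[OF m, of "deriv (hg_cut \<kappa>)"] by blast+
  thus ?thesis unfolding hg_row_cut_def[abs_def] by (intro continuous_intros)
qed

text \<open>A row depends linearly on \<phi> and \<phi>', so the circuit relation and its derivative
  suffice. Reflection reverses the sign of the derivative, and (1 - m) - (1 - \<eta>) = - (m -
  \<eta>); hence the data k1, - k2, 1 - m of the reflected row.\<close>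

lemma hg_row_jump:
  assumes \<kappa>: "\<kappa> = a * (a + 1)"
  shows "0 < Im \<eta> \<Longrightarrow> hg_row \<kappa> c k1 k2 m \<eta> =
      hg_row_cut \<kappa> c k1 k2 m \<eta> + \<i> * sin (of_real pi * a) * hg_row \<kappa> c k1 (- k2) (1 - m) (1 - \<eta>)"
    and "Im \<eta> < 0 \<Longrightarrow> hg_row \<kappa> c k1 k2 m \<eta> =
      hg_row_cut \<kappa> c k1 k2 m \<eta> - \<i> * sin (of_real pi * a) * hg_row \<kappa> c k1 (- k2) (1 - m) (1 - \<eta>)"
proof -
  define \<sigma> where "\<sigma> = \<i> * sin (of_real pi * a)"
  note circ = hg_circuit[OF \<kappa>, folded \<sigma>_def]
  have *: "hg_row \<kappa> c k1 k2 m \<eta> = hg_row_cut \<kappa> c k1 k2 m \<eta> + s * hg_row \<kappa> c k1 (- k2) (1 - m) (1 - \<eta>)"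
    if S: "open S" "\<eta> \<in> S" and nr: "\<And>z. z \<in> S \<Longrightarrow> Im z \<noteq> 0"
      and eq: "\<And>z. z \<in> S \<Longrightarrow> hg_phi \<kappa> z = hg_cut \<kappa> (1 - z) + s * hg_phi \<kappa> (1 - z)" for S s
  proof -
    have p: "1 - \<eta> \<in> plane0" "1 - \<eta> \<in> plane1" "\<eta> \<in> plane1"
      using nr[OF S(2)] by (auto simp: plane0_iff plane1_iff)
    have m: "((\<lambda>z. 1 - z) has_field_derivative -1) (at \<eta>)" by (auto intro!: derivative_eq_intros)
    have "((\<lambda>z. hg_cut \<kappa> (1 - z) + s * hg_phi \<kappa> (1 - z)) has_field_derivative
        deriv (hg_cut \<kappa>) (1 - \<eta>) * -1 + s * (deriv (hg_phi \<kappa>) (1 - \<eta>) * -1)) (at \<eta>)"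
      by (intro DERIV_add DERIV_cmult DERIV_chain2[of "hg_cut \<kappa>", OF hg_odeD(1)[OF hg_cut_ode open_plane0 p(1)] m]
           DERIV_chain2[of "hg_phi \<kappa>", OF hg_odeD(1)[OF hg_phi_ode open_plane1 p(2)] m])
    hence "(hg_phi \<kappa> has_field_derivative deriv (hg_cut \<kappa>) (1 - \<eta>) * -1 + s * (deriv (hg_phi \<kappa>) (1 - \<eta>) * -1)) (at \<eta>)"
      by (rule has_field_derivative_transform_within_open[OF _ S]) (simp add: eq)
    hence d: "deriv (hg_phi \<kappa>) \<eta> = deriv (hg_cut \<kappa>) (1 - \<eta>) * -1 + s * (deriv (hg_phi \<kappa>) (1 - \<eta>) * -1)"
      by (rule DERIV_imp_deriv)
    show ?thesis unfolding hg_row_def hg_row_cut_def d eq[OF S(2)] by (simp add: algebra_simps)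
  qed
  show "hg_row \<kappa> c k1 k2 m \<eta> = hg_row_cut \<kappa> c k1 k2 m \<eta> + \<sigma> * hg_row \<kappa> c k1 (- k2) (1 - m) (1 - \<eta>)"
    if "0 < Im \<eta>" using *[OF open_halfspace_Im_gt[of 0], of \<sigma>] that circ(3) by simp
  have "hg_row \<kappa> c k1 k2 m \<eta> = hg_row_cut \<kappa> c k1 k2 m \<eta> + (- \<sigma>) * hg_row \<kappa> c k1 (- k2) (1 - m) (1 - \<eta>)"
    if "Im \<eta> < 0" using *[OF open_halfspace_Im_lt[of 0], of "- \<sigma>"] that circ(4) by simp
  thus "Im \<eta> < 0 \<Longrightarrow> hg_row \<kappa> c k1 k2 m \<eta> = hg_row_cut \<kappa> c k1 k2 m \<eta> - \<sigma> * hg_row \<kappa> c k1 (- k2) (1 - m) (1 - \<eta>)"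
    by simp
qed

section \<open>Growth of a row at 1 and at infinity\<close>

lemma holomorphic_bounded_cball:
  assumes "f holomorphic_on S" "cball z r \<subseteq> S"
  obtains B where "0 \<le> B" "\<And>w. w \<in> cball z r \<Longrightarrow> cmod (f w) \<le> B"
proof -
  have "compact (f ` cball z r)"
    by (intro compact_continuous_image compact_cball
         continuous_on_subset[OF holomorphic_on_imp_continuous_on[OF assms(1)] assms(2)])
  from compact_imp_bounded[OF this] obtain B where "\<And>w. w \<in> cball z r \<Longrightarrow> cmod (f w) \<le> B"
    unfolding bounded_iff by blast
  thus thesis by (intro that[of "max 0 B"]) (auto simp: le_max_iff_disj)
qed

text \<open>At z = 1 - \<eta> the connection formula expresses \<phi> (\<eta>) through
  \<open>hg_log\<close>. Its derivative is no worse than logarithmic, because \<phi> vanishes at 0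
  and so the term \<phi> (z) / z stays bounded.\<close>

lemma hg_row_bound_1:
  obtains C where "0 \<le> C"
    "\<And>\<eta>. \<eta> \<in> eta_domain \<Longrightarrow> cmod (1 - \<eta>) \<le> 1/2 \<Longrightarrow> cmod (hg_row \<kappa> c k1 k2 m \<eta>) \<le> C * (1 + cmod (Ln (1 - \<eta>)))"
proof -
  have sub: "cball 0 (1/2) \<subseteq> plane1"
  proof
    fix w :: complex assume "w \<in> cball 0 (1/2)"
    thus "w \<in> plane1" using complex_Re_le_cmod[of w] by (auto simp: plane1_iff)
  qed
  have phi: "hg_phi \<kappa> holomorphic_on plane1" and p: "hg_reg \<kappa> holomorphic_on plane1"
    using hg_phi_ode hg_reg_holomorphic by (auto intro: hg_ode_holomorphic)
  obtain B1 where B1: "0 \<le> B1" "\<And>w. w \<in> cball 0 (1/2) \<Longrightarrow> cmod (hg_phi \<kappa> w) \<le> B1"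
    using holomorphic_bounded_cball[OF phi sub] by blast
  obtain B2 where B2: "0 \<le> B2" "\<And>w. w \<in> cball 0 (1/2) \<Longrightarrow> cmod (deriv (hg_phi \<kappa>) w) \<le> B2"
    using holomorphic_bounded_cball[OF holomorphic_deriv[OF phi open_plane1] sub] by blast
  obtain B3 where B3: "0 \<le> B3" "\<And>w. w \<in> cball 0 (1/2) \<Longrightarrow> cmod (hg_reg \<kappa> w) \<le> B3"
    using holomorphic_bounded_cball[OF p sub] by blast
  obtain B4 where B4: "0 \<le> B4" "\<And>w. w \<in> cball 0 (1/2) \<Longrightarrow> cmod (deriv (hg_reg \<kappa>) w) \<le> B4"
    using holomorphic_bounded_cball[OF holomorphic_deriv[OF p open_plane1] sub] by blast
  obtain B5 where B5: "0 \<le> B5" "\<And>w. w \<in> cball 0 (1/2) \<Longrightarrow>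
      cmod (if w = 0 then deriv (hg_phi \<kappa>) 0 else (hg_phi \<kappa> w - hg_phi \<kappa> 0) / (w - 0)) \<le> B5"
    using holomorphic_bounded_cball[OF pole_lemma_open[OF phi open_plane1, of 0] sub] by blast
  let ?A = "cmod (hg_alpha \<kappa>)" and ?b = "cmod (hg_beta \<kappa>)" and ?k = "cmod \<kappa>"
  define K1 where "K1 = ?A * (B3 + ?k * B1) + ?b * B1"
  define K2 where "K2 = ?A * (B4 + ?k * B2 + ?k * B5) + ?b * B2"
  define M where "M = cmod k1 * (cmod m + 2) * cmod c + cmod k2"
  have nn: "0 \<le> K1" "0 \<le> K2" "0 \<le> M" using B1 B2 B3 B4 B5 by (auto simp: K1_def K2_def M_def)
  show thesis
  proof (rule that[of "cmod k1 * K1 + M * K2"])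
    show "0 \<le> cmod k1 * K1 + M * K2" using nn by simp
    fix \<eta> assume \<eta>: "\<eta> \<in> eta_domain" and le: "cmod (1 - \<eta>) \<le> 1/2"
    define z where "z = 1 - \<eta>"
    have z: "z \<in> eta_domain" "z \<in> cball 0 (1/2)" "1 - z = \<eta>" "z \<noteq> 0"
      using \<eta> le by (auto simp: z_def eta_domain_iff)
    define L where "L = 1 + cmod (Ln z)"
    have L: "1 \<le> L" "cmod (Ln z) \<le> L" by (auto simp: L_def)
    have grow: "x \<le> x * L" if "0 \<le> x" for x using that L(1) by (simp add: mult_le_cancel_left1)
    have b5: "cmod (hg_phi \<kappa> z / z) \<le> B5" using B5(2)[OF z(2)] z(4) by (simp add: hg_phi_0)
    have "cmod (hg_log \<kappa> Ln z) \<le> B3 + ?k * (B1 * L)"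
      unfolding hg_log_def using B3(2)[OF z(2)] B1(2)[OF z(2)] L B1(1)
      by (intro order_trans[OF norm_triangle_ineq4] add_mono) (auto simp: norm_mult mult.assoc intro!: mult_mono)
    also have "\<dots> \<le> (B3 + ?k * B1) * L" using grow[of B3] B3(1) by (simp add: algebra_simps)
    finally have l0: "cmod (hg_log \<kappa> Ln z) \<le> (B3 + ?k * B1) * L" .
    have "deriv (hg_log \<kappa> Ln) z = deriv (hg_reg \<kappa>) z - \<kappa> * (deriv (hg_phi \<kappa>) z * Ln z) - \<kappa> * (hg_phi \<kappa> z / z)"
      by (rule hg_log_deriv[OF open_eta_domain eta_domain_subset(1) Ln_deriv_eta_domain z(1)])
    hence "cmod (deriv (hg_log \<kappa> Ln) z) \<le> B4 + ?k * (B2 * L) + ?k * B5"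
      using B4(2)[OF z(2)] B2(2)[OF z(2)] b5 L B2(1)
      by (simp only:) (intro order_trans[OF norm_triangle_ineq4] add_mono, auto simp: norm_mult simp del: times_divide_eq_right intro!: mult_mono)
    also have "\<dots> \<le> (B4 + ?k * B2 + ?k * B5) * L" using grow[of B4] grow[of "?k * B5"] B4(1) B5(1) by (simp add: algebra_simps)
    finally have l1: "cmod (deriv (hg_log \<kappa> Ln) z) \<le> (B4 + ?k * B2 + ?k * B5) * L" .
    have b1: "cmod (hg_phi \<kappa> z) \<le> B1 * L" "cmod (deriv (hg_phi \<kappa>) z) \<le> B2 * L"
      using B1 B2 z(2) grow order_trans by blast+
    have "cmod (hg_phi \<kappa> \<eta>) \<le> ?A * ((B3 + ?k * B1) * L) + ?b * (B1 * L)"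
      unfolding z(3)[symmetric] hg_connection[OF z(1)]
      by (intro order_trans[OF norm_triangle_ineq] add_mono) (auto simp: norm_mult intro!: mult_left_mono l0 b1)
    hence f0: "cmod (hg_phi \<kappa> \<eta>) \<le> K1 * L" by (simp add: K1_def algebra_simps)
    have "cmod (deriv (hg_phi \<kappa>) \<eta>) \<le> ?A * ((B4 + ?k * B2 + ?k * B5) * L) + ?b * (B2 * L)"
      unfolding z(3)[symmetric] hg_phi_reflect_deriv(2)[OF z(1)] norm_minus_cancel
      by (intro order_trans[OF norm_triangle_ineq] add_mono) (auto simp: norm_mult intro!: mult_left_mono l1 b1)
    hence f1: "cmod (deriv (hg_phi \<kappa>) \<eta>) \<le> K2 * L" by (simp add: K2_def algebra_simps)
    have "cmod \<eta> \<le> 2" using norm_triangle_ineq4[of 1 z] z(2,3) by simp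
    hence "cmod (m - \<eta>) \<le> cmod m + 2" using norm_triangle_ineq4[of m \<eta>] by linarith
    hence "cmod (k1 * (m - \<eta>) * c + k2) \<le> M" unfolding M_def
      by (intro order_trans[OF norm_triangle_ineq] add_mono) (auto simp: norm_mult intro!: mult_mono)
    hence "cmod (hg_row \<kappa> c k1 k2 m \<eta>) \<le> cmod k1 * (K1 * L) + M * (K2 * L)"
      unfolding hg_row_def using f0 f1 nn
      by (intro order_trans[OF norm_triangle_ineq] add_mono) (auto simp: norm_mult intro!: mult_mono)
    thus "cmod (hg_row \<kappa> c k1 k2 m \<eta>) \<le> (cmod k1 * K1 + M * K2) * (1 + cmod (Ln (1 - \<eta>)))"
      unfolding z_def[symmetric] L_def[symmetric] by (simp add: algebra_simps)
  qed
qed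

lemma norm_exp_Ln_le:
  assumes "\<eta> \<noteq> 0"
  shows "cmod (exp (- \<rho> * Ln (- \<eta>))) \<le> exp (pi * \<bar>Im \<rho>\<bar>) * cmod \<eta> powr (- Re \<rho>)"
proof -
  have n: "- \<eta> \<noteq> 0" using assms by simp
  have "\<bar>Im (Ln (- \<eta>))\<bar> \<le> pi" using mpi_less_Im_Ln[OF n] Im_Ln_le_pi[OF n] by auto
  hence "\<bar>Im \<rho> * Im (Ln (- \<eta>))\<bar> \<le> \<bar>Im \<rho>\<bar> * pi" unfolding abs_mult by (intro mult_left_mono) auto
  hence "Im \<rho> * Im (Ln (- \<eta>)) \<le> pi * \<bar>Im \<rho>\<bar>" by (simp add: mult.commute)
  hence "Re (- \<rho> * Ln (- \<eta>)) \<le> pi * \<bar>Im \<rho>\<bar> + (- Re \<rho>) * ln (cmod \<eta>)" using n by simp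
  hence "exp (Re (- \<rho> * Ln (- \<eta>))) \<le> exp (pi * \<bar>Im \<rho>\<bar>) * exp ((- Re \<rho>) * ln (cmod \<eta>))"
    unfolding exp_add[symmetric] by simp
  thus ?thesis using assms by (simp add: powr_def)
qed

text \<open>With w = 1 / \<eta> the row is \<eta> to the power - \<rho> times k1 (1 + c \<rho>) F
  (w) plus w times a bounded function. For \<rho> = a the power itself has modulus of order |\<eta>|
  to the - Re a. For \<rho> = - a - 1 the first term vanishes and the factor w lowers the exponent
  Re a + 1 to Re a. Both exponents are at most b, since |Re a| \<le> b.\<close>

lemma hg_inf_row_bound:
  assumes a: "\<bar>Re a\<bar> < 1/2" "\<bar>Re a\<bar> \<le> b" and \<rho>: "2 * \<rho> \<notin> \<int>" "\<rho> = a \<or> \<rho> = - a - 1" and c: "c = 1 / (a + 1)"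
  obtains C where "\<And>\<eta>. \<eta> \<in> outer_slit0 \<Longrightarrow> 2 \<le> cmod \<eta> \<Longrightarrow>
    cmod (k1 * hg_inf \<rho> (\<lambda>z. Ln (- z)) \<eta> + (k1 * (m - \<eta>) * c + k2) * deriv (hg_inf \<rho> (\<lambda>z. Ln (- z))) \<eta>) \<le> C * cmod \<eta> powr b"
proof -
  let ?F = "hg_F \<rho>" and ?H = "hg_inf \<rho> (\<lambda>z. Ln (- z))"
  have F: "?F holomorphic_on ball 0 1" by (rule hg_F_holomorphic[OF \<rho>(1)])
  have sub: "cball 0 (1/2) \<subseteq> ball (0::complex) 1" by auto
  obtain B1 where B1: "0 \<le> B1" "\<And>w. w \<in> cball 0 (1/2) \<Longrightarrow> cmod (?F w) \<le> B1"
    using holomorphic_bounded_cball[OF F sub] by blast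
  have G: "(\<lambda>w. k1 * c * (- m * \<rho> * ?F w - m * w * deriv ?F w + deriv ?F w) + k2 * (- \<rho> * ?F w - w * deriv ?F w)) holomorphic_on ball 0 1"
    by (intro holomorphic_intros F open_ball)
  obtain B2 where B2: "0 \<le> B2" "\<And>w. w \<in> cball 0 (1/2) \<Longrightarrow>
      cmod (k1 * c * (- m * \<rho> * ?F w - m * w * deriv ?F w + deriv ?F w) + k2 * (- \<rho> * ?F w - w * deriv ?F w)) \<le> B2"
    using holomorphic_bounded_cball[OF G sub] by blast
  define D where "D = exp (pi * \<bar>Im \<rho>\<bar>)"
  have D0: "0 \<le> D" by (simp add: D_def)
  have a1: "a + 1 \<noteq> 0"
  proof
    assume "a + 1 = 0"
    hence "a = -1" by (simp add: eq_neg_iff_add_eq_0)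
    thus False using a(1) by simp
  qed
  show thesis
  proof (rule that[of "D * (cmod (k1 * (1 + c * a)) * B1 + B2)"])
    fix \<eta> assume \<eta>: "\<eta> \<in> outer_slit0" "2 \<le> cmod \<eta>"
    have n0: "\<eta> \<noteq> 0" using \<eta>(2) by auto
    define w where "w = 1 / \<eta>"
    define E where "E = exp (- \<rho> * Ln (- \<eta>))"
    have w: "w \<in> cball 0 (1/2)" "\<eta> * w = 1" "cmod w \<le> 1" using \<eta>(2) n0 by (auto simp: w_def norm_divide field_simps)
    have L0: "((\<lambda>z. Ln (- z)) has_field_derivative 1 / z) (at z)" if "z \<in> outer_slit0" for z
      using that outer_subset(7) by (intro Ln_minus_deriv) auto
    have gt: "\<And>z. z \<in> outer_slit0 \<Longrightarrow> 1 < cmod z" by (auto simp: outer_slit0_def)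
    have "deriv ?H \<eta> = exp (- \<rho> * Ln (- \<eta>)) * (- \<rho> / \<eta> * ?F (1 / \<eta>) - deriv ?F (1 / \<eta>) / \<eta>\<^sup>2)"
      by (rule hg_inf_deriv[OF \<rho>(1) open_outer(3) gt L0 \<eta>(1)])
    hence d: "deriv ?H \<eta> = E * (- \<rho> * w * ?F w - deriv ?F w * w\<^sup>2)"
      unfolding E_def w_def by (simp add: power_divide)
    have alg: "(m - \<eta>) * (- \<rho> * w * x - y * w\<^sup>2) = - m * \<rho> * w * x - m * w\<^sup>2 * y + \<rho> * (\<eta> * w) * x + (\<eta> * w) * w * y" for x y
      by (simp add: algebra_simps power2_eq_square)
    have "k1 * ?H \<eta> + (k1 * (m - \<eta>) * c + k2) * deriv ?H \<eta> =
        E * (k1 * ?F w + k1 * c * ((m - \<eta>) * (- \<rho> * w * ?F w - deriv ?F w * w\<^sup>2)) + k2 * (- \<rho> * w * ?F w - deriv ?F w * w\<^sup>2))"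
      unfolding d hg_inf_def E_def[symmetric] w_def[symmetric] by (simp add: algebra_simps)
    also have "\<dots> = E * (k1 * (1 + c * \<rho>) * ?F w + w * (k1 * c * (- m * \<rho> * ?F w - m * w * deriv ?F w + deriv ?F w) + k2 * (- \<rho> * ?F w - w * deriv ?F w)))"
      unfolding alg w(2) by (simp add: algebra_simps power2_eq_square)
    finally have eq: "k1 * ?H \<eta> + (k1 * (m - \<eta>) * c + k2) * deriv ?H \<eta> = \<dots>" .
    have bE: "cmod E \<le> D * cmod \<eta> powr (- Re \<rho>)" unfolding E_def D_def by (rule norm_exp_Ln_le[OF n0])
    let ?X = "k1 * c * (- m * \<rho> * ?F w - m * w * deriv ?F w + deriv ?F w) + k2 * (- \<rho> * ?F w - w * deriv ?F w)"
    have X: "cmod ?X \<le> B2" by (rule B2(2)[OF w(1)])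
    from \<rho>(2) show "cmod (k1 * ?H \<eta> + (k1 * (m - \<eta>) * c + k2) * deriv ?H \<eta>) \<le> D * (cmod (k1 * (1 + c * a)) * B1 + B2) * cmod \<eta> powr b"
    proof
      assume r: "\<rho> = a"
      have "cmod \<eta> powr (- Re \<rho>) \<le> cmod \<eta> powr b" using a \<eta>(2) r by (intro powr_mono) auto
      hence "cmod E \<le> D * cmod \<eta> powr b" using bE D0 mult_left_mono order_trans by blast
      moreover have "cmod (k1 * (1 + c * \<rho>) * ?F w + w * ?X) \<le> cmod (k1 * (1 + c * a)) * B1 + 1 * B2"
        unfolding r[symmetric]
      proof (intro order_trans[OF norm_triangle_ineq] add_mono)
        show "cmod (k1 * (1 + c * \<rho>) * ?F w) \<le> cmod (k1 * (1 + c * \<rho>)) * B1"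
          unfolding norm_mult[of _ "?F w"] by (intro mult_left_mono B1(2) w(1)) simp
        show "cmod (w * ?X) \<le> 1 * B2"
          unfolding norm_mult[of w] by (intro mult_mono w(3) X) simp_all
      qed
      ultimately have "cmod E * cmod (k1 * (1 + c * \<rho>) * ?F w + w * ?X) \<le> D * cmod \<eta> powr b * (cmod (k1 * (1 + c * a)) * B1 + 1 * B2)"
        using D0 by (intro mult_mono) auto
      thus ?thesis unfolding eq norm_mult[of E] by (simp add: mult_ac)
    next
      assume r: "\<rho> = - a - 1"
      \<comment> \<open>This is the origin of the constant 1 / (a + 1) in the unipotent factor of
        the formula.\<close>
      have "1 + c * \<rho> = 0" unfolding c r using a1 by (simp add: field_simps)
      hence eq': "k1 * ?H \<eta> + (k1 * (m - \<eta>) * c + k2) * deriv ?H \<eta> = E * w * ?X" unfolding eq by simp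
      have "cmod E * cmod w \<le> D * cmod \<eta> powr (Re a + 1) * (1 / cmod \<eta>)"
        using bE r by (intro mult_mono) (auto simp: w_def norm_divide D0 add.commute)
      also have "\<dots> = D * cmod \<eta> powr (Re a)" using n0 by (simp add: powr_add)
      also have "\<dots> \<le> D * cmod \<eta> powr b" using a \<eta>(2) D0 by (intro mult_left_mono powr_mono) auto
      finally have Ew: "cmod E * cmod w \<le> D * cmod \<eta> powr b" .
      have "0 \<le> cmod (k1 * (1 + c * a)) * B1" using B1(1) by simp
      hence "cmod ?X \<le> cmod (k1 * (1 + c * a)) * B1 + B2" using X by linarith
      hence "cmod E * cmod w * cmod ?X \<le> D * cmod \<eta> powr b * (cmod (k1 * (1 + c * a)) * B1 + B2)"
        using D0 by (intro mult_mono[OF Ew]) auto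
      thus ?thesis unfolding eq' norm_mult[of "E * w"] norm_mult[of E] by (simp add: mult_ac)
    qed
  qed
qed

text \<open>\<phi> (1 - \<eta>) is eliminated from the connection formulas for \<rho> = a and \<rho>
  = - a - 1. As e' = - 1 / e, both e - e' and 1 / e - 1 / e' equal q = e + 1 / e = 2 cos (\<pi> a),
  so the same coefficients represent \<phi> in both half-planes.\<close>

lemma hg_row_bound_inf:
  assumes a: "\<bar>Re a\<bar> < 1/2" "a \<noteq> 0" "\<bar>Re a\<bar> \<le> b" and \<kappa>: "\<kappa> = a * (a + 1)" and c: "c = 1 / (a + 1)"
  obtains C where "\<And>\<eta>. Im \<eta> \<noteq> 0 \<Longrightarrow> 2 \<le> cmod \<eta> \<Longrightarrow> cmod (hg_row \<kappa> c k1 k2 m \<eta>) \<le> C * cmod \<eta> powr b"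
proof -
  note r = not_half_int_strip[OF a(1,2)]
  let ?H = "hg_inf a (\<lambda>z. Ln (- z))" and ?S = "hg_inf (- a - 1) (\<lambda>z. Ln (- z))"
  define e where "e = exp (\<i> * of_real pi * a)"
  define e' where "e' = exp (\<i> * of_real pi * (- a - 1))"
  have e0: "e \<noteq> 0" by (simp add: e_def)
  have ee: "e' = - 1 / e"
  proof -
    have "\<i> * of_real pi * (- a - 1) = - (\<i> * of_real pi * a) + - (of_real pi * \<i>)" by (simp add: algebra_simps)
    hence "e' = exp (- (\<i> * of_real pi * a)) * exp (- (of_real pi * \<i>))"
      by (simp only: e'_def exp_add)
    also have "exp (- (of_real pi * \<i>)) = -1" unfolding exp_minus by simp
    finally show ?thesis by (simp add: e_def exp_minus divide_inverse)
  qed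
  have k2: "\<kappa> = (- a - 1) * ((- a - 1) + 1)" by (simp add: \<kappa> algebra_simps)
  define q where "q = e + 1 / e"
  have q0: "q \<noteq> 0"
  proof -
    have "sin (of_real pi * (2 * a)) \<noteq> 0"
    proof
      assume "sin (of_real pi * (2 * a)) = 0"
      then obtain n :: int where "of_real pi * (2 * a) = of_real (of_int n * pi)" by (auto simp: sin_eq_0)
      hence "2 * a = of_int n" by simp
      thus False using r(1) by simp
    qed
    hence "cos (of_real pi * a) \<noteq> 0"
      using sin_double[of "of_real pi * a"] by (auto simp: mult_ac)
    moreover have "q = 2 * cos (of_real pi * a)"
      unfolding cos_exp_eq by (simp add: q_def e_def exp_minus inverse_eq_divide mult.assoc)
    ultimately show ?thesis by simp
  qed
  define A where "A = 1 / (hg_c a * q)"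
  define B where "B = 1 / (hg_c (- a - 1) * q)"
  note nz = hg_c_nonzero[OF r(1)] hg_c_nonzero[OF r(2)]
  have phi: "hg_phi \<kappa> z = A * ?H z - B * ?S z" if z: "z \<in> outer_upper \<union> outer_lower" for z
  proof -
    have *: "A * (hg_c a * x) - B * (hg_c (- a - 1) * y) = (x - y) / q" for x y
      using nz q0 by (simp add: A_def B_def divide_simps)
    have n: "e * x + y - (e' * x + y) = q * x" "x / e + y - (x / e' + y) = q * x" for x y
      by (simp_all add: ee q_def algebra_simps)
    from z show ?thesis
    proof
      assume zz: "z \<in> outer_upper"
      show ?thesis unfolding hg_inf_half_planes(1)[OF r(1) e_def \<kappa> zz] hg_inf_half_planes(1)[OF r(2) e'_def k2 zz] * n
        using q0 by simp
    next
      assume zz: "z \<in> outer_lower"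
      show ?thesis unfolding hg_inf_half_planes(2)[OF r(1) e_def \<kappa> zz] hg_inf_half_planes(2)[OF r(2) e'_def k2 zz] * n
        using q0 by simp
    qed
  qed
  have L0: "((\<lambda>z. Ln (- z)) has_field_derivative 1 / z) (at z)" if "z \<in> outer_slit0" for z
    using that outer_subset(7) by (intro Ln_minus_deriv) auto
  have gt: "\<And>z. z \<in> outer_slit0 \<Longrightarrow> 1 < cmod z" by (auto simp: outer_slit0_def)
  have op: "open (outer_upper \<union> outer_lower)" using open_outer by auto
  have row: "hg_row \<kappa> c k1 k2 m \<eta> = A * (k1 * ?H \<eta> + (k1 * (m - \<eta>) * c + k2) * deriv ?H \<eta>)
      - B * (k1 * ?S \<eta> + (k1 * (m - \<eta>) * c + k2) * deriv ?S \<eta>)" if z: "\<eta> \<in> outer_upper \<union> outer_lower" for \<eta>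
  proof -
    have os: "\<eta> \<in> outer_slit0" using z outer_subset by auto
    have "((\<lambda>z. A * ?H z - B * ?S z) has_field_derivative A * deriv ?H \<eta> - B * deriv ?S \<eta>) (at \<eta>)"
      by (intro DERIV_diff DERIV_cmult hg_odeD(1)[OF hg_inf_ode[OF r(1) open_outer(3) gt L0] open_outer(3) os]
           hg_odeD(1)[OF hg_inf_ode[OF r(2) open_outer(3) gt L0] open_outer(3) os])
    hence "(hg_phi \<kappa> has_field_derivative A * deriv ?H \<eta> - B * deriv ?S \<eta>) (at \<eta>)"
      by (rule has_field_derivative_transform_within_open[OF _ op z]) (simp add: phi)
    hence d: "deriv (hg_phi \<kappa>) \<eta> = A * deriv ?H \<eta> - B * deriv ?S \<eta>" by (rule DERIV_imp_deriv)
    show ?thesis unfolding hg_row_def phi[OF z] d by (simp add: algebra_simps)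
  qed
  obtain C1 where C1: "\<And>\<eta>. \<eta> \<in> outer_slit0 \<Longrightarrow> 2 \<le> cmod \<eta> \<Longrightarrow>
    cmod (k1 * ?H \<eta> + (k1 * (m - \<eta>) * c + k2) * deriv ?H \<eta>) \<le> C1 * cmod \<eta> powr b"
    using hg_inf_row_bound[OF a(1,3) r(1) _ c] by blast
  obtain C2 where C2: "\<And>\<eta>. \<eta> \<in> outer_slit0 \<Longrightarrow> 2 \<le> cmod \<eta> \<Longrightarrow>
    cmod (k1 * ?S \<eta> + (k1 * (m - \<eta>) * c + k2) * deriv ?S \<eta>) \<le> C2 * cmod \<eta> powr b"
    using hg_inf_row_bound[OF a(1,3) r(2) _ c] by blast
  show thesis
  proof (rule that[of "cmod A * C1 + cmod B * C2"])
    fix \<eta> assume \<eta>: "Im \<eta> \<noteq> 0" "2 \<le> cmod \<eta>"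
    hence z: "\<eta> \<in> outer_upper \<union> outer_lower" by (auto simp: outer_upper_def outer_lower_def)
    hence os: "\<eta> \<in> outer_slit0" using outer_subset by auto
    have "cmod (hg_row \<kappa> c k1 k2 m \<eta>) \<le> cmod A * (C1 * cmod \<eta> powr b) + cmod B * (C2 * cmod \<eta> powr b)"
      unfolding row[OF z] using C1[OF os \<eta>(2)] C2[OF os \<eta>(2)]
      by (intro order_trans[OF norm_triangle_ineq4] add_mono) (auto simp: norm_mult intro!: mult_left_mono)
    thus "cmod (hg_row \<kappa> c k1 k2 m \<eta>) \<le> (cmod A * C1 + cmod B * C2) * cmod \<eta> powr b"
      by (simp add: algebra_simps)
  qed
qed

section \<open>The Moebius transformation \<open>M1\<close>\<close>

lemma real_seg_iff: "z \<in> real_seg a b \<longleftrightarrow> Im z = 0 \<and> a \<le> Re z \<and> Re z \<le> b"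
  by (auto simp: real_seg_def image_iff complex_eq_iff)

lemma closed_real_seg: "closed (real_seg a b)"
  unfolding real_seg_def by (rule closed_of_real_image) simp

definition row1 :: "real \<Rightarrow> real \<Rightarrow> complex \<Rightarrow> complex \<Rightarrow> complex \<Rightarrow> complex \<Rightarrow> complex \<Rightarrow> complex" where
  "row1 bL bR \<kappa> c k1 k2 z = hg_row \<kappa> c k1 k2 (M1_infinity bL bR) (M1 bL bR z)"

text \<open>The second column of \<open>hg_mat\<close> consists of - \<phi> (1 - \<eta>) and \<phi>'
  (1 - \<eta>). In terms of \<eta>' = 1 - \<eta> the corresponding entry is minus a row of the first
  kind, with k2 and m replaced by - k2 and 1 - m.\<close>

definition row2 :: "real \<Rightarrow> real \<Rightarrow> complex \<Rightarrow> complex \<Rightarrow> complex \<Rightarrow> complex \<Rightarrow> complex \<Rightarrow> complex" where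
  "row2 bL bR \<kappa> c k1 k2 z = - hg_row \<kappa> c k1 (- k2) (1 - M1_infinity bL bR) (1 - M1 bL bR z)"

text \<open>The upper half of the \<open>z\<close>-plane corresponds to the lower half of the \<open>\<eta>\<close>-plane; \<open>s\<close> is the sign
  of the side from which the cut is approached.\<close>

definition bval1 :: "real \<Rightarrow> real \<Rightarrow> complex \<Rightarrow> complex \<Rightarrow> complex \<Rightarrow> complex \<Rightarrow> complex \<Rightarrow> real \<Rightarrow> real \<Rightarrow> complex" where
  "bval1 bL bR \<kappa> a c k1 k2 s x = (if x < 0 then row1 bL bR \<kappa> c k1 k2 (of_real x)
     else hg_row_cut \<kappa> c k1 k2 (M1_infinity bL bR) (M1 bL bR (of_real x)) +
       of_real s * \<i> * sin (of_real pi * a) * row2 bL bR \<kappa> c k1 k2 (of_real x))"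

definition bval2 :: "real \<Rightarrow> real \<Rightarrow> complex \<Rightarrow> complex \<Rightarrow> complex \<Rightarrow> complex \<Rightarrow> complex \<Rightarrow> real \<Rightarrow> real \<Rightarrow> complex" where
  "bval2 bL bR \<kappa> a c k1 k2 s x = (if x < 0
     then - hg_row_cut \<kappa> c k1 (- k2) (1 - M1_infinity bL bR) (1 - M1 bL bR (of_real x))
       - of_real s * \<i> * sin (of_real pi * a) * row1 bL bR \<kappa> c k1 k2 (of_real x)
     else row2 bL bR \<kappa> c k1 k2 (of_real x))"

context
  fixes bL bR :: real
  assumes bL: "bL < 0" and bR: "0 < bR"
begin

lemma M1_infinity_eta: "M1_infinity bL bR \<in> eta_domain"
  using bL bR by (auto simp: M1_infinity_def eta_domain_iff field_simps)

lemma zero_in_seg: "z \<in> - real_seg bL bR \<Longrightarrow> z \<noteq> 0"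
  using bL bR by (auto simp: real_seg_iff)

lemma M1_altdef: "z \<noteq> 0 \<Longrightarrow> M1 bL bR z = M1_infinity bL bR - M1_infinity bL bR * of_real bL * (1 / z)"
  using bL bR by (simp add: M1_def M1_infinity_def divide_simps) (simp add: algebra_simps)

lemma one_minus_M1: "z \<noteq> 0 \<Longrightarrow> 1 - M1 bL bR z = - of_real bL * (z - of_real bR) / (z * of_real (bR - bL))"
  using bL bR by (simp add: M1_def divide_simps) (simp add: algebra_simps)

lemma Im_M1: "z \<noteq> 0 \<Longrightarrow> Im (M1 bL bR z) = (bR * bL / (bR - bL)) * Im z / (cmod z)\<^sup>2"
proof -
  assume "z \<noteq> 0"
  hence eq: "M1 bL bR z = of_real (bR / (bR - bL)) - of_real (bR / (bR - bL) * bL) * (1 / z)"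
    by (simp add: M1_altdef M1_infinity_def)
  have "Im (M1 bL bR z) = - (bR / (bR - bL) * bL) * Im (1 / z)"
  proof -
    have *: "Im (of_real k * w) = k * Im w" for k w by simp
    show ?thesis unfolding eq by (simp only: minus_complex.simps Im_complex_of_real *) simp
  qed
  also have "Im (1 / z) = - Im z / (cmod z)\<^sup>2" by (simp add: Im_divide cmod_power2)
  finally show ?thesis by simp
qed

lemma Im_M1_sign: "0 < Im z \<Longrightarrow> Im (M1 bL bR z) < 0" "Im z < 0 \<Longrightarrow> 0 < Im (M1 bL bR z)"
proof -
  have c: "bR * bL / (bR - bL) < 0" using bL bR by (simp add: divide_neg_pos mult_pos_neg)
  show "Im (M1 bL bR z) < 0" if "0 < Im z"
  proof -
    have z: "z \<noteq> 0" using that by auto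
    have "bR * bL / (bR - bL) * Im z < 0" using c that by (rule mult_neg_pos)
    thus ?thesis unfolding Im_M1[OF z] using z by (intro divide_neg_pos) auto
  qed
  show "0 < Im (M1 bL bR z)" if "Im z < 0"
  proof -
    have z: "z \<noteq> 0" using that by auto
    have "0 < bR * bL / (bR - bL) * Im z" using c that by (rule mult_neg_neg)
    thus ?thesis unfolding Im_M1[OF z] using z by (intro divide_pos_pos) auto
  qed
qed

lemma M1_of_real: "M1 bL bR (of_real x) = of_real (bR * (x - bL) / (x * (bR - bL)))"
  by (simp add: M1_def)

lemma M1_real_neg: "x \<in> {bL<..<0} \<Longrightarrow> Re (M1 bL bR (of_real x)) < 0"
  using bL bR unfolding M1_of_real by (auto intro!: divide_pos_neg mult_pos_pos mult_neg_pos)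

lemma M1_real_gt1:
  assumes "x \<in> {0<..<bR}" shows "1 < Re (M1 bL bR (of_real x))"
proof -
  have "x * (bR - bL) < bR * (x - bL)" using assms bL bR by (simp add: algebra_simps mult_less_cancel_right)
  thus ?thesis unfolding M1_of_real using assms bL bR by simp
qed

lemma Im_M1_of_real [simp]: "Im (M1 bL bR (of_real x)) = 0"
  unfolding M1_of_real by simp

lemma M1_eta:
  assumes "z \<in> - real_seg bL bR"
  shows "M1 bL bR z \<in> eta_domain"
proof (cases "Im z = 0")
  case False
  thus ?thesis using Im_M1_sign[of z] by (cases "0 < Im z") (auto simp: eta_domain_iff)
next
  case True
  define x where "x = Re z"
  have z: "z = of_real x" using True by (simp add: x_def complex_eq_iff)
  have x: "x < bL \<or> bR < x" using assms True by (auto simp: real_seg_iff x_def)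
  have x0: "x \<noteq> 0" using x bL bR by linarith
  define t where "t = bR * (x - bL) / (x * (bR - bL))"
  have "0 < t \<and> t < 1"
  proof -
    have d: "1 - t = - bL * (x - bR) / (x * (bR - bL))"
      using x0 bL bR by (simp add: t_def divide_simps) (simp add: algebra_simps)
    show ?thesis using x
    proof
      assume x: "x < bL"
      have "0 < t" unfolding t_def using x bL bR by (intro divide_neg_neg mult_pos_neg mult_neg_pos) auto
      moreover have "0 < 1 - t" unfolding d using x bL bR by (intro divide_neg_neg mult_pos_neg mult_neg_pos) auto
      ultimately show ?thesis by simp
    next
      assume x: "bR < x"
      have "0 < t" unfolding t_def using x bL bR by (intro divide_pos_pos mult_pos_pos) auto
      moreover have "0 < 1 - t" unfolding d using x bL bR by (intro divide_pos_pos mult_pos_pos) auto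
      ultimately show ?thesis by simp
    qed
  qed
  thus ?thesis unfolding z M1_of_real t_def[symmetric] by (simp add: eta_domain_iff)
qed

lemma M1_holomorphic: "M1 bL bR holomorphic_on - {0}"
proof -
  have "(\<lambda>z. M1_infinity bL bR - M1_infinity bL bR * of_real bL * (1 / z)) holomorphic_on - {0}"
    by (intro holomorphic_intros) auto
  thus ?thesis by (rule holomorphic_transform) (simp add: M1_altdef)
qed

lemma M1_isCont: "z \<noteq> 0 \<Longrightarrow> isCont (M1 bL bR) z"
  using holomorphic_on_imp_continuous_on[OF M1_holomorphic]
    continuous_on_eq_continuous_at[OF open_Compl[OF closed_singleton], of 0 "M1 bL bR"] by simp

lemma M1_bL: "M1 bL bR (of_real bL) = 0" and M1_bR: "M1 bL bR (of_real bR) = 1"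
  using bL bR by (simp_all add: M1_def)

lemma row_plane1: "z \<in> - real_seg bL bR \<Longrightarrow> M1 bL bR z \<in> plane1 \<and> 1 - M1 bL bR z \<in> plane1"
  using M1_eta[of z] by (auto simp: eta_domain_iff plane1_iff)

lemma row_holomorphic:
  "row1 bL bR \<kappa> c k1 k2 holomorphic_on - real_seg bL bR" "row2 bL bR \<kappa> c k1 k2 holomorphic_on - real_seg bL bR"
proof -
  have M: "M1 bL bR holomorphic_on - real_seg bL bR"
    by (rule holomorphic_on_subset[OF M1_holomorphic]) (use zero_in_seg in auto)
  have M': "(\<lambda>z. 1 - M1 bL bR z) holomorphic_on - real_seg bL bR" by (intro holomorphic_intros M)
  have "(hg_row \<kappa> c k1 k2 (M1_infinity bL bR) \<circ> M1 bL bR) holomorphic_on - real_seg bL bR"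
    by (rule holomorphic_on_compose_gen[OF M hg_row_holomorphic]) (use row_plane1 in auto)
  thus "row1 bL bR \<kappa> c k1 k2 holomorphic_on - real_seg bL bR" by (simp add: o_def row1_def[abs_def])
  have "(hg_row \<kappa> c k1 (- k2) (1 - M1_infinity bL bR) \<circ> (\<lambda>z. 1 - M1 bL bR z)) holomorphic_on - real_seg bL bR"
    by (rule holomorphic_on_compose_gen[OF M' hg_row_holomorphic]) (use row_plane1 in auto)
  thus "row2 bL bR \<kappa> c k1 k2 holomorphic_on - real_seg bL bR"
    unfolding row2_def[abs_def] o_def by (intro holomorphic_intros)
qed

lemma M1_at_infinity:
  assumes f: "f holomorphic_on plane1"
  shows "\<exists>g. g analytic_on {0} \<and> g 0 = f (M1_infinity bL bR) \<and> (\<forall>\<^sub>F z in at_infinity. f (M1 bL bR z) = g (1 / z))"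
    and "\<exists>g. g analytic_on {0} \<and> g 0 = f (1 - M1_infinity bL bR) \<and> (\<forall>\<^sub>F z in at_infinity. f (1 - M1 bL bR z) = g (1 / z))"
proof -
  let ?m = "M1_infinity bL bR"
  \<comment> \<open>\<open>M1\<close> is affine in u = 1 / z and sends u = 0 to a point of the open
    set \<open>eta_domain\<close>, so analyticity at infinity is inherited from f.\<close>
  define l where "l u = ?m - ?m * of_real bL * u" for u
  define S where "S = {u. l u \<in> eta_domain}"
  have l: "l holomorphic_on UNIV" unfolding l_def[abs_def] by (intro holomorphic_intros)
  have S: "open S" unfolding S_def
    using open_vimage[OF open_eta_domain, of l] holomorphic_on_imp_continuous_on[OF l] by (simp add: vimage_def)
  have S0: "0 \<in> S" using M1_infinity_eta by (simp add: S_def l_def)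
  have p: "l u \<in> plane1" "1 - l u \<in> plane1" if "u \<in> S" for u using that by (auto simp: S_def eta_domain_iff plane1_iff)
  have lS: "l holomorphic_on S" by (rule holomorphic_on_subset[OF l]) simp
  hence lS': "(\<lambda>u. 1 - l u) holomorphic_on S" by (intro holomorphic_intros)
  have ev: "\<forall>\<^sub>F z in at_infinity. M1 bL bR z = l (1 / z)"
    using eventually_not_equal_at_infinity[of 0] by eventually_elim (simp add: M1_altdef l_def)
  have "(f \<circ> l) holomorphic_on S" "(f \<circ> (\<lambda>u. 1 - l u)) holomorphic_on S"
    by (rule holomorphic_on_compose_gen[OF lS f] holomorphic_on_compose_gen[OF lS' f]; use p in auto)+
  hence a: "(\<lambda>u. f (l u)) analytic_on {0}" "(\<lambda>u. f (1 - l u)) analytic_on {0}"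
    unfolding analytic_at o_def using S S0 by auto
  show "\<exists>g. g analytic_on {0} \<and> g 0 = f ?m \<and> (\<forall>\<^sub>F z in at_infinity. f (M1 bL bR z) = g (1 / z))"
    by (intro exI[of _ "\<lambda>u. f (l u)"] conjI a eventually_mono[OF ev]) (simp_all add: l_def)
  show "\<exists>g. g analytic_on {0} \<and> g 0 = f (1 - ?m) \<and> (\<forall>\<^sub>F z in at_infinity. f (1 - M1 bL bR z) = g (1 / z))"
    by (intro exI[of _ "\<lambda>u. f (1 - l u)"] conjI a eventually_mono[OF ev]) (simp_all add: l_def)
qed

text \<open>For x < 0 the image \<eta> is negative and \<open>row1\<close> is continuous there; for
  x > 0 it is greater than 1 and \<open>row2\<close> is continuous. The other entry follows from
  \<open>hg_row_jump\<close>, whose right-hand side extends continuously to the cut.\<close>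

lemma row_limits:
  assumes \<kappa>: "\<kappa> = a * (a + 1)" and s: "s = 1 \<or> s = -1" and x: "x \<in> {bL<..<0} \<union> {0<..<bR}"
  shows "(row1 bL bR \<kappa> c k1 k2 \<longlongrightarrow> bval1 bL bR \<kappa> a c k1 k2 s x) (at (of_real x) within {z. 0 < s * Im z})"
    and "(row2 bL bR \<kappa> c k1 k2 \<longlongrightarrow> bval2 bL bR \<kappa> a c k1 k2 s x) (at (of_real x) within {z. 0 < s * Im z})"
proof -
  let ?m = "M1_infinity bL bR" and ?z = "complex_of_real x" and ?F = "at (complex_of_real x) within {z. 0 < s * Im z}"
  let ?\<eta> = "M1 bL bR ?z"
  define \<sigma> where "\<sigma> = \<i> * sin (of_real pi * a)"
  note jump = hg_row_jump[OF \<kappa>, folded \<sigma>_def]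
  have z0: "?z \<noteq> 0" using x by auto
  have M: "isCont (M1 bL bR) ?z" "isCont (\<lambda>z. 1 - M1 bL bR z) ?z"
    using M1_isCont[OF z0] by (auto intro!: continuous_intros)
  have ev: "eventually (\<lambda>z. 0 < s * Im z) ?F" by (auto simp: eventually_at_filter)
  have lim: "isCont f ?z \<Longrightarrow> (f \<longlongrightarrow> f ?z) ?F" for f :: "complex \<Rightarrow> complex"
    unfolding isCont_def by (rule tendsto_within_subset) auto
  have comp: "(\<lambda>z. f (M1 bL bR z)) \<midarrow>?z\<rightarrow> f ?\<eta>" if "isCont f ?\<eta>" for f :: "complex \<Rightarrow> complex"
    using isCont_o2[OF M(1) that] by (simp add: isCont_def)
  have c1: "isCont (\<lambda>z. f (M1 bL bR z)) ?z" if "isCont f ?\<eta>" for f :: "complex \<Rightarrow> complex"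
    using isCont_o2[OF M(1) that] .
  have c2: "isCont (\<lambda>z. f (1 - M1 bL bR z)) ?z" if "isCont f (1 - ?\<eta>)" for f :: "complex \<Rightarrow> complex"
    using isCont_o2[OF M(2) that] .
  have j1: "row1 bL bR \<kappa> c k1 k2 z = hg_row_cut \<kappa> c k1 k2 ?m (M1 bL bR z) + of_real s * \<sigma> * row2 bL bR \<kappa> c k1 k2 z"
    if "0 < s * Im z" for z
    using s that jump[of "M1 bL bR z" c k1 k2 ?m] Im_M1_sign[of z] by (auto simp: row1_def row2_def)
  have j2: "row2 bL bR \<kappa> c k1 k2 z = - hg_row_cut \<kappa> c k1 (- k2) (1 - ?m) (1 - M1 bL bR z) - of_real s * \<sigma> * row1 bL bR \<kappa> c k1 k2 z"
    if "0 < s * Im z" for z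
    using s that jump[of "1 - M1 bL bR z" c k1 "- k2" "1 - ?m"] Im_M1_sign[of z] by (auto simp: row1_def row2_def)
  have "((row1 bL bR \<kappa> c k1 k2 \<longlongrightarrow> bval1 bL bR \<kappa> a c k1 k2 s x) ?F) \<and> ((row2 bL bR \<kappa> c k1 k2 \<longlongrightarrow> bval2 bL bR \<kappa> a c k1 k2 s x) ?F)"
  proof (cases "x < 0")
    case True
    hence e: "Re ?\<eta> < 0" using x M1_real_neg[of x] by auto
    have r1: "(row1 bL bR \<kappa> c k1 k2 \<longlongrightarrow> row1 bL bR \<kappa> c k1 k2 ?z) ?F"
      unfolding row1_def[abs_def] by (intro lim c1 hg_row_isCont) (use e in \<open>auto simp: plane1_iff\<close>)
    have "((\<lambda>z. - hg_row_cut \<kappa> c k1 (- k2) (1 - ?m) (1 - M1 bL bR z)) \<longlongrightarrow> - hg_row_cut \<kappa> c k1 (- k2) (1 - ?m) (1 - ?\<eta>)) ?F"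
      by (intro tendsto_minus lim[of "\<lambda>z. hg_row_cut \<kappa> c k1 (- k2) (1 - ?m) (1 - M1 bL bR z)"] c2 hg_row_cut_isCont)
         (use e in \<open>auto simp: plane0_iff\<close>)
    hence "((\<lambda>z. - hg_row_cut \<kappa> c k1 (- k2) (1 - ?m) (1 - M1 bL bR z) - of_real s * \<sigma> * row1 bL bR \<kappa> c k1 k2 z) \<longlongrightarrow>
        bval2 bL bR \<kappa> a c k1 k2 s x) ?F"
      using True r1 unfolding bval2_def \<sigma>_def mult.assoc[symmetric] by (auto intro!: tendsto_intros)
    hence "(row2 bL bR \<kappa> c k1 k2 \<longlongrightarrow> bval2 bL bR \<kappa> a c k1 k2 s x) ?F"
      by (rule Lim_transform_eventually) (rule eventually_mono[OF ev], simp add: j2)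
    with r1 True show ?thesis by (simp add: bval1_def)
  next
    case False
    hence e: "1 < Re ?\<eta>" using x M1_real_gt1[of x] by auto
    have "((\<lambda>z. hg_row \<kappa> c k1 (- k2) (1 - ?m) (1 - M1 bL bR z)) \<longlongrightarrow> hg_row \<kappa> c k1 (- k2) (1 - ?m) (1 - ?\<eta>)) ?F"
      by (intro lim[of "\<lambda>z. hg_row \<kappa> c k1 (- k2) (1 - ?m) (1 - M1 bL bR z)"] c2 hg_row_isCont)
         (use e in \<open>auto simp: plane1_iff\<close>)
    hence r2: "(row2 bL bR \<kappa> c k1 k2 \<longlongrightarrow> row2 bL bR \<kappa> c k1 k2 ?z) ?F"
      unfolding row2_def[abs_def] by (rule tendsto_minus)
    have "((\<lambda>z. hg_row_cut \<kappa> c k1 k2 ?m (M1 bL bR z)) \<longlongrightarrow> hg_row_cut \<kappa> c k1 k2 ?m ?\<eta>) ?F"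
      by (intro lim[of "\<lambda>z. hg_row_cut \<kappa> c k1 k2 ?m (M1 bL bR z)"] c1 hg_row_cut_isCont)
         (use e in \<open>auto simp: plane0_iff\<close>)
    hence "((\<lambda>z. hg_row_cut \<kappa> c k1 k2 ?m (M1 bL bR z) + of_real s * \<sigma> * row2 bL bR \<kappa> c k1 k2 z) \<longlongrightarrow>
        bval1 bL bR \<kappa> a c k1 k2 s x) ?F"
      using False r2 unfolding bval1_def \<sigma>_def mult.assoc[symmetric] by (auto intro!: tendsto_intros)
    hence "(row1 bL bR \<kappa> c k1 k2 \<longlongrightarrow> bval1 bL bR \<kappa> a c k1 k2 s x) ?F"
      by (rule Lim_transform_eventually) (rule eventually_mono[OF ev], simp add: j1)
    with r2 False show ?thesis by (simp add: bval2_def)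
  qed
  thus "(row1 bL bR \<kappa> c k1 k2 \<longlongrightarrow> bval1 bL bR \<kappa> a c k1 k2 s x) ?F" "(row2 bL bR \<kappa> c k1 k2 \<longlongrightarrow> bval2 bL bR \<kappa> a c k1 k2 s x) ?F" by auto
qed

lemma bval_jump:
  "x < 0 \<Longrightarrow> bval1 bL bR \<kappa> a c k1 k2 1 x = bval1 bL bR \<kappa> a c k1 k2 (-1) x"
  "x < 0 \<Longrightarrow> bval2 bL bR \<kappa> a c k1 k2 1 x = bval1 bL bR \<kappa> a c k1 k2 (-1) x * (- \<i> * (2 * sin (of_real pi * a))) + bval2 bL bR \<kappa> a c k1 k2 (-1) x"
  "0 < x \<Longrightarrow> bval1 bL bR \<kappa> a c k1 k2 1 x = bval1 bL bR \<kappa> a c k1 k2 (-1) x + bval2 bL bR \<kappa> a c k1 k2 (-1) x * (\<i> * (2 * sin (of_real pi * a)))"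
  "0 < x \<Longrightarrow> bval2 bL bR \<kappa> a c k1 k2 1 x = bval2 bL bR \<kappa> a c k1 k2 (-1) x"
  by (simp_all add: bval1_def bval2_def algebra_simps)

end

subsection \<open>Growth at the nodes\<close>

text \<open>At the end points \<open>M1\<close> and 1 - \<open>M1\<close> have the form (z - c) q
  (z) with q (c) nonzero. The radius is at most exp (-1), so that |ln |z - c|| \<ge> 1 absorbs all
  constants, including the bounded argument of the logarithm.\<close>

lemma log_factor_bound:
  fixes q :: "complex \<Rightarrow> complex"
  assumes q: "isCont q c" "q c \<noteq> 0"
  obtains d K where "0 < d" "0 \<le> K"
    "\<And>z. z \<noteq> c \<Longrightarrow> cmod (z - c) < d \<Longrightarrow> 1 + cmod (Ln ((z - c) * q z)) \<le> K * \<bar>ln (cmod (z - c))\<bar>"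
    "\<And>z. z \<noteq> c \<Longrightarrow> cmod (z - c) < d \<Longrightarrow> 1 \<le> \<bar>ln (cmod (z - c))\<bar> \<and> cmod (z - c) < 1"
proof -
  define r where "r = cmod (q c)"
  have r: "0 < r" using q(2) by (simp add: r_def)
  have "eventually (\<lambda>z. dist (q z) (q c) < r / 2) (at c)"
    using q(1) r by (intro tendstoD) (auto simp: isCont_def)
  then obtain d0 where d0: "0 < d0" "\<And>z. z \<noteq> c \<Longrightarrow> dist z c < d0 \<Longrightarrow> dist (q z) (q c) < r / 2"
    by (auto simp: eventually_at)
  define M where "M = \<bar>ln (r / 2)\<bar> + \<bar>ln (2 * r)\<bar>"
  have near: "1 \<le> \<bar>ln (cmod (z - c))\<bar> \<and> cmod (z - c) < 1" if z: "z \<noteq> c" "cmod (z - c) < min d0 (exp (-1))" for z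
  proof -
    have "ln (cmod (z - c)) \<le> ln (exp (-1))" using z by (subst ln_le_cancel_iff) auto
    moreover have "cmod (z - c) < exp (-1)" using z(2) by simp
    hence "cmod (z - c) < 1" by (rule less_trans) simp
    ultimately show ?thesis by auto
  qed
  show thesis
  proof (rule that[of "min d0 (exp (-1))" "2 + M + pi"])
    fix z assume z: "z \<noteq> c" "cmod (z - c) < min d0 (exp (-1))"
    have qz: "dist (q z) (q c) < r / 2" using d0(2) z by (simp add: dist_norm)
    have "cmod (q z) \<le> cmod (q c) + cmod (q z - q c)" by (rule norm_triangle_sub)
    moreover have "cmod (q c) \<le> cmod (q z) + cmod (q z - q c)" using norm_triangle_sub[of "q c" "q z"] by (simp add: norm_minus_commute)
    ultimately have qb: "r / 2 < cmod (q z)" "cmod (q z) < 2 * r" using qz r by (auto simp: dist_norm r_def)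
    have pos: "0 < cmod (q z)" using qb r by linarith
    have "ln (r / 2) \<le> ln (cmod (q z))" "ln (cmod (q z)) \<le> ln (2 * r)"
      by (subst ln_le_cancel_iff, use qb r pos in auto)+
    hence lq: "\<bar>ln (cmod (q z))\<bar> \<le> M" unfolding M_def by linarith
    have nz: "(z - c) * q z \<noteq> 0" using z qb r by auto
    let ?w = "(z - c) * q z"
    have "cmod (Ln ?w) \<le> \<bar>Re (Ln ?w)\<bar> + \<bar>Im (Ln ?w)\<bar>" by (rule cmod_le)
    also have "\<bar>Im (Ln ?w)\<bar> \<le> pi" using mpi_less_Im_Ln[OF nz] Im_Ln_le_pi[OF nz] by auto
    also have "\<bar>Re (Ln ?w)\<bar> = \<bar>ln (cmod (z - c)) + ln (cmod (q z))\<bar>"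
      using nz by (simp add: norm_mult ln_mult)
    also have "\<dots> \<le> \<bar>ln (cmod (z - c))\<bar> + M" using lq by linarith
    finally have "1 + cmod (Ln ?w) \<le> \<bar>ln (cmod (z - c))\<bar> + (1 + M + pi) * 1" by simp
    also have "\<dots> \<le> \<bar>ln (cmod (z - c))\<bar> + (1 + M + pi) * \<bar>ln (cmod (z - c))\<bar>"
      using near[OF z] by (intro add_left_mono mult_left_mono) (auto simp: M_def)
    finally show "1 + cmod (Ln ?w) \<le> (2 + M + pi) * \<bar>ln (cmod (z - c))\<bar>" by (simp add: algebra_simps)
  next
    show "\<And>z. z \<noteq> c \<Longrightarrow> cmod (z - c) < min d0 (exp (-1)) \<Longrightarrow> 1 \<le> \<bar>ln (cmod (z - c))\<bar> \<and> cmod (z - c) < 1"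
      by (rule near)
  qed (use d0 in \<open>auto simp: M_def\<close>)
qed

lemma abs_ln_le_powr:
  fixes r b :: real
  assumes "0 < r" "r < 1" "0 < b"
  shows "\<bar>ln r\<bar> \<le> r powr (- b) / b"
proof -
  have "ln (1 / r) \<le> (1 / r) powr b / b" using assms by (intro ln_powr_bound) auto
  thus ?thesis using assms by (simp add: ln_div powr_divide powr_minus_divide)
qed

lemma isCont_bounded_near:
  fixes f :: "complex \<Rightarrow> complex"
  assumes "isCont f x" "isCont g c" "g c = x"
  obtains d C where "0 < d" "0 \<le> C" "\<And>z. cmod (z - c) < d \<Longrightarrow> cmod (f (g z)) \<le> C"
proof -
  have "isCont (\<lambda>z. f (g z)) c" using isCont_o2[OF assms(2)] assms by simp
  then obtain d where d: "0 < d" "\<And>z. dist z c < d \<Longrightarrow> dist (f (g z)) (f (g c)) < 1"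
    unfolding continuous_at_eps_delta by (metis zero_less_one)
  have "cmod (f (g z)) \<le> cmod (f (g c)) + 1" if "cmod (z - c) < d" for z
    using d(2)[of z] that norm_triangle_sub[of "f (g z)" "f (g c)"] by (auto simp: dist_norm)
  thus thesis using d(1) by (intro that[of d "cmod (f (g c)) + 1"]) auto
qed

context
  fixes bL bR :: real
  assumes bL: "bL < 0" and bR: "0 < bR"
begin

text \<open>\<open>M1\<close> has a simple zero at bL: \<open>row1\<close> is a row taken near 0,
  where \<phi> is regular, while \<open>row2\<close> is taken near 1, where
  \<open>hg_row_bound_1\<close> applies. By the last conclusion a bounded entry is also bounded by a
  multiple of the logarithm.\<close>

lemma row_bounds_bL:
  obtains d C where "0 < d" "0 \<le> C"
    "\<And>z. z \<in> - real_seg bL bR \<Longrightarrow> cmod (z - of_real bL) < d \<Longrightarrow> cmod (row1 bL bR \<kappa> c k1 k2 z) \<le> C"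
    "\<And>z. z \<in> - real_seg bL bR \<Longrightarrow> cmod (z - of_real bL) < d \<Longrightarrow>
       cmod (row2 bL bR \<kappa> c k1 k2 z) \<le> C * \<bar>ln (cmod (z - of_real bL))\<bar>"
    "\<And>z. z \<in> - real_seg bL bR \<Longrightarrow> cmod (z - of_real bL) < d \<Longrightarrow>
       1 \<le> \<bar>ln (cmod (z - of_real bL))\<bar> \<and> cmod (z - of_real bL) < 1"
proof -
  let ?M = "M1 bL bR" and ?b = "complex_of_real bL"
  have b0: "?b \<noteq> 0" using bL by simp
  note M1b = M1_bL[OF bL bR] and Mc = M1_isCont[OF bL bR b0]
  have p: "(0::complex) \<in> plane1" by (auto simp: plane1_iff)
  obtain d1 C1 where 1: "0 < d1" "0 \<le> C1"
    "\<And>z. cmod (z - ?b) < d1 \<Longrightarrow> cmod (hg_row \<kappa> c k1 k2 (M1_infinity bL bR) (?M z)) \<le> C1"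
    using isCont_bounded_near[OF hg_row_isCont[OF p] Mc M1b] by blast
  obtain C2 where C2: "0 \<le> C2" "\<And>\<eta>. \<eta> \<in> eta_domain \<Longrightarrow> cmod (1 - \<eta>) \<le> 1/2 \<Longrightarrow>
      cmod (hg_row \<kappa> c k1 (- k2) (1 - M1_infinity bL bR) \<eta>) \<le> C2 * (1 + cmod (Ln (1 - \<eta>)))"
    using hg_row_bound_1 by blast
  define q where "q z = of_real bR / (z * of_real (bR - bL))" for z :: complex
  have q: "isCont q ?b" "q ?b \<noteq> 0" unfolding q_def[abs_def] using bL bR by (auto intro!: continuous_intros)
  have Mq: "?M z = (z - ?b) * q z" for z by (simp add: M1_def q_def)
  obtain d3 K where 3: "0 < d3" "0 \<le> K"
    "\<And>z. z \<noteq> ?b \<Longrightarrow> cmod (z - ?b) < d3 \<Longrightarrow> 1 + cmod (Ln ((z - ?b) * q z)) \<le> K * \<bar>ln (cmod (z - ?b))\<bar>"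
    "\<And>z. z \<noteq> ?b \<Longrightarrow> cmod (z - ?b) < d3 \<Longrightarrow> 1 \<le> \<bar>ln (cmod (z - ?b))\<bar> \<and> cmod (z - ?b) < 1"
    using log_factor_bound[OF q] by blast
  have "eventually (\<lambda>z. dist (?M z) (?M ?b) < 1/2) (at ?b)"
    using Mc by (intro tendstoD) (auto simp: isCont_def)
  then obtain d4 where 4: "0 < d4" "\<And>z. z \<noteq> ?b \<Longrightarrow> dist z ?b < d4 \<Longrightarrow> dist (?M z) (?M ?b) < 1/2"
    by (auto simp: eventually_at)
  show thesis
  proof (rule that[of "min d1 (min d3 d4)" "C1 + C2 * K"])
    fix z assume z: "z \<in> - real_seg bL bR" "cmod (z - ?b) < min d1 (min d3 d4)"
    have zb: "z \<noteq> ?b" using z(1) bL bR by (auto simp: real_seg_iff)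
    have C2K: "0 \<le> C2 * K" using C2 3 by simp
    have "cmod (row1 bL bR \<kappa> c k1 k2 z) \<le> C1" unfolding row1_def using 1(3) z(2) by simp
    thus "cmod (row1 bL bR \<kappa> c k1 k2 z) \<le> C1 + C2 * K" using C2K by simp
    have ez: "1 - ?M z \<in> eta_domain" using M1_eta[OF bL bR z(1)] by (auto simp: eta_domain_iff)
    have "cmod (?M z) < 1/2" using 4(2)[OF zb] z(2) M1b by (simp add: dist_norm)
    hence "cmod (row2 bL bR \<kappa> c k1 k2 z) \<le> C2 * (1 + cmod (Ln (?M z)))"
      unfolding row2_def using C2(2)[OF ez] by simp
    also have "\<dots> \<le> C2 * (K * \<bar>ln (cmod (z - ?b))\<bar>)"
      unfolding Mq using 3(3)[OF zb] z(2) C2(1) by (intro mult_left_mono) auto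
    also have "\<dots> \<le> (C1 + C2 * K) * \<bar>ln (cmod (z - ?b))\<bar>"
      using 1(2) by (simp add: algebra_simps)
    finally show "cmod (row2 bL bR \<kappa> c k1 k2 z) \<le> (C1 + C2 * K) * \<bar>ln (cmod (z - ?b))\<bar>" .
    show "1 \<le> \<bar>ln (cmod (z - ?b))\<bar> \<and> cmod (z - ?b) < 1" using 3(4)[OF zb] z(2) by simp
  qed (use 1 C2 3 4 in auto)
qed

lemma row_bounds_bR:
  obtains d C where "0 < d" "0 \<le> C"
    "\<And>z. z \<in> - real_seg bL bR \<Longrightarrow> cmod (z - of_real bR) < d \<Longrightarrow> cmod (row2 bL bR \<kappa> c k1 k2 z) \<le> C"
    "\<And>z. z \<in> - real_seg bL bR \<Longrightarrow> cmod (z - of_real bR) < d \<Longrightarrow>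
       cmod (row1 bL bR \<kappa> c k1 k2 z) \<le> C * \<bar>ln (cmod (z - of_real bR))\<bar>"
    "\<And>z. z \<in> - real_seg bL bR \<Longrightarrow> cmod (z - of_real bR) < d \<Longrightarrow>
       1 \<le> \<bar>ln (cmod (z - of_real bR))\<bar> \<and> cmod (z - of_real bR) < 1"
proof -
  let ?M = "M1 bL bR" and ?b = "complex_of_real bR"
  have b0: "?b \<noteq> 0" using bR by simp
  note M1b = M1_bR[OF bL bR] and Mc = M1_isCont[OF bL bR b0]
  have p: "(0::complex) \<in> plane1" by (auto simp: plane1_iff)
  have Mc': "isCont (\<lambda>z. 1 - ?M z) ?b" using Mc by (intro continuous_intros)
  have M1b': "1 - ?M ?b = 0" using M1b by simp
  obtain d1 C1 where 1: "0 < d1" "0 \<le> C1"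
    "\<And>z. cmod (z - ?b) < d1 \<Longrightarrow> cmod (hg_row \<kappa> c k1 (- k2) (1 - M1_infinity bL bR) (1 - ?M z)) \<le> C1"
    using isCont_bounded_near[OF hg_row_isCont[OF p] Mc' M1b'] by blast
  obtain C2 where C2: "0 \<le> C2" "\<And>\<eta>. \<eta> \<in> eta_domain \<Longrightarrow> cmod (1 - \<eta>) \<le> 1/2 \<Longrightarrow>
      cmod (hg_row \<kappa> c k1 k2 (M1_infinity bL bR) \<eta>) \<le> C2 * (1 + cmod (Ln (1 - \<eta>)))"
    using hg_row_bound_1 by blast
  define q where "q z = - of_real bL / (z * of_real (bR - bL))" for z :: complex
  have q: "isCont q ?b" "q ?b \<noteq> 0" unfolding q_def[abs_def] using bL bR by (auto intro!: continuous_intros)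
  have Mq: "1 - ?M z = (z - ?b) * q z" if "z \<noteq> 0" for z using that bL bR by (simp add: one_minus_M1 q_def)
  obtain d3 K where 3: "0 < d3" "0 \<le> K"
    "\<And>z. z \<noteq> ?b \<Longrightarrow> cmod (z - ?b) < d3 \<Longrightarrow> 1 + cmod (Ln ((z - ?b) * q z)) \<le> K * \<bar>ln (cmod (z - ?b))\<bar>"
    "\<And>z. z \<noteq> ?b \<Longrightarrow> cmod (z - ?b) < d3 \<Longrightarrow> 1 \<le> \<bar>ln (cmod (z - ?b))\<bar> \<and> cmod (z - ?b) < 1"
    using log_factor_bound[OF q] by blast
  have "eventually (\<lambda>z. dist (?M z) (?M ?b) < 1/2) (at ?b)"
    using Mc by (intro tendstoD) (auto simp: isCont_def)
  then obtain d4 where 4: "0 < d4" "\<And>z. z \<noteq> ?b \<Longrightarrow> dist z ?b < d4 \<Longrightarrow> dist (?M z) (?M ?b) < 1/2"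
    by (auto simp: eventually_at)
  show thesis
  proof (rule that[of "min d1 (min d3 d4)" "C1 + C2 * K"])
    fix z assume z: "z \<in> - real_seg bL bR" "cmod (z - ?b) < min d1 (min d3 d4)"
    have zb: "z \<noteq> ?b" using z(1) bL bR by (auto simp: real_seg_iff)
    have z0: "z \<noteq> 0" using zero_in_seg[OF bL bR z(1)] .
    have C2K: "0 \<le> C2 * K" using C2 3 by simp
    have "cmod (row2 bL bR \<kappa> c k1 k2 z) \<le> C1" unfolding row2_def using 1(3) z(2) by simp
    thus "cmod (row2 bL bR \<kappa> c k1 k2 z) \<le> C1 + C2 * K" using C2K by simp
    have "cmod (1 - ?M z) < 1/2" using 4(2)[OF zb] z(2) M1b by (simp add: dist_norm norm_minus_commute)
    hence "cmod (row1 bL bR \<kappa> c k1 k2 z) \<le> C2 * (1 + cmod (Ln (1 - ?M z)))"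
      unfolding row1_def using C2(2)[OF M1_eta[OF bL bR z(1)]] by simp
    also have "\<dots> \<le> C2 * (K * \<bar>ln (cmod (z - ?b))\<bar>)"
      unfolding Mq[OF z0] using 3(3)[OF zb] z(2) C2(1) by (intro mult_left_mono) auto
    also have "\<dots> \<le> (C1 + C2 * K) * \<bar>ln (cmod (z - ?b))\<bar>"
      using 1(2) by (simp add: algebra_simps)
    finally show "cmod (row1 bL bR \<kappa> c k1 k2 z) \<le> (C1 + C2 * K) * \<bar>ln (cmod (z - ?b))\<bar>" .
    show "1 \<le> \<bar>ln (cmod (z - ?b))\<bar> \<and> cmod (z - ?b) < 1" using 3(4)[OF zb] z(2) by simp
  qed (use 1 C2 3 4 in auto)
qed

text \<open>\<open>M1\<close> has a simple pole at 0, so growth of order |\<eta>| to the b becomes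
  growth of order |z| to the - b. Both \<eta> and 1 - \<eta> are of the form p (z - u) / (z (bR -
  bL)) with |p| |u| = - bL bR, which is why \<open>main\<close> treats them together.\<close>

lemma row_bounds_0:
  assumes a: "\<bar>Re a\<bar> < 1/2" "a \<noteq> 0" "\<bar>Re a\<bar> \<le> b" and b: "0 < b" and \<kappa>: "\<kappa> = a * (a + 1)" and c: "c = 1 / (a + 1)"
  obtains d C where "0 < d" "0 \<le> C"
    "\<And>z. z \<in> - real_seg bL bR \<Longrightarrow> cmod z < d \<Longrightarrow>
       cmod (row1 bL bR \<kappa> c k1 k2 z) \<le> C * cmod z powr (- b) \<and> cmod (row2 bL bR \<kappa> c k1 k2 z) \<le> C * cmod z powr (- b)"
proof -
  let ?M = "M1 bL bR"
  obtain C1 where C1: "\<And>\<eta>. Im \<eta> \<noteq> 0 \<Longrightarrow> 2 \<le> cmod \<eta> \<Longrightarrow> cmod (hg_row \<kappa> c k1 k2 (M1_infinity bL bR) \<eta>) \<le> C1 * cmod \<eta> powr b"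
    using hg_row_bound_inf[OF a \<kappa> c] by blast
  obtain C2 where C2: "\<And>\<eta>. Im \<eta> \<noteq> 0 \<Longrightarrow> 2 \<le> cmod \<eta> \<Longrightarrow> cmod (hg_row \<kappa> c k1 (- k2) (1 - M1_infinity bL bR) \<eta>) \<le> C2 * cmod \<eta> powr b"
    using hg_row_bound_inf[OF a \<kappa> c] by blast
  define A where "A = bR * (- bL) / (bR - bL)"
  have A: "0 < A" unfolding A_def using bL bR by (intro divide_pos_pos mult_pos_pos) auto
  \<comment> \<open>4 d \<le> A gives |\<eta>| \<ge> A / (2 |z|) \<ge> 2, as
    \<open>hg_row_bound_inf\<close> demands; d below - bL and bR puts the real points of the disc on
    the segment.\<close>
  define d where "d = min (min (- bL) bR) A / 4"
  have d: "0 < d" "d < - bL" "d < bR" "4 * d \<le> A" using bL bR A by (auto simp: d_def)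
  define D where "D = 2 * A"
  have main: "2 \<le> cmod \<eta> \<and> cmod \<eta> \<le> D / cmod z"
    if z: "z \<noteq> 0" "cmod z < d" and e: "\<eta> = of_real p * (z - of_real u) / (z * of_real (bR - bL))"
      and pu: "\<bar>p\<bar> * \<bar>u\<bar> = bR * (- bL)" "d < \<bar>u\<bar>" "cmod z \<le> \<bar>u\<bar> / 2" for z \<eta> p u
  proof -
    have n: "cmod \<eta> = \<bar>p\<bar> * cmod (z - of_real u) / (cmod z * (bR - bL))"
      unfolding e using bL bR by (simp add: norm_mult norm_divide flip: of_real_diff)
    have u: "\<bar>u\<bar> / 2 \<le> cmod (z - of_real u)" "cmod (z - of_real u) \<le> 2 * \<bar>u\<bar>"
      using norm_triangle_ineq2[of "of_real u" z] norm_triangle_ineq4[of z "of_real u"] pu(3)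
      by (auto simp: norm_minus_commute)
    have pos: "0 < cmod z * (bR - bL)" using z bL bR by simp
    have "\<bar>p\<bar> * (\<bar>u\<bar> / 2) / (cmod z * (bR - bL)) \<le> cmod \<eta>"
      unfolding n using u(1) pos by (intro divide_right_mono mult_left_mono) auto
    moreover have "\<bar>p\<bar> * (\<bar>u\<bar> / 2) / (cmod z * (bR - bL)) = A / (2 * cmod z)"
      using pu(1) by (simp add: A_def field_simps)
    moreover have "2 \<le> A / (2 * cmod z)" using z d(4) by (simp add: field_simps)
    ultimately have "2 \<le> cmod \<eta>" by linarith
    moreover have "cmod \<eta> \<le> \<bar>p\<bar> * (2 * \<bar>u\<bar>) / (cmod z * (bR - bL))"
      unfolding n using u(2) pos by (intro divide_right_mono mult_left_mono) auto
    moreover have "\<bar>p\<bar> * (2 * \<bar>u\<bar>) / (cmod z * (bR - bL)) = D / cmod z"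
    proof -
      have e: "\<bar>p\<bar> * (2 * \<bar>u\<bar>) = 2 * (bR * (- bL))" using pu(1) by simp
      show ?thesis unfolding e D_def A_def by (simp add: mult.commute)
    qed
    ultimately show ?thesis by simp
  qed
  have pw: "x powr b \<le> D powr b * cmod z powr (- b)" if "0 \<le> x" "x \<le> D / cmod z" "z \<noteq> 0" for x z
  proof -
    have "x powr b \<le> (D / cmod z) powr b" using that b by (intro powr_mono2) auto
    also have "\<dots> = D powr b * cmod z powr (- b)" using A that(3) by (simp add: D_def powr_divide powr_minus_divide)
    finally show ?thesis .
  qed
  define C where "C = (\<bar>C1\<bar> + \<bar>C2\<bar>) * D powr b"
  have fin: "y \<le> C * cmod z powr (- b)" if "y \<le> C' * x powr b" "C' \<le> \<bar>C1\<bar> + \<bar>C2\<bar>" "0 \<le> x" "x \<le> D / cmod z" "z \<noteq> 0" for y x C' z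
  proof -
    have "C' * x powr b \<le> (\<bar>C1\<bar> + \<bar>C2\<bar>) * (D powr b * cmod z powr (- b))"
      using that by (intro mult_mono pw) auto
    thus ?thesis using that(1) by (simp add: C_def mult.assoc)
  qed
  show thesis
  proof (rule that[of "d / 2" C])
    show "0 < d / 2" "0 \<le> C" using d by (auto simp: C_def)
    fix z assume z: "z \<in> - real_seg bL bR" "cmod z < d / 2"
    have z0: "z \<noteq> 0" using zero_in_seg[OF bL bR z(1)] .
    have zd: "cmod z < d" using z(2) d(1) by simp
    \<comment> \<open>Within this disc every real point lies on the segment, so a point off the
      segment is nonreal and so is its image.\<close>
    have "Im z \<noteq> 0"
    proof
      assume i: "Im z = 0"
      hence "\<bar>Re z\<bar> < d" using zd by (simp add: cmod_def)
      thus False using z(1) i d by (auto simp: real_seg_iff)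
    qed
    hence im: "Im (?M z) \<noteq> 0" using Im_M1_sign[OF bL bR, of z] by (cases "0 < Im z") auto
    have "2 \<le> cmod (?M z) \<and> cmod (?M z) \<le> D / cmod z"
      by (rule main[OF z0 zd, of _ bR bL]) (use z d bL bR in \<open>auto simp: M1_def\<close>)
    moreover have "2 \<le> cmod (1 - ?M z) \<and> cmod (1 - ?M z) \<le> D / cmod z"
      by (rule main[OF z0 zd, of _ "- bL" bR]) (use z d bL bR one_minus_M1[OF bL bR z0] in \<open>auto simp: mult.commute\<close>)
    moreover have "cmod (row1 bL bR \<kappa> c k1 k2 z) \<le> C * cmod z powr (- b)"
      unfolding row1_def by (rule fin[OF C1]) (use calculation im z0 in auto)
    moreover have "cmod (row2 bL bR \<kappa> c k1 k2 z) \<le> C * cmod z powr (- b)"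
      unfolding row2_def norm_minus_cancel by (rule fin[OF C2]) (use calculation im z0 in auto)
    ultimately show "cmod (row1 bL bR \<kappa> c k1 k2 z) \<le> C * cmod z powr (- b) \<and> cmod (row2 bL bR \<kappa> c k1 k2 z) \<le> C * cmod z powr (- b)"
      by blast
  qed
qed

end

section \<open>Boundary values in \<open>L\<^sup>2\<close>\<close>

lemma nn_integral_powr_finite:
  fixes A B c p :: real
  assumes p: "0 < p" "p < 1"
  shows "(\<integral>\<^sup>+ x\<in>{A..B}. ennreal (\<bar>x - c\<bar> powr (- p)) \<partial>lborel) < \<infinity>"
proof -
  define L where "L = \<bar>A\<bar> + \<bar>B\<bar> + \<bar>c\<bar>"
  have L: "0 \<le> L" by (simp add: L_def)
  define f where "f x = indicator {0..L} x *\<^sub>R (x powr (- p))" for x :: real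
  have fm [measurable]: "f \<in> borel_measurable borel" unfolding f_def[abs_def] by measurable
  have f0: "0 \<le> f x" for x by (simp add: f_def)
  have "((\<lambda>x. x powr (- p)) has_integral (L powr (- p + 1) / (- p + 1))) {0..L}"
    using p L by (intro has_integral_powr_from_0) auto
  hence "((\<lambda>x. if x \<in> {0..L} then x powr (- p) else 0) has_integral (L powr (- p + 1) / (- p + 1))) UNIV"
    by (subst has_integral_restrict_UNIV)
  moreover have "(\<lambda>x. if x \<in> {0..L} then x powr (- p) else 0) = f" by (auto simp: f_def fun_eq_iff)
  ultimately have "integral\<^sup>N lborel f = ennreal (L powr (- p + 1) / (- p + 1))"
    by (intro nn_integral_has_integral_lborel fm f0) simp
  hence fin: "(\<integral>\<^sup>+x. ennreal (f x) \<partial>lborel) < \<infinity>" by simp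
  have m: "(\<lambda>x. ennreal (f x)) \<in> borel_measurable borel" by measurable
  \<comment> \<open>The two substitutions x - c and c - x cover the two sides of the singularity
    c.\<close>
  have "(\<integral>\<^sup>+x. ennreal (f (- c + 1 * x)) \<partial>lborel) = (\<integral>\<^sup>+x. ennreal (f x) \<partial>lborel)"
    using nn_integral_real_affine[OF m, of 1 "- c"] by simp
  moreover have "(\<integral>\<^sup>+x. ennreal (f (c + (-1) * x)) \<partial>lborel) = (\<integral>\<^sup>+x. ennreal (f x) \<partial>lborel)"
    using nn_integral_real_affine[OF m, of "-1" c] by simp
  ultimately have fin2: "(\<integral>\<^sup>+x. ennreal (f (- c + 1 * x)) + ennreal (f (c + (-1) * x)) \<partial>lborel) < \<infinity>"
    using fin by (subst nn_integral_add) (auto simp: less_top[symmetric])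
  have "(\<integral>\<^sup>+ x\<in>{A..B}. ennreal (\<bar>x - c\<bar> powr (- p)) \<partial>lborel) \<le>
      (\<integral>\<^sup>+x. ennreal (f (- c + 1 * x)) + ennreal (f (c + (-1) * x)) \<partial>lborel)"
  proof (rule nn_integral_mono)
    fix x
    show "ennreal (\<bar>x - c\<bar> powr (- p)) * indicator {A..B} x \<le> ennreal (f (- c + 1 * x)) + ennreal (f (c + (-1) * x))"
    proof (cases "x \<in> {A..B}")
      case True
      hence "\<bar>x - c\<bar> \<le> L" by (auto simp: L_def)
      hence "\<bar>x - c\<bar> powr (- p) \<le> f (- c + 1 * x) + f (c + (-1) * x)"
        by (cases "c \<le> x") (auto simp: f_def)
      thus ?thesis using True f0 by (simp add: ennreal_plus[symmetric] del: ennreal_plus)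
    qed simp
  qed
  with fin2 show ?thesis by (rule le_less_trans[rotated])
qed

text \<open>A common majorant for all entries up to the boundary. For 0 < b < 1/2 it is square
  integrable on the segment, and any positive b is enough to dominate the logarithms at bL and
  bR.\<close>

definition node_weight :: "real \<Rightarrow> real \<Rightarrow> real \<Rightarrow> complex \<Rightarrow> real" where
  "node_weight bL bR b z = cmod z powr (- b) + cmod (z - of_real bL) powr (- b) + cmod (z - of_real bR) powr (- b)"

lemma node_weight_nonneg: "0 \<le> node_weight bL bR b z"
  by (simp add: node_weight_def)

lemma node_weight_square_finite:
  assumes b: "0 < b" "b < 1/2"
  shows "(\<integral>\<^sup>+ x\<in>{bL..bR}. ennreal ((C * node_weight bL bR b (of_real x))\<^sup>2) \<partial>lborel) < \<infinity>"
proof -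
  let ?g = "\<lambda>c x. ennreal (\<bar>x - c\<bar> powr (- (2 * b))) * indicator {bL..bR} x"
  have fin: "(\<integral>\<^sup>+ x. ?g c x \<partial>lborel) < \<infinity>" for c
    using nn_integral_powr_finite[where p = "2 * b" and A = bL and B = bR and c = c] b by simp
  have "(\<integral>\<^sup>+ x. ennreal (3 * C\<^sup>2) * (?g 0 x + ?g bL x + ?g bR x) \<partial>lborel) =
      ennreal (3 * C\<^sup>2) * ((\<integral>\<^sup>+ x. ?g 0 x \<partial>lborel) + (\<integral>\<^sup>+ x. ?g bL x \<partial>lborel) + (\<integral>\<^sup>+ x. ?g bR x \<partial>lborel))"
    by (subst nn_integral_cmult, measurable, subst nn_integral_add, measurable, subst nn_integral_add, measurable)
  also have "\<dots> < \<infinity>" using fin[of 0] fin[of bL] fin[of bR] by (auto simp: ennreal_mult_less_top)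
  finally have "(\<integral>\<^sup>+ x. ennreal (3 * C\<^sup>2) * (?g 0 x + ?g bL x + ?g bR x) \<partial>lborel) < \<infinity>" .
  moreover have "(\<integral>\<^sup>+ x\<in>{bL..bR}. ennreal ((C * node_weight bL bR b (of_real x))\<^sup>2) \<partial>lborel) \<le>
      (\<integral>\<^sup>+ x. ennreal (3 * C\<^sup>2) * (?g 0 x + ?g bL x + ?g bR x) \<partial>lborel)"
  proof (rule nn_integral_mono)
    fix x
    have sq: "(p + q + r)\<^sup>2 \<le> 3 * (p\<^sup>2 + q\<^sup>2 + r\<^sup>2)" for p q r :: real
      using zero_le_power2[of "p - q"] zero_le_power2[of "q - r"] zero_le_power2[of "p - r"]
      by (simp add: power2_eq_square algebra_simps)
    have pw: "(t powr (- b))\<^sup>2 = t powr (- (2 * b))" for t :: real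
      by (simp add: power2_eq_square powr_add[symmetric])
    have nrm: "cmod (of_real x - of_real c) = \<bar>x - c\<bar>" for c
      by (metis norm_of_real of_real_diff)
    have "(C * node_weight bL bR b (of_real x))\<^sup>2 \<le> 3 * C\<^sup>2 * (\<bar>x - 0\<bar> powr (- (2 * b)) + \<bar>x - bL\<bar> powr (- (2 * b)) + \<bar>x - bR\<bar> powr (- (2 * b)))"
      unfolding power_mult_distrib node_weight_def nrm
      using mult_left_mono[OF sq[of "\<bar>x\<bar> powr (- b)" "\<bar>x - bL\<bar> powr (- b)" "\<bar>x - bR\<bar> powr (- b)"], of "C\<^sup>2"]
      unfolding pw by (simp add: algebra_simps)
    hence "ennreal ((C * node_weight bL bR b (of_real x))\<^sup>2) \<le>
       ennreal (3 * C\<^sup>2) * (ennreal (\<bar>x - 0\<bar> powr (- (2 * b))) + ennreal (\<bar>x - bL\<bar> powr (- (2 * b))) + ennreal (\<bar>x - bR\<bar> powr (- (2 * b))))"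
      by (simp add: ennreal_plus[symmetric] ennreal_mult[symmetric] ennreal_leI del: ennreal_plus)
    thus "ennreal ((C * node_weight bL bR b (of_real x))\<^sup>2) * indicator {bL..bR} x \<le>
       ennreal (3 * C\<^sup>2) * (?g 0 x + ?g bL x + ?g bR x)"
      by (cases "x \<in> {bL..bR}") auto
  qed
  ultimately show ?thesis by (rule le_less_trans[rotated])
qed

lemma Complex_notin_seg: "y \<noteq> 0 \<Longrightarrow> Complex x y \<notin> real_seg bL bR"
  by (simp add: real_seg_iff)

lemma AE_not_nodes: "AE x in lborel. x \<noteq> bL \<and> x \<noteq> (0::real) \<and> x \<noteq> bR"
  using AE_lborel_singleton[of bL] AE_lborel_singleton[of 0] AE_lborel_singleton[of bR] by eventually_elim auto

definition open_pieces :: "real \<Rightarrow> real \<Rightarrow> real set" where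
  "open_pieces bL bR = {bL<..<0} \<union> {0<..<bR}"

lemma seq_side_limit:
  assumes s: "s = 1 \<or> s = -1" and X: "\<And>i. 0 < X i" "X \<longlonglongrightarrow> (0::real)"
    and l: "(f \<longlongrightarrow> y) (at (of_real x) within {z. 0 < s * Im z})"
  shows "(\<lambda>i. f (Complex x (s * X i))) \<longlonglongrightarrow> y"
proof (rule filterlim_compose[OF l])
  have "(\<lambda>i. Complex x (s * X i)) \<longlonglongrightarrow> Complex x (s * 0)"
    by (intro tendsto_Complex tendsto_intros X(2))
  moreover have "Complex x (s * 0) = of_real x" by (simp add: complex_eq_iff)
  moreover have "\<forall>i. Complex x (s * X i) \<in> {z. 0 < s * Im z} \<and> Complex x (s * X i) \<noteq> of_real x"
    using s X(1) by (auto simp: complex_eq_iff) (metis less_irrefl)+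
  ultimately show "filterlim (\<lambda>i. Complex x (s * X i)) (at (complex_of_real x) within {z. 0 < s * Im z}) sequentially"
    by (auto simp: filterlim_at)
qed

lemma line_measurable:
  assumes f: "continuous_on (- real_seg bL bR) f" and y: "y \<noteq> 0"
  shows "(\<lambda>x. f (Complex x y)) \<in> borel_measurable borel"
proof (rule borel_measurable_continuous_onI)
  show "continuous_on UNIV (\<lambda>x. f (Complex x y))"
    by (rule continuous_on_compose2[OF f])
       (use Complex_notin_seg[OF y] in \<open>auto simp: Complex_eq intro!: continuous_intros\<close>)
qed

text \<open>On the pieces the boundary value is a pointwise limit of continuous functions on
  horizontal lines. Elsewhere nothing is known about it, so it is replaced by 0 there.\<close>

lemma boundary_measurable:
  fixes f :: "complex \<Rightarrow> complex"
  assumes f: "continuous_on (- real_seg bL bR) f" and s: "s = 1 \<or> s = -1"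
    and lim: "\<And>x. x \<in> open_pieces bL bR \<Longrightarrow> (f \<longlongrightarrow> fp x) (at (of_real x) within {z. 0 < s * Im z})"
  shows "(\<lambda>x. if x \<in> open_pieces bL bR then fp x else 0) \<in> borel_measurable borel"
proof (rule borel_measurable_LIMSEQ_metric)
  define X where "X i = inverse (real (Suc i))" for i
  have X: "0 < X i" "X \<longlonglongrightarrow> 0" for i
    unfolding X_def[abs_def] using LIMSEQ_inverse_real_of_nat by (simp_all add: field_simps)
  have S: "open_pieces bL bR \<in> sets borel" unfolding open_pieces_def by simp
  show "(\<lambda>x. if x \<in> open_pieces bL bR then f (Complex x (s * X i)) else 0) \<in> borel_measurable borel" for i
    using line_measurable[OF f, of "s * X i"] s X(1)[of i] S
    by (intro measurable_If_set) auto
  show "(\<lambda>i. if x \<in> open_pieces bL bR then f (Complex x (s * X i)) else 0) \<longlonglongrightarrow>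
      (if x \<in> open_pieces bL bR then fp x else 0)" for x
    using seq_side_limit[OF s X lim, of x] by auto
qed

lemma AE_open_pieces:
  "AE x in lborel. x \<in> {bL..bR} \<longrightarrow> x \<in> open_pieces bL bR"
  using AE_not_nodes[of bL bR] by eventually_elim (auto simp: open_pieces_def)

lemma L2_dist_sq_cong:
  assumes "\<And>x. x \<in> open_pieces bL bR \<Longrightarrow> fp x = fq x"
  shows "L2_dist_sq bL bR f fp = L2_dist_sq bL bR f fq"
  unfolding L2_dist_sq_def
  by (rule nn_integral_cong_AE, rule eventually_mono[OF AE_open_pieces[of bL bR]])
     (auto simp: assms indicator_def)

text \<open>Leaving the real line increases the distance to every node, so the weight on the segment
  dominates f at all heights at once and dominated convergence applies. Only heights up to 1 are
  considered, which is why the bound is asked for on the disc of radius bR - bL + 1.\<close>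

lemma L2_boundary_scalar:
  fixes f :: "complex \<Rightarrow> complex"
  assumes bLR: "bL < 0" "0 < bR" and f: "continuous_on (- real_seg bL bR) f" and s: "s = 1 \<or> s = -1"
    and lim: "\<And>x. x \<in> open_pieces bL bR \<Longrightarrow> (f \<longlongrightarrow> fp x) (at (of_real x) within {z. 0 < s * Im z})"
    and b: "0 < b" "b < 1/2" and C: "0 \<le> C"
    and bound: "\<And>z. z \<in> - real_seg bL bR \<Longrightarrow> cmod z \<le> bR - bL + 1 \<Longrightarrow> cmod (f z) \<le> C * node_weight bL bR b z"
  shows "set_integrable lborel {bL..bR} (\<lambda>x. (cmod (fp x))\<^sup>2)"
    and "((\<lambda>\<epsilon>. L2_dist_sq bL bR (\<lambda>x. f (Complex x (s * \<epsilon>))) fp) \<longlongrightarrow> 0) (at_right 0)"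
proof -
  let ?S = "open_pieces bL bR"
  let ?w = "\<lambda>x. C * node_weight bL bR b (of_real x)"
  define fp0 where "fp0 x = (if x \<in> ?S then fp x else 0)" for x
  have fp0 [measurable]: "fp0 \<in> borel_measurable borel"
    using boundary_measurable[OF f s lim] unfolding fp0_def[abs_def] .
  have near: "cmod (f (Complex x (s * e))) \<le> ?w x" if x: "x \<in> ?S" and e: "0 < e" "e \<le> 1" for x e
  proof -
    let ?z = "Complex x (s * e)"
    have se: "\<bar>s * e\<bar> \<le> 1" "s * e \<noteq> 0" using s e by auto
    have "cmod ?z \<le> \<bar>x\<bar> + \<bar>s * e\<bar>" using cmod_le[of ?z] by simp
    also have "\<dots> \<le> bR - bL + 1" using x se bLR by (auto simp: open_pieces_def)
    finally have "cmod (f ?z) \<le> C * node_weight bL bR b ?z"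
      using Complex_notin_seg[OF se(2)] by (intro bound) auto
    also have "\<dots> \<le> ?w x"
    proof (rule mult_left_mono[OF _ C])
      have p: "cmod (?z - of_real c) powr (- b) \<le> cmod (of_real x - of_real c) powr (- b)" if "x \<noteq> c" for c
      proof (rule powr_mono2')
        show "cmod (of_real x - of_real c) \<le> cmod (?z - of_real c)"
          using abs_Re_le_cmod[of "?z - of_real c"] by (simp flip: of_real_diff)
        show "0 < cmod (complex_of_real x - of_real c)" using that by simp
      qed (use b in auto)
      show "node_weight bL bR b ?z \<le> node_weight bL bR b (of_real x)"
        unfolding node_weight_def using p[of 0] p[of bL] p[of bR] x bLR by (auto simp: open_pieces_def intro!: add_mono)
    qed
    finally show ?thesis .
  qed
  define X where "X i = inverse (real (Suc i))" for i
  have X: "0 < X i" "X i \<le> 1" "X \<longlonglongrightarrow> 0" for i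
    unfolding X_def[abs_def] using LIMSEQ_inverse_real_of_nat by (simp_all add: field_simps)
  have fpb: "cmod (fp x) \<le> ?w x" if x: "x \<in> ?S" for x
    by (rule tendsto_upperbound[OF tendsto_norm[OF seq_side_limit[OF s X(1,3) lim[OF x]]]])
       (auto intro!: always_eventually near x X)
  have w0: "0 \<le> ?w x" for x using C node_weight_nonneg by simp
  have wfin: "(\<integral>\<^sup>+ x\<in>{bL..bR}. ennreal ((D * node_weight bL bR b (of_real x))\<^sup>2) \<partial>lborel) < \<infinity>" for D
    by (rule node_weight_square_finite[OF b])
  have wm [measurable]: "(\<lambda>x. node_weight bL bR b (complex_of_real x)) \<in> borel_measurable borel"
    unfolding node_weight_def by measurable
  have "integrable lborel (\<lambda>x. indicator {bL..bR} x *\<^sub>R (cmod (fp0 x))\<^sup>2)"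
  proof (rule integrableI_bounded)
    have "(\<integral>\<^sup>+ x. ennreal (norm (indicator {bL..bR} x *\<^sub>R (cmod (fp0 x))\<^sup>2)) \<partial>lborel) \<le>
        (\<integral>\<^sup>+ x\<in>{bL..bR}. ennreal ((?w x)\<^sup>2) \<partial>lborel)"
    proof (rule nn_integral_mono)
      fix x
      have "(cmod (fp0 x))\<^sup>2 \<le> (?w x)\<^sup>2" using fpb[of x] w0[of x] by (intro power_mono) (auto simp: fp0_def)
      thus "ennreal (norm (indicator {bL..bR} x *\<^sub>R (cmod (fp0 x))\<^sup>2)) \<le> ennreal ((?w x)\<^sup>2) * indicator {bL..bR} x"
        by (auto simp: indicator_def intro: ennreal_leI)
    qed
    thus "(\<integral>\<^sup>+ x. ennreal (norm (indicator {bL..bR} x *\<^sub>R (cmod (fp0 x))\<^sup>2)) \<partial>lborel) < \<infinity>"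
      using wfin[of C] by (rule le_less_trans)
  qed measurable
  thus "set_integrable lborel {bL..bR} (\<lambda>x. (cmod (fp x))\<^sup>2)"
    unfolding set_integrable_def
    by (subst integrable_discrete_difference[of "{bL, 0, bR}"])
       (auto simp: fp0_def open_pieces_def indicator_def)
  have eq: "L2_dist_sq bL bR g fp = L2_dist_sq bL bR g fp0" for g
    by (rule L2_dist_sq_cong) (simp add: fp0_def)
  show "((\<lambda>\<epsilon>. L2_dist_sq bL bR (\<lambda>x. f (Complex x (s * \<epsilon>))) fp) \<longlongrightarrow> 0) (at_right 0)"
    unfolding eq tendsto_at_iff_sequentially
  proof (intro allI impI)
    fix Y :: "nat \<Rightarrow> real" assume Y: "\<forall>i. Y i \<in> {0<..} - {0}" "Y \<longlonglongrightarrow> 0"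
    have "eventually (\<lambda>i. Y i < 1) sequentially" using Y(2) by (rule order_tendstoD) simp
    then obtain N where N: "\<And>i. N \<le> i \<Longrightarrow> Y i < 1" by (auto simp: eventually_sequentially)
    \<comment> \<open>Dropping the first N terms brings all heights below 1, where
      \<open>near\<close> applies.\<close>
    define Z where "Z i = Y (i + N)" for i
    have Z: "0 < Z i" "Z i \<le> 1" "Z \<longlonglongrightarrow> 0" for i
      using Y(1) N[of "i + N"] LIMSEQ_ignore_initial_segment[OF Y(2), of N] by (auto simp: Z_def[abs_def] less_imp_le)
    have fm [measurable]: "(\<lambda>x. f (Complex x (s * Z i))) \<in> borel_measurable borel" for i
      using line_measurable[OF f, of "s * Z i"] s Z(1)[of i] by auto
    have "(\<lambda>i. \<integral>\<^sup>+ x\<in>{bL..bR}. ennreal ((cmod (f (Complex x (s * Z i)) - fp0 x))\<^sup>2) \<partial>lborel) \<longlonglongrightarrow> (\<integral>\<^sup>+ x. 0 \<partial>(lborel :: real measure))"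
    proof (rule nn_integral_dominated_convergence[where w = "\<lambda>x. ennreal ((2 * C * node_weight bL bR b (of_real x))\<^sup>2) * indicator {bL..bR} x"])
      show "(\<integral>\<^sup>+ x. ennreal ((2 * C * node_weight bL bR b (of_real x))\<^sup>2) * indicator {bL..bR} x \<partial>lborel) < \<infinity>"
        by (rule wfin)
      show "AE x in lborel. ennreal ((cmod (f (Complex x (s * Z j)) - fp0 x))\<^sup>2) * indicator {bL..bR} x \<le>
          ennreal ((2 * C * node_weight bL bR b (of_real x))\<^sup>2) * indicator {bL..bR} x" for j
        using AE_open_pieces[of bL bR]
      proof eventually_elim
        case (elim x)
        show ?case
        proof (cases "x \<in> {bL..bR}")
          case True
          hence x: "x \<in> ?S" using elim by blast
          have "cmod (f (Complex x (s * Z j)) - fp0 x) \<le> ?w x + ?w x"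
            using near[OF x Z(1,2)] fpb[OF x] x by (intro order_trans[OF norm_triangle_ineq4] add_mono) (auto simp: fp0_def)
          hence "(cmod (f (Complex x (s * Z j)) - fp0 x))\<^sup>2 \<le> (2 * C * node_weight bL bR b (of_real x))\<^sup>2"
            by (intro power_mono) auto
          thus ?thesis by (intro mult_right_mono ennreal_leI) auto
        qed simp
      qed
      show "AE x in lborel. (\<lambda>i. ennreal ((cmod (f (Complex x (s * Z i)) - fp0 x))\<^sup>2) * indicator {bL..bR} x) \<longlonglongrightarrow> 0"
        using AE_open_pieces[of bL bR]
      proof eventually_elim
        case (elim x)
        show ?case
        proof (cases "x \<in> {bL..bR}")
          case True
          hence x: "x \<in> ?S" using elim by blast
          have "(\<lambda>i. ennreal ((cmod (f (Complex x (s * Z i)) - fp x))\<^sup>2)) \<longlonglongrightarrow> ennreal ((cmod (fp x - fp x))\<^sup>2)"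
            by (intro tendsto_intros seq_side_limit[OF s Z(1,3) lim[OF x]])
          thus ?thesis using True x by (simp add: fp0_def)
        qed simp
      qed
    qed measurable
    hence "(\<lambda>i. L2_dist_sq bL bR (\<lambda>x. f (Complex x (s * Y (i + N)))) fp0) \<longlonglongrightarrow> 0"
      by (simp add: L2_dist_sq_def Z_def)
    from LIMSEQ_offset[OF this]
    show "((\<lambda>\<epsilon>. L2_dist_sq bL bR (\<lambda>x. f (Complex x (s * \<epsilon>))) fp0) \<circ> Y) \<longlonglongrightarrow> 0"
      by (simp add: o_def)
  qed
qed

section \<open>Removable singularities\<close>

lemma norm_integral_le_nn_integral:
  fixes g :: "real \<Rightarrow> complex"
  assumes "continuous_on {a..b} g"
  shows "ennreal (norm (integral {a..b} g)) \<le> (\<integral>\<^sup>+ x\<in>{a..b}. ennreal (norm (g x)) \<partial>lborel)"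
proof -
  have i: "set_integrable lborel {a..b} g" by (rule borel_integrable_atLeastAtMost'[OF assms])
  have "ennreal (norm (integral {a..b} g)) = ennreal (norm (LINT x:{a..b}|lborel. g x))"
    using set_borel_integral_eq_integral(2)[OF i] by simp
  also have "\<dots> \<le> (\<integral>\<^sup>+ x. ennreal (norm (indicator {a..b} x *\<^sub>R g x)) \<partial>lborel)"
    unfolding set_lebesgue_integral_def
    by (rule integral_norm_bound_ennreal) (use i in \<open>simp add: set_integrable_def\<close>)
  also have "\<dots> = (\<integral>\<^sup>+ x\<in>{a..b}. ennreal (norm (g x)) \<partial>lborel)"
    by (rule nn_integral_cong) (auto simp: indicator_def)
  finally show ?thesis .
qed

lemma integral_horizontal:
  assumes P: "\<And>t. t \<in> {a..b} \<Longrightarrow> (P has_field_derivative F (Complex t y)) (at (Complex t y))" and ab: "a \<le> b"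
  shows "integral {a..b} (\<lambda>t. F (Complex t y)) = P (Complex b y) - P (Complex a y)"
proof -
  have "((\<lambda>t. F (Complex t y)) has_integral P (Complex b y) - P (Complex a y)) {a..b}"
  proof (rule fundamental_theorem_of_calculus[OF ab])
    fix t assume t: "t \<in> {a..b}"
    have e: "Complex t y = of_real t + \<i> * of_real y" for t by (simp add: complex_eq_iff)
    have m: "((\<lambda>w. w + \<i> * of_real y) has_field_derivative 1) (at (of_real t))"
      by (auto intro!: derivative_eq_intros)
    have "((\<lambda>w. P (w + \<i> * of_real y)) has_field_derivative F (Complex t y) * 1) (at (of_real t))"
      by (rule DERIV_chain2[of P, OF _ m]) (use P[OF t] in \<open>simp add: e\<close>)
    from has_vector_derivative_real_field[OF this]
    show "((\<lambda>t. P (Complex t y)) has_vector_derivative F (Complex t y)) (at t within {a..b})"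
      by (simp add: e)
  qed
  thus ?thesis by (rule integral_unique)
qed

text \<open>A primitive of \<open>F\<close> on the slit disc is bounded because \<open>F\<close> is bounded in \<open>L\<^sup>1\<close> on horizontal lines,
  and the primitives from above and from below fit together because the two boundary values agree.\<close>

lemma removable_L1_horizontal:
  assumes F: "F holomorphic_on ball 0 r - {0}" and d: "0 < d" "d < r / 2"
    and bnd: "\<And>s. s = 1 \<or> s = -1 \<Longrightarrow>
      eventually (\<lambda>e. (\<integral>\<^sup>+ x\<in>{-d..d}. ennreal (cmod (F (Complex x (s * e)))) \<partial>lborel) \<le> ennreal K) (at_right 0)"
    and dif: "((\<lambda>e. \<integral>\<^sup>+ x\<in>{-d..d}. ennreal (cmod (F (Complex x e) - F (Complex x (- e)))) \<partial>lborel) \<longlongrightarrow> 0) (at_right 0)"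
  shows "F \<in> O[at 0](\<lambda>_. 1)"
proof -
  have r: "0 < r" using d by simp
  \<comment> \<open>The disc without 0 and without the vertical radius on the side opposite to s. It
    is star-shaped about the point i s r / 2, so F has a primitive on it.\<close>
  define U where "U s = ball 0 r \<inter> {z. 0 < s * Im z \<or> Re z \<noteq> 0}" for s :: real
  have Uop: "open (U s)" for s unfolding U_def
    by (intro open_Int open_ball open_Collect_disj open_Collect_less open_Collect_neq continuous_intros)
  have Ust: "starlike (U s)" if s: "s = 1 \<or> s = -1" for s
    unfolding starlike_def
  proof (intro bexI[of _ "Complex 0 (s * (r / 2))"] ballI subsetI)
    have "cmod (Complex 0 (s * (r / 2))) = r / 2" using s r by (auto simp: cmod_def)
    thus m: "Complex 0 (s * (r / 2)) \<in> U s" using s r by (auto simp: U_def)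
    fix z w assume z: "z \<in> U s" and w: "w \<in> closed_segment (Complex 0 (s * (r / 2))) z"
    have "w \<in> ball 0 r"
      using w z m closed_segment_subset[OF _ _ convex_ball, of "Complex 0 (s * (r / 2))" 0 r z] by (auto simp: U_def)
    moreover obtain t where t: "0 \<le> t" "t \<le> 1" "w = (1 - t) *\<^sub>R Complex 0 (s * (r / 2)) + t *\<^sub>R z"
      using w by (auto simp: closed_segment_def)
    have ww: "Re w = t * Re z" "s * Im w = (1 - t) * (r / 2) + t * (s * Im z)"
      using s by (auto simp: t(3) field_simps)
    have "0 < s * Im w \<or> Re w \<noteq> 0"
    proof (cases "t = 0 \<or> Re z \<noteq> 0")
      case True
      thus ?thesis using ww r by auto
    next
      case False
      hence "0 < t" "0 < s * Im z" using t(1) z by (auto simp: U_def)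
      hence "0 < t * (s * Im z)" "0 \<le> (1 - t) * (r / 2)" using t(2) r by auto
      thus ?thesis unfolding ww by simp
    qed
    ultimately show "w \<in> U s" by (simp add: U_def)
  qed
  have Usub: "U s \<subseteq> ball 0 r - {0}" for s by (auto simp: U_def)
  have "\<exists>P. \<forall>z\<in>U s. (P has_field_derivative F z) (at z)" if s: "s = 1 \<or> s = -1" for s
  proof (rule holomorphic_starlike_primitive[where k = "{}", OF _ Ust[OF s] Uop])
    have h: "F holomorphic_on U s" by (rule holomorphic_on_subset[OF F Usub])
    show "continuous_on (U s) F" by (rule holomorphic_on_imp_continuous_on[OF h])
    show "\<And>x. x \<in> U s - {} \<Longrightarrow> F field_differentiable at x"
      using h Uop holomorphic_on_imp_differentiable_at by blast
  qed simp
  from this[of 1] this[of "-1"] obtain P1 P2' where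
    P1: "\<And>z. z \<in> U 1 \<Longrightarrow> (P1 has_field_derivative F z) (at z)" and
    P2': "\<And>z. z \<in> U (-1) \<Longrightarrow> (P2' has_field_derivative F z) (at z)" by auto
  \<comment> \<open>Normalised so that both primitives agree at d, hence on the right half of the
    disc.\<close>
  define P2 where "P2 z = P2' z + (P1 (of_real d) - P2' (of_real d))" for z
  have P2: "(P2 has_field_derivative F z) (at z)" if "z \<in> U (-1)" for z
    unfolding P2_def[abs_def] using P2'[OF that] by (auto intro!: derivative_eq_intros)
  have dU: "complex_of_real d \<in> U s" "complex_of_real (- d) \<in> U s" for s using d r by (auto simp: U_def)
  have lineU: "Complex t (s * e) \<in> U s" if "t \<in> {-d..d}" "0 < e" "e < r / 2" "s = 1 \<or> s = -1" for t e s
  proof -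
    have "cmod (Complex t (s * e)) \<le> \<bar>t\<bar> + \<bar>s * e\<bar>" using cmod_le[of "Complex t (s * e)"] by simp
    also have "\<dots> < r" using that d by auto
    finally show ?thesis using that by (auto simp: U_def)
  qed
  define Ps where "Ps s = (if s = (1::real) then P1 else P2)" for s
  have Ps: "(Ps s has_field_derivative F z) (at z)" if "s = 1 \<or> s = -1" "z \<in> U s" for s z
    using that P1 P2 by (auto simp: Ps_def)
  have Pc: "isCont (Ps s) z" if "s = 1 \<or> s = -1" "z \<in> U s" for s z
    using Ps[OF that] by (rule DERIV_isCont)
  have Fc: "continuous_on {a..b} (\<lambda>t. F (Complex t (s * e)))"
    if "-d \<le> a" "b \<le> d" "0 < e" "e < r / 2" "s = 1 \<or> s = -1" for a b s e
  proof (rule continuous_on_compose2[OF holomorphic_on_imp_continuous_on[OF F]])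
    show "continuous_on {a..b} (\<lambda>t. Complex t (s * e))" by (auto simp: Complex_eq intro!: continuous_intros)
    show "(\<lambda>t. Complex t (s * e)) ` {a..b} \<subseteq> ball 0 r - {0}"
    proof (rule image_subsetI)
      fix t assume "t \<in> {a..b}"
      hence "t \<in> {-d..d}" using that(1,2) by simp
      from lineU[OF this that(3-5)] Usub show "Complex t (s * e) \<in> ball 0 r - {0}" by blast
    qed
  qed
  have hor: "integral {a..b} (\<lambda>t. F (Complex t (s * e))) = Ps s (Complex b (s * e)) - Ps s (Complex a (s * e))"
    if "-d \<le> a" "a \<le> b" "b \<le> d" "0 < e" "e < r / 2" "s = 1 \<or> s = -1" for a b s e
    using that lineU[of _ e s] by (intro integral_horizontal Ps) auto
  have small: "eventually (\<lambda>e. 0 < e \<and> e < r / 2) (at_right (0::real))"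
    using eventually_at_right_real[of 0 "r / 2"] r by (auto elim: eventually_mono)
  have lim: "((\<lambda>e. Ps s (Complex x (s * e))) \<longlongrightarrow> Ps s (of_real x)) (at_right 0)"
    if s: "s = 1 \<or> s = -1" and x: "of_real x \<in> U s" for s x
  proof -
    have "((\<lambda>e. Complex x (s * e)) \<longlongrightarrow> Complex x (s * 0)) (at_right 0)"
      by (intro tendsto_Complex tendsto_intros)
    moreover have "Complex x (s * 0) = of_real x" by (simp add: complex_eq_iff)
    ultimately have "((\<lambda>e. Complex x (s * e)) \<longlongrightarrow> of_real x) (at_right 0)" by simp
    from isCont_tendsto_compose[OF Pc[OF s x] this] show ?thesis .
  qed
  \<comment> \<open>Here a residue is excluded. The increments of the two primitives over [- d, d]
    are limits of integrals of F over the lines at heights e and - e, and the difference of these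
    integrals tends to 0 by \<open>dif\<close>. Thus the primitives also agree on the left
    half.\<close>
  have eqd: "P1 (of_real (- d)) = P2 (of_real (- d))"
  proof -
    let ?A = "\<lambda>s e. Ps s (Complex d (s * e)) - Ps s (Complex (- d) (s * e))"
    have "((\<lambda>e. ennreal (cmod (?A 1 e - ?A (-1) e))) \<longlongrightarrow>
        ennreal (cmod ((Ps 1 (of_real d) - Ps 1 (of_real (- d))) - (Ps (-1) (of_real d) - Ps (-1) (of_real (- d)))))) (at_right 0)"
      by (intro tendsto_ennrealI tendsto_norm tendsto_diff lim dU) auto
    moreover have "((\<lambda>e. ennreal (cmod (?A 1 e - ?A (-1) e))) \<longlongrightarrow> 0) (at_right 0)"
    proof (rule tendsto_sandwich[OF _ _ tendsto_const dif])
      show "\<forall>\<^sub>F e in at_right 0. ennreal (cmod (?A 1 e - ?A (-1) e)) \<le>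
          (\<integral>\<^sup>+ x\<in>{-d..d}. ennreal (cmod (F (Complex x e) - F (Complex x (- e)))) \<partial>lborel)"
        using small
      proof eventually_elim
        case (elim e)
        note c1 = Fc[of "-d" d e 1] and c2 = Fc[of "-d" d e "-1"]
        have "?A 1 e - ?A (-1) e = integral {-d..d} (\<lambda>t. F (Complex t (1 * e))) - integral {-d..d} (\<lambda>t. F (Complex t ((-1) * e)))"
          using hor[of "-d" d e 1] hor[of "-d" d e "-1"] d elim by simp
        also have "\<dots> = integral {-d..d} (\<lambda>t. F (Complex t (1 * e)) - F (Complex t ((-1) * e)))"
          using c1 c2 elim by (intro integral_diff[symmetric] integrable_continuous_real) auto
        finally have "?A 1 e - ?A (-1) e = integral {-d..d} (\<lambda>t. F (Complex t e) - F (Complex t (- e)))" by simp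
        moreover have "continuous_on {-d..d} (\<lambda>t. F (Complex t e) - F (Complex t (- e)))"
          using c1 c2 elim by (intro continuous_on_diff) auto
        ultimately show ?case using norm_integral_le_nn_integral by simp
      qed
    qed simp
    ultimately have "ennreal (cmod ((Ps 1 (of_real d) - Ps 1 (of_real (- d))) - (Ps (-1) (of_real d) - Ps (-1) (of_real (- d))))) = 0"
      by (rule tendsto_unique[rotated]) simp
    hence "P1 (of_real d) - P1 (of_real (- d)) = P2' (of_real d) - P2' (of_real (- d))"
      by (simp add: Ps_def P2_def)
    thus ?thesis unfolding P2_def by (simp only: algebra_simps)
  qed
  have eqside: "P1 z = P2 z" if z: "z \<in> ball 0 r" "Re z \<noteq> 0" for z
  proof -
    have *: "P1 z = P2 z" if S: "open S" "connected S" "S \<subseteq> U 1" "S \<subseteq> U (-1)" "z \<in> S" "w \<in> S" "P1 w = P2 w" for S w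
    proof -
      have D: "((\<lambda>z. P1 z - P2 z) has_field_derivative 0) (at z)" if "z \<in> S" for z
        using DERIV_diff[OF P1 P2, of z] that S by auto
      hence "continuous_on S (\<lambda>z. P1 z - P2 z)"
        by (intro continuous_at_imp_continuous_on ballI) (metis DERIV_isCont)
      then obtain c where "\<And>x. x \<in> S \<Longrightarrow> P1 x - P2 x = c"
        using DERIV_zero_connected_constant[OF S(2,1), of "{}" "\<lambda>z. P1 z - P2 z"] D by auto
      from this[OF S(5)] this[OF S(6)] S(7) show ?thesis by simp
    qed
    show ?thesis
    proof (cases "0 < Re z")
      case True
      have "convex (ball 0 r \<inter> {z. 0 < Re z})" by (intro convex_Int convex_ball convex_halfspace_Re_gt)
      thus ?thesis
        using z True dU[of 1] d by (intro *[of "ball 0 r \<inter> {z. 0 < Re z}" "of_real d"])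
          (auto simp: U_def P2_def intro!: convex_connected open_Int open_halfspace_Re_gt)
    next
      case False
      have "convex (ball 0 r \<inter> {z. Re z < 0})" by (intro convex_Int convex_ball convex_halfspace_Re_lt)
      thus ?thesis
        using z False dU[of 1] d eqd by (intro *[of "ball 0 r \<inter> {z. Re z < 0}" "of_real (- d)"])
          (auto simp: U_def intro!: convex_connected open_Int open_halfspace_Re_lt)
    qed
  qed
  define P where "P z = (if 0 < Im z \<or> Re z \<noteq> 0 then P1 z else P2 z)" for z
  have PU: "P z = Ps s z" if "s = 1 \<or> s = -1" "z \<in> U s" for s z
    using that eqside[of z] by (auto simp: P_def Ps_def U_def)
  have PD: "(P has_field_derivative F z) (at z)" if z: "z \<in> ball 0 r - {0}" for z
  proof -
    have *: "(P has_field_derivative F z) (at z)" if s: "s = 1 \<or> s = -1" and zs: "z \<in> U s" for s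
      by (rule has_field_derivative_transform_within_open[OF Ps[OF s zs] Uop zs]) (simp add: PU[OF s])
    show ?thesis
    proof (cases "z \<in> U 1")
      case True thus ?thesis by (intro *) auto
    next
      case False
      hence "z \<in> U (-1)" using z by (auto simp: U_def complex_eq_iff)
      thus ?thesis by (intro *) auto
    qed
  qed
  have Phol: "P holomorphic_on ball 0 r - {0}"
    unfolding holomorphic_on_def field_differentiable_def using PD has_field_derivative_at_within by blast
  obtain e1 where e1: "0 < e1" "\<And>s w. s = 1 \<or> s = -1 \<Longrightarrow> dist w (of_real d) < e1 \<Longrightarrow> cmod (Ps s w - Ps s (of_real d)) < 1"
  proof -
    have "\<exists>e>0. \<forall>w. dist w (of_real d) < e \<longrightarrow> dist (Ps s w) (Ps s (of_real d)) < 1" if "s = 1 \<or> s = -1" for s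
      using Pc[OF that dU(1)] unfolding continuous_at_eps_delta by (metis zero_less_one)
    from this[of 1] this[of "-1"] obtain a b where
      "0 < a" "\<And>w. dist w (of_real d) < a \<Longrightarrow> dist (Ps 1 w) (Ps 1 (of_real d)) < 1"
      "0 < b" "\<And>w. dist w (of_real d) < b \<Longrightarrow> dist (Ps (-1) w) (Ps (-1) (of_real d)) < 1" by auto
    thus ?thesis by (intro that[of "min a b"]) (auto simp: dist_norm)
  qed
  have "eventually (\<lambda>e. (0 < e \<and> e < r / 2) \<and>
      (\<integral>\<^sup>+ x\<in>{-d..d}. ennreal (cmod (F (Complex x (1 * e)))) \<partial>lborel) \<le> ennreal K \<and>
      (\<integral>\<^sup>+ x\<in>{-d..d}. ennreal (cmod (F (Complex x ((-1) * e)))) \<partial>lborel) \<le> ennreal K) (at_right 0)"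
    using small bnd[of 1, OF disjI1[OF refl]] bnd[of "-1", OF disjI2[OF refl]] by eventually_elim auto
  then obtain e2 where e2': "0 < e2" "\<And>e. 0 < e \<Longrightarrow> e < e2 \<Longrightarrow> (0 < e \<and> e < r / 2) \<and>
      (\<integral>\<^sup>+ x\<in>{-d..d}. ennreal (cmod (F (Complex x (1 * e)))) \<partial>lborel) \<le> ennreal K \<and>
      (\<integral>\<^sup>+ x\<in>{-d..d}. ennreal (cmod (F (Complex x ((-1) * e)))) \<partial>lborel) \<le> ennreal K"
    unfolding eventually_at_right_field by blast
  have e2: "0 < e2" "\<And>s e. s = 1 \<or> s = -1 \<Longrightarrow> 0 < e \<Longrightarrow> e < e2 \<Longrightarrow> e < r / 2 \<and>
      (\<integral>\<^sup>+ x\<in>{-d..d}. ennreal (cmod (F (Complex x (s * e)))) \<partial>lborel) \<le> ennreal K"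
    using e2' by blast+
  define B where "B = cmod (P1 (of_real d)) + 1 + \<bar>K\<bar>"
  have Bnr: "cmod (P z) \<le> B" if z: "Im z \<noteq> 0" "\<bar>Im z\<bar> < min e1 e2" "\<bar>Re z\<bar> \<le> d" for z
  proof -
    define s where "s = sgn (Im z)"
    define e where "e = \<bar>Im z\<bar>"
    have s: "s = 1 \<or> s = -1" and ze: "z = Complex (Re z) (s * e)" and e: "0 < e" "e < e1" "e < e2"
      using z by (auto simp: s_def e_def sgn_if complex_eq_iff)
    note E = e2(2)[OF s e(1,3)]
    have zU: "z \<in> U s" by (subst ze, rule lineU) (use z(3) s e E in auto)
    \<comment> \<open>The value at z is compared with the value above or below d at the same height;
      the difference is an integral of F along a horizontal segment, bounded by K.\<close>
    have "Ps s (Complex d (s * e)) - Ps s z = integral {Re z..d} (\<lambda>t. F (Complex t (s * e)))"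
      using hor[of "Re z" d e s] z(3) s e E ze by auto
    hence "ennreal (cmod (Ps s (Complex d (s * e)) - Ps s z)) \<le>
        (\<integral>\<^sup>+ x\<in>{Re z..d}. ennreal (cmod (F (Complex x (s * e)))) \<partial>lborel)"
      by (simp only:, intro norm_integral_le_nn_integral Fc) (use z(3) s e E in auto)
    also have "\<dots> \<le> (\<integral>\<^sup>+ x\<in>{-d..d}. ennreal (cmod (F (Complex x (s * e)))) \<partial>lborel)"
      by (rule nn_integral_mono) (use z(3) in \<open>auto simp: indicator_def\<close>)
    also have "\<dots> \<le> ennreal K" using E by blast
    also have "\<dots> \<le> ennreal \<bar>K\<bar>" by (rule ennreal_leI) simp
    finally have "ennreal (cmod (Ps s (Complex d (s * e)) - Ps s z)) \<le> ennreal \<bar>K\<bar>" .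
    hence 1: "cmod (Ps s (Complex d (s * e)) - Ps s z) \<le> \<bar>K\<bar>" by simp
    have "dist (Complex d (s * e)) (of_real d) < e1"
      using e s by (auto simp: dist_norm cmod_def)
    hence 2: "cmod (Ps s (Complex d (s * e)) - Ps s (of_real d)) < 1" by (rule e1(2)[OF s])
    have 3: "Ps s (of_real d) = P1 (of_real d)" by (simp add: Ps_def P2_def)
    have "cmod (Ps s z) \<le> cmod (Ps s (of_real d)) + cmod (Ps s (Complex d (s * e)) - Ps s (of_real d)) + cmod (Ps s (Complex d (s * e)) - Ps s z)"
      using norm_triangle_ineq4[of "Ps s (of_real d) + (Ps s (Complex d (s * e)) - Ps s (of_real d))" "Ps s (Complex d (s * e)) - Ps s z"]
        norm_triangle_ineq[of "Ps s (of_real d)" "Ps s (Complex d (s * e)) - Ps s (of_real d)"] by simp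
    thus ?thesis using 1 2 3 PU[OF s zU] by (simp add: B_def)
  qed
  have "eventually (\<lambda>z. cmod (P z) \<le> B) (at 0)"
    unfolding eventually_at
  proof (intro exI[of _ "min (min e1 e2) d"] conjI ballI impI)
    show "0 < min (min e1 e2) d" using e1 e2 d by auto
    fix z :: complex assume z: "z \<noteq> 0 \<and> dist z 0 < min (min e1 e2) d"
    have zz: "\<bar>Im z\<bar> < min e1 e2" "\<bar>Re z\<bar> \<le> d" using z abs_Im_le_cmod[of z] abs_Re_le_cmod[of z] by auto
    show "cmod (P z) \<le> B"
    proof (cases "Im z = 0")
      case False thus ?thesis using Bnr zz by blast
    next
      case True
      hence zr: "z = of_real (Re z)" by (simp add: complex_eq_iff)
      have zU: "z \<in> U 1" using z d True by (auto simp: U_def complex_eq_iff)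
      have "((\<lambda>e. Ps 1 (Complex (Re z) (1 * e))) \<longlongrightarrow> Ps 1 (of_real (Re z))) (at_right 0)"
        by (rule lim) (use zU zr in auto)
      moreover have "eventually (\<lambda>e. Ps 1 (Complex (Re z) (1 * e)) = P (Complex (Re z) e)) (at_right 0)"
        using small by eventually_elim (use PU[of 1, OF _ lineU] zz(2) in \<open>auto simp: abs_le_iff\<close>)
      ultimately have L: "((\<lambda>e. P (Complex (Re z) e)) \<longlongrightarrow> Ps 1 z) (at_right 0)"
        using zr by (auto intro: Lim_transform_eventually)
      have "eventually (\<lambda>e. cmod (P (Complex (Re z) e)) \<le> B) (at_right 0)"
        using eventually_at_right_real[of 0 "min e1 e2"] e1(1) e2(1)
        by (auto elim!: eventually_mono intro!: Bnr simp: zz)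
      from tendsto_upperbound[OF tendsto_norm[OF L] this] have "cmod (Ps 1 z) \<le> B" by simp
      thus ?thesis using PU[of 1 z] zU by simp
    qed
  qed
  \<comment> \<open>The glued primitive is bounded, so it extends holomorphically to 0. F is then
    the derivative of a holomorphic function, which excludes essential singularities as
    well.\<close>
  hence "\<exists>g. g holomorphic_on ball 0 r \<and> (\<forall>z\<in>ball 0 r - {0}. g z = P z)"
    using r by (subst holomorphic_on_extend_bounded[OF Phol]) auto
  then obtain g where g: "g holomorphic_on ball 0 r" "\<And>z. z \<in> ball 0 r - {0} \<Longrightarrow> g z = P z" by blast
  have Fg: "F z = deriv g z" if z: "z \<in> ball 0 r - {0}" for z
  proof -
    have "(g has_field_derivative F z) (at z)"
      by (rule has_field_derivative_transform_within_open[OF PD[OF z] open_delete[OF open_ball] z]) (simp add: g(2))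
    thus ?thesis by (simp add: DERIV_imp_deriv)
  qed
  have "deriv g holomorphic_on ball 0 r" by (rule holomorphic_deriv[OF g(1) open_ball])
  hence "isCont (deriv g) 0" using r holomorphic_on_imp_continuous_on by (force simp: continuous_on_eq_continuous_at)
  hence "deriv g \<in> O[at 0](\<lambda>_. 1)" by (intro bigoI_tendsto[of _ _ "deriv g 0"]) (auto simp: isCont_def)
  moreover have "eventually (\<lambda>z. F z = deriv g z) (at 0)"
    using eventually_at_ball[OF r, of 0 UNIV] eventually_neq_at_within[of 0 0 UNIV] by eventually_elim (use Fg in auto)
  ultimately show ?thesis by (subst landau_o.big.in_cong)
qed

section \<open>Uniqueness\<close>

lemma side_limit_norm_le:
  fixes D :: "complex \<Rightarrow> complex"
  assumes lim: "\<And>s x. s = 1 \<or> s = -1 \<Longrightarrow> x \<in> open_pieces bL bR \<Longrightarrow> (D \<longlongrightarrow> D0 x) (at (of_real x) within {z. 0 < s * Im z})"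
    and x: "x \<in> open_pieces bL bR"
    and bd: "\<And>z. Im z \<noteq> 0 \<Longrightarrow> dist z (of_real x) < d \<Longrightarrow> cmod (D z - v) \<le> B" and d: "0 < d"
  shows "cmod (D0 x - v) \<le> B"
proof -
  define X where "X i = inverse (real (Suc i))" for i
  have X: "0 < X i" "X \<longlonglongrightarrow> 0" for i
    unfolding X_def[abs_def] using LIMSEQ_inverse_real_of_nat by (simp_all add: field_simps)
  have s1: "(1::real) = 1 \<or> (1::real) = -1" by simp
  have L: "(\<lambda>i. D (Complex x (1 * X i))) \<longlonglongrightarrow> D0 x" by (rule seq_side_limit[OF s1 X lim[OF s1 x]])
  have ev: "eventually (\<lambda>i. cmod (D (Complex x (1 * X i)) - v) \<le> B) sequentially"
    using order_tendstoD(2)[OF X(2) d]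
  proof eventually_elim
    case (elim i)
    have "Complex x (X i) - of_real x = Complex 0 (X i)" by (simp add: complex_eq_iff)
    hence "dist (Complex x (X i)) (of_real x) = X i" using X(1)[of i] by (simp add: dist_norm cmod_def)
    thus ?case using elim X(1)[of i] by (intro bd) auto
  qed
  show ?thesis by (rule tendsto_upperbound[OF tendsto_norm[OF tendsto_diff[OF L tendsto_const]] ev]) simp
qed

text \<open>Agreement of the limits from both sides makes the extension by D0 continuous, and a
  function continuous across a line and holomorphic on both sides of it is holomorphic.\<close>

lemma continuation_across_pieces:
  fixes D :: "complex \<Rightarrow> complex"
  assumes bLR: "bL < 0" "0 < bR" and D: "D holomorphic_on - real_seg bL bR"
    and lim: "\<And>s x. s = 1 \<or> s = -1 \<Longrightarrow> x \<in> open_pieces bL bR \<Longrightarrow> (D \<longlongrightarrow> D0 x) (at (of_real x) within {z. 0 < s * Im z})"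
  defines "F \<equiv> \<lambda>z. if z \<in> real_seg bL bR then D0 (Re z) else D z"
  shows "F holomorphic_on - {of_real bL, 0, of_real bR}"
proof -
  let ?X = "{complex_of_real bL, 0, complex_of_real bR}"
  have op: "open (- real_seg bL bR)" using closed_real_seg by (simp add: open_Compl)
  have "open (open_pieces bL bR)" by (auto simp: open_pieces_def)
  hence piece: "x \<in> open_pieces bL bR \<Longrightarrow> \<exists>r>0. \<forall>y. \<bar>y - x\<bar> < r \<longrightarrow> y \<in> open_pieces bL bR" for x
    unfolding open_dist dist_real_def by blast
  have cont: "isCont F z" if z: "z \<notin> ?X" for z
  proof (cases "z \<in> real_seg bL bR")
    case False
    have "isCont D z"
      using False op holomorphic_on_imp_continuous_on[OF D] by (simp add: continuous_on_eq_continuous_at)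
    moreover have "eventually (\<lambda>w. w \<in> - real_seg bL bR) (nhds z)" using op False by (intro eventually_nhds_in_open) auto
    hence "eventually (\<lambda>w. F w = D w) (nhds z)" by eventually_elim (simp add: F_def)
    ultimately show ?thesis by (simp cong: isCont_cong)
  next
    case True
    define x where "x = Re z"
    have zx: "z = of_real x" using True by (simp add: x_def real_seg_iff complex_eq_iff)
    have x: "x \<in> open_pieces bL bR" using True z unfolding zx by (auto simp: real_seg_iff open_pieces_def) 
    obtain r where r: "0 < r" "\<And>y. \<bar>y - x\<bar> < r \<Longrightarrow> y \<in> open_pieces bL bR" using piece[OF x] by blast
    have Fz: "F z = D0 x" using True by (simp add: F_def x_def)
    show ?thesis unfolding continuous_at_eps_delta
    proof (intro allI impI)
      fix e :: real assume e: "0 < e"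
      have side: "\<exists>d>0. \<forall>w. 0 < s * Im w \<longrightarrow> dist w z < d \<longrightarrow> dist (D w) (D0 x) < e / 2" if s: "s = 1 \<or> s = -1" for s
        using tendstoD[OF lim[OF s x], of "e / 2"] e unfolding zx eventually_at
        by (metis half_gt_zero mem_Collect_eq Im_complex_of_real mult_zero_right less_irrefl)
      obtain d1 d2 where d: "0 < d1" "\<And>w. 0 < Im w \<Longrightarrow> dist w z < d1 \<Longrightarrow> dist (D w) (D0 x) < e / 2"
        "0 < d2" "\<And>w. Im w < 0 \<Longrightarrow> dist w z < d2 \<Longrightarrow> dist (D w) (D0 x) < e / 2"
        using side[of 1] side[of "-1"] by auto
      define d where "d = min (min d1 d2) r"
      have d0: "0 < d" using d r by (simp add: d_def)
      have off: "cmod (D w - D0 x) \<le> e / 2" if "Im w \<noteq> 0" "dist w z < d" for w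
        using d(2,4)[of w] that by (cases "0 < Im w") (auto simp: d_def dist_norm)
      show "\<exists>d>0. \<forall>w. dist w z < d \<longrightarrow> dist (F w) (F z) < e"
      proof (intro exI[of _ d] conjI allI impI d0)
        fix w assume w: "dist w z < d"
        have "cmod (F w - D0 x) \<le> e / 2"
        proof (cases "Im w = 0")
          case False
          thus ?thesis using off[OF False w] by (simp add: F_def real_seg_iff)
        next
          case True
          define y where "y = Re w"
          have wy: "w = of_real y" using True by (simp add: y_def complex_eq_iff)
          have dy: "dist w z = \<bar>y - x\<bar>" unfolding wy zx by (simp add: dist_norm flip: of_real_diff)
          have y: "y \<in> open_pieces bL bR" using r(2)[of y] w dy by (simp add: d_def)
          \<comment> \<open>The continuity of D0 along the line is obtained here: an estimate that
            holds at all nearby nonreal points is inherited by the boundary value at y.\<close>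
          have "cmod (D0 y - D0 x) \<le> e / 2"
          proof (rule side_limit_norm_le[OF lim y])
            show "0 < d - dist w z" using w by simp
            fix v assume "Im v \<noteq> 0" "dist v (of_real y) < d - dist w z"
            thus "cmod (D v - D0 x) \<le> e / 2" using dist_triangle[of v z w] unfolding wy by (intro off) auto
          qed
          moreover have "F w = D0 y" using y bLR by (auto simp: F_def real_seg_iff wy open_pieces_def)
          ultimately show ?thesis by simp
        qed
        thus "dist (F w) (F z) < e" using e by (simp add: Fz dist_norm)
      qed
    qed
  qed
  have half: "F holomorphic_on - ?X \<inter> S" if "S \<subseteq> {z. Im z \<noteq> 0}" for S
  proof (rule holomorphic_transform[of D])
    show "D holomorphic_on - ?X \<inter> S" using that by (intro holomorphic_on_subset[OF D]) (auto simp: real_seg_iff)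
    show "\<And>z. z \<in> - ?X \<inter> S \<Longrightarrow> D z = F z" using that by (auto simp: F_def real_seg_iff)
  qed
  show ?thesis
  proof (rule holomorphic_on_paste_across_line[where d = \<i> and k = 0])
    show "open (- ?X)" by (intro open_Compl finite_imp_closed) simp
    show "F holomorphic_on - ?X \<inter> {z. \<i> \<bullet> z < 0}" "F holomorphic_on - ?X \<inter> {z. 0 < \<i> \<bullet> z}"
      by (intro half, force simp: inner_complex_def)+
    show "continuous_on (- ?X) F" using cont by (intro continuous_at_imp_continuous_on) auto
  qed simp
qed

text \<open>A logarithm is weaker than a simple pole, so (z - c) F tends to 0 and the singularity is
  removable.\<close>

lemma removable_log:
  fixes F :: "complex \<Rightarrow> complex"
  assumes F: "F holomorphic_on ball c r - {c}" and r: "0 < r"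
    and bd: "\<And>z. z \<noteq> c \<Longrightarrow> dist z c < r \<Longrightarrow> cmod (F z) \<le> C * (\<bar>ln (dist z c)\<bar> + pi)"
  shows "F \<in> O[at c](\<lambda>_. 1)"
proof -
  have c: "c \<in> interior (ball c r)" using r by simp
  have "((\<lambda>z. (z - c) * F z) \<longlongrightarrow> 0) (at c)"
  proof (rule Lim_null_comparison)
    have "((\<lambda>t. C * (t * (\<bar>ln t\<bar> + pi))) \<longlongrightarrow> 0) (at_right 0)" by real_asymp
    moreover have "filterlim (\<lambda>z. dist z c) (at_right 0) (at c)"
      by (auto simp: filterlim_at eventually_at_filter intro!: tendsto_eq_intros)
    ultimately show "((\<lambda>z. C * (dist z c * (\<bar>ln (dist z c)\<bar> + pi))) \<longlongrightarrow> 0) (at c)" by (rule filterlim_compose)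
    show "\<forall>\<^sub>F z in at c. norm ((z - c) * F z) \<le> C * (dist z c * (\<bar>ln (dist z c)\<bar> + pi))"
      unfolding eventually_at
    proof (intro exI[of _ r] conjI ballI impI r)
      fix z assume z: "z \<noteq> c \<and> dist z c < r"
      have "dist z c * cmod (F z) \<le> dist z c * (C * (\<bar>ln (dist z c)\<bar> + pi))"
        using z by (intro mult_left_mono bd) auto
      thus "norm ((z - c) * F z) \<le> C * (dist z c * (\<bar>ln (dist z c)\<bar> + pi))"
        by (simp add: norm_mult dist_norm mult_ac)
    qed
  qed
  hence "\<exists>g. g holomorphic_on ball c r \<and> (\<forall>z\<in>ball c r - {c}. g z = F z)"
    using holomorphic_on_extend_lim[OF F c] by blast
  hence "\<exists>B. eventually (\<lambda>z. cmod (F z) \<le> B) (at c)"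
    using holomorphic_on_extend_bounded[OF F c] by blast
  thus ?thesis by (auto intro: bigoI[where c = "B" for B])
qed

lemma cmod_Ln_le: "z \<noteq> 0 \<Longrightarrow> cmod (Ln z) \<le> \<bar>ln (cmod z)\<bar> + pi"
proof -
  assume z: "z \<noteq> 0"
  have "\<bar>Im (Ln z)\<bar> \<le> pi" using mpi_less_Im_Ln[OF z] Im_Ln_le_pi[OF z] by auto
  thus ?thesis using cmod_le[of "Ln z"] z by simp
qed

lemma no_jump_constant:
  fixes D :: "complex \<Rightarrow> complex"
  assumes bLR: "bL < 0" "0 < bR" and D: "D holomorphic_on - real_seg bL bR"
    and lim: "\<And>s x. s = 1 \<or> s = -1 \<Longrightarrow> x \<in> open_pieces bL bR \<Longrightarrow> (D \<longlongrightarrow> D0 x) (at (of_real x) within {z. 0 < s * Im z})"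
    and L1: "\<And>s. s = 1 \<or> s = -1 \<Longrightarrow>
      ((\<lambda>e. \<integral>\<^sup>+ x\<in>{bL..bR}. ennreal (cmod (D (Complex x (s * e)) - D0 x)) \<partial>lborel) \<longlongrightarrow> 0) (at_right 0)"
    and D0 [measurable]: "D0 \<in> borel_measurable borel"
    and D0fin: "(\<integral>\<^sup>+ x\<in>{bL..bR}. ennreal (cmod (D0 x)) \<partial>lborel) < \<infinity>"
    and grow: "\<And>c. c = bL \<or> c = bR \<Longrightarrow> D \<in> O[at (of_real c) within - real_seg bL bR](\<lambda>z. Ln (z - of_real c))"
    and inf: "(D \<longlongrightarrow> l) at_infinity" and z: "z \<in> - real_seg bL bR"
  shows "D z = l"
proof -
  let ?X = "{complex_of_real bL, 0, complex_of_real bR}"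
  define F where "F z = (if z \<in> real_seg bL bR then D0 (Re z) else D z)" for z
  have F: "F holomorphic_on - ?X"
    unfolding F_def[abs_def] by (rule continuation_across_pieces[OF bLR D lim])
  have FD: "F (Complex x y) = D (Complex x y)" if "y \<noteq> 0" for x y
    using Complex_notin_seg[OF that] by (simp add: F_def)
  have end_point: "F \<in> O[at (of_real c)](\<lambda>_. 1)" if c: "c = bL \<or> c = bR" for c
  proof -
    obtain C where C: "0 < C" "eventually (\<lambda>z. cmod (D z) \<le> C * cmod (Ln (z - of_real c))) (at (of_real c) within - real_seg bL bR)"
      using landau_o.bigE[OF grow[OF c]] by auto
    then obtain r0 where r0: "0 < r0" "\<And>z. z \<in> - real_seg bL bR \<Longrightarrow> z \<noteq> of_real c \<Longrightarrow> dist z (of_real c) < r0 \<Longrightarrow>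
        cmod (D z) \<le> C * cmod (Ln (z - of_real c))" by (auto simp: eventually_at)
    \<comment> \<open>The disc of this radius about bL or bR contains no other node, so its real
      points on the segment, other than the centre, belong to the open pieces.\<close>
    define r where "r = min r0 (min (- bL) bR)"
    have r: "0 < r" "r \<le> r0" "r \<le> - bL" "r \<le> bR" using r0 bLR by (auto simp: r_def)
    define B where "B z = C * (\<bar>ln (dist z (complex_of_real c))\<bar> + pi)" for z
    have off: "cmod (D z) \<le> B z" if "z \<in> - real_seg bL bR" "dist z (of_real c) < r" for z
    proof -
      have "z \<noteq> of_real c" using that(1) c bLR by (auto simp: real_seg_iff)
      thus ?thesis using r0(2)[of z] that r C(1) cmod_Ln_le[of "z - of_real c"]
        by (auto simp: B_def dist_norm intro: order_trans mult_left_mono)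
    qed
    have "cmod (F z) \<le> B z" if z: "z \<noteq> of_real c" "dist z (of_real c) < r" for z
    proof (cases "z \<in> real_seg bL bR")
      case False
      thus ?thesis using off[of z] z by (simp add: F_def)
    next
      case True
      define x where "x = Re z"
      have zx: "z = of_real x" using True by (simp add: x_def real_seg_iff complex_eq_iff)
      have dx: "dist z (of_real c) = \<bar>x - c\<bar>" unfolding zx by (simp add: dist_norm flip: of_real_diff)
      have "x \<noteq> c" using z zx by simp
      hence x: "x \<in> open_pieces bL bR"
        using True z(2) c r bLR unfolding dx zx by (auto simp: real_seg_iff open_pieces_def dist_real_def abs_if split: if_splits)
      have Bc: "isCont B z" unfolding B_def using z by (intro continuous_intros) auto
      \<comment> \<open>The bound B depends on the point. A boundary value therefore inherits it
        only up to an error e, by continuity of B, and e is arbitrary.\<close>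
      show ?thesis
      proof (rule field_le_epsilon)
        fix e :: real assume e: "0 < e"
        obtain d where d: "0 < d" "\<And>w. dist w z < d \<Longrightarrow> dist (B w) (B z) < e"
          using Bc e unfolding continuous_at_eps_delta by blast
        have "cmod (D0 x - 0) \<le> B z + e"
        proof (rule side_limit_norm_le[OF lim x])
          show "0 < min d (r - dist z (of_real c))" using d z by simp
          fix v assume v: "Im v \<noteq> 0" "dist v (of_real x) < min d (r - dist z (of_real c))"
          have "cmod (D v) \<le> B v"
            using v dist_triangle[of v "of_real c" z] unfolding zx by (intro off) (auto simp: real_seg_iff)
          also have "\<dots> \<le> B z + e" using d(2)[of v] v zx by (auto simp: dist_real_def)
          finally show "cmod (D v - 0) \<le> B z + e" by simp
        qed
        thus "cmod (F z) \<le> B z + e" using True by (simp add: F_def x_def)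
      qed
    qed
    moreover have "F holomorphic_on ball (of_real c) r - {of_real c}"
      by (rule holomorphic_on_subset[OF F]) (use c r bLR in \<open>auto simp: dist_norm simp flip: of_real_diff\<close>)
    ultimately show ?thesis unfolding B_def by (intro removable_log[OF _ r(1)])
  qed
  have zero: "F \<in> O[at 0](\<lambda>_. 1)"
  proof -
    define r where "r = min (- bL) bR"
    define d where "d = r / 3"
    have r: "0 < r" "r \<le> - bL" "r \<le> bR" and d: "0 < d" "d < r / 2" using bLR by (auto simp: r_def d_def)
    let ?N = "\<lambda>s e. \<integral>\<^sup>+ x\<in>{bL..bR}. ennreal (cmod (D (Complex x (s * e)) - D0 x)) \<partial>lborel"
    have Dm [measurable]: "(\<lambda>x. D (Complex x y)) \<in> borel_measurable borel" if "y \<noteq> 0" for y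
      by (rule line_measurable[OF holomorphic_on_imp_continuous_on[OF D] that])
    obtain K0 where K0: "(\<integral>\<^sup>+ x\<in>{bL..bR}. ennreal (cmod (D0 x)) \<partial>lborel) = ennreal K0" "0 \<le> K0"
      using D0fin by (cases "\<integral>\<^sup>+ x\<in>{bL..bR}. ennreal (cmod (D0 x)) \<partial>lborel") auto
    have pos: "eventually (\<lambda>e. (0::real) < e) (at_right 0)" by (simp add: eventually_at_filter)
    have tri: "(\<integral>\<^sup>+ x\<in>{-d..d}. ennreal (cmod (f x)) \<partial>lborel) \<le>
        (\<integral>\<^sup>+ x\<in>{bL..bR}. ennreal (cmod (g x)) \<partial>lborel) + (\<integral>\<^sup>+ x\<in>{bL..bR}. ennreal (cmod (h x)) \<partial>lborel)"
      if [measurable]: "g \<in> borel_measurable borel" "h \<in> borel_measurable borel" and le: "\<And>x. cmod (f x) \<le> cmod (g x) + cmod (h x)"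
      for f g h :: "real \<Rightarrow> complex"
    proof -
      have "(\<integral>\<^sup>+ x\<in>{-d..d}. ennreal (cmod (f x)) \<partial>lborel) \<le>
          (\<integral>\<^sup>+ x. ennreal (cmod (g x)) * indicator {bL..bR} x + ennreal (cmod (h x)) * indicator {bL..bR} x \<partial>lborel)"
      proof (rule nn_integral_mono)
        fix x
        have "ennreal (cmod (f x)) \<le> ennreal (cmod (g x)) + ennreal (cmod (h x))"
          using le[of x] by (simp add: ennreal_leI flip: ennreal_plus)
        thus "ennreal (cmod (f x)) * indicator {-d..d} x \<le>
            ennreal (cmod (g x)) * indicator {bL..bR} x + ennreal (cmod (h x)) * indicator {bL..bR} x"
          using r d by (cases "x \<in> {-d..d}") (auto simp: d_def indicator_def)
      qed
      also have "\<dots> = (\<integral>\<^sup>+ x\<in>{bL..bR}. ennreal (cmod (g x)) \<partial>lborel) + (\<integral>\<^sup>+ x\<in>{bL..bR}. ennreal (cmod (h x)) \<partial>lborel)"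
        by (intro nn_integral_add) measurable
      finally show ?thesis .
    qed
    show ?thesis
    proof (rule removable_L1_horizontal[OF _ d])
      show "F holomorphic_on ball 0 r - {0}"
        by (rule holomorphic_on_subset[OF F]) (use r bLR in auto)
      show "eventually (\<lambda>e. (\<integral>\<^sup>+ x\<in>{-d..d}. ennreal (cmod (F (Complex x (s * e)))) \<partial>lborel) \<le> ennreal (1 + K0)) (at_right 0)"
        if s: "s = 1 \<or> s = -1" for s
        using order_tendstoD(2)[OF L1[OF s] zero_less_one] pos
      proof eventually_elim
        case (elim e)
        have y: "s * e \<noteq> 0" using s elim by auto
        have "(\<integral>\<^sup>+ x\<in>{-d..d}. ennreal (cmod (F (Complex x (s * e)))) \<partial>lborel) \<le> ?N s e + (\<integral>\<^sup>+ x\<in>{bL..bR}. ennreal (cmod (D0 x)) \<partial>lborel)"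
          by (rule tri, use Dm[OF y] in measurable) (use norm_triangle_ineq[of "D (Complex x (s * e)) - D0 x" "D0 x" for x] FD[OF y] in simp)
        also have "\<dots> \<le> 1 + ennreal K0" using elim K0(1) by (intro add_mono) auto
        also have "\<dots> = ennreal (1 + K0)" using K0 by simp
        finally show ?case .
      qed
      have lim0: "((\<lambda>e. ?N 1 e + ?N (-1) e) \<longlongrightarrow> 0 + 0) (at_right 0)"
        by (intro tendsto_add L1) auto
      show "((\<lambda>e. \<integral>\<^sup>+ x\<in>{-d..d}. ennreal (cmod (F (Complex x e) - F (Complex x (- e)))) \<partial>lborel) \<longlongrightarrow> 0) (at_right 0)"
      proof (rule tendsto_sandwich[OF _ _ tendsto_const])
        show "((\<lambda>e. ?N 1 e + ?N (-1) e) \<longlongrightarrow> 0) (at_right 0)" using lim0 by simp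
        show "\<forall>\<^sub>F e in at_right 0. (\<integral>\<^sup>+ x\<in>{-d..d}. ennreal (cmod (F (Complex x e) - F (Complex x (- e)))) \<partial>lborel) \<le> ?N 1 e + ?N (-1) e"
          using pos
        proof eventually_elim
          case (elim e)
          have y: "1 * e \<noteq> 0" "(-1) * e \<noteq> 0" using elim by auto
          show ?case
          proof (rule tri)
            show "(\<lambda>x. D (Complex x (1 * e)) - D0 x) \<in> borel_measurable borel" using Dm[OF y(1)] by measurable
            show "(\<lambda>x. D (Complex x ((-1) * e)) - D0 x) \<in> borel_measurable borel" using Dm[OF y(2)] by measurable
            show "cmod (F (Complex x e) - F (Complex x (- e))) \<le> cmod (D (Complex x (1 * e)) - D0 x) + cmod (D (Complex x ((-1) * e)) - D0 x)" for x
              using norm_triangle_ineq4[of "D (Complex x e) - D0 x" "D (Complex x (- e)) - D0 x"] FD[of e x] FD[of "-e" x] elim by simp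
          qed
        qed
      qed simp
    qed
  qed
  have "\<exists>g. g holomorphic_on UNIV \<and> (\<forall>z\<in>UNIV - ?X. g z = F z)"
    by (rule removable_singularities) (use F end_point[of bL] end_point[of bR] zero in \<open>auto simp: Compl_eq_Diff_UNIV\<close>)
  then obtain g where g: "g holomorphic_on UNIV" "\<And>z. z \<notin> ?X \<Longrightarrow> g z = F z" by auto
  have gD: "g w = D w" if "w \<in> - real_seg bL bR" for w
  proof -
    have "w \<notin> ?X" using that bLR by (auto simp: real_seg_iff)
    thus ?thesis using g(2)[of w] that by (simp add: F_def)
  qed
  have "bounded (real_seg bL bR)"
    unfolding real_seg_def by (intro compact_imp_bounded compact_continuous_image continuous_intros) auto
  then obtain R where R: "\<And>w. w \<in> real_seg bL bR \<Longrightarrow> cmod w \<le> R" by (auto simp: bounded_iff)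
  have "eventually (\<lambda>w. g w = D w) at_infinity"
    unfolding eventually_at_infinity using R gD by (intro exI[of _ "R + 1"]) (force intro!: gD)
  hence "(g \<longlongrightarrow> l) at_infinity" using inf by (simp add: tendsto_cong)
  hence "g z = l" by (rule Liouville_weak[OF g(1)])
  thus ?thesis using gD[OF z] by simp
qed

no_notation fps_nth (infixl "$" 75)

section \<open>Products of square integrable boundary values\<close>

lemma Cauchy_Schwarz_set_nn_integral:
  fixes p q :: "real \<Rightarrow> complex"
  assumes [measurable]: "p \<in> borel_measurable borel" "q \<in> borel_measurable borel"
  shows "(\<integral>\<^sup>+ x\<in>{A..B}. ennreal (cmod (p x * q x)) \<partial>lborel)\<^sup>2 \<le>
    (\<integral>\<^sup>+ x\<in>{A..B}. ennreal ((cmod (p x))\<^sup>2) \<partial>lborel) * (\<integral>\<^sup>+ x\<in>{A..B}. ennreal ((cmod (q x))\<^sup>2) \<partial>lborel)"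
proof -
  have 1: "ennreal (cmod (p x * q x)) * indicator {A..B} x =
      (ennreal (cmod (p x)) * indicator {A..B} x) * (ennreal (cmod (q x)) * indicator {A..B} x)" for x
    by (auto simp: indicator_def norm_mult ennreal_mult)
  have 2: "ennreal ((cmod (f x))\<^sup>2) * indicator {A..B} x = (ennreal (cmod (f x)) * indicator {A..B} x)\<^sup>2" for f :: "real \<Rightarrow> complex" and x
    by (auto simp: indicator_def power2_eq_square ennreal_mult)
  show ?thesis unfolding 1 2 by (rule Cauchy_Schwarz_nn_integral) measurable
qed

text \<open>Lets the Cauchy-Schwarz inequality be used in its squared form, without square roots of
  extended reals.\<close>

lemma ennreal_square_tendsto_0:
  fixes X :: "'a \<Rightarrow> ennreal"
  assumes Y: "(Y \<longlongrightarrow> 0) F" and le: "eventually (\<lambda>e. (X e)\<^sup>2 \<le> Y e) F"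
  shows "(X \<longlongrightarrow> 0) F"
proof (rule order_tendstoI)
  fix a :: ennreal assume "0 < a"
  hence "0 < a\<^sup>2" by (simp add: zero_less_iff_neq_zero)
  from order_tendstoD(2)[OF Y this] le show "eventually (\<lambda>e. X e < a) F"
  proof eventually_elim
    case (elim e)
    have "\<not> a\<^sup>2 \<le> (X e)\<^sup>2" using elim by auto
    thus ?case using power_mono[of a "X e" 2] by (force simp: not_le[symmetric])
  qed
qed simp

definition side_value :: "real \<Rightarrow> real \<Rightarrow> real \<Rightarrow> (complex \<Rightarrow> complex) \<Rightarrow> (real \<Rightarrow> complex) \<Rightarrow> bool" where
  "side_value bL bR s f fp \<longleftrightarrow>
    (\<forall>x\<in>open_pieces bL bR. (f \<longlongrightarrow> fp x) (at (of_real x) within {z. 0 < s * Im z})) \<and>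
    set_integrable lborel {bL..bR} (\<lambda>x. (cmod (fp x))\<^sup>2) \<and>
    ((\<lambda>\<epsilon>. L2_dist_sq bL bR (\<lambda>x. f (Complex x (s * \<epsilon>))) fp) \<longlongrightarrow> 0) (at_right 0)"

text \<open>\<open>side_value\<close> provides measurability only for the squared modulus of fp. A
  measurable representative is obtained from the boundary limits instead; it agrees with fp off the
  nodes, hence almost everywhere on the segment.\<close>

lemma side_value_normalise:
  fixes f :: "complex \<Rightarrow> complex"
  assumes f: "continuous_on (- real_seg bL bR) f" and s: "s = 1 \<or> s = -1" and v: "side_value bL bR s f fp"
  obtains gp where "gp \<in> borel_measurable borel" "\<forall>x\<in>open_pieces bL bR. gp x = fp x"
    "((\<lambda>e. \<integral>\<^sup>+ x\<in>{bL..bR}. ennreal ((cmod (f (Complex x (s * e)) - gp x))\<^sup>2) \<partial>lborel) \<longlongrightarrow> 0) (at_right 0)"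
    "(\<integral>\<^sup>+ x\<in>{bL..bR}. ennreal ((cmod (gp x))\<^sup>2) \<partial>lborel) < \<infinity>"
proof -
  define gp where "gp x = (if x \<in> open_pieces bL bR then fp x else 0)" for x
  have eq: "\<And>x. x \<in> open_pieces bL bR \<Longrightarrow> gp x = fp x" by (simp add: gp_def)
  show thesis
  proof (rule that)
    show "\<forall>x\<in>open_pieces bL bR. gp x = fp x" by (simp add: eq)
    show "gp \<in> borel_measurable borel"
      unfolding gp_def[abs_def] using v by (intro boundary_measurable[OF f s]) (auto simp: side_value_def)
    show "((\<lambda>e. \<integral>\<^sup>+ x\<in>{bL..bR}. ennreal ((cmod (f (Complex x (s * e)) - gp x))\<^sup>2) \<partial>lborel) \<longlongrightarrow> 0) (at_right 0)"
      using v L2_dist_sq_cong[OF eq, where bL = bL and bR = bR] by (simp add: side_value_def L2_dist_sq_def)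
    have "(\<integral>\<^sup>+ x\<in>{bL..bR}. ennreal ((cmod (gp x))\<^sup>2) \<partial>lborel) = (\<integral>\<^sup>+ x. ennreal (norm (indicator {bL..bR} x *\<^sub>R (cmod (fp x))\<^sup>2)) \<partial>lborel)"
      by (rule nn_integral_cong_AE, rule eventually_mono[OF AE_open_pieces[of bL bR]]) (auto simp: eq indicator_def)
    also have "\<dots> < \<infinity>"
      using v unfolding side_value_def set_integrable_def integrable_iff_bounded by blast
    finally show "(\<integral>\<^sup>+ x\<in>{bL..bR}. ennreal ((cmod (gp x))\<^sup>2) \<partial>lborel) < \<infinity>" .
  qed
qed

text \<open>The difference of the products is split as (p - p0) q0 + p0 (q - q0) + (p - p0) (q -
  q0), with p, q on the line and p0, q0 on the boundary. By Cauchy-Schwarz each term tends to 0 in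
  the mean, given just the finite norms of the boundary values and the convergence of the
  differences.\<close>

lemma side_value_product:
  fixes f g :: "complex \<Rightarrow> complex"
  assumes f: "continuous_on (- real_seg bL bR) f" and g: "continuous_on (- real_seg bL bR) g"
    and s: "s = 1 \<or> s = -1" and fp: "side_value bL bR s f fp" and gp: "side_value bL bR s g gp"
  obtains P where "P \<in> borel_measurable borel" "\<forall>x\<in>open_pieces bL bR. P x = fp x * gp x"
    "((\<lambda>e. \<integral>\<^sup>+ x\<in>{bL..bR}. ennreal (cmod (f (Complex x (s * e)) * g (Complex x (s * e)) - P x)) \<partial>lborel) \<longlongrightarrow> 0) (at_right 0)"
    "(\<integral>\<^sup>+ x\<in>{bL..bR}. ennreal (cmod (P x)) \<partial>lborel) < \<infinity>"
proof -
  obtain f0 where [measurable]: "f0 \<in> borel_measurable borel" and f0: "\<forall>x\<in>open_pieces bL bR. f0 x = fp x"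
    "((\<lambda>e. \<integral>\<^sup>+ x\<in>{bL..bR}. ennreal ((cmod (f (Complex x (s * e)) - f0 x))\<^sup>2) \<partial>lborel) \<longlongrightarrow> 0) (at_right 0)"
    "(\<integral>\<^sup>+ x\<in>{bL..bR}. ennreal ((cmod (f0 x))\<^sup>2) \<partial>lborel) < \<infinity>"
    by (rule side_value_normalise[OF f s fp])
  obtain g0 where [measurable]: "g0 \<in> borel_measurable borel" and g0: "\<forall>x\<in>open_pieces bL bR. g0 x = gp x"
    "((\<lambda>e. \<integral>\<^sup>+ x\<in>{bL..bR}. ennreal ((cmod (g (Complex x (s * e)) - g0 x))\<^sup>2) \<partial>lborel) \<longlongrightarrow> 0) (at_right 0)"
    "(\<integral>\<^sup>+ x\<in>{bL..bR}. ennreal ((cmod (g0 x))\<^sup>2) \<partial>lborel) < \<infinity>"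
    by (rule side_value_normalise[OF g s gp])
  define I where "I h = (\<integral>\<^sup>+ x\<in>{bL..bR}. ennreal (cmod (h x)) \<partial>lborel)" for h :: "real \<Rightarrow> complex"
  define Q where "Q h = (\<integral>\<^sup>+ x\<in>{bL..bR}. ennreal ((cmod (h x))\<^sup>2) \<partial>lborel)" for h :: "real \<Rightarrow> complex"
  have CS: "(I (\<lambda>x. p x * q x))\<^sup>2 \<le> Q p * Q q" if "p \<in> borel_measurable borel" "q \<in> borel_measurable borel" for p q
    unfolding I_def Q_def by (rule Cauchy_Schwarz_set_nn_integral[OF that])
  let ?F = "\<lambda>e x. f (Complex x (s * e)) - f0 x" and ?G = "\<lambda>e x. g (Complex x (s * e)) - g0 x"
  have QF: "((\<lambda>e. Q (?F e)) \<longlongrightarrow> 0) (at_right 0)" and QG: "((\<lambda>e. Q (?G e)) \<longlongrightarrow> 0) (at_right 0)"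
    using f0(2) g0(2) by (simp_all add: Q_def)
  have Qfin: "Q f0 < top" "Q g0 < top" using f0(3) g0(3) by (simp_all add: Q_def)
  have pos: "eventually (\<lambda>e. (0::real) < e) (at_right 0)" by (simp add: eventually_at_filter)
  have Fm: "?F e \<in> borel_measurable borel" and Gm: "?G e \<in> borel_measurable borel" if "0 < e" for e
  proof -
    have y: "s * e \<noteq> 0" using s that by auto
    show "?F e \<in> borel_measurable borel" using line_measurable[OF f y] by measurable
    show "?G e \<in> borel_measurable borel" using line_measurable[OF g y] by measurable
  qed
  have QQ: "((\<lambda>e. Q (?F e) * Q g0) \<longlongrightarrow> 0) (at_right 0)" "((\<lambda>e. Q f0 * Q (?G e)) \<longlongrightarrow> 0) (at_right 0)"
    "((\<lambda>e. Q (?F e) * Q (?G e)) \<longlongrightarrow> 0) (at_right 0)"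
    using tendsto_mult_ennreal[OF QF tendsto_const, of "Q g0"] tendsto_mult_ennreal[OF tendsto_const QG, of "Q f0"]
      tendsto_mult_ennreal[OF QF QG] Qfin by auto
  have l1: "((\<lambda>e. I (\<lambda>x. ?F e x * g0 x)) \<longlongrightarrow> 0) (at_right 0)"
    by (rule ennreal_square_tendsto_0[OF QQ(1)], rule eventually_mono[OF pos]) (intro CS Fm, auto)
  have l2: "((\<lambda>e. I (\<lambda>x. f0 x * ?G e x)) \<longlongrightarrow> 0) (at_right 0)"
    by (rule ennreal_square_tendsto_0[OF QQ(2)], rule eventually_mono[OF pos]) (intro CS Gm, auto)
  have l3: "((\<lambda>e. I (\<lambda>x. ?F e x * ?G e x)) \<longlongrightarrow> 0) (at_right 0)"
    by (rule ennreal_square_tendsto_0[OF QQ(3)], rule eventually_mono[OF pos]) (intro CS Fm Gm, auto)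
  have "((\<lambda>e. I (\<lambda>x. ?F e x * g0 x) + I (\<lambda>x. f0 x * ?G e x) + I (\<lambda>x. ?F e x * ?G e x)) \<longlongrightarrow> 0 + 0 + 0) (at_right 0)"
    by (intro tendsto_add l1 l2 l3)
  hence lsum: "((\<lambda>e. I (\<lambda>x. ?F e x * g0 x) + I (\<lambda>x. f0 x * ?G e x) + I (\<lambda>x. ?F e x * ?G e x)) \<longlongrightarrow> 0) (at_right 0)" by simp
  have "((\<lambda>e. I (\<lambda>x. f (Complex x (s * e)) * g (Complex x (s * e)) - f0 x * g0 x)) \<longlongrightarrow> 0) (at_right 0)"
  proof (rule tendsto_sandwich[OF _ _ tendsto_const lsum])
    show "\<forall>\<^sub>F e in at_right 0. I (\<lambda>x. f (Complex x (s * e)) * g (Complex x (s * e)) - f0 x * g0 x)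
        \<le> I (\<lambda>x. ?F e x * g0 x) + I (\<lambda>x. f0 x * ?G e x) + I (\<lambda>x. ?F e x * ?G e x)"
      using pos
    proof eventually_elim
      case (elim e)
      note [measurable] = Fm[OF elim] Gm[OF elim]
      have "I (\<lambda>x. f (Complex x (s * e)) * g (Complex x (s * e)) - f0 x * g0 x) \<le>
         (\<integral>\<^sup>+ x. ennreal (cmod (?F e x * g0 x)) * indicator {bL..bR} x + ennreal (cmod (f0 x * ?G e x)) * indicator {bL..bR} x
            + ennreal (cmod (?F e x * ?G e x)) * indicator {bL..bR} x \<partial>lborel)"
        unfolding I_def
      proof (rule nn_integral_mono)
        fix x
        have *: "cmod (p * q - p0 * q0) \<le> cmod ((p - p0) * q0) + cmod (p0 * (q - q0)) + cmod ((p - p0) * (q - q0))" for p q p0 q0 :: complex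
        proof -
          have "p * q - p0 * q0 = (p - p0) * q0 + p0 * (q - q0) + (p - p0) * (q - q0)" by (simp add: algebra_simps)
          thus ?thesis using norm_triangle_ineq[of "(p - p0) * q0 + p0 * (q - q0)" "(p - p0) * (q - q0)"]
              norm_triangle_ineq[of "(p - p0) * q0" "p0 * (q - q0)"] by simp
        qed
        have "ennreal (cmod (f (Complex x (s * e)) * g (Complex x (s * e)) - f0 x * g0 x)) \<le>
            ennreal (cmod (?F e x * g0 x)) + ennreal (cmod (f0 x * ?G e x)) + ennreal (cmod (?F e x * ?G e x))"
          by (simp only: ennreal_plus[symmetric] norm_ge_zero add_nonneg_nonneg) (rule ennreal_leI, rule *)
        thus "ennreal (cmod (f (Complex x (s * e)) * g (Complex x (s * e)) - f0 x * g0 x)) * indicator {bL..bR} x \<le>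
            ennreal (cmod (?F e x * g0 x)) * indicator {bL..bR} x + ennreal (cmod (f0 x * ?G e x)) * indicator {bL..bR} x
            + ennreal (cmod (?F e x * ?G e x)) * indicator {bL..bR} x"
          by (cases "x \<in> {bL..bR}") auto
      qed
      also have "\<dots> = I (\<lambda>x. ?F e x * g0 x) + I (\<lambda>x. f0 x * ?G e x) + I (\<lambda>x. ?F e x * ?G e x)"
        unfolding I_def by (subst nn_integral_add, measurable, subst nn_integral_add, measurable)
      finally show ?case .
    qed
  qed simp
  moreover have "I (\<lambda>x. f0 x * g0 x) < top"
  proof (rule ccontr)
    assume "\<not> I (\<lambda>x. f0 x * g0 x) < top"
    hence "I (\<lambda>x. f0 x * g0 x) = top" by (simp add: less_top[symmetric])
    hence "top \<le> Q f0 * Q g0" using CS[of f0 g0] by (simp add: ennreal_top_mult power2_eq_square)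
    thus False using Qfin ennreal_mult_less_top[of "Q f0" "Q g0"] by auto
  qed
  ultimately show thesis
    using f0(1) g0(1) by (intro that[of "\<lambda>x. f0 x * g0 x"]) (auto simp: I_def)
qed

text \<open>The jump matrices act from the right, so each row of a solution satisfies the conditions
  by itself.\<close>

definition rhp_row :: "real \<Rightarrow> real \<Rightarrow> complex \<Rightarrow> (complex \<Rightarrow> complex) \<Rightarrow> (complex \<Rightarrow> complex) \<Rightarrow> bool" where
  "rhp_row bL bR r u1 u2 \<longleftrightarrow>
    u1 holomorphic_on - real_seg bL bR \<and> u2 holomorphic_on - real_seg bL bR \<and>
    (\<exists>p1 p2 m1 m2. side_value bL bR 1 u1 p1 \<and> side_value bL bR 1 u2 p2 \<and>
      side_value bL bR (-1) u1 m1 \<and> side_value bL bR (-1) u2 m2 \<and>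
      (\<forall>x\<in>{bL<..<0}. p1 x = m1 x \<and> p2 x = m1 x * (- \<i> * r) + m2 x) \<and>
      (\<forall>x\<in>{0<..<bR}. p1 x = m1 x + m2 x * (\<i> * r) \<and> p2 x = m2 x)) \<and>
    (let FL = at (complex_of_real bL) within - real_seg bL bR;
         FR = at (complex_of_real bR) within - real_seg bL bR
     in u1 \<in> O[FL](\<lambda>_. 1) \<and> u2 \<in> O[FL](\<lambda>z. Ln (z - of_real bL)) \<and>
        u1 \<in> O[FR](\<lambda>z. Ln (z - of_real bR)) \<and> u2 \<in> O[FR](\<lambda>_. 1))"

text \<open>The jump matrices have determinant 1, hence the determinant of two rows does not jump.
  At each end point every product pairs a bounded entry with a logarithmic one, and the boundary
  values are attained in the mean by \<open>side_value_product\<close>.\<close>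

lemma rhp_row_wronskian:
  assumes bLR: "bL < 0" "0 < bR" and u: "rhp_row bL bR r u1 u2" and v: "rhp_row bL bR r v1 v2"
    and inf: "(u1 \<longlongrightarrow> a1) at_infinity" "(u2 \<longlongrightarrow> a2) at_infinity" "(v1 \<longlongrightarrow> b1) at_infinity" "(v2 \<longlongrightarrow> b2) at_infinity"
    and z: "z \<in> - real_seg bL bR"
  shows "u1 z * v2 z - u2 z * v1 z = a1 * b2 - a2 * b1"
proof -
  let ?S = "- real_seg bL bR"
  have hol: "u1 holomorphic_on ?S" "u2 holomorphic_on ?S" "v1 holomorphic_on ?S" "v2 holomorphic_on ?S"
    using u v by (auto simp: rhp_row_def)
  note cont = hol[THEN holomorphic_on_imp_continuous_on]
  obtain p1 p2 m1 m2 where P: "side_value bL bR 1 u1 p1" "side_value bL bR 1 u2 p2"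
      "side_value bL bR (-1) u1 m1" "side_value bL bR (-1) u2 m2"
      "\<And>x. x \<in> {bL<..<0} \<Longrightarrow> p1 x = m1 x \<and> p2 x = m1 x * (- \<i> * r) + m2 x"
      "\<And>x. x \<in> {0<..<bR} \<Longrightarrow> p1 x = m1 x + m2 x * (\<i> * r) \<and> p2 x = m2 x"
    using u unfolding rhp_row_def by blast
  obtain q1 q2 n1 n2 where Q: "side_value bL bR 1 v1 q1" "side_value bL bR 1 v2 q2"
      "side_value bL bR (-1) v1 n1" "side_value bL bR (-1) v2 n2"
      "\<And>x. x \<in> {bL<..<0} \<Longrightarrow> q1 x = n1 x \<and> q2 x = n1 x * (- \<i> * r) + n2 x"
      "\<And>x. x \<in> {0<..<bR} \<Longrightarrow> q1 x = n1 x + n2 x * (\<i> * r) \<and> q2 x = n2 x"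
    using v unfolding rhp_row_def by blast
  let ?D = "\<lambda>z. u1 z * v2 z - u2 z * v1 z"
  have nojump: "p1 x * q2 x - p2 x * q1 x = m1 x * n2 x - m2 x * n1 x" if "x \<in> open_pieces bL bR" for x
  proof -
    from that consider "x \<in> {bL<..<0}" | "x \<in> {0<..<bR}" by (auto simp: open_pieces_def)
    thus ?thesis
    proof cases
      case 1 show ?thesis by (simp add: P(5)[OF 1] Q(5)[OF 1] algebra_simps)
    next
      case 2 show ?thesis by (simp add: P(6)[OF 2] Q(6)[OF 2] algebra_simps)
    qed
  qed
  have side: "\<exists>D0\<in>borel_measurable borel. (\<forall>x\<in>open_pieces bL bR. D0 x = f1 x * g2 x - f2 x * g1 x \<and>
        (?D \<longlongrightarrow> D0 x) (at (of_real x) within {z. 0 < s * Im z})) \<and>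
      ((\<lambda>e. \<integral>\<^sup>+ x\<in>{bL..bR}. ennreal (cmod (?D (Complex x (s * e)) - D0 x)) \<partial>lborel) \<longlongrightarrow> 0) (at_right 0) \<and>
      (\<integral>\<^sup>+ x\<in>{bL..bR}. ennreal (cmod (D0 x)) \<partial>lborel) < \<infinity>"
    if s: "s = 1 \<or> s = -1" and sv: "side_value bL bR s u1 f1" "side_value bL bR s u2 f2" "side_value bL bR s v1 g1" "side_value bL bR s v2 g2"
    for s f1 f2 g1 g2
  proof -
    obtain A where A [measurable]: "A \<in> borel_measurable borel" and A1: "\<forall>x\<in>open_pieces bL bR. A x = f1 x * g2 x"
      "((\<lambda>e. \<integral>\<^sup>+ x\<in>{bL..bR}. ennreal (cmod (u1 (Complex x (s * e)) * v2 (Complex x (s * e)) - A x)) \<partial>lborel) \<longlongrightarrow> 0) (at_right 0)"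
      "(\<integral>\<^sup>+ x\<in>{bL..bR}. ennreal (cmod (A x)) \<partial>lborel) < \<infinity>"
      by (rule side_value_product[OF cont(1,4) s sv(1,4)])
    obtain B where B [measurable]: "B \<in> borel_measurable borel" and B1: "\<forall>x\<in>open_pieces bL bR. B x = f2 x * g1 x"
      "((\<lambda>e. \<integral>\<^sup>+ x\<in>{bL..bR}. ennreal (cmod (u2 (Complex x (s * e)) * v1 (Complex x (s * e)) - B x)) \<partial>lborel) \<longlongrightarrow> 0) (at_right 0)"
      "(\<integral>\<^sup>+ x\<in>{bL..bR}. ennreal (cmod (B x)) \<partial>lborel) < \<infinity>"
      by (rule side_value_product[OF cont(2,3) s sv(2,3)])
    have diff: "(\<integral>\<^sup>+ x\<in>{bL..bR}. ennreal (cmod (p x - q x)) \<partial>lborel) \<le>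
        (\<integral>\<^sup>+ x\<in>{bL..bR}. ennreal (cmod (p x)) \<partial>lborel) + (\<integral>\<^sup>+ x\<in>{bL..bR}. ennreal (cmod (q x)) \<partial>lborel)"
      if [measurable]: "p \<in> borel_measurable borel" "q \<in> borel_measurable borel" for p q :: "real \<Rightarrow> complex"
    proof -
      have "(\<integral>\<^sup>+ x\<in>{bL..bR}. ennreal (cmod (p x - q x)) \<partial>lborel) \<le>
          (\<integral>\<^sup>+ x. ennreal (cmod (p x)) * indicator {bL..bR} x + ennreal (cmod (q x)) * indicator {bL..bR} x \<partial>lborel)"
        by (rule nn_integral_mono) (auto simp: indicator_def norm_triangle_ineq4 intro!: ennreal_leI simp flip: ennreal_plus)
      also have "\<dots> = (\<integral>\<^sup>+ x\<in>{bL..bR}. ennreal (cmod (p x)) \<partial>lborel) + (\<integral>\<^sup>+ x\<in>{bL..bR}. ennreal (cmod (q x)) \<partial>lborel)"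
        by (intro nn_integral_add) measurable
      finally show ?thesis .
    qed
    show ?thesis
    proof (intro bexI[of _ "\<lambda>x. A x - B x"] conjI ballI)
      show "(\<lambda>x. A x - B x) \<in> borel_measurable borel" by measurable
      fix x assume x: "x \<in> open_pieces bL bR"
      show eq: "A x - B x = f1 x * g2 x - f2 x * g1 x" using x by (simp add: A1 B1)
      show "(?D \<longlongrightarrow> A x - B x) (at (of_real x) within {z. 0 < s * Im z})"
        unfolding eq using sv x by (intro tendsto_intros) (auto simp: side_value_def)
    next
      have "((\<lambda>e. (\<integral>\<^sup>+ x\<in>{bL..bR}. ennreal (cmod (u1 (Complex x (s * e)) * v2 (Complex x (s * e)) - A x)) \<partial>lborel) +
          (\<integral>\<^sup>+ x\<in>{bL..bR}. ennreal (cmod (u2 (Complex x (s * e)) * v1 (Complex x (s * e)) - B x)) \<partial>lborel)) \<longlongrightarrow> 0 + 0) (at_right 0)"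
        by (intro tendsto_add A1 B1)
      hence l: "((\<lambda>e. (\<integral>\<^sup>+ x\<in>{bL..bR}. ennreal (cmod (u1 (Complex x (s * e)) * v2 (Complex x (s * e)) - A x)) \<partial>lborel) +
          (\<integral>\<^sup>+ x\<in>{bL..bR}. ennreal (cmod (u2 (Complex x (s * e)) * v1 (Complex x (s * e)) - B x)) \<partial>lborel)) \<longlongrightarrow> 0) (at_right 0)" by simp
      show "((\<lambda>e. \<integral>\<^sup>+ x\<in>{bL..bR}. ennreal (cmod (?D (Complex x (s * e)) - (A x - B x))) \<partial>lborel) \<longlongrightarrow> 0) (at_right 0)"
      proof (rule tendsto_sandwich[OF _ _ tendsto_const l])
        show "\<forall>\<^sub>F e in at_right 0. (\<integral>\<^sup>+ x\<in>{bL..bR}. ennreal (cmod (?D (Complex x (s * e)) - (A x - B x))) \<partial>lborel) \<le>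
            (\<integral>\<^sup>+ x\<in>{bL..bR}. ennreal (cmod (u1 (Complex x (s * e)) * v2 (Complex x (s * e)) - A x)) \<partial>lborel) +
            (\<integral>\<^sup>+ x\<in>{bL..bR}. ennreal (cmod (u2 (Complex x (s * e)) * v1 (Complex x (s * e)) - B x)) \<partial>lborel)"
        proof (rule eventually_mono)
          show "eventually (\<lambda>e. (0::real) < e) (at_right 0)" by (simp add: eventually_at_filter)
          fix e :: real assume "0 < e"
          hence y: "s * e \<noteq> 0" using s by auto
          note [measurable] = cont[THEN line_measurable, OF y]
          have eq: "?D w - (a - b) = (u1 w * v2 w - a) - (u2 w * v1 w - b)" for w a b by simp
          show "(\<integral>\<^sup>+ x\<in>{bL..bR}. ennreal (cmod (?D (Complex x (s * e)) - (A x - B x))) \<partial>lborel) \<le>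
            (\<integral>\<^sup>+ x\<in>{bL..bR}. ennreal (cmod (u1 (Complex x (s * e)) * v2 (Complex x (s * e)) - A x)) \<partial>lborel) +
            (\<integral>\<^sup>+ x\<in>{bL..bR}. ennreal (cmod (u2 (Complex x (s * e)) * v1 (Complex x (s * e)) - B x)) \<partial>lborel)"
            unfolding eq by (rule diff) measurable
        qed
      qed simp
      show "(\<integral>\<^sup>+ x\<in>{bL..bR}. ennreal (cmod (A x - B x)) \<partial>lborel) < \<infinity>"
        by (rule le_less_trans[OF diff[OF A B]]) (use A1(3) B1(3) in simp)
    qed
  qed
  obtain D1 where D1: "D1 \<in> borel_measurable borel" "\<And>x. x \<in> open_pieces bL bR \<Longrightarrow> D1 x = p1 x * q2 x - p2 x * q1 x"
      "\<And>x. x \<in> open_pieces bL bR \<Longrightarrow> (?D \<longlongrightarrow> D1 x) (at (of_real x) within {z. 0 < 1 * Im z})"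
      "((\<lambda>e. \<integral>\<^sup>+ x\<in>{bL..bR}. ennreal (cmod (?D (Complex x (1 * e)) - D1 x)) \<partial>lborel) \<longlongrightarrow> 0) (at_right 0)"
      "(\<integral>\<^sup>+ x\<in>{bL..bR}. ennreal (cmod (D1 x)) \<partial>lborel) < \<infinity>"
    using side[OF disjI1[OF refl] P(1,2) Q(1,2)] by blast
  obtain D2 where D2: "\<And>x. x \<in> open_pieces bL bR \<Longrightarrow> D2 x = m1 x * n2 x - m2 x * n1 x"
      "\<And>x. x \<in> open_pieces bL bR \<Longrightarrow> (?D \<longlongrightarrow> D2 x) (at (of_real x) within {z. 0 < (-1) * Im z})"
      "((\<lambda>e. \<integral>\<^sup>+ x\<in>{bL..bR}. ennreal (cmod (?D (Complex x ((-1) * e)) - D2 x)) \<partial>lborel) \<longlongrightarrow> 0) (at_right 0)"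
    using side[OF disjI2[OF refl] P(3,4) Q(3,4)] by blast
  have D12: "D1 x = D2 x" if "x \<in> open_pieces bL bR" for x using that by (simp add: D1(2) D2(1) nojump)
  have "(\<integral>\<^sup>+ x\<in>{bL..bR}. ennreal (cmod (h x - D1 x)) \<partial>lborel) = (\<integral>\<^sup>+ x\<in>{bL..bR}. ennreal (cmod (h x - D2 x)) \<partial>lborel)" for h
    by (rule nn_integral_cong_AE, rule eventually_mono[OF AE_open_pieces[of bL bR]]) (auto simp: D12 indicator_def)
  hence D2': "((\<lambda>e. \<integral>\<^sup>+ x\<in>{bL..bR}. ennreal (cmod (?D (Complex x ((-1) * e)) - D1 x)) \<partial>lborel) \<longlongrightarrow> 0) (at_right 0)"
    using D2(3) by simp
  show ?thesis
  proof (rule no_jump_constant[OF bLR _ _ _ D1(1,5) _ _ z])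
    show "?D holomorphic_on ?S" by (intro holomorphic_intros hol)
    show "(?D \<longlongrightarrow> a1 * b2 - a2 * b1) at_infinity" by (intro tendsto_intros inf)
    show "(?D \<longlongrightarrow> D1 x) (at (of_real x) within {z. 0 < s * Im z})" if "s = 1 \<or> s = -1" "x \<in> open_pieces bL bR" for s x
      using that(1) D1(3)[OF that(2)] D2(2)[OF that(2)] D12[OF that(2)] by auto
    show "((\<lambda>e. \<integral>\<^sup>+ x\<in>{bL..bR}. ennreal (cmod (?D (Complex x (s * e)) - D1 x)) \<partial>lborel) \<longlongrightarrow> 0) (at_right 0)" if "s = 1 \<or> s = -1" for s
      using that D1(4) D2' by blast
    have 1: "u1 \<in> O[at (of_real bL) within ?S](\<lambda>_. 1)" "v1 \<in> O[at (of_real bL) within ?S](\<lambda>_. 1)"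
        "u2 \<in> O[at (of_real bR) within ?S](\<lambda>_. 1)" "v2 \<in> O[at (of_real bR) within ?S](\<lambda>_. 1)"
      and 2: "u2 \<in> O[at (of_real bL) within ?S](\<lambda>z. Ln (z - of_real bL))" "v2 \<in> O[at (of_real bL) within ?S](\<lambda>z. Ln (z - of_real bL))"
        "u1 \<in> O[at (of_real bR) within ?S](\<lambda>z. Ln (z - of_real bR))" "v1 \<in> O[at (of_real bR) within ?S](\<lambda>z. Ln (z - of_real bR))"
      using u v by (auto simp: rhp_row_def Let_def)
    have L: "?D \<in> O[at (of_real bL) within ?S](\<lambda>z. Ln (z - of_real bL))"
      using landau_o.big.mult[OF 1(1) 2(2)] landau_o.big.mult[OF 2(1) 1(2)] by (intro sum_in_bigo) simp_all
    have R: "?D \<in> O[at (of_real bR) within ?S](\<lambda>z. Ln (z - of_real bR))"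
      using landau_o.big.mult[OF 2(3) 1(4)] landau_o.big.mult[OF 1(3) 2(4)] by (intro sum_in_bigo) simp_all
    show "?D \<in> O[at (of_real c) within ?S](\<lambda>z. Ln (z - of_real c))" if "c = bL \<or> c = bR" for c
      using that L R by blast
  qed
qed

section \<open>From rows back to matrices\<close>

lemma mat2_mult_right_nth:
  fixes A :: "complex^2^2"
  shows "(A ** mat2 p q r s) $ i $ 1 = A $ i $ 1 * p + A $ i $ 2 * r"
    "(A ** mat2 p q r s) $ i $ 2 = A $ i $ 1 * q + A $ i $ 2 * s"
  by (simp_all add: matrix_matrix_mult_def sum_2)

lemma RHP_solution_row:
  fixes G :: "complex \<Rightarrow> complex^2^2"
  assumes "RHP_solution bL bR l G"
  shows "rhp_row bL bR (recip l) (\<lambda>z. G z $ i $ 1) (\<lambda>z. G z $ i $ 2)"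
    and "((\<lambda>z. G z $ i $ j) \<longlongrightarrow> mat 1 $ i $ j) at_infinity"
proof -
  obtain Gp Gm where H: "analytic_off bL bR G" "boundary_values bL bR G Gp Gm" "jump_conditions bL bR l Gp Gm"
    "L2_boundary bL bR G Gp Gm" "endpoint_growth bL bR G" "normalised_at_infinity G"
    using assms by (auto simp: RHP_solution_def)
  have p: "side_value bL bR 1 (\<lambda>z. G z $ i $ j) (\<lambda>x. Gp x $ i $ j)" for j
    using H(2,4) unfolding side_value_def boundary_values_def L2_boundary_def open_pieces_def
    by (auto intro!: tendsto_vec_nth)
  have m: "side_value bL bR (-1) (\<lambda>z. G z $ i $ j) (\<lambda>x. Gm x $ i $ j)" for j
    using H(2,4) unfolding side_value_def boundary_values_def L2_boundary_def open_pieces_def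
    by (auto intro!: tendsto_vec_nth)
  show "rhp_row bL bR (recip l) (\<lambda>z. G z $ i $ 1) (\<lambda>z. G z $ i $ 2)"
    unfolding rhp_row_def
  proof (intro conjI exI)
    show "side_value bL bR 1 (\<lambda>z. G z $ i $ 1) (\<lambda>x. Gp x $ i $ 1)" "side_value bL bR 1 (\<lambda>z. G z $ i $ 2) (\<lambda>x. Gp x $ i $ 2)"
      "side_value bL bR (-1) (\<lambda>z. G z $ i $ 1) (\<lambda>x. Gm x $ i $ 1)" "side_value bL bR (-1) (\<lambda>z. G z $ i $ 2) (\<lambda>x. Gm x $ i $ 2)"
      by (rule p m)+
  qed (use H in \<open>auto simp: analytic_off_def jump_conditions_def mat2_mult_right_nth endpoint_growth_def Let_def\<close>)
  have "(\<lambda>z. G z $ i $ j - mat 1 $ i $ j) \<in> O[at_infinity](\<lambda>z. 1 / z)"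
    using H(6) by (simp add: normalised_at_infinity_def)
  then obtain C where C: "0 < C" "\<forall>\<^sub>F z in at_infinity. cmod (G z $ i $ j - mat 1 $ i $ j) \<le> C * cmod (1 / z)"
    by (auto elim: landau_o.bigE)
  have "((\<lambda>z. C * cmod (1 / z)) \<longlongrightarrow> C * cmod 0) at_infinity"
    by (intro tendsto_intros tendsto_divide_0[OF tendsto_const filterlim_ident])
  hence "((\<lambda>z. G z $ i $ j - mat 1 $ i $ j) \<longlongrightarrow> 0) at_infinity"
    by (intro Lim_null_comparison[OF C(2)]) simp
  thus "((\<lambda>z. G z $ i $ j) \<longlongrightarrow> mat 1 $ i $ j) at_infinity" by (rule LIM_zero_cancel)
qed

text \<open>Row i of G' and row i of G have the same determinants with both rows of G. The rows of G
  have determinant 1, so Cramer's rule recovers a row from these two numbers.\<close>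

lemma RHP_solution_unique:
  fixes G G' :: "complex \<Rightarrow> complex^2^2"
  assumes bLR: "bL < 0" "0 < bR" and G: "RHP_solution bL bR l G" and G': "RHP_solution bL bR l G'"
    and z: "z \<in> - real_seg bL bR"
  shows "G' z = G z"
proof -
  have W: "A z $ i $ 1 * B z $ j $ 2 - A z $ i $ 2 * B z $ j $ 1 =
      mat 1 $ i $ 1 * mat 1 $ j $ 2 - mat 1 $ i $ 2 * mat 1 $ j $ 1"
    if "RHP_solution bL bR l A" "RHP_solution bL bR l B" for A B :: "complex \<Rightarrow> complex^2^2" and i j
    by (rule rhp_row_wronskian[OF bLR RHP_solution_row(1)[OF that(1)] RHP_solution_row(1)[OF that(2)]
        RHP_solution_row(2)[OF that(1)] RHP_solution_row(2)[OF that(1)]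
        RHP_solution_row(2)[OF that(2)] RHP_solution_row(2)[OF that(2)] z])
  have *: "p = p' \<and> q = q'"
    if "p' * s - q' * r = d" "a * s - b * r = 1" "p' * b - q' * a = e" "p * s - q * r = d" "p * b - q * a = e" for p q p' q' a b r s d e :: complex
  proof -
    have "p = a * (p * s - q * r) - r * (p * b - q * a)" "q = b * (p * s - q * r) - s * (p * b - q * a)"
      "p' = a * (p' * s - q' * r) - r * (p' * b - q' * a)" "q' = b * (p' * s - q' * r) - s * (p' * b - q' * a)"
      using that(2) by algebra+
    thus ?thesis using that by metis
  qed
  have "G' z $ i $ 1 = G z $ i $ 1 \<and> G' z $ i $ 2 = G z $ i $ 2" for i
    by (rule *[where a = "G z $ 1 $ 1" and b = "G z $ 1 $ 2" and r = "G z $ 2 $ 1" and s = "G z $ 2 $ 2",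
        OF W[OF G G] _ W[OF G G] W[OF G' G] W[OF G' G]])
       (use W[OF G G, of 1 2] in \<open>simp add: mat_def\<close>)
  thus ?thesis by (simp add: vec_eq_iff forall_2)
qed

section \<open>Existence\<close>

text \<open>Points of K may lie outside A, for instance on the segment itself, whereas the estimates
  concern only nearby points of A.\<close>

lemma compact_local_bound:
  fixes f g :: "complex \<Rightarrow> real"
  assumes K: "compact K" and g: "\<And>w. w \<in> A \<Longrightarrow> 0 \<le> g w"
    and loc: "\<And>z. z \<in> K \<Longrightarrow> \<exists>d>0. \<exists>C. \<forall>w\<in>A. dist w z < d \<longrightarrow> f w \<le> C * g w"
  obtains C where "0 \<le> C" "\<And>w. w \<in> A \<Longrightarrow> w \<in> K \<Longrightarrow> f w \<le> C * g w"
proof -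
  obtain d C where dC: "\<And>z. z \<in> K \<Longrightarrow> 0 < d z" "\<And>z w. z \<in> K \<Longrightarrow> w \<in> A \<Longrightarrow> dist w z < d z \<Longrightarrow> f w \<le> C z * g w"
    using loc by metis
  have "K \<subseteq> (\<Union>z\<in>K. ball z (d z))" using dC(1) by force
  then obtain D where D: "D \<subseteq> K" "finite D" "K \<subseteq> (\<Union>z\<in>D. ball z (d z))"
    using compactE_image[OF K, of K "\<lambda>z. ball z (d z)"] by auto
  define M where "M = (\<Sum>z\<in>D. \<bar>C z\<bar>)"
  show thesis
  proof (rule that[of M])
    show "0 \<le> M" by (simp add: M_def sum_nonneg)
    fix w assume w: "w \<in> A" "w \<in> K"
    then obtain z where z: "z \<in> D" "dist w z < d z" using D(3) by (auto simp: dist_commute)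
    have "f w \<le> C z * g w" using z D(1) w by (intro dC) auto
    also have "C z \<le> \<bar>C z\<bar>" by simp
    also have "\<bar>C z\<bar> \<le> M" unfolding M_def using z D(2) by (intro member_le_sum) auto
    finally show "f w \<le> M * g w" using g[OF w(1)] by (simp add: mult_right_mono)
  qed
qed

lemma node_weight_ge:
  assumes "0 < b"
  shows "cmod z powr (- b) \<le> node_weight bL bR b z" "cmod (z - of_real bL) powr (- b) \<le> node_weight bL bR b z"
    "cmod (z - of_real bR) powr (- b) \<le> node_weight bL bR b z"
  unfolding node_weight_def by simp_all

text \<open>Away from the nodes f is locally bounded, up to both sides of the open pieces, and the
  weight is bounded below. At 0 the weight has the assumed growth, and at the ends it dominates the
  logarithm. Compactness of the disc makes the constants uniform.\<close>

lemma node_weight_bound: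
  fixes f :: "complex \<Rightarrow> complex"
  assumes bLR: "bL < 0" "0 < bR" and f: "f holomorphic_on - real_seg bL bR" and b: "0 < b"
    and lim: "\<And>s x. s = 1 \<or> s = -1 \<Longrightarrow> x \<in> open_pieces bL bR \<Longrightarrow> (f \<longlongrightarrow> v s x) (at (of_real x) within {z. 0 < s * Im z})"
    and ends: "\<And>c. c = bL \<or> c = bR \<Longrightarrow> \<exists>d>0. \<exists>C. \<forall>z\<in>- real_seg bL bR. cmod (z - of_real c) < d \<longrightarrow>
        cmod (f z) \<le> C * \<bar>ln (cmod (z - of_real c))\<bar> \<and> cmod (z - of_real c) < 1"
    and zero: "\<exists>d>0. \<exists>C. \<forall>z\<in>- real_seg bL bR. cmod z < d \<longrightarrow> cmod (f z) \<le> C * cmod z powr (- b)"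
  obtains C where "0 \<le> C" "\<And>z. z \<in> - real_seg bL bR \<Longrightarrow> cmod z \<le> bR - bL + 1 \<Longrightarrow> cmod (f z) \<le> C * node_weight bL bR b z"
proof -
  let ?R = "bR - bL + 1" and ?w = "node_weight bL bR b"
  define A where "A = - real_seg bL bR \<inter> cball 0 ?R"
  have op: "open (- real_seg bL bR)" using closed_real_seg by (simp add: open_Compl)
  \<comment> \<open>A lower bound of the weight on the disc; it turns a bound by a constant into a
    bound by the weight.\<close>
  define \<rho> where "\<rho> = ?R powr (- b)"
  have \<rho>: "0 < \<rho>" using bLR by (simp add: \<rho>_def)
  have w\<rho>: "\<rho> \<le> ?w z" if "z \<in> A" for z
  proof -
    have "z \<noteq> 0" "cmod z \<le> ?R" using that bLR by (auto simp: A_def real_seg_iff)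
    hence "\<rho> \<le> cmod z powr (- b)" unfolding \<rho>_def using b by (intro powr_mono2') auto
    thus ?thesis using node_weight_ge(1)[OF b, of z bL bR] by simp
  qed
  have bounded: "\<exists>C. \<forall>w\<in>A. dist w z < d \<longrightarrow> cmod (f w) \<le> C * ?w w"
    if "\<And>w. w \<in> A \<Longrightarrow> dist w z < d \<Longrightarrow> cmod (f w) \<le> B" for z d B
  proof (intro exI[of _ "\<bar>B\<bar> / \<rho>"] ballI impI)
    fix w assume w: "w \<in> A" "dist w z < d"
    have "cmod (f w) \<le> \<bar>B\<bar> / \<rho> * \<rho>" using that[OF w] \<rho> by simp
    also have "\<dots> \<le> \<bar>B\<bar> / \<rho> * ?w w" using w\<rho>[OF w(1)] \<rho> by (intro mult_left_mono) auto
    finally show "cmod (f w) \<le> \<bar>B\<bar> / \<rho> * ?w w" .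
  qed
  have loc: "\<exists>d>0. \<exists>C. \<forall>w\<in>A. dist w z < d \<longrightarrow> cmod (f w) \<le> C * ?w w" for z
  proof -
    consider "z \<notin> real_seg bL bR" | x where "z = of_real x" "x \<in> open_pieces bL bR" | "z = 0" | c where "z = of_real c" "c = bL \<or> c = bR"
    proof (cases "z \<in> real_seg bL bR")
      case True
      hence "z = of_real (Re z)" "bL \<le> Re z" "Re z \<le> bR" by (auto simp: real_seg_iff complex_eq_iff)
      moreover from this have "z = 0 \<or> Re z \<in> open_pieces bL bR \<or> Re z = bL \<or> Re z = bR"
        using linorder_less_linear[of "Re z" 0] by (auto simp: open_pieces_def complex_eq_iff le_less)
      ultimately show ?thesis using that(2-4) by metis
    qed (use that in blast)
    thus ?thesis
    proof cases
      case 1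
      hence "isCont f z" using op holomorphic_on_imp_continuous_on[OF f] by (simp add: continuous_on_eq_continuous_at)
      then obtain d where d: "0 < d" "\<And>w. dist w z < d \<Longrightarrow> dist (f w) (f z) < 1"
        unfolding continuous_at_eps_delta by (metis zero_less_one)
      have "cmod (f w) \<le> cmod (f z) + 1" if "dist w z < d" for w
        using d(2)[OF that] norm_triangle_sub[of "f w" "f z"] by (simp add: dist_norm)
      thus ?thesis using bounded[of z d] d(1) by blast
    next
      case (2 x)
      have "\<exists>d>0. \<forall>w. 0 < s * Im w \<longrightarrow> dist w z < d \<longrightarrow> cmod (f w) \<le> cmod (v s x) + 1" if s: "s = 1 \<or> s = -1" for s
      proof -
        obtain d where d: "0 < d" "\<And>w. 0 < s * Im w \<Longrightarrow> w \<noteq> z \<Longrightarrow> dist w z < d \<Longrightarrow> dist (f w) (v s x) < 1"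
          using tendstoD[OF lim[OF s 2(2)] zero_less_one] unfolding eventually_at 2(1) by auto
        have "cmod (f w) \<le> cmod (v s x) + 1" if "0 < s * Im w" "dist w z < d" for w
        proof -
          have "w \<noteq> z" using that(1) 2(1) by auto
          thus ?thesis using d(2)[OF that(1) _ that(2)] norm_triangle_sub[of "f w" "v s x"] by (simp add: dist_norm)
        qed
        thus ?thesis using d(1) by blast
      qed
      from this[of 1] this[of "-1"] obtain d1 d2 where d: "0 < d1" "0 < d2"
        "\<And>w. 0 < Im w \<Longrightarrow> dist w z < d1 \<Longrightarrow> cmod (f w) \<le> cmod (v 1 x) + 1"
        "\<And>w. Im w < 0 \<Longrightarrow> dist w z < d2 \<Longrightarrow> cmod (f w) \<le> cmod (v (-1) x) + 1" by auto
      have "open (open_pieces bL bR)" by (auto simp: open_pieces_def)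
      then obtain r where r: "0 < r" "\<And>y. dist y x < r \<Longrightarrow> y \<in> open_pieces bL bR"
        using 2(2) unfolding open_dist by blast
      define d where "d = min (min d1 d2) r"
      have "cmod (f w) \<le> cmod (v 1 x) + cmod (v (-1) x) + 1" if w: "w \<in> A" "dist w z < d" for w
      proof -
        have "Im w \<noteq> 0"
        proof
          assume "Im w = 0"
          hence "dist (Re w) x = dist w z" unfolding 2(1) by (simp add: dist_norm cmod_def)
          hence "Re w \<in> open_pieces bL bR" using w by (intro r) (simp add: d_def)
          thus False using w(1) \<open>Im w = 0\<close> bLR by (auto simp: A_def real_seg_iff open_pieces_def)
        qed
        thus ?thesis using d(3,4)[of w] w by (cases "0 < Im w") (auto simp: d_def intro: order_trans)
      qed
      moreover have "0 < d" using d r by (simp add: d_def)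
      ultimately show ?thesis using bounded[of z d] by blast
    next
      case 3
      obtain d C where "0 < d" "\<And>z. z \<in> - real_seg bL bR \<Longrightarrow> cmod z < d \<Longrightarrow> cmod (f z) \<le> C * cmod z powr (- b)"
        using zero by blast
      note dC = this
      show ?thesis
      proof (rule exI[of _ d], rule conjI[OF dC(1)], rule exI[of _ "\<bar>C\<bar>"], intro ballI impI)
        fix w assume w: "w \<in> A" "dist w z < d"
        have "cmod (f w) \<le> C * cmod w powr (- b)" using w 3 by (intro dC) (auto simp: A_def)
        also have "\<dots> \<le> \<bar>C\<bar> * ?w w" using node_weight_ge(1)[OF b] by (intro mult_mono) auto
        finally show "cmod (f w) \<le> \<bar>C\<bar> * ?w w" .
      qed
    next
      case (4 c)
      obtain d C where "0 < d" "\<And>z. z \<in> - real_seg bL bR \<Longrightarrow> cmod (z - of_real c) < d \<Longrightarrow>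
          cmod (f z) \<le> C * \<bar>ln (cmod (z - of_real c))\<bar> \<and> cmod (z - of_real c) < 1"
        using ends[OF 4(2)] by blast
      note dC = this
      show ?thesis
      proof (rule exI[of _ d], rule conjI[OF dC(1)], rule exI[of _ "\<bar>C\<bar> / b"], intro ballI impI)
        fix w assume w: "w \<in> A" "dist w z < d"
        have wc: "w \<noteq> of_real c" using w(1) 4(2) bLR by (auto simp: A_def real_seg_iff)
        have "w \<in> - real_seg bL bR" "cmod (w - of_real c) < d" using w 4(1) by (auto simp: A_def dist_norm)
        from dC(2)[OF this] have 1: "cmod (f w) \<le> C * \<bar>ln (cmod (w - of_real c))\<bar>" "cmod (w - of_real c) < 1" by auto
        note 1(1)
        also have "C * \<bar>ln (cmod (w - of_real c))\<bar> \<le> \<bar>C\<bar> * (cmod (w - of_real c) powr (- b) / b)"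
          using 1(2) wc b by (intro mult_mono abs_ln_le_powr) auto
        also have "\<dots> = \<bar>C\<bar> / b * cmod (w - of_real c) powr (- b)" by simp
        also have "\<dots> \<le> \<bar>C\<bar> / b * ?w w"
          using 4(2) node_weight_ge(2,3)[OF b, of w] b by (intro mult_left_mono) auto
        finally show "cmod (f w) \<le> \<bar>C\<bar> / b * ?w w" .
      qed
    qed
  qed
  obtain C where C: "0 \<le> C" "\<And>w. w \<in> A \<Longrightarrow> w \<in> cball 0 ?R \<Longrightarrow> cmod (f w) \<le> C * ?w w"
    by (rule compact_local_bound[OF compact_cball, of A ?w 0 ?R "\<lambda>w. cmod (f w)"])
       (use loc node_weight_nonneg in auto)
  show thesis by (rule that[OF C(1)]) (auto intro!: C(2) simp: A_def)
qed

lemma analytic_at_infinity_bigo: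
  assumes "g analytic_on {0}"
  shows "(\<lambda>z. g (1 / z) - g 0) \<in> O[at_infinity](\<lambda>z. 1 / z)"
proof -
  have "(g has_field_derivative deriv g 0) (at 0)"
    using analytic_on_imp_differentiable_at[OF assms] by (simp add: DERIV_deriv_iff_field_differentiable)
  hence "((\<lambda>w. (g w - g 0) / w) \<longlongrightarrow> deriv g 0) (at 0)"
    by (simp add: has_field_derivative_iff)
  moreover have "filterlim (\<lambda>z. 1 / z :: complex) (at 0) at_infinity"
    by (auto simp: filterlim_at eventually_at_infinity intro!: tendsto_divide_0[OF tendsto_const filterlim_ident] exI[of _ 1])
  ultimately have "((\<lambda>z. (g (1 / z) - g 0) / (1 / z)) \<longlongrightarrow> deriv g 0) at_infinity"
    by (rule filterlim_compose)
  thus ?thesis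
    by (rule bigoI_tendsto) (auto simp: eventually_at_infinity intro!: exI[of _ 1])
qed

lemma abs_ln_le_cmod_Ln: "z \<noteq> 0 \<Longrightarrow> \<bar>ln (cmod z)\<bar> \<le> cmod (Ln z)"
  using abs_Re_le_cmod[of "Ln z"] by simp

lemma RHP_solution_one:
  assumes bLR: "bL < 0" "0 < bR"
  shows "RHP_solution bL bR None (\<lambda>_. mat 1)"
proof -
  \<comment> \<open>Constants satisfy the logarithmic bound, since |Ln (z - c)| \<ge> 1 as soon as
    |z - c| < exp (-1).\<close>
  have c: "(\<lambda>_. k) \<in> O[at c within S](\<lambda>z. Ln (z - c))" for c k S
  proof (rule bigoI[where c = "cmod k"])
    show "\<forall>\<^sub>F z in at c within S. norm k \<le> cmod k * norm (Ln (z - c))"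
      unfolding eventually_at
    proof (intro exI[of _ "exp (-1)"] conjI ballI impI)
      fix z assume z: "z \<noteq> c \<and> dist z c < exp (-1)"
      have "ln (cmod (z - c)) \<le> ln (exp (-1))" using z by (subst ln_le_cancel_iff) (auto simp: dist_norm)
      hence "1 \<le> cmod (Ln (z - c))" using abs_ln_le_cmod_Ln[of "z - c"] z by auto
      thus "norm k \<le> cmod k * norm (Ln (z - c))" by (simp add: mult_le_cancel_left1)
    qed simp
  qed
  show ?thesis unfolding RHP_solution_def
  proof (intro conjI exI)
    show "analytic_off bL bR (\<lambda>_. mat 1)"
      unfolding analytic_off_def
    proof (intro conjI allI)
      fix i j :: 2
      show "\<exists>g. g analytic_on {0} \<and> (\<forall>\<^sub>F z :: complex in at_infinity. (mat 1 :: complex^2^2) $ i $ j = g (1 / z))"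
        by (rule exI[of _ "\<lambda>_. (mat 1 :: complex^2^2) $ i $ j"]) (simp add: analytic_on_const)
    qed simp
    show "boundary_values bL bR (\<lambda>_. mat 1) (\<lambda>_. mat 1) (\<lambda>_. mat 1)"
      by (simp add: boundary_values_def)
    show "jump_conditions bL bR None (\<lambda>_. mat 1) (\<lambda>_. mat 1)"
      by (simp add: jump_conditions_def recip_def mat2_one mat2_mult)
    have "set_integrable lborel {bL..bR} (\<lambda>x. k)" for k :: real
      by (rule borel_integrable_atLeastAtMost') simp
    thus "L2_boundary bL bR (\<lambda>_. mat 1) (\<lambda>_. mat 1) (\<lambda>_. mat 1)"
      by (simp add: L2_boundary_def L2_dist_sq_def)
    show "endpoint_growth bL bR (\<lambda>_. mat 1)"
      by (simp add: endpoint_growth_def Let_def c)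
    show "normalised_at_infinity (\<lambda>_. mat 1)"
      by (simp add: normalised_at_infinity_def)
  qed
qed

section \<open>The reduced formula and its limit at a = 0\<close>

definition rhp_mat :: "real \<Rightarrow> real \<Rightarrow> complex \<Rightarrow> complex \<Rightarrow> complex^2^2" where
  "rhp_mat bL bR a z = hg_mat_inv (a * (a + 1)) (M1_infinity bL bR) **
    mat2 1 (of_real (bL * bR) / (z * of_real (bR - bL) * (a + 1))) 0 1 **
    hg_mat (a * (a + 1)) (M1 bL bR z)"

lemma M1_infinity_minus_M1:
  assumes bLR: "bL < 0" "0 < bR" and z: "z \<noteq> 0"
  shows "M1_infinity bL bR - M1 bL bR z = of_real (bL * bR) / (z * of_real (bR - bL))"
  by (simp add: M1_altdef[OF bLR z] M1_infinity_def mult_ac)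

lemma matrix_mult_tendsto:
  fixes A B :: "'a \<Rightarrow> complex^2^2"
  assumes "(A \<longlongrightarrow> P) F" "(B \<longlongrightarrow> Q) F"
  shows "((\<lambda>x. A x ** B x) \<longlongrightarrow> P ** Q) F"
  unfolding matrix_matrix_mult_def
  by (intro vec_tendstoI) (simp add: sum_2, intro tendsto_intros tendsto_vec_nth assms)

lemma mat2_tendsto:
  assumes "(p \<longlongrightarrow> p') F" "(q \<longlongrightarrow> q') F" "(r \<longlongrightarrow> r') F" "(s \<longlongrightarrow> s') F"
  shows "((\<lambda>x. mat2 (p x) (q x) (r x) (s x)) \<longlongrightarrow> mat2 p' q' r' s') F"
proof (intro vec_tendstoI)
  fix i j :: 2
  show "((\<lambda>x. mat2 (p x) (q x) (r x) (s x) $ i $ j) \<longlongrightarrow> mat2 p' q' r' s' $ i $ j) F"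
    using exhaust_2[of i] exhaust_2[of j] assms by auto
qed

lemma rhp_mat_tendsto:
  assumes bLR: "bL < 0" "0 < bR" and z: "z \<in> - real_seg bL bR" and a: "(a \<longlongrightarrow> 0) F"
  shows "((\<lambda>x. rhp_mat bL bR (a x) z) \<longlongrightarrow> mat 1) F"
proof -
  let ?m = "M1_infinity bL bR" and ?\<eta> = "M1 bL bR z"
  have z0: "z \<noteq> 0" using zero_in_seg[OF bLR z] .
  have m: "?m \<in> eta_domain" and e: "?\<eta> \<in> eta_domain" using M1_infinity_eta[OF bLR] M1_eta[OF bLR z] .
  hence pl: "?m \<in> plane1" "1 - ?m \<in> plane1" "?\<eta> \<in> plane1" "1 - ?\<eta> \<in> plane1" by (auto simp: eta_domain_iff plane1_iff)
  have "((\<lambda>x. a x * (a x + 1)) \<longlongrightarrow> 0 * (0 + 1)) F" by (intro tendsto_intros a)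
  hence k: "filterlim (\<lambda>x. a x * (a x + 1)) (nhds 0) F" by simp
  note p = hg_phi_tendsto(1)[THEN filterlim_compose, OF _ k] and d = hg_phi_tendsto(2)[THEN filterlim_compose, OF _ k]
  \<comment> \<open>The quotient sin (\<pi> a) / (\<pi> \<kappa>) is undefined at \<kappa> = 0. The
    limit of \<open>hg_alpha\<close> is therefore read off from the determinant, which tends to m +
    (1 - m) = 1.\<close>
  have "((\<lambda>x. hg_phi (a x * (a x + 1)) ?m * deriv (hg_phi (a x * (a x + 1))) (1 - ?m) +
      hg_phi (a x * (a x + 1)) (1 - ?m) * deriv (hg_phi (a x * (a x + 1))) ?m) \<longlongrightarrow> ?m * 1 + (1 - ?m) * 1) F"
    by (intro tendsto_intros p d pl)
  hence al: "((\<lambda>x. hg_alpha (a x * (a x + 1))) \<longlongrightarrow> 1) F" by (simp add: hg_mat_det[OF m])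
  have "((\<lambda>x. hg_mat_inv (a x * (a x + 1)) ?m) \<longlongrightarrow> mat2 (1 / 1) ((1 - ?m) / 1) (- 1 / 1) (?m / 1)) F"
    unfolding hg_mat_inv_def by (intro mat2_tendsto tendsto_intros p d pl al) simp_all
  moreover have "((\<lambda>x. hg_mat (a x * (a x + 1)) ?\<eta>) \<longlongrightarrow> mat2 ?\<eta> (- (1 - ?\<eta>)) 1 1) F"
    unfolding hg_mat_def by (intro mat2_tendsto tendsto_intros p d pl)
  moreover have "((\<lambda>x. mat2 1 (of_real (bL * bR) / (z * of_real (bR - bL) * (a x + 1))) 0 1) \<longlongrightarrow>
      mat2 1 (of_real (bL * bR) / (z * of_real (bR - bL) * (0 + 1))) 0 1) F"
    using z0 bLR by (intro mat2_tendsto tendsto_intros a) (simp flip: of_real_diff)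
  moreover have "of_real (bL * bR) / (z * of_real (bR - bL) * (0 + 1)) = ?m - ?\<eta>"
    using M1_infinity_minus_M1[OF bLR z0] by simp
  ultimately have "((\<lambda>x. rhp_mat bL bR (a x) z) \<longlongrightarrow>
      mat2 1 (1 - ?m) (- 1) ?m ** mat2 1 (?m - ?\<eta>) 0 1 ** mat2 ?\<eta> (- (1 - ?\<eta>)) 1 1) F"
    unfolding rhp_mat_def by (intro matrix_mult_tendsto) auto
  thus ?thesis by (simp add: mat2_mult mat2_one)
qed

lemma rhp_mat_nth:
  assumes bLR: "bL < 0" "0 < bR" and a: "a + 1 \<noteq> 0" and z: "z \<noteq> 0"
  defines "\<kappa> \<equiv> a * (a + 1)" and "K \<equiv> hg_mat_inv (a * (a + 1)) (M1_infinity bL bR)"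
  shows "rhp_mat bL bR a z $ i $ 1 = row1 bL bR \<kappa> (1 / (a + 1)) (K $ i $ 1) (K $ i $ 2) z"
    and "rhp_mat bL bR a z $ i $ 2 = row2 bL bR \<kappa> (1 / (a + 1)) (K $ i $ 1) (K $ i $ 2) z"
proof -
  let ?m = "M1_infinity bL bR" and ?\<eta> = "M1 bL bR z"
  have t: "of_real (bL * bR) / (z * of_real (bR - bL) * (a + 1)) = (?m - ?\<eta>) * (1 / (a + 1))"
  proof -
    show ?thesis by (simp add: M1_infinity_minus_M1[OF bLR z])
  qed
  have K: "rhp_mat bL bR a z = (K ** mat2 1 ((?m - ?\<eta>) * (1 / (a + 1))) 0 1) ** hg_mat \<kappa> ?\<eta>"
    unfolding rhp_mat_def t K_def \<kappa>_def ..
  show "rhp_mat bL bR a z $ i $ 1 = row1 bL bR \<kappa> (1 / (a + 1)) (K $ i $ 1) (K $ i $ 2) z"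
    unfolding K hg_mat_def mat2_mult_right_nth row1_def hg_row_def by (simp add: algebra_simps)
  show "rhp_mat bL bR a z $ i $ 2 = row2 bL bR \<kappa> (1 / (a + 1)) (K $ i $ 1) (K $ i $ 2) z"
    unfolding K hg_mat_def mat2_mult_right_nth row2_def hg_row_def by (simp add: algebra_simps)
qed

lemma RHP_solution_rhp_mat:
  assumes bLR: "bL < 0" "0 < bR" and a: "\<bar>Re a\<bar> < 1/2" "a \<noteq> 0" and l: "recip l = 2 * sin (of_real pi * a)"
  shows "RHP_solution bL bR l (rhp_mat bL bR a)"
proof -
  let ?S = "- real_seg bL bR" and ?m = "M1_infinity bL bR"
  define \<kappa> where "\<kappa> = a * (a + 1)"
  define c where "c = 1 / (a + 1)"
  define K where "K = hg_mat_inv \<kappa> ?m"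
  \<comment> \<open>Strictly between |Re a| and 1/2: below 1/2 for square integrability at 0, and
    positive even if Re a = 0, so that the logarithms at the ends are dominated too.\<close>
  define b where "b = (\<bar>Re a\<bar> + 1/2) / 2"
  have b: "0 < b" "b < 1/2" "\<bar>Re a\<bar> \<le> b" using a by (auto simp: b_def)
  have "Re (a + 1) \<noteq> 0" using a by auto
  hence a1: "a + 1 \<noteq> 0" by (metis zero_complex.simps(1))
  have al: "hg_alpha \<kappa> \<noteq> 0"
    using hg_alpha[OF \<kappa>_def] sin_pi_not_half_int[OF not_half_int_strip(1)[OF a]] by auto
  let ?r1 = "\<lambda>i. row1 bL bR \<kappa> c (K $ i $ 1) (K $ i $ 2)" and ?r2 = "\<lambda>i. row2 bL bR \<kappa> c (K $ i $ 1) (K $ i $ 2)"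
  define r where "r i j = (if j = 1 then ?r1 i else ?r2 i)" for i j :: 2
  define v :: "real \<Rightarrow> real \<Rightarrow> complex^2^2" where "v s x = (\<chi> i j. if j = 1 then bval1 bL bR \<kappa> a c (K $ i $ 1) (K $ i $ 2) s x
      else bval2 bL bR \<kappa> a c (K $ i $ 1) (K $ i $ 2) s x)" for s x
  \<comment> \<open>At z = 0 both sides involve division by zero. That point lies on the segment, so
    it is avoided by all the conditions to be checked.\<close>
  have G: "rhp_mat bL bR a z $ i $ j = r i j z" if "z \<noteq> 0" for z i j
    using exhaust_2[of j] rhp_mat_nth[OF bLR a1 that, folded \<kappa>_def, folded K_def, folded c_def] by (auto simp: r_def)
  have hol: "r i j holomorphic_on ?S" for i j
    unfolding r_def using row_holomorphic[OF bLR] by auto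
  note cont = hol[THEN holomorphic_on_imp_continuous_on]
  have lim: "(r i j \<longlongrightarrow> v s x $ i $ j) (at (of_real x) within {z. 0 < s * Im z})"
    if "s = 1 \<or> s = -1" "x \<in> open_pieces bL bR" for s x i j
    using row_limits[OF bLR \<kappa>_def that(1), of x] that(2) by (auto simp: r_def v_def open_pieces_def)
  have endL: "\<exists>d>0. \<exists>C. \<forall>z\<in>?S. cmod (z - of_real bL) < d \<longrightarrow>
      cmod (?r1 i z) \<le> C \<and> cmod (?r2 i z) \<le> C * \<bar>ln (cmod (z - of_real bL))\<bar> \<and>
      cmod (?r1 i z) \<le> C * \<bar>ln (cmod (z - of_real bL))\<bar> \<and> cmod (z - of_real bL) < 1" for i
  proof (rule row_bounds_bL[OF bLR, where \<kappa> = \<kappa> and c = c and ?k1.0 = "K $ i $ 1" and ?k2.0 = "K $ i $ 2"])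
    fix d C assume H: "0 < d" "0 \<le> C"
      "\<And>z. z \<in> ?S \<Longrightarrow> cmod (z - of_real bL) < d \<Longrightarrow> cmod (?r1 i z) \<le> C"
      "\<And>z. z \<in> ?S \<Longrightarrow> cmod (z - of_real bL) < d \<Longrightarrow> cmod (?r2 i z) \<le> C * \<bar>ln (cmod (z - of_real bL))\<bar>"
      "\<And>z. z \<in> ?S \<Longrightarrow> cmod (z - of_real bL) < d \<Longrightarrow> 1 \<le> \<bar>ln (cmod (z - of_real bL))\<bar> \<and> cmod (z - of_real bL) < 1"
    have "cmod (?r1 i z) \<le> C * \<bar>ln (cmod (z - of_real bL))\<bar>" if "z \<in> ?S" "cmod (z - of_real bL) < d" for z
      using H(3)[OF that] mult_left_mono[of 1 "\<bar>ln (cmod (z - of_real bL))\<bar>" C] H(2) H(5)[OF that] by simp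
    thus ?thesis using H by blast
  qed
  have endR: "\<exists>d>0. \<exists>C. \<forall>z\<in>?S. cmod (z - of_real bR) < d \<longrightarrow>
      cmod (?r2 i z) \<le> C \<and> cmod (?r1 i z) \<le> C * \<bar>ln (cmod (z - of_real bR))\<bar> \<and>
      cmod (?r2 i z) \<le> C * \<bar>ln (cmod (z - of_real bR))\<bar> \<and> cmod (z - of_real bR) < 1" for i
  proof (rule row_bounds_bR[OF bLR, where \<kappa> = \<kappa> and c = c and ?k1.0 = "K $ i $ 1" and ?k2.0 = "K $ i $ 2"])
    fix d C assume H: "0 < d" "0 \<le> C"
      "\<And>z. z \<in> ?S \<Longrightarrow> cmod (z - of_real bR) < d \<Longrightarrow> cmod (?r2 i z) \<le> C"
      "\<And>z. z \<in> ?S \<Longrightarrow> cmod (z - of_real bR) < d \<Longrightarrow> cmod (?r1 i z) \<le> C * \<bar>ln (cmod (z - of_real bR))\<bar>"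
      "\<And>z. z \<in> ?S \<Longrightarrow> cmod (z - of_real bR) < d \<Longrightarrow> 1 \<le> \<bar>ln (cmod (z - of_real bR))\<bar> \<and> cmod (z - of_real bR) < 1"
    have "cmod (?r2 i z) \<le> C * \<bar>ln (cmod (z - of_real bR))\<bar>" if "z \<in> ?S" "cmod (z - of_real bR) < d" for z
      using H(3)[OF that] mult_left_mono[of 1 "\<bar>ln (cmod (z - of_real bR))\<bar>" C] H(2) H(5)[OF that] by simp
    thus ?thesis using H by blast
  qed
  have zero: "\<exists>d>0. \<exists>C. \<forall>z\<in>?S. cmod z < d \<longrightarrow> cmod (r i j z) \<le> C * cmod z powr (- b)" for i j
  proof (rule row_bounds_0[OF bLR a b(3,1) \<kappa>_def c_def, where ?k1.0 = "K $ i $ 1" and ?k2.0 = "K $ i $ 2"])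
    fix d C assume "0 < d"
      "\<And>z. z \<in> ?S \<Longrightarrow> cmod z < d \<Longrightarrow> cmod (?r1 i z) \<le> C * cmod z powr (- b) \<and> cmod (?r2 i z) \<le> C * cmod z powr (- b)"
    thus ?thesis by (auto simp: r_def)
  qed
  have ends: "\<exists>d>0. \<exists>C. \<forall>z\<in>?S. cmod (z - of_real e) < d \<longrightarrow>
      cmod (r i j z) \<le> C * \<bar>ln (cmod (z - of_real e))\<bar> \<and> cmod (z - of_real e) < 1" if "e = bL \<or> e = bR" for e i j
    using that endL[of i] endR[of i] unfolding r_def by (cases "j = 1") (simp_all, (blast+)?)
  have L2: "set_integrable lborel {bL..bR} (\<lambda>x. (cmod (v s x $ i $ j))\<^sup>2)"
    "((\<lambda>\<epsilon>. L2_dist_sq bL bR (\<lambda>x. r i j (Complex x (s * \<epsilon>))) (\<lambda>x. v s x $ i $ j)) \<longlongrightarrow> 0) (at_right 0)"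
    if s: "s = 1 \<or> s = -1" for s i j
  proof -
    obtain C where C: "0 \<le> C" "\<And>z. z \<in> ?S \<Longrightarrow> cmod z \<le> bR - bL + 1 \<Longrightarrow> cmod (r i j z) \<le> C * node_weight bL bR b z"
      by (rule node_weight_bound[OF bLR hol[of i j] b(1), of "\<lambda>s x. v s x $ i $ j"])
         (use lim ends zero in blast)+
    note L = L2_boundary_scalar[OF bLR cont s lim[OF s] b(1,2) C]
    show "set_integrable lborel {bL..bR} (\<lambda>x. (cmod (v s x $ i $ j))\<^sup>2)"
      "((\<lambda>\<epsilon>. L2_dist_sq bL bR (\<lambda>x. r i j (Complex x (s * \<epsilon>))) (\<lambda>x. v s x $ i $ j)) \<longlongrightarrow> 0) (at_right 0)"
      by (rule L; assumption)+
  qed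
  have inf: "\<exists>g. g analytic_on {0} \<and> g 0 = mat 1 $ i $ j \<and> (\<forall>\<^sub>F z in at_infinity. rhp_mat bL bR a z $ i $ j = g (1 / z))" for i j
  proof -
    have nz: "\<forall>\<^sub>F z in at_infinity. z \<noteq> (0::complex)" by (rule eventually_not_equal_at_infinity)
    \<comment> \<open>At infinity \<eta> = m, the unipotent factor becomes the identity, and K is
      the inverse of the remaining factor.\<close>
    have h1: "hg_row \<kappa> c (K $ i $ 1) (K $ i $ 2) ?m ?m = mat 1 $ i $ 1"
      and h2: "- hg_row \<kappa> c (K $ i $ 1) (- (K $ i $ 2)) (1 - ?m) (1 - ?m) = mat 1 $ i $ 2"
      using exhaust_2[of i] hg_mat_det[OF M1_infinity_eta[OF bLR], of \<kappa>] al
      by (auto simp: hg_row_def K_def hg_mat_inv_def mat2_one divide_simps mult_ac)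
    show ?thesis
    proof (cases "j = 1")
      case True
      obtain g where g: "g analytic_on {0}" "g 0 = hg_row \<kappa> c (K $ i $ 1) (K $ i $ 2) ?m ?m"
        "\<forall>\<^sub>F z in at_infinity. hg_row \<kappa> c (K $ i $ 1) (K $ i $ 2) ?m (M1 bL bR z) = g (1 / z)"
        using M1_at_infinity(1)[OF bLR hg_row_holomorphic] by blast
      have "\<forall>\<^sub>F z in at_infinity. rhp_mat bL bR a z $ i $ j = g (1 / z)"
        using g(3) nz by eventually_elim (simp add: G r_def True row1_def)
      thus ?thesis using g h1 True by auto
    next
      case False
      hence j: "j = 2" using exhaust_2[of j] by auto
      obtain g where g: "g analytic_on {0}" "g 0 = hg_row \<kappa> c (K $ i $ 1) (- (K $ i $ 2)) (1 - ?m) (1 - ?m)"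
        "\<forall>\<^sub>F z in at_infinity. hg_row \<kappa> c (K $ i $ 1) (- (K $ i $ 2)) (1 - ?m) (1 - M1 bL bR z) = g (1 / z)"
        using M1_at_infinity(2)[OF bLR hg_row_holomorphic] by blast
      have "\<forall>\<^sub>F z in at_infinity. rhp_mat bL bR a z $ i $ j = - g (1 / z)"
        using g(3) nz by eventually_elim (simp add: G r_def j row2_def)
      moreover have "(\<lambda>u. - g u) analytic_on {0}" by (intro analytic_intros g)
      ultimately show ?thesis using g(2) h2 j by (intro exI[of _ "\<lambda>u. - g u"]) auto
    qed
  qed
  have bigL: "?r1 i \<in> O[at (of_real bL) within ?S](\<lambda>_. 1) \<and> ?r2 i \<in> O[at (of_real bL) within ?S](\<lambda>z. Ln (z - of_real bL))" for i
  proof -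
    obtain d C where H: "0 < d" "\<And>z. z \<in> ?S \<Longrightarrow> cmod (z - of_real bL) < d \<Longrightarrow>
      cmod (?r1 i z) \<le> C \<and> cmod (?r2 i z) \<le> C * \<bar>ln (cmod (z - of_real bL))\<bar>"
      using endL[of i] by blast
    have "cmod (?r2 i z) \<le> \<bar>C\<bar> * cmod (Ln (z - of_real bL))" if "z \<in> ?S" "z \<noteq> of_real bL" "cmod (z - of_real bL) < d" for z
    proof -
      have "C * \<bar>ln (cmod (z - of_real bL))\<bar> \<le> \<bar>C\<bar> * cmod (Ln (z - of_real bL))"
        using abs_ln_le_cmod_Ln[of "z - of_real bL"] that by (intro mult_mono) auto
      thus ?thesis using H(2)[of z] that by auto
    qed
    thus ?thesis using H by (intro conjI bigoI[where c = C] bigoI[where c = "\<bar>C\<bar>"]) (auto simp: eventually_at dist_norm)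
  qed
  have bigR: "?r2 i \<in> O[at (of_real bR) within ?S](\<lambda>_. 1) \<and> ?r1 i \<in> O[at (of_real bR) within ?S](\<lambda>z. Ln (z - of_real bR))" for i
  proof -
    obtain d C where H: "0 < d" "\<And>z. z \<in> ?S \<Longrightarrow> cmod (z - of_real bR) < d \<Longrightarrow>
      cmod (?r2 i z) \<le> C \<and> cmod (?r1 i z) \<le> C * \<bar>ln (cmod (z - of_real bR))\<bar>"
      using endR[of i] by blast
    have "cmod (?r1 i z) \<le> \<bar>C\<bar> * cmod (Ln (z - of_real bR))" if "z \<in> ?S" "z \<noteq> of_real bR" "cmod (z - of_real bR) < d" for z
    proof -
      have "C * \<bar>ln (cmod (z - of_real bR))\<bar> \<le> \<bar>C\<bar> * cmod (Ln (z - of_real bR))"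
        using abs_ln_le_cmod_Ln[of "z - of_real bR"] that by (intro mult_mono) auto
      thus ?thesis using H(2)[of z] that by auto
    qed
    thus ?thesis using H by (intro conjI bigoI[where c = C] bigoI[where c = "\<bar>C\<bar>"]) (auto simp: eventually_at dist_norm)
  qed
  have off0: "\<forall>\<^sub>F z in at p within ?S. z \<noteq> 0" for p
    using zero_in_seg[OF bLR] by (auto simp: eventually_at_filter)
  have GO: "(\<lambda>z. rhp_mat bL bR a z $ i $ j) \<in> O[at p within ?S](h)" if "r i j \<in> O[at p within ?S](h)" for i j p and h :: "complex \<Rightarrow> complex"
  proof -
    have "\<forall>\<^sub>F z in at p within ?S. rhp_mat bL bR a z $ i $ j = r i j z"
      using off0[of p] by eventually_elim (rule G)
    from landau_o.big.in_cong[OF this] that show ?thesis by blast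
  qed
  show ?thesis unfolding RHP_solution_def
  proof (intro conjI exI)
    show "analytic_off bL bR (rhp_mat bL bR a)"
      unfolding analytic_off_def
    proof (intro conjI allI)
      show "(\<lambda>z. rhp_mat bL bR a z $ i $ j) holomorphic_on ?S" for i j
        by (rule holomorphic_transform[OF hol[of i j]]) (simp add: G zero_in_seg[OF bLR])
      show "\<exists>g. g analytic_on {0} \<and> (\<forall>\<^sub>F z in at_infinity. rhp_mat bL bR a z $ i $ j = g (1 / z))" for i j
        using inf by blast
    qed
    show "boundary_values bL bR (rhp_mat bL bR a) (v 1) (v (-1))"
      unfolding boundary_values_def
    proof (intro ballI conjI vec_tendstoI)
      fix x i j assume "x \<in> {bL<..<0} \<union> {0<..<bR}"
      hence x: "x \<in> open_pieces bL bR" by (simp add: open_pieces_def)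
      have ev: "eventually (\<lambda>z. r i j z = rhp_mat bL bR a z $ i $ j) (at (of_real x) within A)" for A
      proof -
        have "eventually (\<lambda>z. z \<noteq> 0) (at (complex_of_real x) within A)"
          using tendsto_imp_eventually_ne[OF tendsto_ident_at, of "complex_of_real x" 0 A] x by (auto simp: open_pieces_def)
        thus ?thesis by eventually_elim (simp add: G)
      qed
      show "((\<lambda>z. rhp_mat bL bR a z $ i $ j) \<longlongrightarrow> v 1 x $ i $ j) (at (of_real x) within {z. 0 < Im z})"
        using Lim_transform_eventually[OF lim[of 1, OF _ x] ev] by simp
      show "((\<lambda>z. rhp_mat bL bR a z $ i $ j) \<longlongrightarrow> v (-1) x $ i $ j) (at (of_real x) within {z. Im z < 0})"
        using Lim_transform_eventually[OF lim[of "-1", OF _ x] ev] by simp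
    qed
    show "jump_conditions bL bR l (v 1) (v (-1))"
      unfolding jump_conditions_def l vec_eq_iff forall_2 mat2_mult_right_nth
      by (simp add: v_def bval_jump[OF bLR] del: mult_minus_left)
    have Gl: "rhp_mat bL bR a (Complex x y) $ i $ j = r i j (Complex x y)" if "y \<noteq> 0" for x y i j
      using that by (intro G) (auto simp: complex_eq_iff)
    have pos: "eventually (\<lambda>e. (0::real) < e) (at_right 0)" by (simp add: eventually_at_filter)
    show "L2_boundary bL bR (rhp_mat bL bR a) (v 1) (v (-1))"
      unfolding L2_boundary_def
    proof (intro allI conjI)
      fix i j :: 2
      show "set_integrable lborel {bL..bR} (\<lambda>x. (cmod (v 1 x $ i $ j))\<^sup>2)"
        "set_integrable lborel {bL..bR} (\<lambda>x. (cmod (v (-1) x $ i $ j))\<^sup>2)" by (rule L2, simp)+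
      show "((\<lambda>\<epsilon>. L2_dist_sq bL bR (\<lambda>x. rhp_mat bL bR a (Complex x \<epsilon>) $ i $ j) (\<lambda>x. v 1 x $ i $ j)) \<longlongrightarrow> 0) (at_right 0)"
        by (rule Lim_transform_eventually[OF L2(2)[of 1 i j]], simp, rule eventually_mono[OF pos]) (simp add: Gl)
      show "((\<lambda>\<epsilon>. L2_dist_sq bL bR (\<lambda>x. rhp_mat bL bR a (Complex x (- \<epsilon>)) $ i $ j) (\<lambda>x. v (-1) x $ i $ j)) \<longlongrightarrow> 0) (at_right 0)"
        by (rule Lim_transform_eventually[OF L2(2)[of "-1" i j]], simp, rule eventually_mono[OF pos]) (simp add: Gl)
    qed
    show "endpoint_growth bL bR (rhp_mat bL bR a)"
      unfolding endpoint_growth_def Let_def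
      using bigL bigR by (auto intro!: GO simp: r_def)
    show "normalised_at_infinity (rhp_mat bL bR a)"
      unfolding normalised_at_infinity_def
    proof (intro allI)
      fix i j :: 2
      obtain g where g: "g analytic_on {0}" "g 0 = mat 1 $ i $ j" "\<forall>\<^sub>F z in at_infinity. rhp_mat bL bR a z $ i $ j = g (1 / z)"
        using inf by blast
      have "\<forall>\<^sub>F z in at_infinity. (rhp_mat bL bR a z - mat 1) $ i $ j = g (1 / z) - g 0"
        using g(3) by eventually_elim (simp add: g(2))
      from landau_o.big.in_cong[OF this] analytic_at_infinity_bigo[OF g(1)]
      show "(\<lambda>z. (rhp_mat bL bR a z - mat 1) $ i $ j) \<in> O[at_infinity](\<lambda>z. 1 / z)" by blast
    qed
  qed
qed

theorem theorem2p3: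
  fixes bL bR :: real and l :: "complex option"
  assumes "bL < 0" and "0 < bR" and "l \<in> lambda_domain"
  shows "\<exists>G. RHP_solution bL bR l G \<and>
           (\<forall>G'. RHP_solution bL bR l G' \<longrightarrow> (\<forall>z \<in> - real_seg bL bR. G' z = G z)) \<and>
           (\<forall>z \<in> - real_seg bL bR.
              case l of
                Some \<mu> \<Rightarrow> G z = Gamma_formula bL bR \<mu> z
              | None \<Rightarrow> ((\<lambda>\<mu>. Gamma_formula bL bR \<mu> z) \<longlongrightarrow> G z) at_infinity)"
proof -
  note bLR = assms(1,2)
  have formula: "Gamma_formula bL bR \<mu> z = rhp_mat bL bR (a_fun \<mu>) z"
    if "\<mu> \<notin> real_seg (-1/2) (1/2)" "z \<in> - real_seg bL bR" for \<mu> z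
    unfolding rhp_mat_def
    by (rule Gamma_formula_eq[OF bLR a_fun_Re[OF that(1)] a_fun_nonzero[OF that(1)] M1_eta[OF bLR that(2)]])
  show ?thesis
  proof (cases l)
    case None
    \<comment> \<open>The reduced formula holds for \<mu> off the segment [-1/2, 1/2]; by
      compactness this covers a neighbourhood of infinity, where the limit is taken.\<close>
    have "compact (real_seg (-1/2) (1/2))"
      unfolding real_seg_def by (intro compact_continuous_image continuous_intros) auto
    then obtain R where R: "\<And>\<mu>. \<mu> \<in> real_seg (-1/2) (1/2) \<Longrightarrow> cmod \<mu> \<le> R"
      using compact_imp_bounded[of "real_seg (-1/2) (1/2)"] unfolding bounded_iff by auto
    have "\<forall>\<^sub>F \<mu> in at_infinity. \<mu> \<notin> real_seg (-1/2) (1/2)"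
      unfolding eventually_at_infinity using R by (intro exI[of _ "R + 1"]) force
    hence lim: "((\<lambda>\<mu>. Gamma_formula bL bR \<mu> z) \<longlongrightarrow> mat 1) at_infinity" if z: "z \<in> - real_seg bL bR" for z
      by (intro Lim_transform_eventually[OF rhp_mat_tendsto[OF bLR z a_fun_tendsto]])
         (elim eventually_mono, rule formula[OF _ z, symmetric])
    show ?thesis unfolding None option.case
      by (intro exI[of _ "\<lambda>_. mat 1"] conjI allI impI ballI RHP_solution_one[OF bLR] lim
          RHP_solution_unique[OF bLR RHP_solution_one[OF bLR]])
  next
    case (Some \<mu>)
    hence \<mu>: "\<mu> \<notin> real_seg (-1/2) (1/2)" using assms(3) by (auto simp: lambda_domain_def)
    have "recip l = 2 * sin (of_real pi * a_fun \<mu>)" by (simp add: sin_a_fun[OF \<mu>] Some recip_def)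
    hence G: "RHP_solution bL bR (Some \<mu>) (rhp_mat bL bR (a_fun \<mu>))"
      unfolding Some by (rule RHP_solution_rhp_mat[OF bLR a_fun_Re[OF \<mu>] a_fun_nonzero[OF \<mu>]])
    show ?thesis unfolding Some option.case
      by (intro exI[of _ "rhp_mat bL bR (a_fun \<mu>)"] conjI allI impI ballI G
          RHP_solution_unique[OF bLR G] formula[OF \<mu>, symmetric])
  qed
qed

end
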